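(* Let $n\ge1$, $0<p<1$, and let $\Phi\in L^1_{loc}(\mathbb{R}^n\setminus\{0\})$. Then for each of the spaces $X=L^p,\ h^p,\ M^{p,p},\ B^{p,p},\ F^{p,p}$ on $\mathbb{R}^n$, $$H_\Phi \text{ is bounded on } X \iff H_\Phi=0.$$
   Context: Functions are complex-valued. $L^1_{loc}(\mathbb{R}^n\setminus\{0\})$ is the set of measurable functions integrable on every compact subset of $\mathbb{R}^n\setminus\{0\}$. The Hausdorff operator is $$H_\Phi f(x)=\int_{\mathbb{R}^n}\Phi(y)\,f\!\left(\frac{x}{|y|}\right)dy ;$$ for $f\in C_c^\infty(\mathbb{R}^n\setminus\{0\})$ (smooth, with compact support not containing the origin) the integral converges absolutely for every $x$ and defines a measurable function. "$H_\Phi$ is bounded on $X$" means: there is a constant $C$ such that for every $f\in C_c^\infty(\mathbb{R}^n\setminus\{0\})$ one has $H_\Phi f\in X$ and $\|H_\Phi f\|_X\le C\|f\|_X$; when $X\ne L^p$, $H_\Phi f\in X$ means that $H_\Phi f$ is a locally integrable function on $\mathbb{R}^n$ defining a tempered distribution that belongs to $X$. "$H_\Phi=0$" means $H_\Phi f=0$ for every $f\in C_c^\infty(\mathbb{R}^n\setminus\{0\})$. Fourier transform: $\mathscr{F}f(\xi)=\int f(x)e^{-2\pi i x\cdot\xi}dx$, extended to the tempered distributions $\mathscr{S}'$. $L^p$ is the usual Lebesgue space with quasi-norm $(\int|f|^p)^{1/p}$. Local Hardy space: fix $\psi\in\mathscr{S}$ with $\int\psi\ne0$, $\psi_t(x)=t^{-n}\psi(x/t)$;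 $h^p$ is the set of $f\in\mathscr{S}'$ with $\|f\|_{h^p}=\|\sup_{0<t<1}|\psi_t*f|\|_{L^p}<\infty$ (different $\psi$ give equivalent quasi-norms). Besov and Triebel–Lizorkin spaces: let $\varphi$ be a smooth bump function supported in $\{|\xi|<3/2\}$ and equal to $1$ on $\{|\xi|\le 4/3\}$, $\phi(\xi)=\varphi(\xi)-\varphi(2\xi)$, $\phi_j(\xi)=\phi(2^{-j}\xi)$ for $j\ge1$, $\phi_0=\varphi$, and $\Delta_j=\mathscr{F}^{-1}\phi_j\mathscr{F}$. $B^{p,p}$ and $F^{p,p}$ (smoothness index $s=0$) consist of all $f\in\mathscr{S}'$ with, respectively, $$\|f\|_{B^{p,p}}=\Big(\sum_{j\ge0}\|\Delta_jf\|_{L^p}^p\Big)^{1/p}<\infty,\qquad \|f\|_{F^{p,p}}=\Big\|\Big(\sum_{j\ge0}|\Delta_jf|^p\Big)^{1/p}\Big\|_{L^p}<\infty .$$ Modulation space: let $\eta:\mathbb{R}^n\to[0,1]$ be smooth with $\eta(\xi)=1$ for $|\xi|_\infty\le 1/2$ and $\eta(\xi)=0$ for $|\xi|_\infty\ge 3/4$, where $|\xi|_\infty=\max_i|\xi_i|$; let $\sigma_k(\xi)=\eta(\xi-k)\big(\sum_{l\in\mathbb{Z}^n}\eta(\xi-l)\big)^{-1}$ and $\Box_k=\mathscr{F}^{-1}\sigma_k\mathscr{F}$ for $k\in\mathbb{Z}^n$. $M^{p,p}$ consists of all $f\in\mathscr{S}'$ with $\|f\|_{M^{p,p}}=\big(\sum_{k\in\mathbb{Z}^n}\|\Box_kf\|_{L^p}^p\big)^{1/p}<\infty$.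 *)

theory Defs
  imports "HOL-Analysis.Analysis"
begin

section \<open>Smooth functions, test functions, Schwartz functions\<close>

(* partial_deriv [i1, ..., im] f is the mixed derivative D_i1 ... D_im f; a multi-index is
   spelled out as the list of the coordinates to differentiate in. *)
primrec partial_deriv ::
  "'n list \<Rightarrow> (real ^ 'n \<Rightarrow> 'b::real_normed_vector) \<Rightarrow> real ^ ('n::finite) \<Rightarrow> 'b" where
  "partial_deriv [] f = f"
| "partial_deriv (i # is) f =
     (\<lambda>x. frechet_derivative (partial_deriv is f) (at x) (axis i 1))"

definition smooth :: "(real ^ 'n \<Rightarrow> 'b::real_normed_vector) \<Rightarrow> bool" where
  "smooth f \<longleftrightarrow> (\<forall>is x. partial_deriv is f differentiable (at x))"

definition supp :: "('a::topological_space \<Rightarrow> 'b::zero) \<Rightarrow> 'a set" where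
  "supp f = closure {x. f x \<noteq> 0}"

definition test_functions :: "(real ^ 'n) set \<Rightarrow> (real ^ 'n \<Rightarrow> complex) set" where
  "test_functions \<Omega> = {f. smooth f \<and> compact (supp f) \<and> supp f \<subseteq> \<Omega>}"

definition schwartz :: "(real ^ 'n \<Rightarrow> complex) set" where
  "schwartz = {f. smooth f \<and>
     (\<forall>N is. bounded (range (\<lambda>x. (1 + norm x) ^ N *\<^sub>R partial_deriv is f x)))}"

definition schwartz_seminorm :: "nat \<Rightarrow> 'n list \<Rightarrow> (real ^ 'n \<Rightarrow> complex) \<Rightarrow> real" where
  "schwartz_seminorm N is f = (SUP x. (1 + norm x) ^ N * cmod (partial_deriv is f x))"

definition schwartz_topology :: "(real ^ 'n \<Rightarrow> complex) topology" where
  "schwartz_topology = topology_generated_by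
     {{g \<in> schwartz. schwartz_seminorm N is (\<lambda>x. g x - f x) < \<epsilon>} | f N is \<epsilon>.
        f \<in> schwartz \<and> 0 < \<epsilon>}"


section \<open>Tempered distributions\<close>

(* A functional is a total HOL function; only its values on Schwartz functions matter. *)
type_synonym 'n functional = "(real ^ 'n \<Rightarrow> complex) \<Rightarrow> complex"

definition tempered_distributions :: "'n::finite functional set" where
  "tempered_distributions = {u. continuous_map schwartz_topology euclidean u \<and>
     (\<forall>f\<in>schwartz. \<forall>g\<in>schwartz. u (\<lambda>x. f x + g x) = u f + u g) \<and>
     (\<forall>c. \<forall>f\<in>schwartz. u (\<lambda>x. c * f x) = c * u f)}"

definition locally_integrable_on :: "(real ^ 'n) set \<Rightarrow> (real ^ 'n \<Rightarrow> complex) \<Rightarrow> bool" where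
  "locally_integrable_on \<Omega> g \<longleftrightarrow> g \<in> borel_measurable (lebesgue_on \<Omega>) \<and>
     (\<forall>K. compact K \<and> K \<subseteq> \<Omega> \<longrightarrow> set_integrable lebesgue K g)"

definition dist_of_fun :: "(real ^ 'n \<Rightarrow> complex) \<Rightarrow> 'n::finite functional" where
  "dist_of_fun g = (\<lambda>\<theta>. LINT x|lebesgue. g x * \<theta> x)"

(* The distribution u is the locally integrable function g.  Only compactly supported test
   functions are used: g itself may grow so fast that the integral of g against a Schwartz
   function does not converge absolutely, although g defines a tempered distribution. *)
definition represents :: "(real ^ 'n \<Rightarrow> complex) \<Rightarrow> 'n::finite functional \<Rightarrow> bool" where
  "represents g u \<longleftrightarrow> locally_integrable_on UNIV g \<and>
     (\<forall>\<theta>\<in>test_functions UNIV. u \<theta> = dist_of_fun g \<theta>)"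

(* |u(x)|, for a distribution u that is a function (determined almost everywhere); infinite if
   u is not a function.  The second case never occurs for the frequency-localized pieces of
   tempered distributions used below, by the Paley-Wiener-Schwartz theorem. *)
definition dist_abs :: "'n::finite functional \<Rightarrow> real ^ 'n \<Rightarrow> ennreal" where
  "dist_abs u x =
     (if \<exists>g. represents g u then ennreal (cmod ((SOME g. represents g u) x)) else \<infinity>)"


section \<open>Fourier transform and Fourier multipliers\<close>

definition fourier :: "(real ^ 'n \<Rightarrow> complex) \<Rightarrow> real ^ 'n \<Rightarrow> complex" where
  "fourier f \<xi> = (LINT x|lebesgue. f x * exp (- 2 * of_real pi * \<i> * of_real (x \<bullet> \<xi>)))"

definition inv_fourier :: "(real ^ 'n \<Rightarrow> complex) \<Rightarrow> real ^ 'n \<Rightarrow> complex" where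
  "inv_fourier f x = (LINT \<xi>|lebesgue. f \<xi> * exp (2 * of_real pi * \<i> * of_real (x \<bullet> \<xi>)))"

definition fourier_dist :: "'n::finite functional \<Rightarrow> 'n functional" where
  "fourier_dist u = (\<lambda>\<theta>. u (fourier \<theta>))"

definition inv_fourier_dist :: "'n::finite functional \<Rightarrow> 'n functional" where
  "inv_fourier_dist u = (\<lambda>\<theta>. u (inv_fourier \<theta>))"

definition mult_dist :: "(real ^ 'n \<Rightarrow> complex) \<Rightarrow> 'n::finite functional \<Rightarrow> 'n functional" where
  "mult_dist m u = (\<lambda>\<theta>. u (\<lambda>\<xi>. m \<xi> * \<theta> \<xi>))"

definition fourier_multiplier ::
  "(real ^ 'n \<Rightarrow> complex) \<Rightarrow> 'n::finite functional \<Rightarrow> 'n functional" where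
  "fourier_multiplier m u = inv_fourier_dist (mult_dist m (fourier_dist u))"


section \<open>The quasi-norms\<close>

text \<open>All quasi-norms take values in \<^typ>\<open>ennreal\<close>; the spaces consist of the elements of
  finite quasi-norm. Exponents below are positive.\<close>

definition epowr :: "ennreal \<Rightarrow> real \<Rightarrow> ennreal" where
  "epowr a r = (if a = \<infinity> then \<infinity> else ennreal (enn2real a powr r))"

definition Lp_norm :: "real \<Rightarrow> (real ^ 'n \<Rightarrow> ennreal) \<Rightarrow> ennreal" where
  "Lp_norm p G = epowr (\<integral>\<^sup>+ x. epowr (G x) p \<partial>lebesgue) (1 / p)"

definition dilate :: "real \<Rightarrow> (real ^ 'n \<Rightarrow> complex) \<Rightarrow> real ^ ('n::finite) \<Rightarrow> complex" where
  "dilate t \<psi> x = \<psi> ((1 / t) *\<^sub>R x) / of_real (t ^ CARD('n))"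

definition conv_dist ::
  "(real ^ 'n \<Rightarrow> complex) \<Rightarrow> 'n::finite functional \<Rightarrow> real ^ 'n \<Rightarrow> complex" where
  "conv_dist \<psi> u x = u (\<lambda>y. \<psi> (x - y))"

definition hardy_norm ::
  "(real ^ 'n \<Rightarrow> complex) \<Rightarrow> real \<Rightarrow> 'n::finite functional \<Rightarrow> ennreal" where
  "hardy_norm \<psi> p u =
     Lp_norm p (\<lambda>x. SUP t\<in>{0<..<1}. ennreal (cmod (conv_dist (dilate t \<psi>) u x)))"

definition dyadic_symbol :: "(real ^ 'n \<Rightarrow> complex) \<Rightarrow> nat \<Rightarrow> real ^ 'n \<Rightarrow> complex" where
  "dyadic_symbol \<phi> j \<xi> =
     (if j = 0 then \<phi> \<xi> else \<phi> ((1 / 2 ^ j) *\<^sub>R \<xi>) - \<phi> (2 *\<^sub>R (1 / 2 ^ j) *\<^sub>R \<xi>))"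

definition dyadic_block ::
  "(real ^ 'n \<Rightarrow> complex) \<Rightarrow> nat \<Rightarrow> 'n::finite functional \<Rightarrow> 'n functional" where
  "dyadic_block \<phi> j = fourier_multiplier (dyadic_symbol \<phi> j)"

definition besov_norm ::
  "(real ^ 'n \<Rightarrow> complex) \<Rightarrow> real \<Rightarrow> 'n::finite functional \<Rightarrow> ennreal" where
  "besov_norm \<phi> p u =
     epowr (\<Sum>j. epowr (Lp_norm p (dist_abs (dyadic_block \<phi> j u))) p) (1 / p)"

definition triebel_lizorkin_norm ::
  "(real ^ 'n \<Rightarrow> complex) \<Rightarrow> real \<Rightarrow> 'n::finite functional \<Rightarrow> ennreal" where
  "triebel_lizorkin_norm \<phi> p u =
     Lp_norm p (\<lambda>x. epowr (\<Sum>j. epowr (dist_abs (dyadic_block \<phi> j u) x) p) (1 / p))"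

definition lattice_point :: "int ^ 'n \<Rightarrow> real ^ 'n" where
  "lattice_point k = (\<chi> i. of_int (k $ i))"

definition uniform_symbol :: "(real ^ 'n \<Rightarrow> real) \<Rightarrow> int ^ 'n \<Rightarrow> real ^ 'n \<Rightarrow> real" where
  "uniform_symbol \<eta> k \<xi> =
     \<eta> (\<xi> - lattice_point k) * inverse (\<Sum>\<^sub>\<infinity>l. \<eta> (\<xi> - lattice_point l))"

definition uniform_block ::
  "(real ^ 'n \<Rightarrow> real) \<Rightarrow> int ^ 'n \<Rightarrow> 'n::finite functional \<Rightarrow> 'n functional" where
  "uniform_block \<eta> k = fourier_multiplier (\<lambda>\<xi>. of_real (uniform_symbol \<eta> k \<xi>))"

definition modulation_norm ::
  "(real ^ 'n \<Rightarrow> real) \<Rightarrow> real \<Rightarrow> 'n::finite functional \<Rightarrow> ennreal" where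
  "modulation_norm \<eta> p u =
     epowr (\<Sum>\<^sub>\<infinity>k. epowr (Lp_norm p (dist_abs (uniform_block \<eta> k u))) p) (1 / p)"


section \<open>The Hausdorff operator and boundedness\<close>

definition hausdorff_op ::
  "(real ^ 'n \<Rightarrow> complex) \<Rightarrow> (real ^ 'n \<Rightarrow> complex) \<Rightarrow> real ^ 'n \<Rightarrow> complex" where
  "hausdorff_op \<Phi> f x = (LINT y|lebesgue. \<Phi> y * f ((1 / norm y) *\<^sub>R x))"

definition bounded_on_Lp ::
  "real \<Rightarrow> ((real ^ 'n \<Rightarrow> complex) \<Rightarrow> real ^ ('n::finite) \<Rightarrow> complex) \<Rightarrow> bool" where
  "bounded_on_Lp p T \<longleftrightarrow> (\<exists>C::real. 0 \<le> C \<and> (\<forall>f\<in>test_functions (- {0}).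
     T f \<in> borel_measurable lebesgue \<and>
     Lp_norm p (\<lambda>x. ennreal (cmod (T f x))) < \<infinity> \<and>
     Lp_norm p (\<lambda>x. ennreal (cmod (T f x)))
       \<le> ennreal C * Lp_norm p (\<lambda>x. ennreal (cmod (f x)))))"

(* Boundedness on the space of all tempered distributions u with N u finite. The tempered
   distribution u defined by the function T f is unique, by density of the test functions. *)
definition bounded_on_dist_space ::
  "('n::finite functional \<Rightarrow> ennreal) \<Rightarrow>
   ((real ^ 'n \<Rightarrow> complex) \<Rightarrow> real ^ 'n \<Rightarrow> complex) \<Rightarrow> bool" where
  "bounded_on_dist_space N T \<longleftrightarrow> (\<exists>C::real. 0 \<le> C \<and> (\<forall>f\<in>test_functions (- {0}).
     \<exists>u\<in>tempered_distributions. represents (T f) u \<and> N u < \<infinity> \<and>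
       N u \<le> ennreal C * N (dist_of_fun f)))"

definition zero_operator ::
  "((real ^ 'n \<Rightarrow> complex) \<Rightarrow> real ^ ('n::finite) \<Rightarrow> complex) \<Rightarrow> bool" where
  "zero_operator T \<longleftrightarrow> (\<forall>f\<in>test_functions (- {0}). \<forall>x. T f x = 0)"

end

theory Submission
  imports Defs "HOL-Probability.Probability"
begin

text \<open>
  Test the operator on the translates \<open>f\<^sub>R(x) = g(x - R e)\<close> of a bump \<open>g\<close>, whose quasi-norms do not
  depend on \<open>R\<close>. Off the origin \<open>H f\<^sub>R\<close> is a continuous function, and each of the quasi-norms dominates
  its \<open>L\<^sup>p\<close> quasi-norm: the Hardy quasi-norm because \<open>\<psi>\<^sub>t * H f\<^sub>R\<close> converges to a multiple of \<open>H f\<^sub>R\<close>, the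
  others because the blocks sum to \<open>H f\<^sub>R\<close> and \<open>|\<Sum>a\<^sub>j|\<^sup>p \<le> \<Sum>|a\<^sub>j|\<^sup>p\<close> for \<open>p < 1\<close>. So boundedness on any of the
  spaces makes \<open>\<integral>|H f\<^sub>R|\<^sup>p\<close> bounded in \<open>R\<close>. As \<open>R\<close> grows, \<open>H f\<^sub>R\<close> spreads over an annulus: its sup norm tends to
  0 when \<open>\<Phi>\<close> is bounded, and for \<open>p < 1\<close> this forces \<open>\<integral>|H f\<^sub>R| \<rightarrow> 0\<close> there. But the integral of
  \<open>H f\<^sub>R(x)\<close> against \<open>\<beta>(|x|/R)\<close> converges to \<open>\<integral>g\<close> times \<open>\<integral>\<Phi>(y) |y|\<^sup>n \<beta>(|y|) dy\<close>; hence the radial averages of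
  \<open>\<Phi>\<close> vanish, and \<open>H f(x)\<close> depends on \<open>\<Phi>\<close> only through them.
\<close>

section \<open>Smooth functions\<close>

text \<open>Two features of the setting shape the work. A distribution is tied to its function only
  through compactly supported tests, while the blocks and the convolutions with
  \<open>\<psi>\<^sub>t\<close> test against Schwartz kernels of unbounded support, and
  \<open>H f\<close> may grow fast or be discontinuous at the origin. So identities with such
  kernels are reached by limits: mollifiers at Lebesgue points identify the blocks, and an
  approximate identity is split near a point, where the distribution acts by integration, and far
  from it, where the kernel tends to 0 in the Schwartz topology. Moreover, that the blocks sum to
  \<open>H f\<close> is a telescoping identity in the dyadic case only. The lattice of the
  modulation space has no natural order of summation, and absolute convergence has to be extracted
  from finiteness of the quasi-norm itself. The sup norm of \<open>H f\<^sub>R\<close> decays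
  because at each point only those \<open>y\<close> contribute whose modulus lies in an interval of
  relative length about 1/R, an annulus of small volume. Since \<Phi> is merely locally integrable,
  this applies to a truncation of \<Phi>; the rest is small in \<open>L^1\<close> only, and the two
  parts must be recombined although the \<open>p\<close>-integral is known just for their
  sum.\<close>

declare partial_deriv.simps(2) [simp del]

text \<open>Peels off a single coordinate as \<open>partial_deriv [i]\<close>, the form in which the
  product and chain rules are stated. The simp rule unfolding to \<open>frechet_derivative\<close>
  is disabled to preserve this form.\<close>

lemma partial_deriv_Cons: "partial_deriv (i # is) f = partial_deriv [i] (partial_deriv is f)"
  by (simp add: partial_deriv.simps)

lemma partial_deriv_append: "partial_deriv (is @ js) f = partial_deriv is (partial_deriv js f)"
  by (induction "is") (auto simp: partial_deriv.simps)

lemma partial_deriv_has_derivative: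
  "(f has_derivative f') (at x) \<Longrightarrow> partial_deriv [i] f x = f' (axis i 1)"
  using frechet_derivative_at[of f f' x] by (simp add: partial_deriv.simps)

text \<open>A class of differentiable functions that is closed under first partial derivatives
  contains all mixed derivatives of its members. This replaces explicit formulas for mixed
  derivatives of composite expressions.\<close>

lemma smooth_coinduct:
  assumes "P f" and diff: "\<And>f x. P f \<Longrightarrow> f differentiable (at x)"
    and step: "\<And>f i. P f \<Longrightarrow> P (partial_deriv [i] f)"
  shows "smooth f"
proof -
  have "P (partial_deriv is f)" for "is"
  proof (induction "is")
    case (Cons i "is")
    then show ?case using step[OF Cons, of i] by (simp add: partial_deriv.simps)
  qed (use assms in simp)
  then show ?thesis using diff by (auto simp: smooth_def)
qed

lemma smooth_differentiable: "smooth f \<Longrightarrow> f differentiable (at x)"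
  using partial_deriv.simps(1)[of f] unfolding smooth_def by metis

lemma smooth_partial_deriv: "smooth f \<Longrightarrow> smooth (partial_deriv is f)"
  unfolding smooth_def by (metis partial_deriv_append)

lemma smooth_continuous: "smooth f \<Longrightarrow> continuous_on A f"
  by (meson continuous_at_imp_continuous_on differentiable_imp_continuous_within smooth_differentiable)

lemma smooth_measurable: 
  fixes f :: "real ^ 'n::finite \<Rightarrow> 'b::real_normed_vector"
  assumes "smooth f" shows "f \<in> borel_measurable borel"
  using assms by (intro borel_measurable_continuous_onI smooth_continuous)

lemma smooth_has_derivative: "smooth f \<Longrightarrow> (f has_derivative frechet_derivative f (at x)) (at x)"
  using frechet_derivative_works smooth_differentiable by blast

lemma frechet_derivative_eq_sum:
  fixes f :: "real ^ 'n::finite \<Rightarrow> 'b::real_normed_vector"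
  assumes "f differentiable (at x)"
  shows "frechet_derivative f (at x) h = (\<Sum>i\<in>UNIV. (h $ i) *\<^sub>R partial_deriv [i] f x)"
proof -
  interpret linear "frechet_derivative f (at x)" by (rule linear_frechet_derivative[OF assms])
  have "h = (\<Sum>i\<in>UNIV. (h $ i) *\<^sub>R axis i 1)"
    using basis_expansion[of h] by (simp add: scalar_mult_eq_scaleR)
  then have "frechet_derivative f (at x) h = frechet_derivative f (at x) (\<Sum>i\<in>UNIV. (h $ i) *\<^sub>R axis i 1)" by simp
  also have "\<dots> = (\<Sum>i\<in>UNIV. (h $ i) *\<^sub>R frechet_derivative f (at x) (axis i 1))"
    by (simp add: sum scale)
  finally show ?thesis by (simp add: partial_deriv.simps)
qed

lemma partial_deriv_const: "partial_deriv is (\<lambda>_. c) = (\<lambda>_. if is = [] then c else 0)"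
proof (induction "is")
  case (Cons i "is")
  show ?case 
    unfolding partial_deriv.simps Cons by simp
qed simp

lemma smooth_const: "smooth (\<lambda>_. c)"
  by (simp add: smooth_def partial_deriv_const)

lemma partial_deriv_coord:
  "partial_deriv [j] (\<lambda>x::real^'n::finite. complex_of_real (x $ i)) = (\<lambda>x. if i = j then 1 else 0)"
proof
  fix x :: "real ^ 'n"
  have "((\<lambda>x. complex_of_real (x $ i)) has_derivative (\<lambda>h. complex_of_real (h $ i))) (at x)"
    by (intro derivative_eq_intros bounded_linear_imp_has_derivative bounded_linear_of_real bounded_linear_vec_nth
        bounded_linear_compose[OF bounded_linear_of_real])
  from partial_deriv_has_derivative[OF this, of j] show "partial_deriv [j] (\<lambda>x. complex_of_real (x $ i)) x = (if i = j then 1 else 0)"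
    by (simp add: axis_def)
qed

lemma smooth_coord: "smooth (\<lambda>x::real^'n::finite. complex_of_real (x $ i))"
proof (rule smooth_coinduct[where P = "\<lambda>h. h = (\<lambda>x::real^'n. complex_of_real (x $ i)) \<or> (\<exists>c. h = (\<lambda>_. c))"])
  fix f :: "real^'n \<Rightarrow> complex" and x j
  assume "f = (\<lambda>x. complex_of_real (x $ i)) \<or> (\<exists>c. f = (\<lambda>_. c))"
  then show "f differentiable at x"
    by (elim disjE exE) (simp_all add: bounded_linear_imp_differentiable bounded_linear_compose[OF bounded_linear_of_real] bounded_linear_vec_nth)
next
  fix f :: "real^'n \<Rightarrow> complex" and j
  assume "f = (\<lambda>x. complex_of_real (x $ i)) \<or> (\<exists>c. f = (\<lambda>_. c))"
  then show "partial_deriv [j] f = (\<lambda>x. complex_of_real (x $ i)) \<or> (\<exists>c. partial_deriv [j] f = (\<lambda>_. c))"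
    using partial_deriv_coord[of j i] partial_deriv_const[of "[j]"] by auto
qed auto

lemma smooth_of_real: 
  fixes f :: "real^'n::finite \<Rightarrow> real"
  assumes "smooth f" shows "smooth (\<lambda>x. complex_of_real (f x))"
proof (rule smooth_coinduct[where P = "\<lambda>h. \<exists>f. smooth f \<and> h = (\<lambda>x. complex_of_real (f x))"])
  fix h :: "real^'n \<Rightarrow> complex" and x i
  assume "\<exists>f. smooth f \<and> h = (\<lambda>x. complex_of_real (f x))"
  then obtain f where f: "smooth f" "h = (\<lambda>x. complex_of_real (f x))" by blast
  have d: "(h has_derivative (\<lambda>t. complex_of_real (frechet_derivative f (at x) t))) (at x)" for x
    unfolding f by (rule bounded_linear.has_derivative[OF bounded_linear_of_real smooth_has_derivative[OF f(1)]])
  then show "h differentiable at x" by (auto simp: differentiable_def)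
  have "partial_deriv [i] h = (\<lambda>x. complex_of_real (partial_deriv [i] f x))"
    using partial_deriv_has_derivative[OF d] by (auto simp: partial_deriv.simps)
  then show "\<exists>f. smooth f \<and> partial_deriv [i] h = (\<lambda>x. complex_of_real (f x))"
    using smooth_partial_deriv[OF f(1)] by blast
qed (use assms in auto)

section \<open>Product, sum and chain rules; closure properties of smoothness\<close>

lemma partial_deriv_mult:
  fixes f g :: "real ^ 'n::finite \<Rightarrow> complex"
  assumes "f differentiable (at x)" "g differentiable (at x)"
  shows "partial_deriv [i] (\<lambda>x. f x * g x) x = f x * partial_deriv [i] g x + partial_deriv [i] f x * g x"
  using partial_deriv_has_derivative[OF has_derivative_mult[OF assms[unfolded frechet_derivative_works]], of i]
  by (simp add: partial_deriv.simps)

lemma partial_deriv_add: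
  fixes f g :: "real ^ 'n::finite \<Rightarrow> 'b::real_normed_vector"
  assumes "f differentiable (at x)" "g differentiable (at x)"
  shows "partial_deriv [i] (\<lambda>x. f x + g x) x = partial_deriv [i] f x + partial_deriv [i] g x"
  using partial_deriv_has_derivative[OF has_derivative_add[OF assms[unfolded frechet_derivative_works]], of i]
  by (simp add: partial_deriv.simps)

lemma partial_deriv_affine:
  fixes f :: "real ^ 'n::finite \<Rightarrow> 'b::real_normed_vector"
  assumes "f differentiable (at (c *\<^sub>R x + a))"
  shows "(\<lambda>x. f (c *\<^sub>R x + a)) differentiable (at x)"
    "partial_deriv [i] (\<lambda>x. f (c *\<^sub>R x + a)) x = c *\<^sub>R partial_deriv [i] f (c *\<^sub>R x + a)"
proof -
  have d: "((\<lambda>x. f (c *\<^sub>R x + a)) has_derivative (\<lambda>h. frechet_derivative f (at (c *\<^sub>R x + a)) (c *\<^sub>R h))) (at x)"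
    by (rule has_derivative_compose[of "\<lambda>x. c *\<^sub>R x + a" "\<lambda>h. c *\<^sub>R h" x UNIV f, OF _ assms[unfolded frechet_derivative_works]])
      (auto intro!: derivative_eq_intros)
  then show "(\<lambda>x. f (c *\<^sub>R x + a)) differentiable (at x)" by (auto simp: differentiable_def)
  show "partial_deriv [i] (\<lambda>x. f (c *\<^sub>R x + a)) x = c *\<^sub>R partial_deriv [i] f (c *\<^sub>R x + a)"
    using partial_deriv_has_derivative[OF d, of i] linear_frechet_derivative[OF assms] by (simp add: linear_cmul partial_deriv.simps)
qed

text \<open>Mixed derivatives of products, reciprocals and exponentials have no convenient closed
  form, but one derivative of each constructor is again an expression in the constructors. The
  closure is therefore invariant under differentiation, and \<open>smooth_coinduct\<close> applies
  to it.\<close>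

inductive smooth_closure :: "(real ^ 'n::finite \<Rightarrow> complex) \<Rightarrow> bool" where
  base: "smooth f \<Longrightarrow> smooth_closure f"
| add: "smooth_closure f \<Longrightarrow> smooth_closure g \<Longrightarrow> smooth_closure (\<lambda>x. f x + g x)"
| mult: "smooth_closure f \<Longrightarrow> smooth_closure g \<Longrightarrow> smooth_closure (\<lambda>x. f x * g x)"
| inverse: "smooth_closure f \<Longrightarrow> (\<And>x. f x \<noteq> 0) \<Longrightarrow> smooth_closure (\<lambda>x. inverse (f x))"
| exp: "smooth_closure f \<Longrightarrow> smooth_closure (\<lambda>x. exp (f x))"
| affine: "smooth_closure f \<Longrightarrow> smooth_closure (\<lambda>x. f (c *\<^sub>R x + a))"

lemma smooth_closure_step: "smooth_closure f \<Longrightarrow> (\<forall>x. f differentiable (at x)) \<and> (\<forall>i. smooth_closure (partial_deriv [i] f))"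
proof (induction rule: smooth_closure.induct)
  case (base f)
  then show ?case using smooth_differentiable smooth_partial_deriv smooth_closure.base by blast
next
  case (add f g)
  have "partial_deriv [i] (\<lambda>x. f x + g x) = (\<lambda>x. partial_deriv [i] f x + partial_deriv [i] g x)" for i
    using add.IH by (intro ext partial_deriv_add) auto
  then show ?case using add.IH by (simp add: smooth_closure.add)
next
  case (mult f g)
  have "partial_deriv [i] (\<lambda>x. f x * g x) = (\<lambda>x. f x * partial_deriv [i] g x + partial_deriv [i] f x * g x)" for i
    using mult.IH by (intro ext partial_deriv_mult) auto
  then show ?case using mult by (simp add: smooth_closure.add smooth_closure.mult)
next
  case (inverse f)
  have d: "((\<lambda>x. inverse (f x)) has_derivative (\<lambda>h. - (inverse (f x) * frechet_derivative f (at x) h * inverse (f x)))) (at x)" for x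
    using inverse by (intro Deriv.has_derivative_inverse) (auto simp: frechet_derivative_works)
  \<comment> \<open>The sign is written as a factor \<open>-1\<close>, because the class has a
    constructor for products and none for negation.\<close>
  have "partial_deriv [i] (\<lambda>x. inverse (f x)) = (\<lambda>x. (-1) * (inverse (f x) * partial_deriv [i] f x * inverse (f x)))" for i
    using partial_deriv_has_derivative[OF d] by (auto simp: partial_deriv.simps)
  then have "smooth_closure (partial_deriv [i] (\<lambda>x. inverse (f x)))" for i
    using inverse smooth_closure.inverse[of f]
    by (simp only: smooth_closure.mult smooth_closure.base[OF smooth_const] not_False_eq_True simp_thms)
  then show ?case using d by (auto simp: differentiable_def)
next
  case (exp f)
  have d: "((\<lambda>x. exp (f x)) has_derivative (\<lambda>h. frechet_derivative f (at x) h * exp (f x))) (at x)" for x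
    using has_derivative_compose[of f "frechet_derivative f (at x)" x UNIV exp, OF _ DERIV_exp[unfolded has_field_derivative_def]] exp
    by (simp add: frechet_derivative_works mult.commute)
  have "partial_deriv [i] (\<lambda>x. exp (f x)) = (\<lambda>x. partial_deriv [i] f x * exp (f x))" for i
    using partial_deriv_has_derivative[OF d] by (auto simp: partial_deriv.simps)
  then have "smooth_closure (partial_deriv [i] (\<lambda>x. exp (f x)))" for i
    using exp by (simp only: smooth_closure.mult smooth_closure.exp)
  then show ?case using d by (auto simp: differentiable_def)
next
  case (affine f c a)
  have "partial_deriv [i] (\<lambda>x. f (c *\<^sub>R x + a)) = (\<lambda>x. of_real c * partial_deriv [i] f (c *\<^sub>R x + a))" for i
    using affine.IH by (auto simp: partial_deriv_affine(2) scaleR_conv_of_real[where 'a = complex])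
  then have "smooth_closure (partial_deriv [i] (\<lambda>x. f (c *\<^sub>R x + a)))" for i
    using affine.IH smooth_closure.affine[of "partial_deriv [i] f" c a] smooth_closure.mult[OF smooth_closure.base[OF smooth_const]] by auto
  then show ?case using affine.IH partial_deriv_affine(1) by blast
qed

lemma smooth_closure_smooth: "smooth_closure f \<Longrightarrow> smooth f"
  using smooth_closure_step by (intro smooth_coinduct[where P = smooth_closure]) auto

lemma smooth_add: "smooth f \<Longrightarrow> smooth g \<Longrightarrow> smooth (\<lambda>x. f x + g x :: complex)"
  by (rule smooth_closure_smooth, rule smooth_closure.add) (rule smooth_closure.base, assumption)+

lemma smooth_mult: "smooth f \<Longrightarrow> smooth g \<Longrightarrow> smooth (\<lambda>x. f x * g x :: complex)"
  by (rule smooth_closure_smooth, rule smooth_closure.mult) (rule smooth_closure.base, assumption)+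

lemma smooth_inverse: "smooth f \<Longrightarrow> (\<And>x. f x \<noteq> 0) \<Longrightarrow> smooth (\<lambda>x. inverse (f x) :: complex)"
  by (rule smooth_closure_smooth, rule smooth_closure.inverse, rule smooth_closure.base) auto

lemma smooth_exp: "smooth f \<Longrightarrow> smooth (\<lambda>x. exp (f x) :: complex)"
  by (rule smooth_closure_smooth, rule smooth_closure.exp, rule smooth_closure.base)

lemma smooth_affine: "smooth f \<Longrightarrow> smooth (\<lambda>x. f (c *\<^sub>R x + a) :: complex)"
  by (rule smooth_closure_smooth, rule smooth_closure.affine, rule smooth_closure.base)

lemma smooth_diff: "smooth f \<Longrightarrow> smooth g \<Longrightarrow> smooth (\<lambda>x. f x - g x :: complex)"
  using smooth_add[OF _ smooth_mult[OF smooth_const[of "-1"]], of f g] by simp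

lemma smooth_sum: "(\<And>i. i \<in> I \<Longrightarrow> smooth (f i)) \<Longrightarrow> smooth (\<lambda>x. \<Sum>i\<in>I. f i x :: complex)"
  by (induction I rule: infinite_finite_induct) (auto intro: smooth_const smooth_add)

lemma smooth_inner: "smooth (\<lambda>x::real ^ 'n::finite. complex_of_real (x \<bullet> a))"
proof -
  have "(\<lambda>x. complex_of_real (x \<bullet> a)) = (\<lambda>x. \<Sum>i\<in>UNIV. complex_of_real (x $ i) * of_real (a $ i))"
    by (auto simp: inner_vec_def)
  then show ?thesis by (simp only:) (intro smooth_sum smooth_mult smooth_coord smooth_const)
qed

text \<open>Serves the sum of all lattice translates of a bump, which is an infinite sum globally
  but a finite one near each point.\<close>

lemma smooth_local:
  assumes "\<And>x. \<exists>U g. open U \<and> x \<in> U \<and> smooth g \<and> (\<forall>y\<in>U. f y = g y)"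
  shows "smooth f"
proof (rule smooth_coinduct[where P = "\<lambda>f. \<forall>x. \<exists>U g. open U \<and> x \<in> U \<and> smooth g \<and> (\<forall>y\<in>U. f y = g y)"])
  have d: "\<exists>U g. open U \<and> x \<in> U \<and> smooth g \<and> (\<forall>y\<in>U. f y = g y \<and> (f has_derivative frechet_derivative g (at y)) (at y))"
    if asm: "\<forall>x. \<exists>U g. open U \<and> x \<in> U \<and> smooth g \<and> (\<forall>y\<in>U. f y = g y)" for f :: "real^'a \<Rightarrow> 'b" and x
  proof -
    obtain U g where U: "open U" "x \<in> U" "smooth g" "\<forall>y\<in>U. f y = g y" using asm by blast
    have "(f has_derivative frechet_derivative g (at y)) (at y)" if "y \<in> U" for y
      using has_derivative_transform_within_open[OF smooth_has_derivative[OF U(3), of y] U(1) that] U(4) by auto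
    then show ?thesis using U by blast
  qed
  fix f :: "real^'a \<Rightarrow> 'b" and x i
  assume asm: "\<forall>x. \<exists>U g. open U \<and> x \<in> U \<and> smooth g \<and> (\<forall>y\<in>U. f y = g y)"
  show "f differentiable at x" using d[OF asm, of x] by (auto simp: differentiable_def)
  show "\<forall>x. \<exists>U g. open U \<and> x \<in> U \<and> smooth g \<and> (\<forall>y\<in>U. partial_deriv [i] f y = g y)"
  proof
    fix x 
    obtain U g where U: "open U" "x \<in> U" "smooth g" "\<forall>y\<in>U. f y = g y \<and> (f has_derivative frechet_derivative g (at y)) (at y)"
      using d[OF asm, of x] by blast
    have "partial_deriv [i] f y = partial_deriv [i] g y" if "y \<in> U" for y
      using U(4) that partial_deriv_has_derivative[of f _ y i] by (auto simp: partial_deriv.simps)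
    then show "\<exists>U g. open U \<and> x \<in> U \<and> smooth g \<and> (\<forall>y\<in>U. partial_deriv [i] f y = g y)"
      using U smooth_partial_deriv by blast
  qed
qed (use assms in auto)

text \<open>The induction needs equality on all of \<open>U\<close>, since every further derivative
  at a point looks at the previous one in a neighbourhood. With \<open>g = 0\<close> it shows that
  derivatives vanish wherever the function vanishes on an open set.\<close>

lemma partial_deriv_eq_on_open:
  assumes "open U" "x \<in> U" "\<And>y. y \<in> U \<Longrightarrow> f y = g y" "smooth g"
  shows "partial_deriv is f x = partial_deriv is g x"
  using assms(2)
proof (induction "is" arbitrary: x)
  case (Cons i "is")
  have "(partial_deriv is f has_derivative frechet_derivative (partial_deriv is g) (at x)) (at x)"
    using has_derivative_transform_within_open[OF smooth_has_derivative[OF smooth_partial_deriv[OF assms(4)], of "is" x] assms(1) Cons.prems]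
      Cons.IH by auto
  from partial_deriv_has_derivative[OF this] show ?case by (simp add: partial_deriv.simps)
qed (use assms in auto)

section \<open>Mixed derivatives of sums, multiples and affine substitutions\<close>

lemma partial_deriv_add_list:
  fixes f g :: "real ^ 'n::finite \<Rightarrow> complex"
  assumes "smooth f" "smooth g"
  shows "partial_deriv is (\<lambda>x. f x + g x) = (\<lambda>x. partial_deriv is f x + partial_deriv is g x)"
proof (induction "is")
  case (Cons i "is")
  have "partial_deriv (i # is) (\<lambda>x. f x + g x) = partial_deriv [i] (\<lambda>x. partial_deriv is f x + partial_deriv is g x)"
    using Cons by (simp add: partial_deriv_Cons[of i "is"])
  also have "\<dots> = (\<lambda>x. partial_deriv [i] (partial_deriv is f) x + partial_deriv [i] (partial_deriv is g) x)"
    using assms by (intro ext partial_deriv_add smooth_differentiable smooth_partial_deriv) auto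
  finally show ?case by (simp add: partial_deriv_Cons[of i "is"])
qed simp

lemma partial_deriv_cmult_list:
  fixes f :: "real ^ 'n::finite \<Rightarrow> complex"
  assumes "smooth f"
  shows "partial_deriv is (\<lambda>x. c * f x) = (\<lambda>x. c * partial_deriv is f x)"
proof (induction "is")
  case (Cons i "is")
  have "partial_deriv (i # is) (\<lambda>x. c * f x) = partial_deriv [i] (\<lambda>x. c * partial_deriv is f x)"
    using Cons by (simp add: partial_deriv_Cons[of i "is"])
  also have "\<dots> = (\<lambda>x. c * partial_deriv [i] (partial_deriv is f) x)"
    using assms partial_deriv_const[of "[i]" c]
    by (intro ext, subst partial_deriv_mult) (auto intro: smooth_differentiable smooth_partial_deriv)
  finally show ?case by (simp add: partial_deriv_Cons[of i "is"])
qed simp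

lemma partial_deriv_affine_list:
  fixes f :: "real ^ 'n::finite \<Rightarrow> complex"
  assumes "smooth f"
  shows "partial_deriv is (\<lambda>x. f (c *\<^sub>R x + a)) = (\<lambda>x. of_real (c ^ length is) * partial_deriv is f (c *\<^sub>R x + a))"
proof (induction "is")
  case (Cons i "is")
  have "partial_deriv (i # is) (\<lambda>x. f (c *\<^sub>R x + a)) = partial_deriv [i] (\<lambda>x. of_real (c ^ length is) * partial_deriv is f (c *\<^sub>R x + a))"
    using Cons by (simp add: partial_deriv_Cons[of i "is"])
  also have "\<dots> = (\<lambda>x. of_real (c ^ length is) * partial_deriv [i] (\<lambda>x. partial_deriv is f (c *\<^sub>R x + a)) x)"
    using assms by (intro partial_deriv_cmult_list[of _ "[i]"] smooth_affine smooth_partial_deriv)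
  also have "\<dots> = (\<lambda>x. of_real (c ^ length is) * (c *\<^sub>R partial_deriv [i] (partial_deriv is f) (c *\<^sub>R x + a)))"
    using assms by (subst partial_deriv_affine(2)) (auto intro: smooth_differentiable smooth_partial_deriv)
  finally show ?case by (simp add: scaleR_conv_of_real[where 'a = complex] algebra_simps partial_deriv_Cons[of i "is"])
qed simp

lemma partial_deriv_diff_list:
  fixes f g :: "real ^ 'n::finite \<Rightarrow> complex"
  assumes "smooth f" "smooth g"
  shows "partial_deriv is (\<lambda>x. f x - g x) = (\<lambda>x. partial_deriv is f x - partial_deriv is g x)"
  using partial_deriv_add_list[OF assms(1) smooth_mult[OF smooth_const assms(2)], of "is" "-1"] partial_deriv_cmult_list[OF assms(2), of "is" "-1"]
  by simp

section \<open>Test functions\<close>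

lemma test_functions_UNIV_iff:
  "f \<in> test_functions UNIV \<longleftrightarrow> smooth f \<and> (\<exists>r. \<forall>x. f x \<noteq> 0 \<longrightarrow> norm x \<le> r)"
proof -
  have "compact (supp f) \<longleftrightarrow> (\<exists>r. \<forall>x. f x \<noteq> 0 \<longrightarrow> norm x \<le> r)"
    by (simp add: supp_def compact_closure bounded_iff)
  then show ?thesis by (simp add: test_functions_def)
qed

lemma test_functions_smooth: "f \<in> test_functions A \<Longrightarrow> smooth f"
  by (simp add: test_functions_def)

text \<open>The support is closed, so avoiding the origin means keeping a positive distance
  \<open>r\<close> from it; the estimates on \<open>x / |y|\<close> use this number.\<close>

lemma test_functions_off_0_iff:
  "f \<in> test_functions (- {0}) \<longleftrightarrow> f \<in> test_functions UNIV \<and> (\<exists>r>0. \<forall>x. f x \<noteq> 0 \<longrightarrow> r \<le> norm x)"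
proof -
  have "(0 \<notin> supp f) \<longleftrightarrow> (\<exists>r>0. \<forall>x. f x \<noteq> 0 \<longrightarrow> r \<le> norm x)"
  proof -
    have "0 \<in> supp f \<longleftrightarrow> (\<forall>r>0. \<exists>x. f x \<noteq> 0 \<and> norm x < r)"
      by (auto simp: supp_def closure_approachable)
    then show ?thesis by (meson not_less)
  qed
  then show ?thesis by (auto simp: test_functions_def)
qed

lemma test_functions_mult:
  assumes "f \<in> test_functions UNIV" "smooth g"
  shows "(\<lambda>x. f x * g x) \<in> test_functions UNIV" "(\<lambda>x. g x * f x) \<in> test_functions UNIV"
  using assms unfolding test_functions_UNIV_iff by (auto intro: smooth_mult)

lemma test_functions_partial_deriv:
  assumes "f \<in> test_functions UNIV"
  shows "partial_deriv is f \<in> test_functions UNIV"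
proof -
  obtain r where r: "\<And>x. f x \<noteq> 0 \<Longrightarrow> norm x \<le> r" and s: "smooth f" using assms by (auto simp: test_functions_UNIV_iff)
  have "partial_deriv is f x = 0" if "norm x > r" for x
  proof -
    have "partial_deriv is f x = partial_deriv is (\<lambda>_. 0) x"
    proof (rule partial_deriv_eq_on_open[where U = "- cball 0 r"])
      show "open (- cball (0::real^'a) r)" by (simp add: open_Compl)
    qed (use r that smooth_const in auto)
    then show ?thesis by (simp add: partial_deriv_const)
  qed
  then show ?thesis using smooth_partial_deriv[OF s] unfolding test_functions_UNIV_iff
    by (meson not_less)
qed

lemma test_functions_affine:
  assumes "f \<in> test_functions UNIV" "c \<noteq> 0"
  shows "(\<lambda>x. f (c *\<^sub>R x + a)) \<in> test_functions UNIV"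
proof -
  obtain r where r: "\<And>x. f x \<noteq> 0 \<Longrightarrow> norm x \<le> r" using assms by (auto simp: test_functions_UNIV_iff)
  have "norm x \<le> (r + norm a) / \<bar>c\<bar>" if "f (c *\<^sub>R x + a) \<noteq> 0" for x
  proof -
    have "\<bar>c\<bar> * norm x = norm ((c *\<^sub>R x + a) - a)" by simp
    also have "\<dots> \<le> norm (c *\<^sub>R x + a) + norm a" by (rule norm_triangle_ineq4)
    also have "\<dots> \<le> r + norm a" using r[OF that] by simp
    finally show ?thesis using assms(2) by (simp add: field_simps)
  qed
  then show ?thesis using assms smooth_affine unfolding test_functions_UNIV_iff by blast
qed

lemma test_functions_bounded:
  fixes f :: "real ^ 'n::finite \<Rightarrow> complex"
  assumes "f \<in> test_functions UNIV"
  obtains B where "\<And>x. norm (f x) \<le> B" "B \<ge> 0"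
proof -
  obtain r where r: "\<And>x. f x \<noteq> 0 \<Longrightarrow> norm x \<le> r" and s: "smooth f" using assms by (auto simp: test_functions_UNIV_iff)
  have "bounded (f ` cball 0 r)" 
    by (intro compact_imp_bounded compact_continuous_image smooth_continuous s) auto
  then obtain B where "\<forall>y\<in>f ` cball 0 r. norm y \<le> B" unfolding bounded_iff by blast
  then have B: "\<And>x. x \<in> cball 0 r \<Longrightarrow> norm (f x) \<le> B" by blast
  have "norm (f x) \<le> max B 0" for x
    using B[of x] r[of x] by (cases "f x = 0") auto
  then show ?thesis using that by fastforce
qed

lemma test_functions_schwartz:
  assumes "f \<in> test_functions UNIV" shows "f \<in> schwartz"
proof -
  have "bounded (range (\<lambda>x. (1 + norm x) ^ N *\<^sub>R partial_deriv is f x))" for N "is"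
  proof -
    have 1: "partial_deriv is f \<in> test_functions UNIV" by (rule test_functions_partial_deriv[OF assms])
    then obtain r where r: "\<And>x. partial_deriv is f x \<noteq> 0 \<Longrightarrow> norm x \<le> r" by (auto simp: test_functions_UNIV_iff)
    obtain B where B: "\<And>x. norm (partial_deriv is f x) \<le> B" "B \<ge> 0" using test_functions_bounded[OF 1] by blast
    have "norm ((1 + norm x) ^ N *\<^sub>R partial_deriv is f x) \<le> (1 + \<bar>r\<bar>) ^ N * B" for x
    proof (cases "partial_deriv is f x = 0")
      case False
      then show ?thesis using r[OF False] B by (auto intro!: mult_mono power_mono)
    qed (use B in auto)
    then show ?thesis by (auto simp: bounded_iff)
  qed
  then show ?thesis using test_functions_smooth[OF assms] by (auto simp: schwartz_def)
qed

lemma continuous_compact_support_integrable: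
  fixes f :: "'a::euclidean_space \<Rightarrow> 'b::euclidean_space"
  assumes "continuous_on UNIV f" "\<And>x. f x \<noteq> 0 \<Longrightarrow> norm x \<le> r"
  shows "integrable lborel f"
proof -
  have "set_integrable lborel (cball 0 r) f"
    unfolding set_integrable_def
    by (intro borel_integrable_compact continuous_on_subset[OF assms(1)]) auto
  moreover have "(\<lambda>x. indicator (cball 0 r) x *\<^sub>R f x) = f"
    using assms(2) by (auto simp: indicator_def fun_eq_iff)
  ultimately show ?thesis by (simp add: set_integrable_def)
qed

lemma test_functions_integrable:
  fixes f :: "real ^ 'n::finite \<Rightarrow> complex"
  assumes "f \<in> test_functions UNIV"
  shows "integrable lborel f"
  using assms continuous_compact_support_integrable[of f] by (auto simp: test_functions_UNIV_iff intro: smooth_continuous)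

section \<open>Schwartz functions and tempered distributions\<close>

lemma schwartz_smooth: "f \<in> schwartz \<Longrightarrow> smooth f"
  by (simp add: schwartz_def)

lemma schwartz_bound:
  assumes "f \<in> schwartz"
  obtains C where "\<And>x. (1 + norm x) ^ N * norm (partial_deriv is f x) \<le> C" "C \<ge> 0"
proof -
  have "bounded (range (\<lambda>x. (1 + norm x) ^ N *\<^sub>R partial_deriv is f x))" using assms by (simp add: schwartz_def)
  then obtain B where "\<forall>y\<in>range (\<lambda>x. (1 + norm x) ^ N *\<^sub>R partial_deriv is f x). norm y \<le> B" unfolding bounded_iff by blast
  then have B: "(1 + norm x) ^ N * norm (partial_deriv is f x) \<le> B" for x by auto
  then show ?thesis using that[of B] order_trans[OF _ B[of 0]] by simp
qed

lemma schwartzI: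
  assumes "smooth f" "\<And>N is. \<exists>C. \<forall>x. (1 + norm x) ^ N * norm (partial_deriv is f x) \<le> C"
  shows "f \<in> schwartz"
proof -
  have "bounded (range (\<lambda>x. (1 + norm x) ^ N *\<^sub>R partial_deriv is f x))" for N "is"
  proof -
    obtain C where "\<forall>x. (1 + norm x) ^ N * norm (partial_deriv is f x) \<le> C" using assms(2) by blast
    then show ?thesis unfolding bounded_iff by (intro exI[of _ C]) simp
  qed
  then show ?thesis using assms(1) unfolding schwartz_def by simp
qed

lemma schwartz_partial_deriv: "f \<in> schwartz \<Longrightarrow> partial_deriv is f \<in> schwartz"
  unfolding schwartz_def partial_deriv_append[symmetric] by (simp add: smooth_partial_deriv partial_deriv_append[symmetric])

lemma schwartz_add:
  assumes "f \<in> schwartz" "g \<in> schwartz"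
  shows "(\<lambda>x. f x + g x) \<in> schwartz"
proof (rule schwartzI)
  show "smooth (\<lambda>x. f x + g x)" using assms by (intro smooth_add schwartz_smooth)
  fix N "is"
  obtain C where C: "\<And>x. (1 + norm x) ^ N * norm (partial_deriv is f x) \<le> C" using schwartz_bound[OF assms(1)] by metis
  obtain D where D: "\<And>x. (1 + norm x) ^ N * norm (partial_deriv is g x) \<le> D" using schwartz_bound[OF assms(2)] by metis
  have "(1 + norm x) ^ N * norm (partial_deriv is (\<lambda>x. f x + g x) x) \<le> C + D" for x
  proof -
    have "(1 + norm x) ^ N * norm (partial_deriv is (\<lambda>x. f x + g x) x) \<le>
      (1 + norm x) ^ N * (norm (partial_deriv is f x) + norm (partial_deriv is g x))"
      using assms by (intro mult_left_mono) (auto simp: partial_deriv_add_list schwartz_smooth norm_triangle_ineq)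
    then show ?thesis using C[of x] D[of x] by (simp add: distrib_left)
  qed
  then show "\<exists>C. \<forall>x. (1 + norm x) ^ N * norm (partial_deriv is (\<lambda>x. f x + g x) x) \<le> C" by blast
qed

lemma schwartz_cmult:
  assumes "f \<in> schwartz"
  shows "(\<lambda>x. c * f x) \<in> schwartz"
proof (rule schwartzI)
  show "smooth (\<lambda>x. c * f x)" using assms by (intro smooth_mult smooth_const schwartz_smooth)
  fix N "is"
  obtain C where C: "\<And>x. (1 + norm x) ^ N * norm (partial_deriv is f x) \<le> C" using schwartz_bound[OF assms(1)] by metis
  have "(1 + norm x) ^ N * norm (partial_deriv is (\<lambda>x. c * f x) x) \<le> norm c * C" for x
    using mult_left_mono[OF C[of x], of "norm c"] assms by (simp add: partial_deriv_cmult_list schwartz_smooth norm_mult mult_ac)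
  then show "\<exists>C. \<forall>x. (1 + norm x) ^ N * norm (partial_deriv is (\<lambda>x. c * f x) x) \<le> C" by blast
qed

lemma schwartz_diff: "f \<in> schwartz \<Longrightarrow> g \<in> schwartz \<Longrightarrow> (\<lambda>x. f x - g x) \<in> schwartz"
  using schwartz_add[of f "\<lambda>x. -1 * g x"] schwartz_cmult[of g "-1"] by simp

lemma schwartz_0: "(\<lambda>_. 0) \<in> schwartz"
  by (rule schwartzI[OF smooth_const]) (auto simp: partial_deriv_const)

lemma schwartz_affine:
  assumes "f \<in> schwartz" "c \<noteq> 0"
  shows "(\<lambda>x. f (c *\<^sub>R x + a)) \<in> schwartz"
proof (rule schwartzI)
  show "smooth (\<lambda>x. f (c *\<^sub>R x + a))" using assms by (intro smooth_affine schwartz_smooth)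
  fix N "is"
  obtain C where C: "\<And>x. (1 + norm x) ^ N * norm (partial_deriv is f x) \<le> C" using schwartz_bound[OF assms(1)] by metis
  \<comment> \<open>Chosen so that \<open>1 + |x| \<le> d (1 + |c x + a|)\<close>: the summand 1 in
    the second factor pays for 1, and the summand \<open>1 / |c|\<close> for
    \<open>|x|\<close>.\<close>
  define d where "d = (1 + norm a) * (1 + 1 / \<bar>c\<bar>)"
  have d: "1 + norm x \<le> d * (1 + norm (c *\<^sub>R x + a))" for x
  proof -
    have "\<bar>c\<bar> * norm x = norm ((c *\<^sub>R x + a) - a)" by simp
    also have "\<dots> \<le> norm (c *\<^sub>R x + a) + norm a" by (rule norm_triangle_ineq4)
    finally have "norm x \<le> (norm (c *\<^sub>R x + a) + norm a) / \<bar>c\<bar>" using assms by (simp add: field_simps)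
    moreover have "(norm (c *\<^sub>R x + a) + norm a) \<le> (1 + norm a) * (1 + norm (c *\<^sub>R x + a))"
      by (simp add: algebra_simps)
    ultimately have "norm x \<le> ((1 + norm a) * (1 + norm (c *\<^sub>R x + a))) / \<bar>c\<bar>" 
      by (meson abs_ge_zero divide_right_mono order_trans)
    moreover have "1 \<le> (1 + norm a) * (1 + norm (c *\<^sub>R x + a))" by (simp add: algebra_simps add_increasing)
    moreover have "d * (1 + norm (c *\<^sub>R x + a)) = (1 + norm a) * (1 + norm (c *\<^sub>R x + a))
        + ((1 + norm a) * (1 + norm (c *\<^sub>R x + a))) / \<bar>c\<bar>"
      unfolding d_def by (simp add: distrib_left distrib_right add_divide_distrib)
    ultimately show ?thesis by linarith
  qed
  have d0: "d \<ge> 0" unfolding d_def by simp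
  have "(1 + norm x) ^ N * norm (partial_deriv is (\<lambda>x. f (c *\<^sub>R x + a)) x) \<le> (d ^ N * \<bar>c\<bar> ^ length is) * C" for x
  proof -
    have "(1 + norm x) ^ N * norm (partial_deriv is (\<lambda>x. f (c *\<^sub>R x + a)) x) 
      = (1 + norm x) ^ N * (\<bar>c\<bar> ^ length is * norm (partial_deriv is f (c *\<^sub>R x + a)))"
      using assms by (simp add: partial_deriv_affine_list schwartz_smooth norm_mult norm_power)
    also have "\<dots> \<le> (d * (1 + norm (c *\<^sub>R x + a))) ^ N * (\<bar>c\<bar> ^ length is * norm (partial_deriv is f (c *\<^sub>R x + a)))"
      by (intro mult_right_mono power_mono d) auto
    also have "\<dots> = (d ^ N * \<bar>c\<bar> ^ length is) * ((1 + norm (c *\<^sub>R x + a)) ^ N * norm (partial_deriv is f (c *\<^sub>R x + a)))"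
      by (simp add: power_mult_distrib)
    also have "\<dots> \<le> (d ^ N * \<bar>c\<bar> ^ length is) * C" using C d0 by (intro mult_left_mono) auto
    finally show ?thesis .
  qed
  then show "\<exists>C. \<forall>x. (1 + norm x) ^ N * norm (partial_deriv is (\<lambda>x. f (c *\<^sub>R x + a)) x) \<le> C" by blast
qed

lemma schwartz_seminorm_bdd:
  assumes "f \<in> schwartz"
  shows "bdd_above (range (\<lambda>x. (1 + norm x) ^ N * cmod (partial_deriv is f x)))"
proof -
  obtain C where C: "\<And>x. (1 + norm x) ^ N * norm (partial_deriv is f x) \<le> C" using schwartz_bound[OF assms] by metis
  then show ?thesis by (rule bdd_aboveI2)
qed

lemma schwartz_seminorm_le:
  assumes "\<And>x. (1 + norm x) ^ N * cmod (partial_deriv is f x) \<le> C"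
  shows "schwartz_seminorm N is f \<le> C"
  unfolding schwartz_seminorm_def using assms by (intro cSUP_least) auto

lemma schwartz_seminorm_triangle:
  fixes f g :: "real ^ 'n::finite \<Rightarrow> complex"
  assumes "f \<in> schwartz" "g \<in> schwartz"
  shows "schwartz_seminorm N is (\<lambda>x. f x + g x) \<le> schwartz_seminorm N is f + schwartz_seminorm N is g"
proof (rule schwartz_seminorm_le)
  fix x
  have "(1 + norm x) ^ N * cmod (partial_deriv is (\<lambda>x. f x + g x) x)
     \<le> (1 + norm x) ^ N * cmod (partial_deriv is f x) + (1 + norm x) ^ N * cmod (partial_deriv is g x)"
    using assms norm_triangle_ineq[of "partial_deriv is f x" "partial_deriv is g x"]
    by (auto simp: partial_deriv_add_list schwartz_smooth simp flip: distrib_left intro!: mult_left_mono)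
  also have "\<dots> \<le> schwartz_seminorm N is f + schwartz_seminorm N is g"
    unfolding schwartz_seminorm_def using assms by (intro add_mono cSUP_upper schwartz_seminorm_bdd) auto
  finally show "(1 + norm x) ^ N * cmod (partial_deriv is (\<lambda>x. f x + g x) x) \<le> schwartz_seminorm N is f + schwartz_seminorm N is g" .
qed

section \<open>Convergence in the Schwartz topology and finite order of distributions\<close>

lemma topspace_schwartz:
  "topspace (schwartz_topology :: (real ^ 'n::finite \<Rightarrow> complex) topology) = schwartz"
proof (rule equalityI; rule subsetI)
  fix f :: "real^'n \<Rightarrow> complex"
  assume "f \<in> topspace schwartz_topology"
  then show "f \<in> schwartz"
    unfolding schwartz_topology_def topology_generated_by_topspace by blast
next
  fix f :: "real^'n \<Rightarrow> complex"
  assume f: "f \<in> schwartz"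
  have 1: "f \<in> {g \<in> schwartz. schwartz_seminorm 0 [] (\<lambda>x. g x - f x) < 1}"
    using f by (simp add: schwartz_seminorm_def)
  have 2: "{g \<in> schwartz. schwartz_seminorm 0 [] (\<lambda>x. g x - f x) < 1} \<in>
    {{g \<in> schwartz. schwartz_seminorm N is (\<lambda>x. g x - f x) < \<epsilon>} | f N is \<epsilon>. f \<in> schwartz \<and> 0 < \<epsilon>}"
    by (rule CollectI, rule exI[of _ f], rule exI[of _ "0::nat"], rule exI[of _ "[]"], rule exI[of _ "1::real"]) (simp add: f)
  show "f \<in> topspace schwartz_topology"
    unfolding schwartz_topology_def topology_generated_by_topspace by (rule UnionI[OF 2 1])
qed

text \<open>Eventual membership survives finite intersections and unions, so convergence may be
  tested on the generating sets.\<close>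

lemma limitin_topology_generated_by:
  assumes "x \<in> \<Union>S" "\<And>U. U \<in> S \<Longrightarrow> x \<in> U \<Longrightarrow> eventually (\<lambda>k. f k \<in> U) F"
  shows "limitin (topology_generated_by S) f x F"
proof -
  have "eventually (\<lambda>k. f k \<in> U) F" if "openin (topology_generated_by S) U" "x \<in> U" for U
  proof -
    have "generate_topology_on S U" using that(1) by (simp add: openin_topology_generated_by_iff)
    then show ?thesis using that(2)
    proof (induction U)
      case (Int a b)
      then show ?case by (auto intro: eventually_conj)
    next
      case (UN K)
      then obtain k where k: "k \<in> K" "x \<in> k" by blast
      then have "eventually (\<lambda>j. f j \<in> k) F" using UN.IH by blast
      then show ?case using k by (auto elim: eventually_mono)
    qed (use assms in auto)
  qed
  then show ?thesis using assms by (auto simp: limitin_def topology_generated_by_topspace)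
qed

lemma tempered_add: "u \<in> tempered_distributions \<Longrightarrow> f \<in> schwartz \<Longrightarrow> g \<in> schwartz \<Longrightarrow> u (\<lambda>x. f x + g x) = u f + u g"
  and tempered_cmult: "u \<in> tempered_distributions \<Longrightarrow> f \<in> schwartz \<Longrightarrow> u (\<lambda>x. c * f x) = c * u f"
  by (auto simp: tempered_distributions_def)

lemma tempered_diff: "u \<in> tempered_distributions \<Longrightarrow> f \<in> schwartz \<Longrightarrow> g \<in> schwartz \<Longrightarrow> u (\<lambda>x. f x - g x) = u f - u g"
  using tempered_add[of u f "\<lambda>x. -1 * g x"] tempered_cmult[of u g "-1"] schwartz_cmult[of g "-1"] by simp

lemma tempered_0: "u \<in> tempered_distributions \<Longrightarrow> u (\<lambda>x. 0) = 0"
  using tempered_cmult[of u "\<lambda>_. 0" 0] schwartz_0 by simp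

lemma tempered_sum:
  assumes "u \<in> tempered_distributions" "finite I" "\<And>i. i \<in> I \<Longrightarrow> f i \<in> schwartz"
  shows "(\<lambda>x. \<Sum>i\<in>I. f i x) \<in> schwartz \<and> u (\<lambda>x. \<Sum>i\<in>I. f i x) = (\<Sum>i\<in>I. u (f i))"
  using assms(2,3)
proof (induction I)
  case empty
  then show ?case using tempered_0[OF assms(1)] schwartz_0 by simp
next
  case (insert i I)
  then show ?case using tempered_add[OF assms(1), of "f i" "\<lambda>x. \<Sum>i\<in>I. f i x"] schwartz_add[of "f i" "\<lambda>x. \<Sum>i\<in>I. f i x"] by simp
qed

text \<open>A generating set containing 0 is a seminorm ball around some other centre
  \<open>h\<close>. The distance from 0 to its boundary is positive, and by the triangle inequality
  \<open>f k\<close> stays inside once its seminorm is below half of that distance.\<close>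

lemma tempered_tendsto_0:
  fixes u :: "'n::finite functional"
  assumes u: "u \<in> tempered_distributions" and f: "\<And>k. f k \<in> schwartz"
    and lim: "\<And>N is e. e > 0 \<Longrightarrow> eventually (\<lambda>k. \<forall>x. (1 + norm x) ^ N * cmod (partial_deriv is (f k) x) \<le> e) F"
  shows "((\<lambda>k. u (f k)) \<longlongrightarrow> 0) F"
proof -
  have "limitin schwartz_topology f (\<lambda>_. 0) F"
    unfolding schwartz_topology_def
  proof (rule limitin_topology_generated_by)
    have "(\<lambda>_::real^'n. 0) \<in> topspace schwartz_topology" using schwartz_0 topspace_schwartz by blast
    then show "(\<lambda>_::real^'n. 0::complex) \<in> \<Union> {{g \<in> schwartz. schwartz_seminorm N is (\<lambda>x. g x - f x) < \<epsilon>} |f N is \<epsilon>. f \<in> schwartz \<and> 0 < \<epsilon>}"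
      by (simp only: schwartz_topology_def topology_generated_by_topspace)
    fix U assume "U \<in> {{g \<in> schwartz. schwartz_seminorm N is (\<lambda>x. g x - f x) < \<epsilon>} |f N is \<epsilon>. f \<in> schwartz \<and> 0 < \<epsilon>}"
      "(\<lambda>_::real^'n. 0::complex) \<in> U"
    then obtain h N "is" e where U: "U = {g \<in> schwartz. schwartz_seminorm N is (\<lambda>x. g x - h x) < e}" and h: "h \<in> schwartz"
      and lt: "schwartz_seminorm N is (\<lambda>x. 0 - h x) < e" by blast
    define d where "d = (e - schwartz_seminorm N is (\<lambda>x. 0 - h x)) / 2"
    have d: "d > 0" using lt by (simp add: d_def)
    have "eventually (\<lambda>k. \<forall>x. (1 + norm x) ^ N * cmod (partial_deriv is (f k) x) \<le> d) F" by (rule lim[OF d])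
    then show "eventually (\<lambda>k. f k \<in> U) F"
    proof eventually_elim
      case (elim k)
      have "schwartz_seminorm N is (\<lambda>x. f k x - h x) = schwartz_seminorm N is (\<lambda>x. f k x + (0 - h x))" by simp
      also have "\<dots> \<le> schwartz_seminorm N is (f k) + schwartz_seminorm N is (\<lambda>x. 0 - h x)"
        by (intro schwartz_seminorm_triangle f schwartz_diff schwartz_0 h)
      also have "\<dots> \<le> d + schwartz_seminorm N is (\<lambda>x. 0 - h x)" using schwartz_seminorm_le[of N "is" "f k" d] elim by auto
      also have "\<dots> < e" using lt by (simp add: d_def field_simps)
      finally show ?case using f by (simp add: U)
    qed
  qed
  moreover have "continuous_map schwartz_topology euclidean u" using u by (simp add: tempered_distributions_def)
  ultimately have "limitin euclidean (u \<circ> f) (u (\<lambda>_. 0)) F" by (rule continuous_map_limit[rotated])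
  then show ?thesis using tempered_0[OF u] by (simp add: o_def)
qed

lemma tempered_tendsto:
  assumes u: "u \<in> tempered_distributions" and f: "\<And>k. f k \<in> schwartz" and g: "g \<in> schwartz"
    and lim: "\<And>N is e. e > 0 \<Longrightarrow> eventually (\<lambda>k. \<forall>x. (1 + norm x) ^ N * cmod (partial_deriv is (f k) x - partial_deriv is g x) \<le> e) F"
  shows "((\<lambda>k. u (f k)) \<longlongrightarrow> u g) F"
proof -
  have "((\<lambda>k. u (\<lambda>x. f k x - g x)) \<longlongrightarrow> 0) F"
    using lim by (intro tempered_tendsto_0[OF u]) 
      (simp_all add: schwartz_diff f g partial_deriv_diff_list[OF schwartz_smooth[OF f] schwartz_smooth[OF g]])
  then have "((\<lambda>k. u (f k) - u g) \<longlongrightarrow> 0) F" by (simp add: tempered_diff[OF u f g])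
  then show ?thesis by (simp add: LIM_zero_iff)
qed

text \<open>If no \<open>N\<close> worked, there would be a counterexample \<open>f N\<close> for
  every \<open>N\<close>; divided by \<open>u (f N)\<close> these tend to 0 in the Schwartz
  topology, while \<open>u\<close> takes the value 1 on each of them. A single \<open>N\<close>
  bounds the weight, the number of derivatives and the constant, so that the counterexamples form
  one sequence.\<close>

lemma tempered_order:
  fixes u :: "'n::finite functional"
  assumes u: "u \<in> tempered_distributions"
  obtains N :: nat where "\<And>f B. f \<in> schwartz \<Longrightarrow> 
    (\<And>is x. length is \<le> N \<Longrightarrow> (1 + norm x) ^ N * cmod (partial_deriv is f x) \<le> B) \<Longrightarrow> cmod (u f) \<le> real N * B"
proof -
  define P where "P N f B \<longleftrightarrow> f \<in> schwartz \<and> (\<forall>is x. length is \<le> N \<longrightarrow> (1 + norm x) ^ N * cmod (partial_deriv is f x) \<le> B)"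
    for N :: nat and f :: "real^'n \<Rightarrow> complex" and B :: real
  have "\<exists>N. \<forall>f B. P N f B \<longrightarrow> cmod (u f) \<le> real N * B"
  proof (rule ccontr)
    assume "\<nexists>N. \<forall>f B. P N f B \<longrightarrow> cmod (u f) \<le> real N * B"
    then have "\<forall>N. \<exists>f B. P N f B \<and> \<not> cmod (u f) \<le> real N * B" by simp
    then have "\<forall>N. \<exists>q. P N (fst q) (snd q) \<and> \<not> cmod (u (fst q)) \<le> real N * snd q" by simp
    from choice[OF this] obtain q where q: "\<forall>N. P N (fst (q N)) (snd (q N)) \<and> \<not> cmod (u (fst (q N))) \<le> real N * snd (q N)" ..
    define f where "f N = fst (q N)" for N
    define B where "B N = snd (q N)" for N
    have PN: "P N (f N) (B N)" and n: "\<not> cmod (u (f N)) \<le> real N * B N" for N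
      using q unfolding f_def B_def by simp_all
    have f: "\<And>N. f N \<in> schwartz"
      and B: "\<And>N is x. length is \<le> N \<Longrightarrow> (1 + norm x) ^ N * cmod (partial_deriv is (f N) x) \<le> B N"
      using PN unfolding P_def by simp_all
    have u0: "cmod (u (f N)) > 0" for N
    proof -
      have "cmod (f N 0) \<le> B N" using B[of "[]" N 0] by simp
      then have "0 \<le> B N" using norm_ge_zero order_trans by blast
      then have "0 \<le> real N * B N" by simp
      then show ?thesis using n[of N] by linarith
    qed
    define h where "h N = (\<lambda>x. (1 / u (f N)) * f N x)" for N
    have h: "h N \<in> schwartz" for N unfolding h_def by (intro schwartz_cmult f)
    have "((\<lambda>N. u (h N)) \<longlongrightarrow> 0) sequentially"
    proof (rule tempered_tendsto_0[OF u h])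
      fix M "is" and e :: real assume e: "e > 0"
      obtain K :: nat where K: "K \<ge> 1 / e" using real_arch_simple by blast
      have "(1 + norm x) ^ M * cmod (partial_deriv is (h N) x) \<le> e" if N: "max (Suc K) (max M (length is)) \<le> N" for N x
      proof -
        have "(1 + norm x) ^ M * cmod (partial_deriv is (h N) x) = (1 + norm x) ^ M * cmod (partial_deriv is (f N) x) / cmod (u (f N))"
          unfolding h_def partial_deriv_cmult_list[OF schwartz_smooth[OF f]] by (simp add: norm_mult norm_divide)
        also have "\<dots> \<le> (1 + norm x) ^ N * cmod (partial_deriv is (f N) x) / cmod (u (f N))"
          using N by (intro divide_right_mono mult_right_mono power_increasing) auto
        also have "\<dots> \<le> B N / cmod (u (f N))" using N by (intro divide_right_mono B) auto
        \<comment> \<open>Failure of the bound for \<open>f N\<close> reads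
          \<open>N * B N < cmod (u (f N))\<close>.\<close>
        also have "\<dots> \<le> 1 / N" using n[of N] u0[of N] N by (simp add: field_simps)
        also have "\<dots> \<le> e"
        proof -
          have "1 / e \<le> N" using K N by linarith
          then show ?thesis using e N by (simp add: field_simps)
        qed
        finally show ?thesis .
      qed
      then show "eventually (\<lambda>k. \<forall>x. (1 + norm x) ^ M * cmod (partial_deriv is (h k) x) \<le> e) sequentially"
        unfolding eventually_sequentially by blast
    qed
    moreover have "u (h N) = 1" for N using u0[of N] tempered_cmult[OF u f, of "1 / u (f N)" N] by (simp add: h_def)
    ultimately show False by (simp add: LIMSEQ_const_iff)
  qed
  then show ?thesis using that unfolding P_def by blast
qed

section \<open>Integrals over Euclidean space\<close>

text \<open>The definitions integrate against the completed measure, whereas Fubini's theorem and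
  affine substitutions are applied over \<open>lborel\<close>; Borel integrands pass freely between
  the two.\<close>

lemma lebesgue_integral_eq_lborel:
  fixes f :: "'a::euclidean_space \<Rightarrow> 'b::{banach, second_countable_topology}"
  shows "f \<in> borel_measurable borel \<Longrightarrow> (LINT x|lebesgue. f x) = (LINT x|lborel. f x)"
  by (rule integral_completion) simp

text \<open>Covers a non-integrable \<open>f\<close> as well: its integral is 0 by convention, and
  \<open>g\<close> is nonnegative.\<close>

lemma norm_integral_le:
  fixes f :: "'a \<Rightarrow> 'b::{banach, second_countable_topology}"
  assumes "integrable M g" "\<And>x. norm (f x) \<le> g x"
  shows "norm (LINT x|M. f x) \<le> (LINT x|M. g x)"
  by (rule order_trans[OF integral_norm_bound integral_mono'[OF assms(1)]])
    (use assms(2) order_trans[OF norm_ge_zero] in blast)+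

section \<open>Affine changes of variables\<close>

lemma nn_integral_affine:
  fixes f :: "'a::euclidean_space \<Rightarrow> ennreal"
  assumes "f \<in> borel_measurable borel" "c \<noteq> 0"
  shows "(\<integral>\<^sup>+x. f x \<partial>lborel) = ennreal (\<bar>c\<bar> ^ DIM('a)) * (\<integral>\<^sup>+x. f (a + c *\<^sub>R x) \<partial>lborel)"
proof -
  have "(\<integral>\<^sup>+x. f x \<partial>lborel) = (\<integral>\<^sup>+x. f x \<partial>density (distr lborel borel (\<lambda>x. a + c *\<^sub>R x)) (\<lambda>_. \<bar>c\<bar> ^ DIM('a)))"
    using lborel_affine[OF assms(2), of a] by simp
  then show ?thesis using assms(1)
    by (simp add: nn_integral_density nn_integral_distr nn_integral_cmult)
qed

lemma integral_affine:
  fixes f :: "'a::euclidean_space \<Rightarrow> 'b::{banach, second_countable_topology}"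
  assumes "f \<in> borel_measurable borel" "c \<noteq> 0"
  shows "(LINT x|lborel. f x) = \<bar>c\<bar> ^ DIM('a) *\<^sub>R (LINT x|lborel. f (a + c *\<^sub>R x))"
proof -
  have "(LINT x|lborel. f x) = (LINT x|density (distr lborel borel (\<lambda>x. a + c *\<^sub>R x)) (\<lambda>_. \<bar>c\<bar> ^ DIM('a)). f x)"
    using lborel_affine[OF assms(2), of a] by simp
  also have "\<dots> = (LINT x|distr lborel borel (\<lambda>x. a + c *\<^sub>R x). (\<bar>c\<bar> ^ DIM('a)) *\<^sub>R f x)"
    using assms by (subst integral_density) auto
  also have "\<dots> = (LINT x|lborel. (\<bar>c\<bar> ^ DIM('a)) *\<^sub>R f (a + c *\<^sub>R x))"
    using assms by (subst integral_distr) auto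
  finally show ?thesis by simp
qed

lemma integrable_affine:
  fixes f :: "'a::euclidean_space \<Rightarrow> 'b::{banach, second_countable_topology}"
  assumes "integrable lborel f" "c \<noteq> 0"
  shows "integrable lborel (\<lambda>x. f (a + c *\<^sub>R x))"
proof -
  have m: "f \<in> borel_measurable borel" using borel_measurable_integrable[OF assms(1)] by simp
  have "ennreal (\<bar>c\<bar> ^ DIM('a)) * (\<integral>\<^sup>+x. norm (f (a + c *\<^sub>R x)) \<partial>lborel) = (\<integral>\<^sup>+x. norm (f x) \<partial>lborel)"
    using nn_integral_affine[of "\<lambda>x. ennreal (norm (f x))" c a] m assms(2) by simp
  also have "\<dots> < \<infinity>" using assms(1) by (simp add: integrable_iff_bounded)
  finally have "(\<integral>\<^sup>+x. norm (f (a + c *\<^sub>R x)) \<partial>lborel) < \<infinity>"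
    using assms(2) by (auto simp: ennreal_mult_less_top top.not_eq_extremum)
  then show ?thesis using m by (simp add: integrable_iff_bounded)
qed

lemma integral_translate:
  fixes f :: "'a::euclidean_space \<Rightarrow> 'b::{banach, second_countable_topology}"
  assumes "f \<in> borel_measurable borel"
  shows "(LINT x|lborel. f (x + a)) = (LINT x|lborel. f x)"
  using integral_affine[OF assms, of 1 a] by (simp add: add.commute)

lemma integral_reflect:
  fixes f :: "'a::euclidean_space \<Rightarrow> 'b::{banach, second_countable_topology}"
  assumes "f \<in> borel_measurable borel"
  shows "(LINT x|lborel. f (a - x)) = (LINT x|lborel. f x)"
  using integral_affine[OF assms, of "-1" a] by simp

lemma single_le_suminf: "f k \<le> (\<Sum>k. f k :: ennreal)"
  using sum_le_suminf[of f "{k}"] by simp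

section \<open>Integrability from polynomial decay\<close>

text \<open>A point whose norm has integer part \<open>k\<close> lies in the ball of radius
  \<open>k + 1\<close>, whose volume is proportional to the \<open>n\<close>-th power of the radius.
  The exponent \<open>n + 2\<close> thus leaves the summable factor
  \<open>1 / (k + 1)^2\<close>.\<close>

lemma nn_integral_decay:
  "(\<integral>\<^sup>+x. ennreal (1 / (1 + norm (x::'a::euclidean_space)) ^ (DIM('a) + 2)) \<partial>lborel) < \<infinity>"
proof -
  let ?d = "DIM('a)" and ?V = "emeasure lborel (ball (0::'a) 1)"
  have V: "emeasure lborel (ball (0::'a) (real (Suc k))) = ennreal (real (Suc k) ^ ?d) * ?V" for k
    using emeasure_ball[of "real (Suc k)" "0::'a"] emeasure_ball[of 1 "0::'a"] 
    by (simp add: ennreal_mult' mult.commute)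
  have "(\<integral>\<^sup>+x. ennreal (1 / (1 + norm (x::'a)) ^ (?d + 2)) \<partial>lborel)
     \<le> (\<integral>\<^sup>+x. (\<Sum>k. ennreal (1 / real (Suc k) ^ (?d + 2)) * indicator (ball 0 (real (Suc k))) (x::'a)) \<partial>lborel)"
  proof (intro nn_integral_mono)
    fix x :: 'a
    define k where "k = nat \<lfloor>norm x\<rfloor>"
    have k: "real k \<le> norm x" "norm x < real (Suc k)" unfolding k_def by (auto simp: of_nat_nat) linarith+
    have "ennreal (1 / (1 + norm x) ^ (?d + 2)) \<le> ennreal (1 / real (Suc k) ^ (?d + 2)) * indicator (ball 0 (real (Suc k))) x"
    proof -
      have "real (Suc k) ^ (?d + 2) \<le> (1 + norm x) ^ (?d + 2)" by (rule power_mono) (use k in auto)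
      then have "1 / (1 + norm x) ^ (?d + 2) \<le> 1 / real (Suc k) ^ (?d + 2)" by (intro frac_le) auto
      then show ?thesis using k by (simp add: indicator_def ennreal_leI)
    qed
    also have "\<dots> \<le> (\<Sum>k. ennreal (1 / real (Suc k) ^ (?d + 2)) * indicator (ball 0 (real (Suc k))) x)"
      by (rule single_le_suminf)
    finally show "ennreal (1 / (1 + norm x) ^ (?d + 2)) \<le> (\<Sum>k. ennreal (1 / real (Suc k) ^ (?d + 2)) * indicator (ball 0 (real (Suc k))) x)" .
  qed
  also have "\<dots> = (\<Sum>k. ennreal (1 / real (Suc k) ^ (?d + 2)) * emeasure lborel (ball (0::'a) (real (Suc k))))"
  proof (subst nn_integral_suminf)
    show "(\<lambda>x. ennreal (1 / real (Suc k) ^ (?d + 2)) * indicator (ball 0 (real (Suc k))) (x::'a)) \<in> borel_measurable lborel" for k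
      by (intro borel_measurable_times_ennreal borel_measurable_const borel_measurable_indicator) auto
  qed (simp add: nn_integral_cmult_indicator)
  also have "\<dots> = (\<Sum>k. ennreal (1 / real (Suc k) ^ 2) * ?V)"
  proof (intro suminf_cong)
    fix k
    have "ennreal (1 / real (Suc k) ^ (?d + 2)) * (ennreal (real (Suc k) ^ ?d) * ?V) = ennreal (1 / real (Suc k) ^ (?d + 2) * real (Suc k) ^ ?d) * ?V"
      by (subst ennreal_mult) (auto simp: mult.assoc)
    also have "1 / real (Suc k) ^ (?d + 2) * real (Suc k) ^ ?d = 1 / real (Suc k) ^ 2" by (simp add: power_add power2_eq_square)
    finally show "ennreal (1 / real (Suc k) ^ (?d + 2)) * emeasure lborel (ball (0::'a) (real (Suc k))) = ennreal (1 / real (Suc k) ^ 2) * ?V"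
      unfolding V .
  qed
  also have "\<dots> = (\<Sum>k. ennreal (1 / real (Suc k) ^ 2)) * ?V" by simp
  also have "\<dots> < \<infinity>"
  proof -
    have "summable (\<lambda>k. 1 / real (Suc k) ^ 2)" 
      using inverse_power_summable[of 2, where 'a = real] by (subst summable_Suc_iff) (simp add: inverse_eq_divide)
    then have "(\<Sum>k. ennreal (1 / real (Suc k) ^ 2)) < \<infinity>" by (subst suminf_ennreal2) auto
    moreover have "?V < \<infinity>" by (rule emeasure_lborel_ball_finite)
    ultimately show ?thesis by (simp add: ennreal_mult_less_top)
  qed
  finally show ?thesis .
qed

lemma integrable_decay:
  fixes f :: "'a::euclidean_space \<Rightarrow> 'b::{banach, second_countable_topology}"
  assumes "f \<in> borel_measurable borel" "\<And>x. (1 + norm x) ^ (DIM('a) + 2) * norm (f x) \<le> C"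
  shows "integrable lborel f"
proof -
  have C: "C \<ge> 0" using assms(2)[of 0] norm_ge_zero order_trans by (metis mult_1 norm_zero power_one add_0_right)
  have "(\<integral>\<^sup>+x. norm (f x) \<partial>lborel) \<le> (\<integral>\<^sup>+x. ennreal C * ennreal (1 / (1 + norm (x::'a)) ^ (DIM('a) + 2)) \<partial>lborel)"
  proof (intro nn_integral_mono)
    fix x :: 'a
    have "0 < (1 + norm x) ^ (DIM('a) + 2)" by (simp add: add_pos_nonneg)
    then have "norm (f x) \<le> C * (1 / (1 + norm x) ^ (DIM('a) + 2))" using assms(2)[of x] by (simp add: field_simps)
    then show "ennreal (norm (f x)) \<le> ennreal C * ennreal (1 / (1 + norm x) ^ (DIM('a) + 2))"
      using C by (subst ennreal_mult'[symmetric]) (auto intro: ennreal_leI)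
  qed
  also have "\<dots> = ennreal C * (\<integral>\<^sup>+x. ennreal (1 / (1 + norm (x::'a)) ^ (DIM('a) + 2)) \<partial>lborel)"
    by (rule nn_integral_cmult) auto
  also have "\<dots> < \<infinity>" using nn_integral_decay[where 'a = 'a] by (simp add: ennreal_mult_less_top)
  finally show ?thesis using assms(1) by (simp add: integrable_iff_bounded)
qed

lemma schwartz_measurable: "f \<in> schwartz \<Longrightarrow> f \<in> borel_measurable borel"
  by (intro smooth_measurable schwartz_smooth)

lemma schwartz_integrable:
  fixes f :: "real ^ 'n::finite \<Rightarrow> complex"
  assumes "f \<in> schwartz"
  shows "integrable lborel f"
proof -
  obtain C where "\<And>x. (1 + norm x) ^ (DIM(real^'n) + 2) * norm (partial_deriv [] f x) \<le> C" 
    using schwartz_bound[OF assms] by metis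
  then show ?thesis using schwartz_measurable[OF assms] by (intro integrable_decay) auto
qed

section \<open>Lipschitz bounds and integrals of derivatives\<close>

lemma lipschitz_of_partial_deriv:
  fixes f :: "real ^ 'n::finite \<Rightarrow> complex"
  assumes "smooth f" "convex S" "\<And>i x. x \<in> S \<Longrightarrow> norm (partial_deriv [i] f x) \<le> B" "x \<in> S" "y \<in> S"
  shows "norm (f x - f y) \<le> real CARD('n) * B * norm (x - y)"
proof (rule differentiable_bound[where S = S and f' = "\<lambda>x. frechet_derivative f (at x)"])
  fix z assume z: "z \<in> S"
  show "(f has_derivative frechet_derivative f (at z)) (at z within S)"
    by (rule has_derivative_at_withinI[OF smooth_has_derivative[OF assms(1)]])
  show "onorm (frechet_derivative f (at z)) \<le> real CARD('n) * B"
  proof (rule onorm_le)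
    fix h :: "real^'n"
    have "norm (frechet_derivative f (at z) h) \<le> (\<Sum>i\<in>UNIV. norm ((h $ i) *\<^sub>R partial_deriv [i] f z))"
      unfolding frechet_derivative_eq_sum[OF smooth_differentiable[OF assms(1)]] by (rule norm_sum)
    also have "\<dots> \<le> (\<Sum>i\<in>(UNIV::'n set). norm h * B)"
      using assms(3)[OF z] by (intro sum_mono) (auto intro!: mult_mono simp: component_le_norm_cart)
    finally show "norm (frechet_derivative f (at z) h) \<le> real CARD('n) * B * norm h" by (simp add: mult_ac)
  qed
qed (use assms in auto)

lemma test_functions_lipschitz:
  fixes f :: "real ^ 'n::finite \<Rightarrow> complex"
  assumes "f \<in> test_functions UNIV"
  obtains L where "\<And>x y. norm (f x - f y) \<le> L * norm (x - y)" "L \<ge> 0"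
proof -
  have "\<forall>i. \<exists>B. B \<ge> 0 \<and> (\<forall>x. norm (partial_deriv [i] f x) \<le> B)"
    using test_functions_bounded[OF test_functions_partial_deriv[OF assms]] by metis
  then obtain B where B: "\<And>i x. norm (partial_deriv [i] f x) \<le> B i" "\<And>i. B i \<ge> 0" by metis
  have "norm (partial_deriv [i] f x) \<le> sum B UNIV" for i x
    using B(1)[of i x] B(2) member_le_sum[of i UNIV B] by (auto intro: order_trans)
  then have "norm (f x - f y) \<le> (real CARD('n) * sum B UNIV) * norm (x - y)" for x y
    using lipschitz_of_partial_deriv[OF test_functions_smooth[OF assms], of UNIV "sum B UNIV" x y] by simp
  then show ?thesis using that[of "real CARD('n) * sum B UNIV"] B(2) by (simp add: sum_nonneg)
qed

text \<open>Every difference quotient has integral 0 by translation invariance. The Lipschitz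
  constant on a bounded set dominates them all, so the limit has integral 0 too.\<close>

lemma integral_partial_deriv:
  fixes f :: "real ^ 'n::finite \<Rightarrow> complex"
  assumes f: "f \<in> test_functions UNIV"
  shows "(LINT x|lborel. partial_deriv [j] f x) = 0"
proof -
  obtain r where r: "\<And>x. f x \<noteq> 0 \<Longrightarrow> norm x \<le> r" using f by (auto simp: test_functions_UNIV_iff)
  obtain L where L: "\<And>x y. norm (f x - f y) \<le> L * norm (x - y)" "L \<ge> 0" using test_functions_lipschitz[OF f] by blast
  have m: "f \<in> borel_measurable borel" by (rule smooth_measurable[OF test_functions_smooth[OF f]])
  define t where "t k = 1 / real (Suc k)" for k
  have t0: "t k > 0" "t k \<le> 1" for k by (auto simp: t_def)
  have tl: "t \<longlonglongrightarrow> 0" unfolding t_def by (rule LIMSEQ_Suc[OF lim_1_over_n])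
  define s where "s k x = (f (x + t k *\<^sub>R axis j 1) - f x) /\<^sub>R t k" for k x
  have int: "integrable lborel (\<lambda>x. f (x + a))" for a
    using integrable_affine[OF test_functions_integrable[OF f], of 1 a] by (simp add: add.commute)
  have "(LINT x|lborel. s k x) = 0" for k
    unfolding s_def using int[of "t k *\<^sub>R axis j 1"] int[of 0] integral_translate[OF m, of "t k *\<^sub>R axis j 1"]
    by (simp add: scaleR_diff_right)
  moreover have "(\<lambda>k. LINT x|lborel. s k x) \<longlonglongrightarrow> (LINT x|lborel. partial_deriv [j] f x)"
  \<comment> \<open>The steps \<open>t k\<close> are at most 1, so the shifted supports stay in the
    ball of radius \<open>|r| + 1\<close>.\<close>
  proof (rule integral_dominated_convergence[where w = "\<lambda>x. L * indicator (cball 0 (\<bar>r\<bar> + 1)) x"])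
    show "partial_deriv [j] f \<in> borel_measurable lborel"
      using smooth_measurable[OF smooth_partial_deriv[OF test_functions_smooth[OF f]]] by simp
    show "s k \<in> borel_measurable lborel" for k unfolding s_def using m by measurable
    show "integrable lborel (\<lambda>x::real^'n. L * indicator (cball 0 (\<bar>r\<bar> + 1)) x)"
      using emeasure_lborel_cball_finite[of "0::real^'n" "\<bar>r\<bar>+1"] by (intro integrable_mult_right integrable_real_indicator) auto
    show "AE x in lborel. (\<lambda>k. s k x) \<longlonglongrightarrow> partial_deriv [j] f x"
    proof (rule AE_I2)
      fix x
      have d: "((\<lambda>h. f (x + h *\<^sub>R axis j 1)) has_derivative (\<lambda>h. frechet_derivative f (at x) (h *\<^sub>R axis j 1))) (at 0)"
        by (rule has_derivative_compose[of "\<lambda>h. x + h *\<^sub>R axis j 1" "\<lambda>h. h *\<^sub>R axis j 1" 0 UNIV f])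
          (auto intro!: derivative_eq_intros smooth_has_derivative test_functions_smooth[OF f])
      have lin: "frechet_derivative f (at x) (h *\<^sub>R axis j 1) = h *\<^sub>R partial_deriv [j] f x" for h
        using linear_cmul[OF linear_frechet_derivative[OF smooth_differentiable[OF test_functions_smooth[OF f]]]]
        by (simp add: partial_deriv.simps)
      have "((\<lambda>h. norm (f (x + h *\<^sub>R axis j 1) - f x - h *\<^sub>R partial_deriv [j] f x) / norm h) \<longlongrightarrow> 0) (at 0)"
        using d unfolding has_derivative_at lin by simp
      moreover have "norm (f (x + h *\<^sub>R axis j 1) - f x - h *\<^sub>R partial_deriv [j] f x) / norm h 
        = norm ((f (x + h *\<^sub>R axis j 1) - f x) /\<^sub>R h - partial_deriv [j] f x)" if "h \<noteq> 0" for h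
      proof -
        have "(f (x + h *\<^sub>R axis j 1) - f x) /\<^sub>R h - partial_deriv [j] f x = (f (x + h *\<^sub>R axis j 1) - f x - h *\<^sub>R partial_deriv [j] f x) /\<^sub>R h"
          using that by (simp add: scaleR_diff_right)
        then show ?thesis by (simp add: divide_inverse mult.commute)
      qed
      ultimately have "((\<lambda>h. norm ((f (x + h *\<^sub>R axis j 1) - f x) /\<^sub>R h - partial_deriv [j] f x)) \<longlongrightarrow> 0) (at 0)"
        by (simp cong: LIM_cong)
      then have "((\<lambda>h. (f (x + h *\<^sub>R axis j 1) - f x) /\<^sub>R h) \<longlongrightarrow> partial_deriv [j] f x) (at 0)"
        by (rule LIM_zero_cancel[OF tendsto_norm_zero_cancel])
      moreover have "filterlim t (at 0) sequentially"
        using tl t0 by (auto simp: filterlim_at intro!: always_eventually) (metis less_irrefl)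
      ultimately show "(\<lambda>k. s k x) \<longlonglongrightarrow> partial_deriv [j] f x"
        unfolding s_def by (rule filterlim_compose)
    qed
    show "AE x in lborel. norm (s k x) \<le> L * indicator (cball 0 (\<bar>r\<bar> + 1)) x" for k
    proof (rule AE_I2)
      fix x :: "real^'n"
      show "norm (s k x) \<le> L * indicator (cball 0 (\<bar>r\<bar> + 1)) x"
      proof (cases "norm x \<le> \<bar>r\<bar> + 1")
        case True
        have "norm (f (x + t k *\<^sub>R axis j 1) - f x) \<le> L * t k"
          using L(1)[of "x + t k *\<^sub>R axis j 1" x] t0(1)[of k] by simp
        then have "norm (f (x + t k *\<^sub>R axis j 1) - f x) / t k \<le> L" using t0(1)[of k] by (simp add: pos_divide_le_eq)
        moreover have "norm (s k x) = norm (f (x + t k *\<^sub>R axis j 1) - f x) / t k"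
          unfolding s_def norm_scaleR using t0(1)[of k] by (simp add: divide_inverse)
        ultimately show ?thesis using True by simp
      next
        case False
        have "norm x \<le> norm (x + t k *\<^sub>R axis j 1) + norm (t k *\<^sub>R axis j (1::real))"
          using norm_triangle_ineq4[of "x + t k *\<^sub>R axis j 1" "t k *\<^sub>R axis j 1"] by simp
        then have "norm x \<le> norm (x + t k *\<^sub>R axis j 1) + 1" using t0[of k] by simp
        then have "f x = 0" "f (x + t k *\<^sub>R axis j 1) = 0" using r[of x] r[of "x + t k *\<^sub>R axis j 1"] False by force+
        then show ?thesis using L(2) by (simp add: s_def)
      qed
    qed
  qed
  ultimately show ?thesis by (simp add: LIMSEQ_const_iff)
qed

section \<open>The Fourier transform\<close>

definition character :: "real ^ 'n \<Rightarrow> real ^ 'n::finite \<Rightarrow> complex" where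
  "character x \<xi> = exp (2 * of_real pi * \<i> * of_real (x \<bullet> \<xi>))"

lemma norm_character [simp]: "norm (character x \<xi>) = 1"
  unfolding character_def by (simp add: norm_exp_eq_Re)

lemma character_add: "character (x + y) \<xi> = character x \<xi> * character y \<xi>"
  unfolding character_def by (simp add: inner_left_distrib ring_distribs exp_add)

lemma character_0 [simp]: "character 0 \<xi> = 1" "character \<xi> 0 = 1"
  unfolding character_def by auto

lemma character_commute: "character x \<xi> = character \<xi> x"
  unfolding character_def by (simp add: inner_commute)

lemma character_uminus: "character (-x) (-\<xi>) = character x \<xi>" "character (-x) \<xi> = character x (-\<xi>)"
  unfolding character_def by auto

lemma smooth_character: "smooth (character x)"
proof -
  have "character x = (\<lambda>\<xi>. exp (2 * of_real pi * \<i> * of_real (\<xi> \<bullet> x)))" by (auto simp: character_def inner_commute)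
  then show ?thesis by (simp only:) (intro smooth_exp smooth_mult smooth_const smooth_inner)
qed

lemma partial_deriv_character:
  "partial_deriv [j] (character x) \<xi> = 2 * of_real pi * \<i> * of_real (x $ j) * character x \<xi>"
proof -
  have 1: "((\<lambda>\<xi>. 2 * of_real pi * \<i> * complex_of_real (x \<bullet> \<xi>)) has_derivative (\<lambda>h. 2 * of_real pi * \<i> * of_real (x \<bullet> h))) (at \<xi>)"
    by (intro derivative_eq_intros bounded_linear_imp_has_derivative bounded_linear_intros | simp)+
  have "((\<lambda>\<xi>. exp (2 * of_real pi * \<i> * complex_of_real (x \<bullet> \<xi>))) has_derivative
     (\<lambda>h. character x \<xi> * (2 * of_real pi * \<i> * of_real (x \<bullet> h)))) (at \<xi>)"
    using has_derivative_compose[OF 1 DERIV_exp[unfolded has_field_derivative_def]] by (simp add: character_def)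
  from partial_deriv_has_derivative[OF this, of j] show ?thesis by (simp add: character_def[abs_def] inner_axis)
qed

lemma character_measurable [measurable]: "character x \<in> borel_measurable borel"
  by (rule smooth_measurable[OF smooth_character])

lemma fourier_eq:
  assumes "f \<in> borel_measurable borel"
  shows "fourier f \<xi> = (LINT x|lborel. f x * character (-\<xi>) x)"
proof -
  have "fourier f \<xi> = (LINT x|lebesgue. f x * character (-\<xi>) x)"
    unfolding fourier_def character_def by (intro Bochner_Integration.integral_cong refl) (simp add: inner_commute)
  then show ?thesis using assms by (simp add: lebesgue_integral_eq_lborel)
qed

lemma inv_fourier_eq_fourier: "inv_fourier f x = fourier f (-x)"
  unfolding fourier_def inv_fourier_def by (simp add: inner_commute[of x])

lemma inv_fourier_eq:
  assumes "f \<in> borel_measurable borel"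
  shows "inv_fourier f \<xi> = (LINT x|lborel. f x * character \<xi> x)"
  unfolding inv_fourier_eq_fourier fourier_eq[OF assms] by simp

lemma integrable_mult_character:
  assumes "integrable lborel f"
  shows "integrable lborel (\<lambda>x. f x * character \<xi> x)"
  by (rule Bochner_Integration.integrable_bound[OF assms]) (use assms in \<open>auto simp: norm_mult\<close>)

lemma norm_fourier_le:
  assumes "integrable lborel f"
  shows "norm (fourier f \<xi>) \<le> (LINT x|lborel. norm (f x))"
proof -
  have m: "f \<in> borel_measurable borel" using borel_measurable_integrable[OF assms] by simp
  show ?thesis unfolding fourier_eq[OF m]
    using integral_norm_bound[of lborel "\<lambda>x. f x * character (-\<xi>) x"] by (simp add: norm_mult)
qed

lemma fourier_add:
  assumes "integrable lborel f" "integrable lborel g"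
  shows "fourier (\<lambda>x. f x + g x) \<xi> = fourier f \<xi> + fourier g \<xi>"
  using assms integrable_mult_character[OF assms(1)] integrable_mult_character[OF assms(2)]
  by (simp add: fourier_eq ring_distribs borel_measurable_integrable[of lborel, simplified])

lemma fourier_cmult:
  assumes "f \<in> borel_measurable borel"
  shows "fourier (\<lambda>x. c * f x) \<xi> = c * fourier f \<xi>"
  using assms by (simp add: fourier_eq mult.assoc)

lemma norm_exp_linear_approx: 
  "norm (exp (\<i> * complex_of_real t) - 1 - \<i> * complex_of_real t) \<le> t\<^sup>2"
proof -
  have "norm (exp (\<i> * complex_of_real t) - 1 - \<i> * complex_of_real t) \<le> \<bar>t\<bar> ^ 2 / 2"
    using iexp_approx1[of t 1] by (simp add: numeral_2_eq_2 diff_diff_eq)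
  also have "\<dots> \<le> t\<^sup>2" by simp
  finally show ?thesis .
qed

lemma has_derivative_quadratic:
  fixes F :: "'a::real_normed_vector \<Rightarrow> 'b::real_normed_vector"
  assumes "bounded_linear F'" "\<And>y. norm (F y - F x - F' (y - x)) \<le> C * (norm (y - x))\<^sup>2"
  shows "(F has_derivative F') (at x)"
proof (rule has_derivativeI[OF assms(1)])
  show "((\<lambda>y. ((F y - F x) - F' (y - x)) /\<^sub>R norm (y - x)) \<longlongrightarrow> 0) (at x)"
  proof (rule Lim_null_comparison)
    show "\<forall>\<^sub>F y in at x. norm (((F y - F x) - F' (y - x)) /\<^sub>R norm (y - x)) \<le> C * norm (y - x)"
    proof (rule eventually_at_topological[THEN iffD2], intro exI[of _ UNIV] conjI ballI impI)
      fix y assume "y \<noteq> x"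
      then show "norm (((F y - F x) - F' (y - x)) /\<^sub>R norm (y - x)) \<le> C * norm (y - x)"
      proof -
        have "norm (((F y - F x) - F' (y - x)) /\<^sub>R norm (y - x)) = norm (F y - F x - F' (y - x)) / norm (y - x)"
          by (simp add: divide_inverse mult.commute)
        also have "\<dots> \<le> (C * (norm (y - x))\<^sup>2) / norm (y - x)" by (intro divide_right_mono assms(2)) auto
        finally show ?thesis using \<open>y \<noteq> x\<close> by (simp add: power2_eq_square)
      qed
    qed auto
    have "((\<lambda>y. C * norm (y - x)) \<longlongrightarrow> C * norm (x - x)) (at x)" by (intro tendsto_intros)
    then show "((\<lambda>y. C * norm (y - x)) \<longlongrightarrow> 0) (at x)" by simp
  qed
qed

section \<open>Smoothness and decay of Fourier transforms\<close>

text \<open>The bound \<open>|exp (i t) - 1 - i t| \<le> t^2\<close> at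
  \<open>t = - 2 pi (x \<bullet> h)\<close> gives a remainder quadratic in \<open>h\<close>,
  uniformly over the bounded support of \<open>f\<close>. The derivative in each direction is again
  the transform of a test function, which keeps the induction over mixed derivatives going.\<close>

lemma fourier_has_derivative:
  fixes f :: "real ^ 'n::finite \<Rightarrow> complex"
  assumes f: "f \<in> test_functions UNIV"
  shows "(fourier f has_derivative (\<lambda>h. fourier (\<lambda>x. - 2 * of_real pi * \<i> * of_real (x \<bullet> h) * f x) \<xi>)) (at \<xi>)"
proof -
  obtain r where r: "\<And>x. f x \<noteq> 0 \<Longrightarrow> norm x \<le> r" using f by (auto simp: test_functions_UNIV_iff)
  have tf: "(\<lambda>x. - 2 * of_real pi * \<i> * of_real (x \<bullet> h) * f x) \<in> test_functions UNIV" for h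
    by (intro test_functions_mult(2)[OF f] smooth_mult smooth_const smooth_inner)
  have tm: "(\<lambda>x. - 2 * of_real pi * \<i> * of_real (x \<bullet> h) * f x) \<in> borel_measurable borel" for h
    by (rule smooth_measurable[OF test_functions_smooth[OF tf]])
  have m: "f \<in> borel_measurable borel" by (rule smooth_measurable[OF test_functions_smooth[OF f]])
  note int = integrable_mult_character[OF test_functions_integrable[OF tf]]
  define I where "I = (LINT x|lborel. norm (f x))"
  have If: "integrable lborel (\<lambda>x. norm (f x))" using test_functions_integrable[OF f] by simp
  have inner: "norm (f x) * \<bar>x \<bullet> h\<bar> \<le> norm (f x) * (\<bar>r\<bar> * norm h)" for x h
    using r[of x] by (cases "f x = 0") (auto intro!: mult_left_mono order_trans[OF Cauchy_Schwarz_ineq2] mult_right_mono)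
  show ?thesis
  proof (rule has_derivative_quadratic[where C = "(2 * pi * \<bar>r\<bar>)\<^sup>2 * I"])
  show "bounded_linear (\<lambda>h. fourier (\<lambda>x. - 2 * of_real pi * \<i> * of_real (x \<bullet> h) * f x) \<xi>)"
  proof (rule bounded_linear_intro[where K = "2 * pi * \<bar>r\<bar> * I"])
    fix h k :: "real^'n" and c :: real
    show "fourier (\<lambda>x. - 2 * of_real pi * \<i> * of_real (x \<bullet> (h + k)) * f x) \<xi> =
      fourier (\<lambda>x. - 2 * of_real pi * \<i> * of_real (x \<bullet> h) * f x) \<xi> + fourier (\<lambda>x. - 2 * of_real pi * \<i> * of_real (x \<bullet> k) * f x) \<xi>"
      by (subst fourier_add[OF test_functions_integrable[OF tf] test_functions_integrable[OF tf], symmetric])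
        (simp add: inner_right_distrib algebra_simps)
    have "fourier (\<lambda>x. - 2 * of_real pi * \<i> * of_real (x \<bullet> (c *\<^sub>R h)) * f x) \<xi> = of_real c * fourier (\<lambda>x. - 2 * of_real pi * \<i> * of_real (x \<bullet> h) * f x) \<xi>"
      by (subst fourier_cmult[OF tm, symmetric]) (simp add: algebra_simps)
    then show "fourier (\<lambda>x. - 2 * of_real pi * \<i> * of_real (x \<bullet> (c *\<^sub>R h)) * f x) \<xi> = c *\<^sub>R fourier (\<lambda>x. - 2 * of_real pi * \<i> * of_real (x \<bullet> h) * f x) \<xi>"
      by (simp add: scaleR_conv_of_real)
    have "norm (fourier (\<lambda>x. - 2 * of_real pi * \<i> * of_real (x \<bullet> h) * f x) \<xi>) \<le> (LINT x|lborel. norm (- 2 * of_real pi * \<i> * of_real (x \<bullet> h) * f x))"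
      by (rule norm_fourier_le[OF test_functions_integrable[OF tf]])
    also have "\<dots> \<le> (LINT x|lborel. norm (f x) * (\<bar>r\<bar> * norm h) * (2 * pi))"
      using inner[of _ h] If by (intro integral_mono') (auto simp: norm_mult mult_ac abs_mult)
    also have "\<dots> = norm h * (2 * pi * \<bar>r\<bar> * I)" unfolding I_def using If by simp
    finally show "norm (fourier (\<lambda>x. - 2 * of_real pi * \<i> * of_real (x \<bullet> h) * f x) \<xi>) \<le> norm h * (2 * pi * \<bar>r\<bar> * I)" .
  qed
  fix \<zeta>
  define h where "h = \<zeta> - \<xi>"
  have \<zeta>: "\<zeta> = \<xi> + h" by (simp add: h_def)
  have "fourier f \<zeta> - fourier f \<xi> - fourier (\<lambda>x. - 2 * of_real pi * \<i> * of_real (x \<bullet> h) * f x) \<xi> =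
    (LINT x|lborel. f x * character (-\<zeta>) x - f x * character (-\<xi>) x - (- 2 * of_real pi * \<i> * of_real (x \<bullet> h) * f x) * character (-\<xi>) x)"
    unfolding fourier_eq[OF tm] fourier_eq[OF m]
    using integrable_mult_character[OF test_functions_integrable[OF f]] int by simp
  also have "\<dots> = (LINT x|lborel. f x * character (-\<xi>) x * (exp (\<i> * of_real (- 2 * pi * (x \<bullet> h))) - 1 - \<i> * of_real (- 2 * pi * (x \<bullet> h))))"
  proof (rule Bochner_Integration.integral_cong[OF refl])
    fix x
    have "character (-\<zeta>) x = character (-\<xi>) x * character (-h) x" using character_add[of "-\<xi>" "-h" x] by (simp add: \<zeta>)
    moreover have "character (-h) x = exp (\<i> * of_real (- 2 * pi * (x \<bullet> h)))" by (simp add: character_def inner_commute mult_ac)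
    ultimately show "f x * character (-\<zeta>) x - f x * character (-\<xi>) x - (- 2 * of_real pi * \<i> * of_real (x \<bullet> h) * f x) * character (-\<xi>) x
      = f x * character (-\<xi>) x * (exp (\<i> * of_real (- 2 * pi * (x \<bullet> h))) - 1 - \<i> * of_real (- 2 * pi * (x \<bullet> h)))"
      by (simp add: algebra_simps)
  qed
  finally have eq: "fourier f \<zeta> - fourier f \<xi> - fourier (\<lambda>x. - 2 * of_real pi * \<i> * of_real (x \<bullet> h) * f x) \<xi> = \<dots>" .
  have "norm (fourier f \<zeta> - fourier f \<xi> - fourier (\<lambda>x. - 2 * of_real pi * \<i> * of_real (x \<bullet> h) * f x) \<xi>)
     \<le> (LINT x|lborel. norm (f x) * ((2 * pi * \<bar>r\<bar>)\<^sup>2 * (norm h)\<^sup>2))"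
    unfolding eq
  proof (rule norm_integral_le)
    show "integrable lborel (\<lambda>x. norm (f x) * ((2 * pi * \<bar>r\<bar>)\<^sup>2 * (norm h)\<^sup>2))" using If by simp
    fix x
    show "norm (f x * character (-\<xi>) x * (exp (\<i> * of_real (- 2 * pi * (x \<bullet> h))) - 1 - \<i> * of_real (- 2 * pi * (x \<bullet> h)))) \<le>
      norm (f x) * ((2 * pi * \<bar>r\<bar>)\<^sup>2 * (norm h)\<^sup>2)"
    proof (cases "f x = 0")
      case False
      have "norm (exp (\<i> * of_real (- 2 * pi * (x \<bullet> h))) - 1 - \<i> * of_real (- 2 * pi * (x \<bullet> h))) \<le> (- 2 * pi * (x \<bullet> h))\<^sup>2"
        by (rule norm_exp_linear_approx)
      also have "\<dots> = (2 * pi)\<^sup>2 * \<bar>x \<bullet> h\<bar>\<^sup>2" by (simp add: power_mult_distrib)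
      also have "\<dots> \<le> (2 * pi)\<^sup>2 * (\<bar>r\<bar> * norm h)\<^sup>2"
        using inner[of x h] False by (intro mult_left_mono power_mono) auto
      finally show ?thesis
        unfolding norm_mult norm_character mult.assoc mult_1_left by (intro mult_left_mono) (simp_all add: power_mult_distrib mult_ac)
    qed auto
  qed
  also have "\<dots> = ((2 * pi * \<bar>r\<bar>)\<^sup>2 * I) * (norm h)\<^sup>2" unfolding I_def using If by simp
  finally show "norm (fourier f \<zeta> - fourier f \<xi> - fourier (\<lambda>x. - 2 * of_real pi * \<i> * of_real (x \<bullet> (\<zeta> - \<xi>)) * f x) \<xi>)
    \<le> ((2 * pi * \<bar>r\<bar>)\<^sup>2 * I) * (norm (\<zeta> - \<xi>))\<^sup>2" unfolding h_def .
qed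
qed

lemma fourier_partial_deriv_eq:
  fixes f :: "real ^ 'n::finite \<Rightarrow> complex"
  assumes f: "f \<in> test_functions UNIV"
  shows "partial_deriv [j] (fourier f) = fourier (\<lambda>x. - 2 * of_real pi * \<i> * of_real (x $ j) * f x)"
  using partial_deriv_has_derivative[OF fourier_has_derivative[OF f]] by (auto simp: inner_axis)

lemma test_functions_mult_coord:
  assumes "f \<in> test_functions UNIV"
  shows "(\<lambda>x. c * of_real (x $ j) * f x) \<in> test_functions UNIV"
  by (intro test_functions_mult(2)[OF assms] smooth_mult smooth_const smooth_coord)

lemma partial_deriv_fourier:
  fixes f :: "real ^ 'n::finite \<Rightarrow> complex"
  assumes "f \<in> test_functions UNIV"
  shows "\<exists>g\<in>test_functions UNIV. partial_deriv is (fourier f) = fourier g"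
proof (induction "is")
  case (Cons i "is")
  then obtain g where g: "g \<in> test_functions UNIV" "partial_deriv is (fourier f) = fourier g" by blast
  have "partial_deriv (i # is) (fourier f) = fourier (\<lambda>x. - 2 * of_real pi * \<i> * of_real (x $ i) * g x)"
    unfolding partial_deriv_Cons[of i "is"] g(2) by (rule fourier_partial_deriv_eq[OF g(1)])
  then show ?case using test_functions_mult_coord[OF g(1)] by blast
qed (use assms in auto)

lemma smooth_fourier:
  assumes "f \<in> test_functions UNIV"
  shows "smooth (fourier f)"
  unfolding smooth_def
proof (intro allI)
  fix "is" x
  obtain g where g: "g \<in> test_functions UNIV" "partial_deriv is (fourier f) = fourier g" using partial_deriv_fourier[OF assms] by blast
  show "partial_deriv is (fourier f) differentiable at x"
    unfolding g(2) differentiable_def using fourier_has_derivative[OF g(1)] by blast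
qed

text \<open>Integration by parts: the product of \<open>f\<close> with a character is a test
  function, so its derivative has integral 0.\<close>

lemma fourier_of_partial_deriv:
  fixes f :: "real ^ 'n::finite \<Rightarrow> complex"
  assumes f: "f \<in> test_functions UNIV"
  shows "fourier (partial_deriv [j] f) \<xi> = 2 * of_real pi * \<i> * of_real (\<xi> $ j) * fourier f \<xi>"
proof -
  note pf = test_functions_partial_deriv[OF f, of "[j]"]
  have m: "f \<in> borel_measurable borel" "partial_deriv [j] f \<in> borel_measurable borel"
    using f pf by (auto intro: smooth_measurable test_functions_smooth)
  have "0 = (LINT x|lborel. partial_deriv [j] (\<lambda>x. f x * character (-\<xi>) x) x)"
    by (rule integral_partial_deriv[symmetric], rule test_functions_mult[OF f smooth_character])
  also have "\<dots> = (LINT x|lborel. partial_deriv [j] f x * character (-\<xi>) x - 2 * of_real pi * \<i> * of_real (\<xi> $ j) * (f x * character (-\<xi>) x))"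
    by (intro Bochner_Integration.integral_cong refl, subst partial_deriv_mult)
      (auto intro!: smooth_differentiable test_functions_smooth[OF f] smooth_character simp: partial_deriv_character algebra_simps)
  also have "\<dots> = fourier (partial_deriv [j] f) \<xi> - 2 * of_real pi * \<i> * of_real (\<xi> $ j) * fourier f \<xi>"
    unfolding fourier_eq[OF m(1)] fourier_eq[OF m(2)]
    using integrable_mult_character[OF test_functions_integrable[OF f]] integrable_mult_character[OF test_functions_integrable[OF pf]]
    by simp
  finally show ?thesis by simp
qed

text \<open>One more power of \<open>1 + |\<xi>|\<close> is bounded by the coordinates of \<xi>, and
  each coordinate is paid for by one derivative of \<open>f\<close>; hence the induction over all
  test functions simultaneously.\<close>

lemma fourier_decay:
  fixes f :: "real ^ 'n::finite \<Rightarrow> complex"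
  assumes "f \<in> test_functions UNIV"
  shows "\<exists>C. \<forall>\<xi>. (1 + norm \<xi>) ^ N * norm (fourier f \<xi>) \<le> C"
  using assms
proof (induction N arbitrary: f)
  case 0
  then show ?case using norm_fourier_le[OF test_functions_integrable[OF 0]] by auto
next
  case (Suc N)
  obtain C where C: "\<And>\<xi>. (1 + norm \<xi>) ^ N * norm (fourier f \<xi>) \<le> C" using Suc by blast
  have "\<forall>j. \<exists>D. \<forall>\<xi>. (1 + norm \<xi>) ^ N * norm (fourier (partial_deriv [j] f) \<xi>) \<le> D"
    using Suc.IH test_functions_partial_deriv[OF Suc.prems] by blast
  then obtain D where D: "\<And>j \<xi>. (1 + norm \<xi>) ^ N * norm (fourier (partial_deriv [j] f) \<xi>) \<le> D j" by metis
  have "(1 + norm \<xi>) ^ Suc N * norm (fourier f \<xi>) \<le> C + sum D UNIV" for \<xi>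
  proof -
    let ?A = "(1 + norm \<xi>) ^ N * norm (fourier f \<xi>)"
    have "\<bar>\<xi> $ j\<bar> * ?A \<le> D j" for j
    proof -
      have "1 * (\<bar>\<xi> $ j\<bar> * ?A) \<le> (2 * pi) * (\<bar>\<xi> $ j\<bar> * ?A)" using pi_gt3 by (intro mult_right_mono) auto
      then have "\<bar>\<xi> $ j\<bar> * ?A \<le> (2 * pi) * (\<bar>\<xi> $ j\<bar> * ?A)" by simp
      also have "\<dots> = (1 + norm \<xi>) ^ N * norm (fourier (partial_deriv [j] f) \<xi>)"
        unfolding fourier_of_partial_deriv[OF Suc.prems] by (simp add: norm_mult)
      finally show ?thesis using D[of \<xi> j] by simp
    qed
    then have "(\<Sum>j\<in>UNIV. \<bar>\<xi> $ j\<bar> * ?A) \<le> sum D UNIV" by (intro sum_mono)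
    moreover have "(1 + norm \<xi>) * ?A \<le> (1 + (\<Sum>j\<in>UNIV. \<bar>\<xi> $ j\<bar>)) * ?A"
      using norm_le_l1_cart[of \<xi>] by (intro mult_right_mono) auto
    ultimately show ?thesis using C[of \<xi>] by (simp add: distrib_right sum_distrib_right mult.assoc)
  qed
  then show ?case by blast
qed

lemma fourier_schwartz:
  assumes "f \<in> test_functions UNIV"
  shows "fourier f \<in> schwartz"
proof (rule schwartzI[OF smooth_fourier[OF assms]])
  fix N "is"
  obtain g where "g \<in> test_functions UNIV" "partial_deriv is (fourier f) = fourier g" using partial_deriv_fourier[OF assms] by blast
  then show "\<exists>C. \<forall>x. (1 + norm x) ^ N * norm (partial_deriv is (fourier f) x) \<le> C" using fourier_decay[of g N] by auto
qed

lemma inv_fourier_schwartz: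
  assumes "f \<in> test_functions UNIV"
  shows "inv_fourier f \<in> schwartz"
proof -
  have "inv_fourier f = (\<lambda>x. fourier f ((-1) *\<^sub>R x + 0))" by (auto simp: inv_fourier_eq_fourier)
  then show ?thesis using schwartz_affine[OF fourier_schwartz[OF assms], of "-1" 0] by simp
qed

lemma fourier_measurable:
  fixes f :: "real ^ 'n::finite \<Rightarrow> complex"
  assumes [measurable]: "f \<in> borel_measurable borel"
  shows "fourier f \<in> borel_measurable borel"
proof -
  have [measurable]: "(\<lambda>p. character (- fst p) (snd p)) \<in> borel_measurable (borel \<Otimes>\<^sub>M borel)"
    unfolding character_def by measurable
  have "(\<lambda>\<xi>. LINT x|lborel. f x * character (-\<xi>) x) \<in> borel_measurable borel" 
    unfolding character_def by measurable
  then show ?thesis unfolding fourier_eq[OF assms, abs_def] .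
qed

section \<open>Multiplication formula and convolutions\<close>

lemma fourier_multiplication_formula:
  fixes f g :: "real ^ 'n::finite \<Rightarrow> complex"
  assumes f: "integrable lborel f" and g: "integrable lborel g"
  shows "(LINT x|lborel. fourier f x * g x) = (LINT x|lborel. f x * fourier g x)"
proof -
  have [measurable]: "f \<in> borel_measurable borel" "g \<in> borel_measurable borel"
    using f g borel_measurable_integrable by force+
  have "integrable (lborel \<Otimes>\<^sub>M lborel) (\<lambda>(x, y). f x * character (-y) x * g y)"
  proof (rule lborel_pair.Fubini_integrable)
    show "(\<lambda>(x, y). f x * character (-y) x * g y) \<in> borel_measurable (lborel \<Otimes>\<^sub>M lborel)"
      unfolding character_def by measurable
    show "integrable lborel (\<lambda>x. LINT y|lborel. norm (case (x, y) of (x, y) \<Rightarrow> f x * character (-y) x * g y))"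
      using f g by (simp add: norm_mult)
    show "AE x in lborel. integrable lborel (\<lambda>y. case (x, y) of (x, y) \<Rightarrow> f x * character (-y) x * g y)"
    proof (rule AE_I2)
      fix x
      have "(\<lambda>y. f x * character (-y) x * g y) = (\<lambda>y. f x * (g y * character (-x) y))"
        by (auto simp: character_def inner_commute)
      then show "integrable lborel (\<lambda>y. case (x, y) of (x, y) \<Rightarrow> f x * character (-y) x * g y)"
        using integrable_mult_character[OF g, of "-x"] by simp
    qed
  qed
  from lborel_pair.Fubini_integral[OF this]
  have "(LINT y|lborel. LINT x|lborel. f x * character (-y) x * g y) = (LINT x|lborel. LINT y|lborel. f x * character (-y) x * g y)" .
  moreover have "(LINT x|lborel. f x * character (-y) x * g y) = fourier f y * g y" for y by (simp add: fourier_eq)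
  moreover have "(LINT y|lborel. f x * character (-y) x * g y) = f x * fourier g x" for x
  proof -
    have "(LINT y|lborel. f x * character (-y) x * g y) = (LINT y|lborel. f x * (g y * character (-x) y))"
      by (intro Bochner_Integration.integral_cong refl) (simp add: character_def inner_commute)
    then show ?thesis by (simp add: fourier_eq)
  qed
  ultimately show ?thesis by (simp only:)
qed

lemma fourier_mult_character:
  assumes "f \<in> borel_measurable borel"
  shows "fourier (\<lambda>x. f x * character a x) \<xi> = fourier f (\<xi> - a)"
proof -
  have "fourier (\<lambda>x. f x * character a x) \<xi> = (LINT x|lborel. f x * character a x * character (-\<xi>) x)"
    using assms by (intro fourier_eq) simp
  also have "\<dots> = (LINT x|lborel. f x * character (-(\<xi> - a)) x)"
    using character_add[of a "-\<xi>"] by (intro Bochner_Integration.integral_cong refl) simp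
  finally show ?thesis using fourier_eq[OF assms] by simp
qed

text \<open>A convolution theorem derived before Fourier inversion:
  \<open>inv_fourier \<theta>\<close> is the transform of the reflected \<theta>, so the
  multiplication formula shifts the transform onto \<open>m\<close> times a character, where it
  becomes a translate of \<open>fourier m\<close>.\<close>

lemma fourier_mult_inv_fourier:
  fixes m \<theta> :: "real ^ 'n::finite \<Rightarrow> complex"
  assumes m: "integrable lborel m" and \<theta>: "integrable lborel \<theta>"
  shows "fourier (\<lambda>\<xi>. m \<xi> * inv_fourier \<theta> \<xi>) x = (LINT y|lborel. fourier m (x - y) * \<theta> y)"
proof -
  have [measurable]: "m \<in> borel_measurable borel" "\<theta> \<in> borel_measurable borel"
    using m \<theta> borel_measurable_integrable by force+
  have [measurable]: "fourier \<theta> \<in> borel_measurable borel" "fourier m \<in> borel_measurable borel" by (auto intro: fourier_measurable)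
  have inv: "inv_fourier \<theta> = fourier (\<lambda>y. \<theta> (-y))"
  proof
    fix \<xi>
    have "inv_fourier \<theta> \<xi> = (LINT y|lborel. \<theta> (0 - y) * character \<xi> (0 - y))"
      unfolding inv_fourier_eq[OF \<open>\<theta> \<in> borel_measurable borel\<close>] by (subst integral_reflect) auto
    then show "inv_fourier \<theta> \<xi> = fourier (\<lambda>y. \<theta> (-y)) \<xi>"
      by (simp add: fourier_eq character_uminus(2))
  qed
  have \<theta>': "integrable lborel (\<lambda>y. \<theta> (-y))" using integrable_affine[OF \<theta>, of "-1" 0] by simp
  have "fourier (\<lambda>\<xi>. m \<xi> * inv_fourier \<theta> \<xi>) x = (LINT \<xi>|lborel. (m \<xi> * character (-x) \<xi>) * fourier (\<lambda>y. \<theta> (-y)) \<xi>)"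
  proof -
    have "inv_fourier \<theta> \<in> borel_measurable borel" unfolding inv by (intro fourier_measurable) simp
    then show ?thesis unfolding inv[symmetric] by (subst fourier_eq) (auto simp: mult_ac)
  qed
  also have "\<dots> = (LINT y|lborel. fourier (\<lambda>\<xi>. m \<xi> * character (-x) \<xi>) y * \<theta> (-y))"
    by (rule fourier_multiplication_formula[symmetric, OF integrable_mult_character[OF m] \<theta>'])
  also have "\<dots> = (LINT y|lborel. fourier m (x + y) * \<theta> (- y))" by (simp add: fourier_mult_character add.commute)
  also have "\<dots> = (LINT y|lborel. fourier m (x - y) * \<theta> y)"
    by (subst integral_reflect[of "\<lambda>y. fourier m (x - y) * \<theta> y" 0, symmetric]) auto
  finally show ?thesis .
qed

section \<open>Fourier inversion\<close>

text \<open>The standard normal density in \<open>n\<close> dimensions, written as a product so that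
  its transform reduces to the characteristic function of the one-dimensional normal
  distribution.\<close>

definition gaussian :: "real ^ 'n::finite \<Rightarrow> complex" where
  "gaussian x = of_real (\<Prod>b\<in>Basis. std_normal_density (x \<bullet> b))"

lemma gaussian_measurable [measurable]: "gaussian \<in> borel_measurable borel"
  unfolding gaussian_def by measurable

lemma std_normal_fourier:
  "integrable lborel (\<lambda>x. of_real (std_normal_density x) * iexp (t * x))"
  "(LINT x|lborel. of_real (std_normal_density x) * iexp (t * x)) = of_real (exp (- (t\<^sup>2) / 2))"
proof -
  have "integrable lborel (\<lambda>x. complex_of_real (std_normal_density x))"
    by (intro integrable_of_real integrable_normal_density) simp
  then show "integrable lborel (\<lambda>x. of_real (std_normal_density x) * iexp (t * x))"
    by (rule Bochner_Integration.integrable_bound) (auto simp: norm_mult)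
  have "char std_normal_distribution t = (LINT x|lborel. std_normal_density x *\<^sub>R iexp (t * x))"
    unfolding char_def by (subst integral_density) (auto simp: normal_density_nonneg)
  then show "(LINT x|lborel. of_real (std_normal_density x) * iexp (t * x)) = of_real (exp (- (t\<^sup>2) / 2))"
    by (simp add: char_std_normal_distribution scaleR_conv_of_real[where 'a = complex])
qed

text \<open>Under the coordinate description of \<open>lborel\<close> as a product measure the
  integrand factors. The factor for \<open>b\<close> is the characteristic function at
  \<open>- 2 pi (\<xi> \<bullet> b)\<close>, and the exponents add up to
  \<open>- 2 pi^2 |\<xi>|^2\<close>.\<close>

lemma gaussian_fourier_1:
  fixes \<xi> :: "real ^ 'n::finite"
  shows "integrable lborel (\<lambda>x. gaussian x * character (-\<xi>) x)"
    "(LINT x|lborel. gaussian x * character (-\<xi>) x) = of_real (exp (- 2 * pi\<^sup>2 * (norm \<xi>)\<^sup>2))"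
proof -
  let ?f = "\<lambda>b x. of_real (std_normal_density x) * iexp ((- 2 * pi * (\<xi> \<bullet> b)) * x)"
  interpret product_sigma_finite "\<lambda>_::real^'n. lborel :: real measure" ..
  let ?T = "\<lambda>f. \<Sum>b\<in>Basis. f b *\<^sub>R (b :: real^'n)"
  have T: "?T \<in> measurable (\<Pi>\<^sub>M b\<in>Basis. lborel) borel" by measurable
  have m: "(\<lambda>x. gaussian x * character (-\<xi>) x) \<in> borel_measurable borel" by measurable
  have eq: "gaussian (?T f) * character (-\<xi>) (?T f) = (\<Prod>b\<in>Basis. ?f b (f b))" for f
  proof -
    have 1: "?T f \<bullet> b = f b" if "b \<in> Basis" for b using that by (simp add: inner_sum_left_Basis)
    have "character (-\<xi>) (?T f) = exp (\<Sum>b\<in>Basis. \<i> * of_real ((- 2 * pi * (\<xi> \<bullet> b)) * f b))"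
      unfolding character_def inner_sum_right by (simp add: sum_distrib_left sum_negf mult_ac)
    also have "\<dots> = (\<Prod>b\<in>Basis. iexp ((- 2 * pi * (\<xi> \<bullet> b)) * f b))" by (rule exp_sum) simp
    finally show ?thesis unfolding gaussian_def by (simp add: 1 prod.distrib cong: prod.cong)
  qed
  have int: "integrable (\<Pi>\<^sub>M b\<in>Basis. lborel) (\<lambda>f. \<Prod>b\<in>Basis. ?f b (f b))"
    by (rule product_integrable_prod) (simp, rule std_normal_fourier(1))
  note L = lborel_eq[where 'a = "real^'n"]
  show "integrable lborel (\<lambda>x. gaussian x * character (-\<xi>) x)"
    by (subst L, subst integrable_distr_eq[OF T m]) (use int in \<open>simp only: eq\<close>)
  have "(LINT x|lborel. gaussian x * character (-\<xi>) x) = integral\<^sup>L (\<Pi>\<^sub>M b\<in>Basis. lborel) (\<lambda>f. \<Prod>b\<in>Basis. ?f b (f b))"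
    by (subst L, subst integral_distr[OF T m]) (simp only: eq)
  also have "\<dots> = (\<Prod>b\<in>Basis. integral\<^sup>L lborel (?f b))"
    by (rule product_integral_prod) (simp, rule std_normal_fourier(1))
  also have "\<dots> = (\<Prod>b\<in>Basis. of_real (exp (- ((- 2 * pi * (\<xi> \<bullet> b))\<^sup>2) / 2)))"
    by (simp only: std_normal_fourier(2))
  also have "\<dots> = of_real (exp (\<Sum>b\<in>Basis. - ((- 2 * pi * (\<xi> \<bullet> b))\<^sup>2) / 2))"
    by (simp add: exp_sum)
  also have "(\<Sum>b\<in>Basis. - ((- 2 * pi * (\<xi> \<bullet> b))\<^sup>2) / 2) = - 2 * pi\<^sup>2 * (norm \<xi>)\<^sup>2"
    unfolding power2_norm_eq_inner euclidean_inner[of \<xi> \<xi>] sum_distrib_left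
    by (intro sum.cong refl) (simp add: power2_eq_square)
  finally show "(LINT x|lborel. gaussian x * character (-\<xi>) x) = of_real (exp (- 2 * pi\<^sup>2 * (norm \<xi>)\<^sup>2))" .
qed

lemma gaussian_integrable: "integrable lborel gaussian" "(LINT x|lborel. gaussian x) = 1"
  using gaussian_fourier_1[of 0] by auto

lemma gaussian_eq:
  fixes x :: "real ^ 'n::finite"
  shows "gaussian x = of_real ((1 / sqrt (2 * pi)) ^ CARD('n) * exp (- (norm x)\<^sup>2 / 2))"
proof -
  have "(\<Prod>b\<in>Basis. std_normal_density (x \<bullet> b)) = (\<Prod>b\<in>(Basis :: (real^'n) set). 1 / sqrt (2 * pi)) * exp (\<Sum>b\<in>Basis. - (x \<bullet> b)\<^sup>2 / 2)"
    unfolding std_normal_density_def exp_sum[OF finite_Basis] prod.distrib[symmetric] ..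
  also have "(\<Sum>b\<in>Basis. - (x \<bullet> b)\<^sup>2 / 2) = - (norm x)\<^sup>2 / 2"
    unfolding power2_norm_eq_inner euclidean_inner[of x x]
    by (simp add: sum_divide_distrib sum_negf power2_eq_square)
  finally show ?thesis unfolding gaussian_def by simp
qed

text \<open>Inversion at the origin. A Gaussian \<open>gaussian (e k x)\<close> is inserted under
  the integral: as \<open>e k\<close> tends to 0 it tends to the constant \<open>g0\<close>, while
  the multiplication formula replaces it by its transform, which concentrates at the origin and
  picks out \<open>m 0\<close>.\<close>

lemma integral_fourier:
  fixes m :: "real ^ 'n::finite \<Rightarrow> complex"
  assumes m: "m \<in> test_functions UNIV"
  shows "(LINT x|lborel. fourier m x) = m 0"
proof -
  define e where "e k = 1 / real (Suc k)" for k
  have e0: "e k > 0" "e k \<noteq> 0" for k by (auto simp: e_def)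
  have el: "e \<longlonglongrightarrow> 0" unfolding e_def by (rule LIMSEQ_Suc[OF lim_1_over_n])
  have int: "integrable lborel (fourier m)" by (rule schwartz_integrable[OF fourier_schwartz[OF m]])
  have mm [measurable]: "m \<in> borel_measurable borel" by (rule smooth_measurable[OF test_functions_smooth[OF m]])
  have mf [measurable]: "fourier m \<in> borel_measurable borel" by (rule fourier_measurable[OF mm])
  obtain B where B: "\<And>x. norm (m x) \<le> B" "B \<ge> 0" using test_functions_bounded[OF m] by blast
  define E :: "real^'n \<Rightarrow> complex" where "E z = of_real (exp (- 2 * pi\<^sup>2 * (norm z)\<^sup>2))" for z
  have [measurable]: "E \<in> borel_measurable borel" unfolding E_def by measurable
  define g0 :: complex where "g0 = of_real ((1 / sqrt (2 * pi)) ^ CARD('n))"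
  have g0: "g0 \<noteq> 0" "gaussian (0::real^'n) = g0" by (auto simp: g0_def gaussian_eq)
  \<comment> \<open>The transform of the Gaussian is itself a rescaled Gaussian, so its integral
    follows from the normalisation of \<open>gaussian\<close> by an affine substitution. It equals
    \<open>g0\<close>, the constant that appears on the other side and cancels.\<close>
  have E_eq: "E z = gaussian (0 + (2 * pi) *\<^sub>R z) / g0" for z
    using g0(1) by (simp add: E_def gaussian_eq g0_def power_mult_distrib)
  have intE: "integrable lborel E"
    unfolding E_eq[abs_def] by (intro integrable_divide integrable_affine gaussian_integrable) auto
  have "(LINT x|lborel. gaussian (x::real^'n)) = \<bar>2 * pi\<bar> ^ DIM(real^'n) *\<^sub>R (LINT x|lborel. gaussian (0 + (2 * pi) *\<^sub>R (x::real^'n)))"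
    by (rule integral_affine) auto
  then have "1 = of_real ((2 * pi) ^ CARD('n)) * (LINT z|lborel. E z * g0)"
    using g0(1) by (simp add: E_eq gaussian_integrable scaleR_conv_of_real[where 'a = complex])
  also have "\<dots> = (of_real ((2 * pi) ^ CARD('n)) * g0) * (LINT z|lborel. E z)" by simp
  also have "of_real ((2 * pi) ^ CARD('n)) * g0 = inverse g0"
  proof -
    have "(2 * pi) ^ CARD('n) * (1 / sqrt (2 * pi)) ^ CARD('n) = inverse ((1 / sqrt (2 * pi)) ^ CARD('n))"
      unfolding power_mult_distrib[symmetric] power_inverse[symmetric]
      by (simp add: real_div_sqrt)
    then show ?thesis unfolding g0_def by (metis of_real_inverse of_real_mult)
  qed
  finally have IE: "(LINT z|lborel. E z) = g0" using g0(1) by (simp add: field_simps)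
  have FG: "fourier (\<lambda>x. gaussian (e k *\<^sub>R x)) y = of_real (1 / e k ^ CARD('n)) * E (y /\<^sub>R e k)" for k and y :: "real^'n"
  proof -
    have "of_real (exp (- 2 * pi\<^sup>2 * (norm (y /\<^sub>R e k))\<^sup>2)) = (LINT x|lborel. gaussian x * character (-(y /\<^sub>R e k)) x)"
      by (rule gaussian_fourier_1(2)[symmetric])
    also have "\<dots> = \<bar>e k\<bar> ^ DIM(real^'n) *\<^sub>R (LINT x|lborel. gaussian (0 + e k *\<^sub>R x) * character (-(y /\<^sub>R e k)) (0 + e k *\<^sub>R x))"
      using e0 by (intro integral_affine) auto
    also have "\<dots> = of_real (e k ^ CARD('n)) * fourier (\<lambda>x. gaussian (e k *\<^sub>R x)) y"
    proof -
      have "(\<lambda>x::real^'n. gaussian (e k *\<^sub>R x)) \<in> borel_measurable borel" by measurable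
      moreover have "character (-(y /\<^sub>R e k)) (0 + e k *\<^sub>R x) = character (-y) x" for x
      proof -
        have "(y /\<^sub>R e k) \<bullet> (e k *\<^sub>R x) = y \<bullet> x" using e0[of k] by simp
        then show ?thesis unfolding character_def by (simp only: add_0 inner_minus_left)
      qed
      ultimately show ?thesis using e0[of k] by (simp add: fourier_eq scaleR_conv_of_real[where 'a = complex])
    qed
    finally show ?thesis using e0[of k] by (simp add: E_def)
  qed
  have intG: "integrable lborel (\<lambda>x::real^'n. gaussian (e k *\<^sub>R x))" for k
    using integrable_affine[OF gaussian_integrable(1) e0(2), of 0] by simp
  have eq: "(LINT x|lborel. fourier m x * gaussian (e k *\<^sub>R x)) = (LINT x|lborel. m (e k *\<^sub>R x) * E x)" for k
  proof -
    have "(LINT x|lborel. fourier m x * gaussian (e k *\<^sub>R x)) = (LINT x|lborel. m x * fourier (\<lambda>x. gaussian (e k *\<^sub>R x)) x)"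
      by (rule fourier_multiplication_formula[OF test_functions_integrable[OF m] intG])
    also have "\<dots> = (LINT x|lborel. m x * (of_real (1 / e k ^ CARD('n)) * E (x /\<^sub>R e k)))" unfolding FG ..
    also have "\<dots> = \<bar>e k\<bar> ^ DIM(real^'n) *\<^sub>R (LINT x|lborel. m (0 + e k *\<^sub>R x) * (of_real (1 / e k ^ CARD('n)) * E ((0 + e k *\<^sub>R x) /\<^sub>R e k)))"
      using e0 by (intro integral_affine) auto
    also have "\<dots> = (LINT x|lborel. m (e k *\<^sub>R x) * E x)"
      using e0[of k] by (simp add: scaleR_conv_of_real[where 'a = complex] mult.left_commute)
    finally show ?thesis .
  qed
  have "(\<lambda>k. LINT x|lborel. fourier m x * gaussian (e k *\<^sub>R x)) \<longlonglongrightarrow> (LINT x|lborel. fourier m x * g0)"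
  proof (rule integral_dominated_convergence[where w = "\<lambda>x. norm (fourier m x) * norm g0"])
    show "AE x in lborel. (\<lambda>k. fourier m x * gaussian (e k *\<^sub>R x)) \<longlonglongrightarrow> fourier m x * g0"
    proof (rule AE_I2)
      fix x :: "real^'n"
      have "(\<lambda>k. gaussian (e k *\<^sub>R x)) \<longlonglongrightarrow> of_real ((1 / sqrt (2 * pi)) ^ CARD('n) * exp (- (norm (0 *\<^sub>R x))\<^sup>2 / 2))"
        unfolding gaussian_eq by (intro tendsto_intros el) auto
      then show "(\<lambda>k. fourier m x * gaussian (e k *\<^sub>R x)) \<longlonglongrightarrow> fourier m x * g0"
        by (intro tendsto_intros) (simp add: g0_def)
    qed
    show "AE x in lborel. norm (fourier m x * gaussian (e k *\<^sub>R x)) \<le> norm (fourier m x) * norm g0" for k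
      by (intro AE_I2) (auto simp: norm_mult gaussian_eq g0_def simp del: of_real_mult of_real_power intro!: mult_left_mono mult_left_le)
  qed (use int in auto)
  moreover have "(\<lambda>k. LINT x|lborel. m (e k *\<^sub>R x) * E x) \<longlonglongrightarrow> (LINT x|lborel. m 0 * E x)"
  proof (rule integral_dominated_convergence[where w = "\<lambda>x. B * norm (E x)"])
    show "AE x in lborel. (\<lambda>k. m (e k *\<^sub>R x) * E x) \<longlonglongrightarrow> m 0 * E x"
    proof (rule AE_I2)
      fix x :: "real^'n"
      have "(\<lambda>k. e k *\<^sub>R x) \<longlonglongrightarrow> 0 *\<^sub>R x" by (intro tendsto_intros el)
      then have "(\<lambda>k. m (e k *\<^sub>R x)) \<longlonglongrightarrow> m 0"
        using isCont_tendsto_compose[of 0 m] smooth_continuous[OF test_functions_smooth[OF m], of UNIV]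
        by (auto simp: continuous_on_eq_continuous_at)
      then show "(\<lambda>k. m (e k *\<^sub>R x) * E x) \<longlonglongrightarrow> m 0 * E x" by (intro tendsto_intros)
    qed
    show "AE x in lborel. norm (m (e k *\<^sub>R x) * E x) \<le> B * norm (E x)" for k
      using B by (intro AE_I2) (auto simp: norm_mult intro!: mult_right_mono)
  qed (use intE in auto)
  ultimately have "(LINT x|lborel. fourier m x * g0) = (LINT x|lborel. m 0 * E x)"
    unfolding eq by (rule LIMSEQ_unique)
  then show ?thesis using IE g0(1) by simp
qed

lemma fourier_translate:
  fixes m :: "real ^ 'n::finite \<Rightarrow> complex"
  assumes [measurable]: "m \<in> borel_measurable borel"
  shows "fourier (\<lambda>x. m (x + a)) \<xi> = character \<xi> a * fourier m \<xi>"
proof -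
  have "fourier (\<lambda>x. m (x + a)) \<xi> = (LINT x|lborel. m (x + a) * character (-\<xi>) (x + a) * character \<xi> a)"
  proof -
    have "character (-\<xi>) (x + a) * character \<xi> a = character (-\<xi>) x" for x
    proof -
      have "character (-\<xi>) a * character \<xi> a = 1" using character_add[of "-\<xi>" \<xi> a] by simp
      moreover have "character (-\<xi>) (x + a) = character (-\<xi>) x * character (-\<xi>) a"
        using character_add[of x a "-\<xi>"] by (simp only: character_commute[of _ "-\<xi>"])
      ultimately show ?thesis by (simp only: mult.assoc mult_1_right)
    qed
    then show ?thesis by (subst fourier_eq) (simp_all add: mult.assoc)
  qed
  also have "\<dots> = (LINT x|lborel. m (x + a) * character (-\<xi>) (x + a)) * character \<xi> a" by simp
  also have "(LINT x|lborel. m (x + a) * character (-\<xi>) (x + a)) = fourier m \<xi>"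
    by (subst integral_translate[of "\<lambda>x. m x * character (-\<xi>) x"]) (auto simp: fourier_eq)
  finally show ?thesis by simp
qed

text \<open>Inversion at \<open>a\<close> is inversion at the origin for the translate
  \<open>m (x + a)\<close>.\<close>

lemma fourier_inversion:
  fixes m :: "real ^ 'n::finite \<Rightarrow> complex"
  assumes m: "m \<in> test_functions UNIV"
  shows "inv_fourier (fourier m) = m"
proof
  fix a
  have [measurable]: "m \<in> borel_measurable borel" by (rule smooth_measurable[OF test_functions_smooth[OF m]])
  have "inv_fourier (fourier m) a = (LINT \<xi>|lborel. fourier m \<xi> * character a \<xi>)"
    by (rule inv_fourier_eq[OF fourier_measurable]) simp
  also have "\<dots> = (LINT \<xi>|lborel. fourier (\<lambda>x. m (x + a)) \<xi>)"
    by (simp add: fourier_translate character_commute[of a] mult.commute)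
  also have "\<dots> = m a"
    using integral_fourier[of "\<lambda>x. m (x + a)"] test_functions_affine[OF m, of 1 a] by simp
  finally show "inv_fourier (fourier m) a = m a" .
qed

section \<open>Lebesgue points\<close>

lemma locally_integrable_UNIV:
  assumes "locally_integrable_on UNIV g"
  shows "g \<in> borel_measurable lebesgue" "compact K \<Longrightarrow> set_integrable lebesgue K g"
  using assms by (auto simp: locally_integrable_on_def lebesgue_on_UNIV_eq)

lemma borel_measurable_lebesgueI:
  fixes f :: "'a::euclidean_space \<Rightarrow> 'b::topological_space"
  shows "f \<in> borel_measurable borel \<Longrightarrow> f \<in> borel_measurable lebesgue"
  by (simp add: measurable_completion)

lemma locally_integrable_mult:
  assumes g: "locally_integrable_on UNIV g" and \<theta>: "\<theta> \<in> borel_measurable borel"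
    and B: "\<And>x. norm (\<theta> x) \<le> B" and r: "\<And>x. \<theta> x \<noteq> 0 \<Longrightarrow> norm x \<le> r"
  shows "integrable lebesgue (\<lambda>x. g x * \<theta> x)"
proof (rule Bochner_Integration.integrable_bound)
  show "integrable lebesgue (\<lambda>x. B *\<^sub>R (indicator (cball 0 r) x *\<^sub>R g x))"
    using locally_integrable_UNIV(2)[OF g compact_cball[of 0 r]] by (intro integrable_scaleR_right) (simp add: set_integrable_def)
  show "(\<lambda>x. g x * \<theta> x) \<in> borel_measurable lebesgue"
    using locally_integrable_UNIV(1)[OF g] borel_measurable_lebesgueI[OF \<theta>] by (rule borel_measurable_times)
  show "AE x in lebesgue. norm (g x * \<theta> x) \<le> norm (B *\<^sub>R (indicator (cball 0 r) x *\<^sub>R g x))"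
  proof (rule AE_I2)
    fix x
    show "norm (g x * \<theta> x) \<le> norm (B *\<^sub>R (indicator (cball 0 r) x *\<^sub>R g x))"
    proof (cases "\<theta> x = 0")
      case False
      have "0 \<le> B" using B[of x] norm_ge_zero order_trans by blast
      then show ?thesis using r[OF False] B[of x] by (auto simp: norm_mult mult.commute[of "norm (g x)"] intro!: mult_right_mono)
    qed simp
  qed
qed

lemma locally_integrable_mult_test:
  assumes "locally_integrable_on UNIV g" "\<theta> \<in> test_functions UNIV"
  shows "integrable lebesgue (\<lambda>x. g x * \<theta> x)"
proof -
  obtain B where "\<And>x. norm (\<theta> x) \<le> B" using test_functions_bounded[OF assms(2)] by blast
  moreover obtain r where "\<And>x. \<theta> x \<noteq> 0 \<Longrightarrow> norm x \<le> r" using assms(2) by (auto simp: test_functions_UNIV_iff)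
  moreover have "\<theta> \<in> borel_measurable borel" using assms(2) by (intro smooth_measurable test_functions_smooth)
  ultimately show ?thesis using locally_integrable_mult[OF assms(1)] by blast
qed

lemma content_cube:
  assumes "h > 0"
  shows "measure lebesgue (cbox x (x + h *\<^sub>R One :: 'a::euclidean_space)) = h ^ DIM('a)"
proof -
  have "measure lebesgue (cbox x (x + h *\<^sub>R One)) = measure lborel (cbox x (x + h *\<^sub>R One))"
    by (rule measure_completion) simp
  also have "\<dots> = h ^ DIM('a)"
    using assms by (subst content_cbox) (auto simp: inner_simps)
  finally show ?thesis .
qed

lemma set_integrable_const_cbox:
  fixes q :: "'b::{banach, second_countable_topology}"
  shows "set_integrable lebesgue (cbox a (b::'a::euclidean_space)) (\<lambda>y. q)"
  unfolding set_integrable_def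
  by (intro integrable_scaleR_left impI integrable_real_indicator) (auto simp: emeasure_lborel_cbox_finite[unfolded infinity_ennreal_def])

text \<open>The differentiation theorem is applied to \<open>|g - q|\<close> for all
  \<open>q\<close> in a countable dense set. Their exceptional sets have a negligible union, and
  outside it a \<open>q\<close> close to \<open>g x\<close> can be chosen.\<close>

lemma lebesgue_point:
  fixes g :: "real ^ 'n::finite \<Rightarrow> complex"
  assumes g: "locally_integrable_on UNIV g"
  shows "AE x in lebesgue. \<forall>e>0. \<exists>d>0. \<forall>h. 0 < h \<and> h < d \<longrightarrow>
    (LINT y:cbox x (x + h *\<^sub>R One)|lebesgue. norm (g y - g x)) \<le> e * h ^ CARD('n)"
proof -
  obtain Q :: "complex set" where Q: "countable Q" "\<And>X. open X \<Longrightarrow> X \<noteq> {} \<Longrightarrow> \<exists>d\<in>Q. d \<in> X"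
    using countable_dense_exists by metis
  have si: "set_integrable lebesgue (cbox a b) (\<lambda>y. norm (g y - q))" for a b q
  proof -
    have "set_integrable lebesgue (cbox a b) (\<lambda>y. q)"
      by (rule set_integrable_const_cbox)
    then have "set_integrable lebesgue (cbox a b) (\<lambda>y. g y - q)"
      using locally_integrable_UNIV(2)[OF g compact_cbox[of a b]] by (rule set_integral_diff(1)[rotated])
    then show ?thesis by (rule set_integrable_norm)
  qed
  have "\<exists>N. negligible N \<and> (\<forall>x e. x \<notin> N \<and> 0 < e \<longrightarrow> (\<exists>d>0. \<forall>h. 0 < h \<and> h < d \<longrightarrow>
      norm (integral (cbox x (x + h *\<^sub>R One)) (\<lambda>y. norm (g y - q)) /\<^sub>R h ^ DIM(real^'n) - norm (g x - q)) < e))" for q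
    by (rule integrable_ccontinuous_explicit[of "\<lambda>y. norm (g y - q)", OF set_lebesgue_integral_eq_integral(1)[OF si]]) blast
  then obtain N where N: "\<And>q. negligible (N q)" and Nd: "\<And>q x e. x \<notin> N q \<Longrightarrow> 0 < e \<Longrightarrow> \<exists>d>0. \<forall>h. 0 < h \<and> h < d \<longrightarrow>
      norm (integral (cbox x (x + h *\<^sub>R One)) (\<lambda>y. norm (g y - q)) /\<^sub>R h ^ DIM(real^'n) - norm (g x - q)) < e"
    by metis
  have "negligible (\<Union>q\<in>Q. N q)" using Q(1) N by (intro negligible_countable_Union) auto
  then have "(\<Union>q\<in>Q. N q) \<in> null_sets lebesgue" by (simp add: negligible_iff_null_sets)
  then have "AE x in lebesgue. x \<notin> (\<Union>q\<in>Q. N q)" by (rule AE_not_in)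
  then show ?thesis
  proof eventually_elim
    case (elim x)
    show ?case
    proof (intro allI impI)
      fix e :: real assume e: "e > 0"
      \<comment> \<open>Two quarters of \<open>e\<close> bound the mean of \<open>|g - q|\<close>
        over the cube; the remaining half covers replacing \<open>q\<close> by
        \<open>g x\<close>.\<close>
      obtain q where q: "q \<in> Q" "q \<in> ball (g x) (e / 4)" using Q(2)[of "ball (g x) (e / 4)"] e by auto
      then have q': "norm (g x - q) < e / 4" by (simp add: dist_norm)
      obtain d where d: "d > 0" "\<And>h. 0 < h \<Longrightarrow> h < d \<Longrightarrow>
         norm (integral (cbox x (x + h *\<^sub>R One)) (\<lambda>y. norm (g y - q)) /\<^sub>R h ^ DIM(real^'n) - norm (g x - q)) < e / 4"
        using Nd[of x q "e/4"] elim q e by auto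
      have "(LINT y:cbox x (x + h *\<^sub>R One)|lebesgue. norm (g y - g x)) \<le> e * h ^ CARD('n)" if h: "0 < h" "h < d" for h
      proof -
        let ?C = "cbox x (x + h *\<^sub>R One)"
        have c: "set_integrable lebesgue ?C (\<lambda>y. norm (g x - q))" by (rule set_integrable_const_cbox)
        have "(LINT y:?C|lebesgue. norm (g y - g x)) \<le> (LINT y:?C|lebesgue. norm (g y - q) + norm (g x - q))"
          by (rule set_integral_mono[OF si set_integral_add(1)[OF si c]])
            (metis norm_minus_commute norm_triangle_ineq diff_add_cancel add_diff_eq)
        also have "\<dots> = (LINT y:?C|lebesgue. norm (g y - q)) + (LINT y:?C|lebesgue. norm (g x - q))"
          by (rule set_integral_add(2)[OF si c])
        also have "(LINT y:?C|lebesgue. norm (g x - q)) = norm (g x - q) * h ^ CARD('n)"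
          using content_cube[OF h(1), of x] by (simp add: set_lebesgue_integral_def mult.commute)
        also have "(LINT y:?C|lebesgue. norm (g y - q)) = integral ?C (\<lambda>y. norm (g y - q))"
          by (rule set_lebesgue_integral_eq_integral(2)[OF si])
        also have "integral ?C (\<lambda>y. norm (g y - q)) \<le> (e / 2) * h ^ CARD('n)"
        proof -
          have "integral ?C (\<lambda>y. norm (g y - q)) /\<^sub>R h ^ CARD('n) \<le> e / 2"
            using d(2)[OF h] q' unfolding real_norm_def DIM_cart DIM_real mult_1_right by linarith
          then show ?thesis using h(1) by (simp add: field_simps)
        qed
        also have "norm (g x - q) * h ^ CARD('n) \<le> (e / 2) * h ^ CARD('n)" using q' e h(1) by (intro mult_right_mono) auto
        finally show ?thesis by (simp add: field_simps)
      qed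
      then show "\<exists>d>0. \<forall>h. 0 < h \<and> h < d \<longrightarrow> (LINT y:cbox x (x + h *\<^sub>R One)|lebesgue. norm (g y - g x)) \<le> e * h ^ CARD('n)"
        using d(1) by blast
    qed
  qed
qed

section \<open>Mollifiers and uniqueness of representing functions\<close>

text \<open>The support lies in the cube with corner 0, not in a centred one, to match the cubes
  \<open>cbox x (x + h *\<^sub>R One)\<close> of the differentiation theorem.\<close>

definition mollifier :: "(real ^ 'n::finite \<Rightarrow> complex) \<Rightarrow> bool" where
  "mollifier \<rho> \<longleftrightarrow> \<rho> \<in> test_functions UNIV \<and> (\<forall>w. \<rho> w \<noteq> 0 \<longrightarrow> w \<in> cbox 0 One) \<and> (LINT w|lborel. \<rho> w) = 1"

definition mollify :: "(real ^ 'n::finite \<Rightarrow> complex) \<Rightarrow> nat \<Rightarrow> real ^ 'n \<Rightarrow> real ^ 'n \<Rightarrow> complex" where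
  "mollify \<rho> k x y = of_real (real (Suc k) ^ CARD('n)) * \<rho> (real (Suc k) *\<^sub>R (y - x))"

lemma mollify_test_function:
  assumes "mollifier \<rho>"
  shows "mollify \<rho> k x \<in> test_functions UNIV"
proof -
  have "\<rho> \<in> test_functions UNIV" using assms by (simp add: mollifier_def)
  from test_functions_affine[OF this, of "real (Suc k)" "- (real (Suc k) *\<^sub>R x)"]
  have "(\<lambda>y. \<rho> (real (Suc k) *\<^sub>R (y - x))) \<in> test_functions UNIV"
    by (simp add: scaleR_diff_right del: of_nat_Suc)
  from test_functions_mult(2)[OF this smooth_const] show ?thesis unfolding mollify_def[abs_def] .
qed

lemma integral_mollify:
  assumes "mollifier \<rho>"
  shows "(LINT y|lborel. mollify \<rho> k x y) = 1"
proof -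
  have m: "mollify \<rho> k x \<in> borel_measurable borel"
    by (intro smooth_measurable test_functions_smooth[OF mollify_test_function[OF assms]])
  have "(LINT y|lborel. mollify \<rho> k x y) = \<bar>1 / real (Suc k)\<bar> ^ DIM(real^'a) *\<^sub>R (LINT y|lborel. mollify \<rho> k x (x + (1 / real (Suc k)) *\<^sub>R y))"
    by (rule integral_affine[OF m]) simp
  also have "\<dots> = (LINT y|lborel. \<rho> y)"
    unfolding mollify_def by (simp add: scaleR_conv_of_real[where 'a = complex] power_divide field_simps del: of_nat_Suc)
  finally show ?thesis using assms by (simp add: mollifier_def)
qed

lemma mollify_support:
  assumes "mollifier \<rho>" "mollify \<rho> k x y \<noteq> 0"
  shows "y \<in> cbox x (x + (1 / real (Suc k)) *\<^sub>R One)"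
proof -
  have "real (Suc k) *\<^sub>R (y - x) \<in> cbox 0 One" using assms by (auto simp: mollifier_def mollify_def)
  then have "0 \<le> real (Suc k) * ((y - x) \<bullet> i) \<and> real (Suc k) * ((y - x) \<bullet> i) \<le> 1" if "i \<in> Basis" for i
    using that by (auto simp: mem_box)
  then have "0 \<le> (y - x) \<bullet> i \<and> (y - x) \<bullet> i \<le> 1 / real (Suc k)" if "i \<in> Basis" for i
    using that by (simp add: zero_le_mult_iff field_simps del: of_nat_Suc)
  then show ?thesis by (auto simp: mem_box inner_simps algebra_simps)
qed

text \<open>The kernel lives on a cube of side \<open>h = 1 / (k + 1)\<close> and is bounded there
  by \<open>B\<close> over the volume of the cube. At a Lebesgue point the error is therefore at
  most \<open>B\<close> times a small mean of \<open>|g - g x|\<close>.\<close>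

lemma mollify_tendsto:
  fixes g :: "real ^ 'n::finite \<Rightarrow> complex"
  assumes g: "locally_integrable_on UNIV g" and \<rho>: "mollifier \<rho>"
  shows "AE x in lebesgue. (\<lambda>k. LINT y|lebesgue. g y * mollify \<rho> k x y) \<longlonglongrightarrow> g x"
  using lebesgue_point[OF g]
proof eventually_elim
  case (elim x)
  have tf: "\<rho> \<in> test_functions UNIV" using \<rho> by (simp add: mollifier_def)
  obtain B where B: "\<And>x. norm (\<rho> x) \<le> B" "B \<ge> 0" using test_functions_bounded[OF tf] by blast
  show ?case
  proof (rule LIMSEQ_I)
    fix e :: real assume e: "e > 0"
    \<comment> \<open>Dividing by \<open>B + 1\<close> avoids the case \<open>B = 0\<close>; the
      factor 2 makes the final inequality strict.\<close>
    define e' where "e' = e / (2 * (B + 1))"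
    have e': "e' > 0" using e B by (simp add: e'_def)
    obtain d where d: "d > 0" "\<And>h. 0 < h \<Longrightarrow> h < d \<Longrightarrow> (LINT y:cbox x (x + h *\<^sub>R One)|lebesgue. norm (g y - g x)) \<le> e' * h ^ CARD('n)"
      using elim e' by blast
    obtain K where K: "1 / real (Suc K) < d" using d(1) by (rule nat_approx_posE)
    have "norm ((LINT y|lebesgue. g y * mollify \<rho> k x y) - g x) < e" if k: "k \<ge> K" for k
    proof -
      let ?h = "1 / real (Suc k)"
      let ?C = "cbox x (x + ?h *\<^sub>R One)"
      have "?h \<le> 1 / real (Suc K)" using k by (intro divide_left_mono) auto
      then have h: "0 < ?h" "?h < d" using K by auto
      have mt: "mollify \<rho> k x \<in> test_functions UNIV" by (rule mollify_test_function[OF \<rho>])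
      have mm: "mollify \<rho> k x \<in> borel_measurable borel" by (intro smooth_measurable test_functions_smooth[OF mt])
      have i1: "integrable lebesgue (\<lambda>y. g y * mollify \<rho> k x y)" by (rule locally_integrable_mult_test[OF g mt])
      have i2: "integrable lebesgue (mollify \<rho> k x)" using test_functions_integrable[OF mt] by (intro integrable_completion[THEN iffD2]) (auto simp: mm)
      have "(LINT y|lebesgue. g y * mollify \<rho> k x y) - g x = (LINT y|lebesgue. g y * mollify \<rho> k x y) - g x * (LINT y|lebesgue. mollify \<rho> k x y)"
        using integral_mollify[OF \<rho>, of k x] lebesgue_integral_eq_lborel[OF mm] by simp
      also have "\<dots> = (LINT y|lebesgue. (g y - g x) * mollify \<rho> k x y)"
        using i1 i2 by (simp add: left_diff_distrib)
      also have "norm \<dots> \<le> (LINT y|lebesgue. (real (Suc k) ^ CARD('n) * B) * (indicator ?C y *\<^sub>R norm (g y - g x)))"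
      proof (rule norm_integral_le)
        have "set_integrable lebesgue ?C (\<lambda>y. g x)" by (rule set_integrable_const_cbox)
        then have "set_integrable lebesgue ?C (\<lambda>y. norm (g y - g x))"
          using locally_integrable_UNIV(2)[OF g compact_cbox] by (intro set_integrable_norm set_integral_diff(1))
        then show "integrable lebesgue (\<lambda>y. (real (Suc k) ^ CARD('n) * B) * (indicator ?C y *\<^sub>R norm (g y - g x)))"
          unfolding set_integrable_def by (rule integrable_mult_right)
        fix y
        show "norm ((g y - g x) * mollify \<rho> k x y) \<le> (real (Suc k) ^ CARD('n) * B) * (indicator ?C y *\<^sub>R norm (g y - g x))"
        proof (cases "mollify \<rho> k x y = 0")
          case False
          have "norm (mollify \<rho> k x y) \<le> real (Suc k) ^ CARD('n) * B"
            unfolding mollify_def norm_mult using B(1) by (auto intro!: mult_left_mono simp: norm_power simp del: of_nat_Suc)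
          then have "norm (g y - g x) * norm (mollify \<rho> k x y) \<le> norm (g y - g x) * (real (Suc k) ^ CARD('n) * B)"
            by (intro mult_left_mono) auto
          then show ?thesis using mollify_support[OF \<rho> False] by (simp add: norm_mult mult.commute)
        qed (use B in auto)
      qed
      also have "\<dots> = (real (Suc k) ^ CARD('n) * B) * (LINT y:?C|lebesgue. norm (g y - g x))"
        by (simp add: set_lebesgue_integral_def)
      also have "\<dots> \<le> (real (Suc k) ^ CARD('n) * B) * (e' * ?h ^ CARD('n))"
        using d(2)[OF h] B(2) by (intro mult_left_mono) auto
      also have "\<dots> = B * e'" by (simp add: power_divide)
      also have "\<dots> < e"
      proof -
        have "B * e' \<le> (B + 1) * e'" using e' by (simp add: algebra_simps)
        also have "\<dots> = e / 2" using B(2) by (simp add: e'_def field_simps)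
        finally show ?thesis using e by simp
      qed
      finally show ?thesis .
    qed
    then show "\<exists>no. \<forall>n\<ge>no. norm ((LINT y|lebesgue. g y * mollify \<rho> n x y) - g x) < e" by blast
  qed
qed

text \<open>\<open>dist_abs\<close> picks some representing function. Mollification shows that any
  two of them agree almost everywhere, so integrals of \<open>dist_abs\<close> may be computed from
  an explicit one.\<close>

lemma represents_unique:
  fixes \<rho> g g' :: "real ^ 'n::finite \<Rightarrow> complex"
  assumes \<rho>: "mollifier \<rho>" and r: "represents g u" "represents g' u"
  shows "AE x in lebesgue. g x = g' x"
proof -
  have "locally_integrable_on UNIV g" "locally_integrable_on UNIV g'" using r by (auto simp: represents_def)
  from mollify_tendsto[OF this(1) \<rho>] mollify_tendsto[OF this(2) \<rho>] show ?thesis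
  proof eventually_elim
    case (elim x)
    have "(LINT y|lebesgue. g y * mollify \<rho> k x y) = (LINT y|lebesgue. g' y * mollify \<rho> k x y)" for k
      using r mollify_test_function[OF \<rho>, of k x] by (simp add: represents_def dist_of_fun_def)
    then show ?case using elim LIMSEQ_unique by simp
  qed
qed

section \<open>Convolutions and Fourier multipliers\<close>

definition conv_fun :: "(real ^ 'n::finite \<Rightarrow> complex) \<Rightarrow> (real ^ 'n \<Rightarrow> complex) \<Rightarrow> real ^ 'n \<Rightarrow> complex" where
  "conv_fun K \<theta> y = (LINT z|lborel. K (y - z) * \<theta> z)"

text \<open>Differentiating a transform multiplies the function inside by coordinates, and these
  factors are independent of \<open>h\<close>; hence the same \<open>m'\<close> serves with and
  without \<open>h\<close>.\<close>

lemma fourier_mult_partial_deriv: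
  fixes m h :: "real ^ 'n::finite \<Rightarrow> complex"
  assumes "m \<in> test_functions UNIV" "smooth h"
  shows "\<exists>m'\<in>test_functions UNIV. partial_deriv is (fourier m) = fourier m' \<and>
    partial_deriv is (fourier (\<lambda>\<xi>. m \<xi> * h \<xi>)) = fourier (\<lambda>\<xi>. m' \<xi> * h \<xi>)"
proof (induction "is")
  case (Cons i "is")
  then obtain m' where m': "m' \<in> test_functions UNIV" "partial_deriv is (fourier m) = fourier m'"
    "partial_deriv is (fourier (\<lambda>\<xi>. m \<xi> * h \<xi>)) = fourier (\<lambda>\<xi>. m' \<xi> * h \<xi>)" by blast
  have "partial_deriv (i # is) (fourier m) = fourier (\<lambda>x. - 2 * of_real pi * \<i> * of_real (x $ i) * m' x)"
    unfolding partial_deriv_Cons[of i "is"] m' by (rule fourier_partial_deriv_eq[OF m'(1)])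
  moreover have "partial_deriv (i # is) (fourier (\<lambda>\<xi>. m \<xi> * h \<xi>)) = fourier (\<lambda>x. - 2 * of_real pi * \<i> * of_real (x $ i) * m' x * h x)"
    unfolding partial_deriv_Cons[of i "is"] m' 
    by (subst fourier_partial_deriv_eq[OF test_functions_mult(1)[OF m'(1) assms(2)]]) (simp add: mult.assoc)
  ultimately show ?case using test_functions_mult_coord[OF m'(1)] by blast
qed (use assms in auto)

lemma convolution_fourier:
  fixes m \<theta> :: "real ^ 'n::finite \<Rightarrow> complex"
  assumes "m \<in> test_functions UNIV" "integrable lborel \<theta>"
  shows "conv_fun (fourier m) \<theta> = fourier (\<lambda>\<xi>. m \<xi> * inv_fourier \<theta> \<xi>)"
  unfolding conv_fun_def using fourier_mult_inv_fourier[OF test_functions_integrable[OF assms(1)] assms(2)] by auto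

text \<open>The convolution is the transform of the test function
  \<open>m * inv_fourier \<theta>\<close>, so it is a Schwartz function. Its derivatives multiply by
  coordinates, which can be absorbed into \<open>m\<close>, and so they all fall on the factor
  \<open>fourier m\<close>.\<close>

lemma
  fixes m \<theta> :: "real ^ 'n::finite \<Rightarrow> complex"
  assumes m: "m \<in> test_functions UNIV" and \<theta>: "integrable lborel \<theta>" "smooth (inv_fourier \<theta>)"
  shows convolution_schwartz: "conv_fun (fourier m) \<theta> \<in> schwartz"
    and partial_deriv_convolution: "partial_deriv is (conv_fun (fourier m) \<theta>) = conv_fun (partial_deriv is (fourier m)) \<theta>"
proof -
  show "conv_fun (fourier m) \<theta> \<in> schwartz"
    unfolding convolution_fourier[OF m \<theta>(1)] by (intro fourier_schwartz test_functions_mult(1)[OF m \<theta>(2)])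
  obtain m' where m': "m' \<in> test_functions UNIV" "partial_deriv is (fourier m) = fourier m'"
    "partial_deriv is (fourier (\<lambda>\<xi>. m \<xi> * inv_fourier \<theta> \<xi>)) = fourier (\<lambda>\<xi>. m' \<xi> * inv_fourier \<theta> \<xi>)"
    using fourier_mult_partial_deriv[OF m \<theta>(2)] by blast
  show "partial_deriv is (conv_fun (fourier m) \<theta>) = conv_fun (partial_deriv is (fourier m)) \<theta>"
    unfolding m'(2) convolution_fourier[OF m \<theta>(1)] convolution_fourier[OF m'(1) \<theta>(1)] by (rule m'(3))
qed

lemma fourier_multiplier_eq:
  fixes m \<theta> :: "real ^ 'n::finite \<Rightarrow> complex"
  assumes "m \<in> test_functions UNIV" "\<theta> \<in> test_functions UNIV"
  shows "fourier_multiplier m u \<theta> = u (conv_fun (fourier m) \<theta>)"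
  unfolding fourier_multiplier_def inv_fourier_dist_def mult_dist_def fourier_dist_def
    convolution_fourier[OF assms(1) test_functions_integrable[OF assms(2)]] ..

lemma smooth_inv_fourier: "\<theta> \<in> test_functions UNIV \<Longrightarrow> smooth (inv_fourier \<theta>)"
  by (intro schwartz_smooth inv_fourier_schwartz)

lemma partial_deriv_translate:
  fixes K :: "real ^ 'n::finite \<Rightarrow> complex"
  assumes "smooth K"
  shows "partial_deriv is (\<lambda>y. K (y - x)) = (\<lambda>y. partial_deriv is K (y - x))"
  using partial_deriv_affine_list[OF assms, of "is" 1 "-x"] by simp

lemma schwartz_translate: "K \<in> schwartz \<Longrightarrow> (\<lambda>y. K (y - x)) \<in> schwartz"
  using schwartz_affine[of K 1 "-x"] by simp

text \<open>The segment between \<open>y - z\<close> and \<open>y - x\<close> stays in the ball of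
  radius \<open>R\<close> around \<open>y\<close>, on which \<open>1 + |y|\<close> is at most
  \<open>1 + R\<close> times the weight at the point itself.\<close>

lemma schwartz_lipschitz:
  fixes L :: "real ^ 'n::finite \<Rightarrow> complex"
  assumes L: "L \<in> schwartz" and R: "R \<ge> 0"
  obtains C where "C \<ge> 0" "\<And>x y z. norm x \<le> R \<Longrightarrow> norm z \<le> R \<Longrightarrow>
    (1 + norm y) ^ N * norm (L (y - z) - L (y - x)) \<le> C * norm (z - x)"
proof -
  have "\<forall>i. \<exists>C. C \<ge> 0 \<and> (\<forall>x. (1 + norm x) ^ N * norm (partial_deriv [i] L x) \<le> C)"
    using schwartz_bound[OF L] by metis
  then obtain D where D: "\<And>i. D i \<ge> 0" "\<And>i x. (1 + norm x) ^ N * norm (partial_deriv [i] L x) \<le> D i" by metis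
  define E where "E = sum D UNIV * (1 + R) ^ N"
  have E: "E \<ge> 0" unfolding E_def using D(1) R by (intro mult_nonneg_nonneg sum_nonneg) auto
  have "(1 + norm y) ^ N * norm (L (y - z) - L (y - x)) \<le> (real CARD('n) * E) * norm (z - x)"
    if xz: "norm x \<le> R" "norm z \<le> R" for x y z
  proof -
    have p: "0 < (1 + norm y) ^ N" by (simp add: add_pos_nonneg)
    have "norm (L (y - z) - L (y - x)) \<le> real CARD('n) * (E / (1 + norm y) ^ N) * norm ((y - z) - (y - x))"
    proof (rule lipschitz_of_partial_deriv[OF schwartz_smooth[OF L], of "cball y R"])
      fix i w assume w: "w \<in> cball y R"
      have "norm y \<le> norm w + R" using w norm_triangle_sub[of y w] by (simp add: dist_norm)
      also have "1 + \<dots> \<le> (1 + R) * (1 + norm w)" using R by (simp add: algebra_simps)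
      finally have "(1 + norm y) ^ N \<le> ((1 + R) * (1 + norm w)) ^ N" by (intro power_mono) auto
      then have "(1 + norm y) ^ N * norm (partial_deriv [i] L w) \<le> ((1 + R) * (1 + norm w)) ^ N * norm (partial_deriv [i] L w)"
        by (intro mult_right_mono) auto
      also have "\<dots> = (1 + R) ^ N * ((1 + norm w) ^ N * norm (partial_deriv [i] L w))" by (simp add: power_mult_distrib)
      also have "\<dots> \<le> (1 + R) ^ N * D i" using R D(2)[of w i] by (intro mult_left_mono) auto
      also have "\<dots> \<le> E" unfolding E_def using R D(1) member_le_sum[of i UNIV D] by (simp add: mult.commute mult_left_mono)
      finally show "norm (partial_deriv [i] L w) \<le> E / (1 + norm y) ^ N" using p by (simp add: field_simps)
    qed (use xz in \<open>auto simp: dist_norm\<close>)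
    also have "norm ((y - z) - (y - x)) = norm (z - x)" by (simp add: norm_minus_commute)
    finally show ?thesis using p by (simp add: field_simps)
  qed
  then show ?thesis using that[of "real CARD('n) * E"] E by simp
qed

text \<open>The mollifiers concentrate at \<open>x\<close>, so convolution with them replaces a
  Schwartz kernel by averages of its translates near \<open>x\<close>. The weighted Lipschitz bound
  makes every seminorm of the difference of order \<open>1 / (k + 1)\<close>.\<close>

lemma tempered_convolution_mollify:
  fixes u :: "'n::finite functional"
  assumes u: "u \<in> tempered_distributions" and m: "m \<in> test_functions UNIV" and \<rho>: "mollifier \<rho>"
  shows "(\<lambda>k. u (conv_fun (fourier m) (mollify \<rho> k x))) \<longlonglongrightarrow> u (\<lambda>y. fourier m (y - x))"
proof (rule tempered_tendsto[OF u])
  note mt = mollify_test_function[OF \<rho>]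
  note Fm = fourier_schwartz[OF m]
  show "conv_fun (fourier m) (mollify \<rho> k x) \<in> schwartz" for k
    by (rule convolution_schwartz[OF m test_functions_integrable[OF mt] smooth_inv_fourier[OF mt]])
  show "(\<lambda>y. fourier m (y - x)) \<in> schwartz" by (rule schwartz_translate[OF Fm])
  fix N "is" and e :: real assume e: "e > 0"
  define L where "L = partial_deriv is (fourier m)"
  have L: "L \<in> schwartz" unfolding L_def by (rule schwartz_partial_deriv[OF Fm])
  have Lm: "L \<in> borel_measurable borel" by (rule schwartz_measurable[OF L])
  \<comment> \<open>The supporting cube has side at most 1, hence all its points lie within
    \<open>n\<close> of \<open>x\<close>.\<close>
  define R where "R = norm x + real CARD('n)"
  obtain C where C: "C \<ge> 0" "\<And>x y z. norm x \<le> R \<Longrightarrow> norm z \<le> R \<Longrightarrow>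
    (1 + norm y) ^ N * norm (L (y - z) - L (y - x)) \<le> C * norm (z - x)"
    using schwartz_lipschitz[OF L, of R N] by (auto simp: R_def)
  define M where "M = (LINT w|lborel. norm (\<rho> w))"
  have \<rho>t: "\<rho> \<in> test_functions UNIV" using \<rho> by (simp add: mollifier_def)
  have M: "(LINT z|lborel. norm (mollify \<rho> k x z)) = M" for k
  proof -
    have m: "(\<lambda>z. norm (mollify \<rho> k x z)) \<in> borel_measurable borel"
      using smooth_measurable[OF test_functions_smooth[OF mt]] by simp
    have "(LINT y|lborel. norm (mollify \<rho> k x y)) = \<bar>1 / real (Suc k)\<bar> ^ DIM(real^'n) *\<^sub>R (LINT y|lborel. norm (mollify \<rho> k x (x + (1 / real (Suc k)) *\<^sub>R y)))"
      by (rule integral_affine[OF m]) simp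
    also have "\<dots> = M"
      unfolding mollify_def M_def by (simp add: norm_mult norm_power power_divide del: of_nat_Suc)
    finally show ?thesis .
  qed
  have M0: "M \<ge> 0" unfolding M_def by simp
  have est: "(1 + norm y) ^ N * norm (partial_deriv is (conv_fun (fourier m) (mollify \<rho> k x)) y
    - partial_deriv is (\<lambda>y. fourier m (y - x)) y) \<le> C * M * real CARD('n) / real (Suc k)" for k y
  proof -
    have p: "0 < (1 + norm y) ^ N" by (simp add: add_pos_nonneg)
    define c where "c = C * (real CARD('n) / real (Suc k)) / (1 + norm y) ^ N"
    have c0: "c \<ge> 0" using C(1) p by (simp add: c_def)
    have i2: "integrable lborel (mollify \<rho> k x)" by (rule test_functions_integrable[OF mt])
    have i1: "integrable lborel (\<lambda>z. L (y - z) * mollify \<rho> k x z)"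
    proof -
      obtain B where "\<And>x. (1 + norm x) ^ 0 * norm (partial_deriv [] L x) \<le> B" using schwartz_bound[OF L] by metis
      then have B: "norm (L x) \<le> B" for x by simp
      have "integrable lborel (\<lambda>z. of_real B * mollify \<rho> k x z)" using i2 by simp
      then show ?thesis
      proof (rule Bochner_Integration.integrable_bound)
        show "(\<lambda>z. L (y - z) * mollify \<rho> k x z) \<in> borel_measurable lborel"
          using Lm smooth_measurable[OF test_functions_smooth[OF mt]] by measurable
        show "AE z in lborel. norm (L (y - z) * mollify \<rho> k x z) \<le> norm (of_real B * mollify \<rho> k x z)"
          using B order_trans[OF norm_ge_zero B] by (auto simp: norm_mult intro!: mult_right_mono)
      qed
    qed
    have "partial_deriv is (conv_fun (fourier m) (mollify \<rho> k x)) y - partial_deriv is (\<lambda>y. fourier m (y - x)) y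
      = (LINT z|lborel. L (y - z) * mollify \<rho> k x z) - L (y - x) * (LINT z|lborel. mollify \<rho> k x z)"
      unfolding partial_deriv_convolution[OF m test_functions_integrable[OF mt] smooth_inv_fourier[OF mt]]
        partial_deriv_translate[OF schwartz_smooth[OF Fm]] conv_fun_def integral_mollify[OF \<rho>] L_def[symmetric] by simp
    also have "\<dots> = (LINT z|lborel. (L (y - z) - L (y - x)) * mollify \<rho> k x z)"
      using i1 i2 by (simp add: left_diff_distrib)
    also have "norm \<dots> \<le> (LINT z|lborel. c * norm (mollify \<rho> k x z))"
    proof (rule norm_integral_le)
      show "integrable lborel (\<lambda>z. c * norm (mollify \<rho> k x z))" using i2 by simp
      fix z
      show "norm ((L (y - z) - L (y - x)) * mollify \<rho> k x z) \<le> c * norm (mollify \<rho> k x z)"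
      proof (cases "mollify \<rho> k x z = 0")
        case False
        have zc: "z \<in> cbox x (x + (1 / real (Suc k)) *\<^sub>R One)" by (rule mollify_support[OF \<rho> False])
        have "norm (z - x) \<le> (\<Sum>b\<in>Basis. \<bar>(z - x) \<bullet> b\<bar>)" by (rule norm_le_l1)
        also have "\<dots> \<le> (\<Sum>b\<in>(Basis::(real^'n) set). 1 / real (Suc k))"
          using zc by (intro sum_mono) (auto simp: mem_box inner_simps algebra_simps)
        finally have zx: "norm (z - x) \<le> real CARD('n) / real (Suc k)" by simp
        also have "\<dots> \<le> real CARD('n)" by (simp add: field_simps)
        finally have "norm z \<le> R" using norm_triangle_sub[of z x] by (simp add: R_def)
        then have "(1 + norm y) ^ N * norm (L (y - z) - L (y - x)) \<le> C * norm (z - x)" by (intro C(2)) (auto simp: R_def)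
        also have "\<dots> \<le> C * (real CARD('n) / real (Suc k))" using zx C(1) by (intro mult_left_mono)
        finally have "norm (L (y - z) - L (y - x)) \<le> c" using p by (simp add: c_def pos_le_divide_eq mult.commute del: of_nat_Suc)
        then show ?thesis by (simp add: norm_mult mult_right_mono)
      qed simp
    qed
    also have "\<dots> = c * M" using M by simp
    finally have "norm (partial_deriv is (conv_fun (fourier m) (mollify \<rho> k x)) y - partial_deriv is (\<lambda>y. fourier m (y - x)) y) \<le> c * M" .
    then have "(1 + norm y) ^ N * norm (partial_deriv is (conv_fun (fourier m) (mollify \<rho> k x)) y - partial_deriv is (\<lambda>y. fourier m (y - x)) y) \<le> (1 + norm y) ^ N * (c * M)"
      using p by (intro mult_left_mono) auto
    also have "\<dots> = C * M * real CARD('n) / real (Suc k)"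
    proof -
      have "0 < 1 + norm y" by (simp add: add_pos_nonneg)
      then have "1 + norm y \<noteq> 0" by linarith
      then show ?thesis by (simp add: c_def)
    qed
    finally show ?thesis .
  qed
  have "(\<lambda>k. C * M * real CARD('n) * (1 / real (Suc k))) \<longlonglongrightarrow> C * M * real CARD('n) * 0"
    by (intro tendsto_intros LIMSEQ_Suc[OF lim_1_over_n])
  then have "eventually (\<lambda>k. C * M * real CARD('n) * (1 / real (Suc k)) < e) sequentially"
    using e by (intro order_tendstoD(2)) auto
  then show "\<forall>\<^sub>F k in sequentially. \<forall>y. (1 + norm y) ^ N * norm (partial_deriv is (conv_fun (fourier m) (mollify \<rho> k x)) y
    - partial_deriv is (\<lambda>y. fourier m (y - x)) y) \<le> e"
  proof eventually_elim
    case (elim k)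
    show ?case
    proof
      fix y
      show "(1 + norm y) ^ N * norm (partial_deriv is (conv_fun (fourier m) (mollify \<rho> k x)) y
        - partial_deriv is (\<lambda>y. fourier m (y - x)) y) \<le> e" using est[of y k] elim by simp
    qed
  qed
qed

text \<open>The representing function is known only through compactly supported tests. Mollifiers
  recover \<open>g x\<close> almost everywhere, and inside \<open>u\<close> they converge to a
  translate of the kernel, which gives an explicit smooth candidate for the block.\<close>

lemma represents_fourier_multiplier:
  fixes u :: "'n::finite functional" and m \<rho> g :: "real ^ 'n \<Rightarrow> complex"
  assumes u: "u \<in> tempered_distributions" and m: "m \<in> test_functions UNIV" and \<rho>: "mollifier \<rho>"
    and g: "represents g (fourier_multiplier m u)"
  shows "AE x in lebesgue. g x = u (\<lambda>y. fourier m (y - x))"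
proof -
  have "locally_integrable_on UNIV g" using g by (simp add: represents_def)
  from mollify_tendsto[OF this \<rho>] show ?thesis
  proof eventually_elim
    case (elim x)
    have "(LINT y|lebesgue. g y * mollify \<rho> k x y) = u (conv_fun (fourier m) (mollify \<rho> k x))" for k
    proof -
      have "fourier_multiplier m u (mollify \<rho> k x) = (LINT y|lebesgue. g y * mollify \<rho> k x y)"
        using g mollify_test_function[OF \<rho>, of k x] unfolding represents_def dist_of_fun_def by blast
      then show ?thesis using fourier_multiplier_eq[OF m mollify_test_function[OF \<rho>]] by metis
    qed
    then show ?case using elim tempered_convolution_mollify[OF u m \<rho>, of x] LIMSEQ_unique by simp
  qed
qed

section \<open>Approximate identities\<close>

text \<open>A normalised form of the bump \<open>\<phi>\<close> of the theorem, which equals 1 up to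
  radius 4/3 and vanishes from radius 3/2 on. It also serves as a cutoff in space and in
  frequency.\<close>

definition cutoff :: "(real ^ 'n::finite \<Rightarrow> complex) \<Rightarrow> bool" where
  "cutoff \<kappa> \<longleftrightarrow> \<kappa> \<in> test_functions UNIV \<and> (\<forall>x. norm x \<le> 1 \<longrightarrow> \<kappa> x = 1) \<and> (\<forall>x. norm x \<ge> 2 \<longrightarrow> \<kappa> x = 0)"

lemma dilated_partial_deriv:
  fixes A B :: "real ^ 'n::finite \<Rightarrow> complex"
  assumes "smooth A" "smooth B"
  shows "partial_deriv [i] (\<lambda>y. of_real c * (A y * B (s *\<^sub>R (x - y)))) =
    (\<lambda>y. of_real c * (partial_deriv [i] A y * B (s *\<^sub>R (x - y))) + of_real (- c * s) * (A y * partial_deriv [i] B (s *\<^sub>R (x - y))))"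
proof
  fix y
  have B: "(\<lambda>y. B (s *\<^sub>R (x - y))) = (\<lambda>y. B ((-s) *\<^sub>R y + s *\<^sub>R x))" by (simp add: scaleR_diff_right)
  have sB: "smooth (\<lambda>y. B (s *\<^sub>R (x - y)))" unfolding B by (rule smooth_affine[OF assms(2)])
  have dB: "partial_deriv [i] (\<lambda>y. B (s *\<^sub>R (x - y))) y = of_real (- s) * partial_deriv [i] B (s *\<^sub>R (x - y))"
    unfolding B partial_deriv_affine_list[OF assms(2)] by (simp add: scaleR_diff_right)
  have "partial_deriv [i] (\<lambda>y. of_real c * (A y * B (s *\<^sub>R (x - y)))) y = of_real c * partial_deriv [i] (\<lambda>y. A y * B (s *\<^sub>R (x - y))) y"
    by (subst partial_deriv_cmult_list[OF smooth_mult[OF assms(1) sB]]) simp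
  also have "\<dots> = of_real c * (A y * partial_deriv [i] (\<lambda>y. B (s *\<^sub>R (x - y))) y + partial_deriv [i] A y * B (s *\<^sub>R (x - y)))"
    by (subst partial_deriv_mult[OF smooth_differentiable[OF assms(1)] smooth_differentiable[OF sB]]) simp
  finally show "partial_deriv [i] (\<lambda>y. of_real c * (A y * B (s *\<^sub>R (x - y)))) y = 
    of_real c * (partial_deriv [i] A y * B (s *\<^sub>R (x - y))) + of_real (- c * s) * (A y * partial_deriv [i] B (s *\<^sub>R (x - y)))"
    unfolding dB by (simp add: algebra_simps)
qed

text \<open>Away from \<open>x\<close> the dilated Schwartz function is smaller than any power of
  \<open>t\<close>, which beats the factor \<open>1 / t^m\<close>. A derivative produces two terms
  of the same shape, with either \<open>A\<close> or \<open>B\<close> differentiated; in the second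
  the chain rule raises \<open>m\<close> by one, so \<open>A\<close>, \<open>B\<close>,
  \<open>m\<close> and \<open>e\<close> are all generalised.\<close>

lemma far_part_tendsto_0:
  fixes A B :: "real ^ 'n::finite \<Rightarrow> complex"
  assumes A: "smooth A" "\<And>is. \<exists>M. \<forall>y. norm (partial_deriv is A y) \<le> M" "\<And>y. norm (y - x) < \<delta> \<Longrightarrow> A y = 0"
    and \<delta>: "\<delta> > 0" and B: "B \<in> schwartz" and e: "e > 0"
  shows "eventually (\<lambda>t. \<forall>y. (1 + norm y) ^ N * norm (partial_deriv is (\<lambda>y. of_real (1 / t ^ m) * (A y * B ((1 / t) *\<^sub>R (x - y)))) y) \<le> e) (at_right 0)"
  using A B e
\<comment> \<open>The last coordinate of the list is the innermost derivative, so the list is taken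
  apart from the right.\<close>
proof (induction "is" arbitrary: A B m e rule: rev_induct)
  case Nil
  obtain M0 where "\<forall>y. norm (partial_deriv [] A y) \<le> M0" using Nil(2) by blast
  then have M: "norm (A y) \<le> \<bar>M0\<bar>" for y using order_trans[OF _ abs_ge_self[of M0]] by simp
  \<comment> \<open>\<open>N\<close> powers absorb the weight in \<open>y\<close>, \<open>m\<close>
    powers cancel \<open>1 / t^m\<close>, and one more leaves a factor \<open>t\<close>.\<close>
  define L where "L = N + Suc m"
  obtain C where C: "\<And>w. (1 + norm w) ^ L * norm (partial_deriv [] B w) \<le> C" "C \<ge> 0" using schwartz_bound[OF Nil(4)] by blast
  \<comment> \<open>Gives \<open>1 + |y| \<le> P |x - y|\<close> as soon as
    \<open>|x - y| \<ge> \<delta>\<close>.\<close>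
  define P where "P = (1 + norm x) / \<delta> + 1"
  have P0: "P \<ge> 0" using \<delta> by (simp add: P_def)
  define E where "E = P ^ N * \<bar>M0\<bar> * C / \<delta> ^ Suc m"
  have E0: "E \<ge> 0" using P0 C \<delta> by (simp add: E_def)
  have main: "(1 + norm y) ^ N * norm (of_real (1 / t ^ m) * (A y * B ((1 / t) *\<^sub>R (x - y)))) \<le> E * t" if t: "0 < t" "t < 1" for t y
  proof (cases "norm (y - x) < \<delta>")
    case True
    then show ?thesis using Nil(3) E0 t by simp
  next
    case False
    define r where "r = norm (x - y)"
    have r: "r \<ge> \<delta>" using False by (simp add: r_def norm_minus_commute)
    have "1 + norm y \<le> 1 + norm x + r" using norm_triangle_sub[of y x] by (simp add: r_def norm_minus_commute)
    also have "\<dots> \<le> P * r"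
    proof -
      have "(1 + norm x) * 1 \<le> (1 + norm x) * (r / \<delta>)" using r \<delta> by (intro mult_left_mono) (auto simp: field_simps)
      then show ?thesis by (simp add: P_def distrib_right)
    qed
    finally have y: "(1 + norm y) ^ N \<le> (P * r) ^ N" by (intro power_mono) auto
    have rt: "r / t \<ge> 0" "r / t \<ge> r" "r / t \<ge> \<delta> / t" "r \<ge> 0" 
      using r t \<delta> by (auto simp: field_simps mult_left_le)
    have "(r ^ N * (\<delta> / t) ^ Suc m) * norm (B ((1 / t) *\<^sub>R (x - y))) \<le> (1 + norm ((1 / t) *\<^sub>R (x - y))) ^ L * norm (B ((1 / t) *\<^sub>R (x - y)))"
    proof (intro mult_right_mono)
      have "r ^ N * (\<delta> / t) ^ Suc m \<le> (r / t) ^ N * (r / t) ^ Suc m"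
        using rt t \<delta> by (intro mult_mono power_mono) auto
      also have "\<dots> = (r / t) ^ L" by (simp only: L_def power_add)
      also have "\<dots> \<le> (1 + norm ((1 / t) *\<^sub>R (x - y))) ^ L" using t rt by (intro power_mono) (auto simp: r_def)
      finally show "r ^ N * (\<delta> / t) ^ Suc m \<le> (1 + norm ((1 / t) *\<^sub>R (x - y))) ^ L" .
    qed auto
    also have "\<dots> \<le> C" using C(1)[of "(1 / t) *\<^sub>R (x - y)"] by simp
    finally have B: "(r ^ N * (\<delta> / t) ^ Suc m) * norm (B ((1 / t) *\<^sub>R (x - y))) \<le> C" .
    have "(1 + norm y) ^ N * norm (of_real (1 / t ^ m) * (A y * B ((1 / t) *\<^sub>R (x - y)))) 
      \<le> (P * r) ^ N * ((1 / t ^ m) * (\<bar>M0\<bar> * norm (B ((1 / t) *\<^sub>R (x - y)))))"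
      unfolding norm_mult using y t M[of y] P0 rt by (intro mult_mono) (auto simp: norm_power norm_divide)
    also have "\<dots> = (P ^ N * \<bar>M0\<bar> * t / \<delta> ^ Suc m) * ((r ^ N * (\<delta> / t) ^ Suc m) * norm (B ((1 / t) *\<^sub>R (x - y))))"
      using t \<delta> by (simp add: field_simps power_mult_distrib)
    also have "\<dots> \<le> (P ^ N * \<bar>M0\<bar> * t / \<delta> ^ Suc m) * C"
      using B P0 t \<delta> by (intro mult_left_mono) auto
    also have "\<dots> = E * t" by (simp add: E_def)
    finally show ?thesis .
  qed
  have "((\<lambda>t. E * t) \<longlongrightarrow> E * 0) (at_right 0)" by (intro tendsto_intros)
  then have "eventually (\<lambda>t. E * t < e) (at_right 0)" using Nil(5) by (intro order_tendstoD(2)) auto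
  moreover have "eventually (\<lambda>t::real. 0 < t \<and> t < 1) (at_right 0)"
    unfolding eventually_at_right_field by (intro exI[of _ 1]) auto
  ultimately show ?case
  proof eventually_elim
    case (elim t)
    then show ?case using main[of t] by (auto intro: order_trans less_imp_le)
  qed
next
  case (snoc i "is")
  let ?F = "\<lambda>m A B t y. of_real (1 / t ^ m) * (A y * B ((1 / t) *\<^sub>R (x - y)))"
  have z: "partial_deriv [i] A y = 0" if "norm (y - x) < \<delta>" for y
  proof -
    have "partial_deriv [i] A y = partial_deriv [i] (\<lambda>_. 0) y"
      by (rule partial_deriv_eq_on_open[where U = "ball x \<delta>"])
        (use that snoc.prems(3) in \<open>auto simp: dist_norm norm_minus_commute smooth_const\<close>)
    then show ?thesis by (simp add: partial_deriv_const)
  qed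
  have b: "\<exists>M. \<forall>y. norm (partial_deriv js (partial_deriv [i] A) y) \<le> M" for js
    using snoc.prems(2)[of "js @ [i]"] by (simp add: partial_deriv_append)
  have e2: "e / 2 > 0" using snoc.prems(5) by simp
  have 1: "eventually (\<lambda>t. \<forall>y. (1 + norm y) ^ N * norm (partial_deriv is (?F m (partial_deriv [i] A) B t) y) \<le> e / 2) (at_right 0)"
    by (rule snoc.IH[OF smooth_partial_deriv[OF snoc.prems(1)] b z snoc.prems(4) e2])
  have 2: "eventually (\<lambda>t. \<forall>y. (1 + norm y) ^ N * norm (partial_deriv is (?F (Suc m) A (partial_deriv [i] B) t) y) \<le> e / 2) (at_right 0)"
    by (rule snoc.IH[OF snoc.prems(1,2,3) schwartz_partial_deriv[OF snoc.prems(4)] e2])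
  show ?case using 1 2
  proof eventually_elim
    case (elim t)
    have sB: "smooth B" by (rule schwartz_smooth[OF snoc.prems(4)])
    have sF: "smooth (?F k A' B' t)" if "smooth A'" "smooth B'" for k and A' B' :: "real^'n \<Rightarrow> complex"
    proof -
      have "smooth (\<lambda>y. B' ((1 / t) *\<^sub>R (x - y)))"
        using smooth_affine[OF that(2), of "- (1 / t)" "(1 / t) *\<^sub>R x"] by (simp add: scaleR_diff_right)
      then show ?thesis using that by (intro smooth_mult smooth_const)
    qed
    note s1 = sF[OF smooth_partial_deriv[OF snoc.prems(1)] sB, of m "[i]"]
    note s2 = sF[OF snoc.prems(1) smooth_partial_deriv[OF sB], of "Suc m" "[i]"]
    have "partial_deriv (is @ [i]) (?F m A B t) = partial_deriv is (\<lambda>y. ?F m (partial_deriv [i] A) B t y + (-1) * ?F (Suc m) A (partial_deriv [i] B) t y)"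
      unfolding partial_deriv_append dilated_partial_deriv[OF snoc.prems(1) sB] by (simp add: mult.commute)
    also have "\<dots> = (\<lambda>y. partial_deriv is (?F m (partial_deriv [i] A) B t) y + (-1) * partial_deriv is (?F (Suc m) A (partial_deriv [i] B) t) y)"
      by (simp only: partial_deriv_add_list[OF s1 smooth_mult[OF smooth_const s2]] partial_deriv_cmult_list[OF s2])
    finally have eq: "partial_deriv (is @ [i]) (?F m A B t) = \<dots>" .
    show ?case
    proof
      fix y
      have "(1 + norm y) ^ N * norm (partial_deriv (is @ [i]) (?F m A B t) y) \<le>
        (1 + norm y) ^ N * (norm (partial_deriv is (?F m (partial_deriv [i] A) B t) y) + norm (partial_deriv is (?F (Suc m) A (partial_deriv [i] B) t) y))"
        unfolding eq using norm_triangle_ineq4 by (intro mult_left_mono) auto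
      also have "\<dots> \<le> e / 2 + e / 2" unfolding distrib_left using elim by (intro add_mono) auto
      finally show "(1 + norm y) ^ N * norm (partial_deriv (is @ [i]) (?F m A B t) y) \<le> e" by simp
    qed
  qed
qed

lemma dilate_eq: "dilate t \<psi> (x - y) = of_real (1 / t ^ CARD('n)) * \<psi> ((1 / t) *\<^sub>R (x - (y :: real ^ 'n::finite)))"
  by (simp add: dilate_def divide_inverse)

lemma dilate_schwartz:
  fixes \<psi> :: "real ^ 'n::finite \<Rightarrow> complex"
  assumes "\<psi> \<in> schwartz" "t > 0"
  shows "(\<lambda>y. dilate t \<psi> (x - y)) \<in> schwartz"
proof -
  have "(\<lambda>y. dilate t \<psi> (x - y)) = (\<lambda>y. of_real (1 / t ^ CARD('n)) * \<psi> ((- (1 / t)) *\<^sub>R y + (1 / t) *\<^sub>R x))"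
    unfolding dilate_eq by (simp add: scaleR_diff_right)
  show ?thesis
    unfolding \<open>(\<lambda>y. dilate t \<psi> (x - y)) = _\<close>
    by (rule schwartz_cmult[OF schwartz_affine[OF assms(1)]]) (use assms(2) in simp)
qed

text \<open>Nothing is known about the growth of \<open>D\<close> away from \<open>x\<close>. A
  cutoff around \<open>x\<close> splits the kernel: the near part is a test function, on which
  \<open>u\<close> is integration against the locally bounded \<open>D\<close>, and the far part
  tends to 0 in the Schwartz topology.\<close>

lemma tempered_approximate_identity:
  fixes u :: "'n::finite functional" and D \<psi> \<kappa> :: "real ^ 'n \<Rightarrow> complex"
  assumes u: "u \<in> tempered_distributions" and D: "represents D u" "D \<in> borel_measurable borel" "isCont D x"
    and \<psi>: "\<psi> \<in> schwartz" and \<kappa>: "cutoff \<kappa>"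
  shows "((\<lambda>t. u (\<lambda>y. dilate t \<psi> (x - y))) \<longlongrightarrow> D x * (LINT z|lborel. \<psi> z)) (at_right 0)"
proof -
  obtain \<delta> where \<delta>: "\<delta> > 0" "\<And>y. dist y x < \<delta> \<Longrightarrow> dist (D y) (D x) < 1"
    using D(3) unfolding continuous_at_eps_delta by (metis zero_less_one)
  \<comment> \<open>The factor \<open>2 / \<delta>\<close> moves the radii 1 and 2 of the cutoff to
    \<open>\<delta> / 2\<close> and \<delta>.\<close>
  define c where "c y = \<kappa> ((2 / \<delta>) *\<^sub>R (y - x))" for y
  have ct: "c \<in> test_functions UNIV"
    using test_functions_affine[of \<kappa> "2 / \<delta>" "- ((2 / \<delta>) *\<^sub>R x)"] \<kappa> \<delta>(1) by (simp add: c_def[abs_def] cutoff_def scaleR_diff_right)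
  have c1: "c y = 1" if "norm (y - x) < \<delta> / 2" for y
  proof -
    have "norm ((2 / \<delta>) *\<^sub>R (y - x)) = 2 / \<delta> * norm (y - x)" unfolding norm_scaleR using \<delta>(1) by simp
    also have "\<dots> \<le> 1" using that \<delta>(1) by (simp add: field_simps)
    finally have "norm ((2 / \<delta>) *\<^sub>R (y - x)) \<le> 1" .
    then show ?thesis using \<kappa> by (simp add: c_def cutoff_def)
  qed
  have c0: "norm (y - x) < \<delta>" if "c y \<noteq> 0" for y
  proof (rule ccontr)
    assume "\<not> norm (y - x) < \<delta>"
    then have "2 \<le> 2 / \<delta> * norm (y - x)" using \<delta>(1) by (simp add: field_simps)
    also have "\<dots> = norm ((2 / \<delta>) *\<^sub>R (y - x))" unfolding norm_scaleR using \<delta>(1) by simp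
    finally have "norm ((2 / \<delta>) *\<^sub>R (y - x)) \<ge> 2" .
    then show False using that \<kappa> by (simp add: c_def cutoff_def)
  qed
  obtain B where B: "\<And>y. norm (c y) \<le> B" "B \<ge> 0" using test_functions_bounded[OF ct] by blast
  have sc: "smooth c" by (rule test_functions_smooth[OF ct])
  have cm: "c \<in> borel_measurable borel" by (rule smooth_measurable[OF sc])
  have \<psi>m: "\<psi> \<in> borel_measurable borel" by (rule schwartz_measurable[OF \<psi>])
  define A where "A y = 1 - c y" for y
  have sA: "smooth A" unfolding A_def by (intro smooth_diff smooth_const sc)
  have bA: "\<exists>M. \<forall>y. norm (partial_deriv is A y) \<le> M" for "is"
  proof -
    obtain M where M: "\<And>y. norm (partial_deriv is c y) \<le> M" using test_functions_bounded[OF test_functions_partial_deriv[OF ct]] by blast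
    have "norm (partial_deriv is A y) \<le> 1 + M" for y
    proof -
      have "partial_deriv is A y = (if is = [] then 1 else 0) - partial_deriv is c y"
        unfolding A_def by (subst partial_deriv_diff_list[OF smooth_const sc]) (simp add: partial_deriv_const)
      also have "norm \<dots> \<le> norm (if is = [] then 1 else 0 :: complex) + norm (partial_deriv is c y)" by (rule norm_triangle_ineq4)
      also have "\<dots> \<le> 1 + M" using M[of y] by auto
      finally show ?thesis .
    qed
    then show ?thesis by blast
  qed
  have zA: "A y = 0" if "norm (y - x) < \<delta> / 2" for y using c1[OF that] by (simp add: A_def)
  let ?far = "\<lambda>t y. of_real (1 / t ^ CARD('n)) * (A y * \<psi> ((1 / t) *\<^sub>R (x - y)))"
  let ?near = "\<lambda>t y. c y * dilate t \<psi> (x - y)"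
  have near_t: "?near t \<in> test_functions UNIV" if "t > 0" for t
    by (rule test_functions_mult(1)[OF ct schwartz_smooth[OF dilate_schwartz[OF \<psi> that]]])
  have far_eq: "?far t = (\<lambda>y. dilate t \<psi> (x - y) - ?near t y)" for t
    unfolding dilate_eq A_def by (auto simp: algebra_simps)
  have far_s: "?far t \<in> schwartz" if "t > 0" for t
    unfolding far_eq by (rule schwartz_diff[OF dilate_schwartz[OF \<psi> that] test_functions_schwartz[OF near_t[OF that]]])
  have pos: "eventually (\<lambda>t::real. t > 0) (at_right 0)" by (rule eventually_at_right_less)
  have far0: "((\<lambda>t. u (?far t)) \<longlongrightarrow> 0) (at_right 0)"
  proof -
    \<comment> \<open>The convergence criterion asks every member of the family to be a Schwartz
      function; the value 0 for \<open>t \<le> 0\<close> is invisible to the filter.\<close>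
    have "((\<lambda>t. u (if t > 0 then ?far t else (\<lambda>_. 0))) \<longlongrightarrow> 0) (at_right 0)"
    proof (rule tempered_tendsto_0[OF u])
      show "(if t > 0 then ?far t else (\<lambda>_. 0)) \<in> schwartz" for t
        by (cases "t > 0") (simp_all only: if_True if_False far_s schwartz_0)
      fix N "is" and e :: real assume e: "e > 0"
      have "eventually (\<lambda>t. \<forall>y. (1 + norm y) ^ N * norm (partial_deriv is (?far t) y) \<le> e) (at_right 0)"
        by (rule far_part_tendsto_0[where \<delta> = "\<delta> / 2", OF sA bA zA _ \<psi> e]) (use \<delta> in auto)
      then show "eventually (\<lambda>t. \<forall>y. (1 + norm y) ^ N * norm (partial_deriv is (if t > 0 then ?far t else (\<lambda>_. 0)) y) \<le> e) (at_right 0)"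
        using pos by eventually_elim simp
    qed
    moreover have "eventually (\<lambda>t. u (if t > 0 then ?far t else (\<lambda>_. 0)) = u (?far t)) (at_right 0)"
      using pos by eventually_elim simp
    ultimately show ?thesis by (simp add: tendsto_cong)
  qed
  have Db: "norm (D y * c y) \<le> (norm (D x) + 1) * B" for y
  proof (cases "c y = 0")
    case False
    have "dist (D y) (D x) < 1" using \<delta>(2)[of y] c0[OF False] by (simp add: dist_norm)
    then have "norm (D y) \<le> norm (D x) + 1" using norm_triangle_sub[of "D y" "D x"] by (simp add: dist_norm)
    then show ?thesis unfolding norm_mult using B by (intro mult_mono) auto
  qed (use B in simp)
  have near: "u (?near t) = (LINT z|lborel. (D (x - t *\<^sub>R z) * c (x - t *\<^sub>R z)) * \<psi> z)" if t: "t > 0" for t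
  proof -
    have "u (?near t) = (LINT y|lebesgue. D y * ?near t y)"
      using D(1) near_t[OF t] by (simp add: represents_def dist_of_fun_def)
    also have "\<dots> = (LINT y|lborel. D y * ?near t y)"
      by (rule lebesgue_integral_eq_lborel[OF borel_measurable_times[OF D(2) smooth_measurable[OF test_functions_smooth[OF near_t[OF t]]]]])
    also have "\<dots> = \<bar>- t\<bar> ^ DIM(real^'n) *\<^sub>R (LINT z|lborel. D (x + (- t) *\<^sub>R z) * ?near t (x + (- t) *\<^sub>R z))"
      by (rule integral_affine[OF borel_measurable_times[OF D(2) smooth_measurable[OF test_functions_smooth[OF near_t[OF t]]]]]) (use t in simp)
    also have "\<dots> = (LINT z|lborel. (D (x - t *\<^sub>R z) * c (x - t *\<^sub>R z)) * \<psi> z)"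
      using t by (simp add: dilate_def mult.assoc scaleR_conv_of_real[where 'a = complex])
    finally show ?thesis .
  qed
  have "((\<lambda>t. LINT z|lborel. (D (x - t *\<^sub>R z) * c (x - t *\<^sub>R z)) * \<psi> z) \<longlongrightarrow> (LINT z|lborel. D x * \<psi> z)) (at_right 0)"
    unfolding tendsto_at_iff_sequentially o_def
  proof (intro allI impI)
    fix X :: "nat \<Rightarrow> real" assume X: "\<forall>i. X i \<in> {0<..} - {0}" "X \<longlonglongrightarrow> 0"
    show "(\<lambda>k. LINT z|lborel. (D (x - X k *\<^sub>R z) * c (x - X k *\<^sub>R z)) * \<psi> z) \<longlonglongrightarrow> (LINT z|lborel. D x * \<psi> z)"
    proof (rule integral_dominated_convergence[where w = "\<lambda>z. (norm (D x) + 1) * B * norm (\<psi> z)"])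
      show "integrable lborel (\<lambda>z. (norm (D x) + 1) * B * norm (\<psi> z))" using schwartz_integrable[OF \<psi>] by simp
      show "(\<lambda>z. D x * \<psi> z) \<in> borel_measurable lborel" using \<psi>m by measurable
      show "(\<lambda>z. (D (x - X k *\<^sub>R z) * c (x - X k *\<^sub>R z)) * \<psi> z) \<in> borel_measurable lborel" for k
        using \<psi>m D(2) cm by measurable
      show "AE z in lborel. norm ((D (x - X k *\<^sub>R z) * c (x - X k *\<^sub>R z)) * \<psi> z) \<le> (norm (D x) + 1) * B * norm (\<psi> z)" for k
        using Db by (intro AE_I2) (simp add: norm_mult mult_right_mono)
      show "AE z in lborel. (\<lambda>k. (D (x - X k *\<^sub>R z) * c (x - X k *\<^sub>R z)) * \<psi> z) \<longlonglongrightarrow> D x * \<psi> z"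
      proof (rule AE_I2)
        fix z
        have "(\<lambda>k. x - X k *\<^sub>R z) \<longlonglongrightarrow> x - 0 *\<^sub>R z" by (intro tendsto_intros X(2))
        then have lim: "(\<lambda>k. x - X k *\<^sub>R z) \<longlonglongrightarrow> x" by simp
        have "isCont c x" using smooth_continuous[OF sc, of UNIV] by (simp add: continuous_on_eq_continuous_at)
        then have "(\<lambda>k. (D (x - X k *\<^sub>R z) * c (x - X k *\<^sub>R z)) * \<psi> z) \<longlonglongrightarrow> (D x * c x) * \<psi> z"
          by (intro tendsto_mult tendsto_const isCont_tendsto_compose[OF _ lim] D(3))
        then show "(\<lambda>k. (D (x - X k *\<^sub>R z) * c (x - X k *\<^sub>R z)) * \<psi> z) \<longlonglongrightarrow> D x * \<psi> z"
          using c1[of x] \<delta>(1) by simp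
      qed
    qed
  qed
  then have "((\<lambda>t. u (?near t)) \<longlongrightarrow> (LINT z|lborel. D x * \<psi> z)) (at_right 0)"
  proof (rule Lim_transform_eventually)
    show "eventually (\<lambda>t. (LINT z|lborel. (D (x - t *\<^sub>R z) * c (x - t *\<^sub>R z)) * \<psi> z) = u (?near t)) (at_right 0)"
      using pos by eventually_elim (simp add: near)
  qed
  from tendsto_add[OF this far0]
  have "((\<lambda>t. u (?near t) + u (?far t)) \<longlongrightarrow> D x * (LINT z|lborel. \<psi> z)) (at_right 0)" by simp
  then show ?thesis
  proof (rule Lim_transform_eventually)
    show "eventually (\<lambda>t. u (?near t) + u (?far t) = u (\<lambda>y. dilate t \<psi> (x - y))) (at_right 0)"
      using pos
    proof eventually_elim
      case (elim t)
      have "u (?far t) = u (\<lambda>y. dilate t \<psi> (x - y)) - u (?near t)"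
        unfolding far_eq by (rule tempered_diff[OF u dilate_schwartz[OF \<psi> elim] test_functions_schwartz[OF near_t[OF elim]]])
      then show ?case by simp
    qed
  qed
qed

section \<open>Lower bounds for the norms\<close>

lemma fourier_scale:
  fixes f :: "real ^ 'n::finite \<Rightarrow> complex"
  assumes f: "f \<in> borel_measurable borel" and t: "t > 0"
  shows "fourier (\<lambda>x. f (t *\<^sub>R x)) \<xi> = of_real (1 / t ^ CARD('n)) * fourier f ((1 / t) *\<^sub>R \<xi>)"
proof -
  have m: "(\<lambda>x. f (t *\<^sub>R x)) \<in> borel_measurable borel" using f by measurable
  have "fourier f ((1 / t) *\<^sub>R \<xi>) = (LINT x|lborel. f x * character (-((1 / t) *\<^sub>R \<xi>)) x)" by (rule fourier_eq[OF f])
  also have "\<dots> = \<bar>t\<bar> ^ DIM(real^'n) *\<^sub>R (LINT x|lborel. f (0 + t *\<^sub>R x) * character (-((1 / t) *\<^sub>R \<xi>)) (0 + t *\<^sub>R x))"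
    using t f by (intro integral_affine) auto
  also have "(LINT x|lborel. f (0 + t *\<^sub>R x) * character (-((1 / t) *\<^sub>R \<xi>)) (0 + t *\<^sub>R x)) = fourier (\<lambda>x. f (t *\<^sub>R x)) \<xi>"
    unfolding fourier_eq[OF m] using t by (intro Bochner_Integration.integral_cong refl) (simp add: character_def)
  finally show ?thesis using t by (simp add: scaleR_conv_of_real[where 'a = complex])
qed

lemma cutoffD:
  assumes "cutoff \<kappa>"
  shows "\<kappa> \<in> test_functions UNIV" "norm x \<le> 1 \<Longrightarrow> \<kappa> x = 1" "norm x \<ge> 2 \<Longrightarrow> \<kappa> x = 0"
  using assms by (auto simp: cutoff_def)

lemma cutoff_dilation:
  assumes "cutoff \<kappa>" "t > 0"
  shows "(\<lambda>\<xi>. \<kappa> (t *\<^sub>R \<xi>)) \<in> test_functions UNIV"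
  using test_functions_affine[OF cutoffD(1)[OF assms(1)], of t 0] assms(2) by simp

text \<open>Dilating the cutoff in frequency contracts its kernel in space: an approximate identity
  of total mass \<open>\<kappa> 0 = 1\<close>.\<close>

lemma tempered_low_frequency:
  fixes u :: "'n::finite functional" and D \<kappa> :: "real ^ 'n \<Rightarrow> complex"
  assumes u: "u \<in> tempered_distributions" and D: "represents D u" "D \<in> borel_measurable borel" "isCont D x"
    and \<kappa>: "cutoff \<kappa>"
  shows "(\<lambda>J. u (\<lambda>y. fourier (\<lambda>\<xi>. \<kappa> ((1 / 2 ^ J) *\<^sub>R \<xi>)) (y - x))) \<longlonglongrightarrow> D x"
proof -
  note tf = cutoffD(1)[OF \<kappa>]
  have m: "\<kappa> \<in> borel_measurable borel" by (rule smooth_measurable[OF test_functions_smooth[OF tf]])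
  \<comment> \<open>The reflection turns kernels in \<open>y - x\<close> into kernels in
    \<open>x - y\<close>, the form in which dilates are convolved.\<close>
  define \<psi> where "\<psi> z = fourier \<kappa> ((-1) *\<^sub>R z + 0)" for z
  have \<psi>: "\<psi> \<in> schwartz" unfolding \<psi>_def by (rule schwartz_affine[OF fourier_schwartz[OF tf]]) simp
  have "(LINT z|lborel. \<psi> z) = (LINT z|lborel. fourier \<kappa> (0 - z))" by (simp add: \<psi>_def)
  also have "\<dots> = (LINT z|lborel. fourier \<kappa> z)" by (rule integral_reflect[OF fourier_measurable[OF m]])
  also have "\<dots> = 1" using integral_fourier[OF tf] cutoffD(2)[OF \<kappa>, of 0] by simp
  finally have I: "(LINT z|lborel. \<psi> z) = 1" .
  have f: "filterlim (\<lambda>J. 1 / 2 ^ J :: real) (at_right 0) sequentially"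
  proof -
    have "(\<lambda>J. (1 / 2) ^ J :: real) \<longlonglongrightarrow> 0" by (rule LIMSEQ_power_zero) simp
    then have "(\<lambda>J. 1 / 2 ^ J :: real) \<longlonglongrightarrow> 0" by (simp add: power_one_over)
    then show ?thesis by (intro tendsto_imp_filterlim_at_right) auto
  qed
  have "(\<lambda>J. u (\<lambda>y. dilate (1 / 2 ^ J) \<psi> (x - y))) \<longlonglongrightarrow> D x * (LINT z|lborel. \<psi> z)"
    by (rule filterlim_compose[OF tempered_approximate_identity[OF u D \<psi> \<kappa>] f])
  moreover have "(\<lambda>y. dilate (1 / 2 ^ J) \<psi> (x - y)) = (\<lambda>y. fourier (\<lambda>\<xi>. \<kappa> ((1 / 2 ^ J) *\<^sub>R \<xi>)) (y - x))" for J
    unfolding dilate_eq \<psi>_def by (simp add: fourier_scale[OF m] scaleR_diff_right)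
  ultimately show ?thesis by (simp add: I)
qed

section \<open>Sums of \<open>p\<close>-th powers and block sums\<close>

text \<open>For two terms, scaling the sum to 1 puts both into the unit interval, where
  \<open>z \<le> z^p\<close>; the general case is an induction.\<close>

lemma powr_sum_le:
  fixes a :: "'i \<Rightarrow> real"
  assumes p: "0 < p" "p \<le> 1" and a: "\<And>i. i \<in> I \<Longrightarrow> a i \<ge> 0"
  shows "(\<Sum>i\<in>I. a i) powr p \<le> (\<Sum>i\<in>I. a i powr p)"
proof -
  have two: "(x + y) powr p \<le> x powr p + y powr p" if xy: "x \<ge> 0" "y \<ge> 0" for x y :: real
  proof (cases "x + y = 0")
    case False
    then have s: "x + y > 0" using xy by simp
    have *: "z \<le> z powr p" if "0 \<le> z" "z \<le> 1" for z :: real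
      using powr_mono'[of p 1 z] that p by simp
    have "1 = x / (x + y) + y / (x + y)" using s by (simp add: add_divide_distrib[symmetric])
    also have "\<dots> \<le> (x / (x + y)) powr p + (y / (x + y)) powr p"
      using xy s by (intro add_mono *) auto
    also have "\<dots> = (x powr p + y powr p) / (x + y) powr p"
      using xy s by (simp add: powr_divide add_divide_distrib)
    finally show ?thesis using s by (simp add: field_simps)
  qed (use xy in auto)
  show ?thesis using a
  proof (induction I rule: infinite_finite_induct)
    case (insert i I)
    have "(\<Sum>i\<in>insert i I. a i) powr p \<le> a i powr p + (\<Sum>i\<in>I. a i) powr p"
      using insert two[of "a i" "\<Sum>i\<in>I. a i"] by (simp add: sum_nonneg)
    also have "\<dots> \<le> a i powr p + (\<Sum>i\<in>I. a i powr p)" using insert by simp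
    finally show ?case using insert by simp
  qed auto
qed

lemma norm_powr_le_suminf:
  fixes v :: "nat \<Rightarrow> complex"
  assumes p: "0 < p" "p \<le> 1" and v: "(\<lambda>J. \<Sum>j<J. v j) \<longlonglongrightarrow> d"
  shows "ennreal (norm d powr p) \<le> (\<Sum>j. ennreal (norm (v j) powr p))"
proof -
  have "(\<lambda>J. norm (\<Sum>j<J. v j) powr p) \<longlonglongrightarrow> norm d powr p"
    using p by (intro tendsto_powr' tendsto_norm v tendsto_const) auto
  then have "(\<lambda>J. ennreal (norm (\<Sum>j<J. v j) powr p)) \<longlonglongrightarrow> ennreal (norm d powr p)" by (rule tendsto_ennrealI)
  then show ?thesis
  proof (rule Lim_bounded)
    show "\<forall>J\<ge>0. ennreal (norm (\<Sum>j<J. v j) powr p) \<le> (\<Sum>j. ennreal (norm (v j) powr p))"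
    proof (intro allI impI)
      fix J
      have "norm (\<Sum>j<J. v j) powr p \<le> (\<Sum>j<J. norm (v j)) powr p" using p by (intro powr_mono2 norm_sum) auto
      also have "\<dots> \<le> (\<Sum>j<J. norm (v j) powr p)" using p by (intro powr_sum_le) auto
      finally have "ennreal (norm (\<Sum>j<J. v j) powr p) \<le> ennreal (\<Sum>j<J. norm (v j) powr p)" by (rule ennreal_leI)
      also have "\<dots> = (\<Sum>j<J. ennreal (norm (v j) powr p))" by simp
      also have "\<dots> \<le> (\<Sum>j. ennreal (norm (v j) powr p))" by (intro sum_le_suminf) auto
      finally show "ennreal (norm (\<Sum>j<J. v j) powr p) \<le> (\<Sum>j. ennreal (norm (v j) powr p))" .
    qed
  qed
qed

lemma epowr_ennreal: "a \<ge> 0 \<Longrightarrow> epowr (ennreal a) r = ennreal (a powr r)"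
  by (simp add: epowr_def)

text \<open>The \<open>p\<close>-th power of a block quasi-norm. With both exponents equal to
  \<open>p\<close>, the Besov and Triebel-Lizorkin quasi-norms differ only in the order of sum and
  integral, and the modulation quasi-norm is the same expression for another family
  \<open>s\<close>; so the three spaces are treated together.\<close>

definition block_sum :: "(nat \<Rightarrow> real ^ 'n \<Rightarrow> complex) \<Rightarrow> real \<Rightarrow> 'n::finite functional \<Rightarrow> ennreal" where
  "block_sum s p u = (\<Sum>j. \<integral>\<^sup>+x. epowr (dist_abs (fourier_multiplier (s j) u) x) p \<partial>lebesgue)"

lemma dist_abs_represents:
  assumes "represents g u"
  obtains g' where "represents g' u" "dist_abs u = (\<lambda>x. ennreal (cmod (g' x)))"
proof -
  have ex: "\<exists>g. represents g u" using assms by blast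
  then have "represents (SOME g. represents g u) u" by (rule someI_ex)
  moreover have "dist_abs u = (\<lambda>x. ennreal (cmod ((SOME g. represents g u) x)))" by (simp add: dist_abs_def[abs_def] ex)
  ultimately show ?thesis using that by blast
qed

text \<open>A block that is no function has \<open>dist_abs\<close> equal to \<infinity> everywhere
  and makes the sum infinite. Finiteness thus provides the representing functions without a
  Paley-Wiener argument.\<close>

lemma block_sum_finite:
  assumes "block_sum s p u < \<infinity>"
  obtains g where "\<And>j. represents (g j) (fourier_multiplier (s j) u)"
    "block_sum s p u = (\<Sum>j. \<integral>\<^sup>+x. ennreal (norm (g j x) powr p) \<partial>lebesgue)"
proof -
  have "\<exists>g. represents g (fourier_multiplier (s j) u)" for j
  proof (rule ccontr)
    assume "\<nexists>g. represents g (fourier_multiplier (s j) u)"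
    then have "dist_abs (fourier_multiplier (s j) u) x = \<infinity>" for x by (simp add: dist_abs_def)
    then have "(\<integral>\<^sup>+x. epowr (dist_abs (fourier_multiplier (s j) u) x) p \<partial>lebesgue) = \<infinity>"
      by (simp add: epowr_def nn_integral_completion)
    then have "\<infinity> \<le> block_sum s p u"
      unfolding block_sum_def using single_le_suminf[of "\<lambda>j. \<integral>\<^sup>+x. epowr (dist_abs (fourier_multiplier (s j) u) x) p \<partial>lebesgue" j] by simp
    then show False using assms by simp
  qed
  then have "\<forall>j. \<exists>g. represents g (fourier_multiplier (s j) u) \<and> dist_abs (fourier_multiplier (s j) u) = (\<lambda>x. ennreal (cmod (g x)))"
    using dist_abs_represents by metis
  then obtain g where g: "\<And>j. represents (g j) (fourier_multiplier (s j) u)"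
    "\<And>j. dist_abs (fourier_multiplier (s j) u) = (\<lambda>x. ennreal (cmod (g j x)))" by metis
  show ?thesis by (rule that[OF g(1)]) (simp add: block_sum_def g(2) epowr_ennreal)
qed

lemma represents_measurable: "represents g u \<Longrightarrow> g \<in> borel_measurable lebesgue"
  by (simp add: represents_def locally_integrable_UNIV(1))

text \<open>Convergence of the partial sums is a hypothesis because its reason depends on the
  blocks: telescoping for the dyadic ones, Bernstein's inequality for the uniform ones.\<close>

lemma block_sum_lower:
  fixes u :: "'n::finite functional" and D \<rho> :: "real ^ 'n \<Rightarrow> complex"
  assumes p: "0 < p" "p < 1" and u: "u \<in> tempered_distributions" and s: "\<And>j. s j \<in> test_functions UNIV"
    and \<rho>: "mollifier \<rho>" and fin: "block_sum s p u < \<infinity>"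
    and lim: "\<And>x. x \<noteq> 0 \<Longrightarrow> (\<lambda>J. \<Sum>j<J. u (\<lambda>y. fourier (s j) (y - x))) \<longlonglongrightarrow> D x"
  shows "(\<integral>\<^sup>+x. ennreal (norm (D x) powr p) \<partial>lebesgue) \<le> block_sum s p u"
proof -
  obtain g where g: "\<And>j. represents (g j) (fourier_multiplier (s j) u)"
    "block_sum s p u = (\<Sum>j. \<integral>\<^sup>+x. ennreal (norm (g j x) powr p) \<partial>lebesgue)"
    using block_sum_finite[OF fin] by blast
  have "AE x in lebesgue. \<forall>j. g j x = u (\<lambda>y. fourier (s j) (y - x))"
    unfolding AE_all_countable using represents_fourier_multiplier[OF u s \<rho> g(1)] by blast
  \<comment> \<open>The origin, where the image function may be discontinuous, is a null
    set.\<close>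
  moreover have "AE x in lebesgue. x \<noteq> (0::real^'n)" by (rule AE_completion[OF AE_lborel_singleton])
  ultimately have "AE x in lebesgue. ennreal (norm (D x) powr p) \<le> (\<Sum>j. ennreal (norm (g j x) powr p))"
  proof eventually_elim
    case (elim x)
    show ?case using norm_powr_le_suminf[OF p(1) less_imp_le[OF p(2)] lim[OF elim(2)]] elim(1) by simp
  qed
  then have "(\<integral>\<^sup>+x. ennreal (norm (D x) powr p) \<partial>lebesgue) \<le> (\<integral>\<^sup>+x. (\<Sum>j. ennreal (norm (g j x) powr p)) \<partial>lebesgue)"
    by (rule nn_integral_mono_AE)
  also have "\<dots> = block_sum s p u"
    unfolding g(2)
  proof (rule nn_integral_suminf)
    fix j
    have [measurable]: "g j \<in> borel_measurable lebesgue" by (rule represents_measurable[OF g(1)])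
    show "(\<lambda>x. ennreal (norm (g j x) powr p)) \<in> borel_measurable lebesgue" by measurable
  qed
  finally show ?thesis .
qed

section \<open>Dyadic blocks\<close>

lemma fourier_sum:
  assumes "finite I" "\<And>i. i \<in> I \<Longrightarrow> integrable lborel (f i)"
  shows "fourier (\<lambda>x. \<Sum>i\<in>I. f i x) \<xi> = (\<Sum>i\<in>I. fourier (f i) \<xi>)"
  using assms
proof (induction I)
  case empty
  then show ?case by (simp add: fourier_def)
next
  case (insert i I)
  then show ?case by (simp add: fourier_add)
qed

lemma tempered_fourier_sum:
  fixes u :: "'n::finite functional"
  assumes u: "u \<in> tempered_distributions" and I: "finite I" and s: "\<And>j. j \<in> I \<Longrightarrow> s j \<in> test_functions UNIV"
  shows "(\<Sum>j\<in>I. u (\<lambda>y. fourier (s j) (y - x))) = u (\<lambda>y. fourier (\<lambda>\<xi>. \<Sum>j\<in>I. s j \<xi>) (y - x))"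
proof -
  have "u (\<lambda>y. \<Sum>j\<in>I. fourier (s j) (y - x)) = (\<Sum>j\<in>I. u (\<lambda>y. fourier (s j) (y - x)))"
    using tempered_sum[OF u I, of "\<lambda>j y. fourier (s j) (y - x)"] schwartz_translate[OF fourier_schwartz[OF s]] by blast
  moreover have "fourier (\<lambda>\<xi>. \<Sum>j\<in>I. s j \<xi>) \<xi> = (\<Sum>j\<in>I. fourier (s j) \<xi>)" for \<xi>
    using I s by (intro fourier_sum test_functions_integrable)
  ultimately show ?thesis by simp
qed

lemma dyadic_symbol_test_function:
  assumes "cutoff \<kappa>"
  shows "dyadic_symbol \<kappa> j \<in> test_functions UNIV"
proof (cases "j = 0")
  case True
  then show ?thesis using cutoffD(1)[OF assms] by (simp add: dyadic_symbol_def[abs_def])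
next
  case False
  have 1: "(\<lambda>\<xi>. \<kappa> ((1 / 2 ^ j) *\<^sub>R \<xi>)) \<in> test_functions UNIV" "(\<lambda>\<xi>. \<kappa> ((2 * (1 / 2 ^ j)) *\<^sub>R \<xi>)) \<in> test_functions UNIV"
    by (rule cutoff_dilation[OF assms], simp)+
  then obtain r1 r2 where r: "\<And>x. \<kappa> ((1 / 2 ^ j) *\<^sub>R x) \<noteq> 0 \<Longrightarrow> norm x \<le> r1" "\<And>x. \<kappa> ((2 * (1 / 2 ^ j)) *\<^sub>R x) \<noteq> 0 \<Longrightarrow> norm x \<le> r2"
    by (auto simp: test_functions_UNIV_iff)
  have "norm x \<le> max r1 r2" if "dyadic_symbol \<kappa> j x \<noteq> 0" for x
  proof (rule ccontr)
    assume "\<not> norm x \<le> max r1 r2"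
    then have "\<kappa> ((1 / 2 ^ j) *\<^sub>R x) = 0" "\<kappa> ((2 * (1 / 2 ^ j)) *\<^sub>R x) = 0" using r[of x] by fastforce+
    then show False using that False by (simp add: dyadic_symbol_def)
  qed
  moreover have "smooth (dyadic_symbol \<kappa> j)"
    using False smooth_diff[OF test_functions_smooth[OF 1(1)] test_functions_smooth[OF 1(2)]] by (simp add: dyadic_symbol_def[abs_def])
  ultimately show ?thesis unfolding test_functions_UNIV_iff by blast
qed

lemma dyadic_symbol_sum: "(\<Sum>j<Suc J. dyadic_symbol \<kappa> j \<xi>) = \<kappa> ((1 / 2 ^ J) *\<^sub>R \<xi>)"
  by (induction J) (auto simp: dyadic_symbol_def)

text \<open>The partial sums telescope to one dilated cutoff and hence form an approximate
  identity.\<close>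

lemma dyadic_limit:
  fixes u :: "'n::finite functional" and D \<kappa> :: "real ^ 'n \<Rightarrow> complex"
  assumes u: "u \<in> tempered_distributions" and D: "represents D u" "D \<in> borel_measurable borel" "isCont D x"
    and \<kappa>: "cutoff \<kappa>"
  shows "(\<lambda>J. \<Sum>j<J. u (\<lambda>y. fourier (dyadic_symbol \<kappa> j) (y - x))) \<longlonglongrightarrow> D x"
proof -
  have "(\<Sum>j<Suc J. u (\<lambda>y. fourier (dyadic_symbol \<kappa> j) (y - x))) = u (\<lambda>y. fourier (\<lambda>\<xi>. \<kappa> ((1 / 2 ^ J) *\<^sub>R \<xi>)) (y - x))" for J
    unfolding dyadic_symbol_sum[symmetric]
    by (rule tempered_fourier_sum[OF u _ dyadic_symbol_test_function[OF \<kappa>]]) simp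
  then have "(\<lambda>J. \<Sum>j<Suc J. u (\<lambda>y. fourier (dyadic_symbol \<kappa> j) (y - x))) \<longlonglongrightarrow> D x"
    using tempered_low_frequency[OF u D \<kappa>] by simp
  then show ?thesis by (rule LIMSEQ_imp_Suc)
qed

section \<open>Growth estimates and Bernstein's inequality\<close>

lemma norm_integral_le_AE:
  fixes f :: "'a \<Rightarrow> 'b::{banach, second_countable_topology}"
  assumes g: "integrable M g" and f: "f \<in> borel_measurable M" and le: "AE x in M. norm (f x) \<le> g x"
  shows "norm (LINT x|M. f x) \<le> (LINT x|M. g x)"
proof -
  have "integrable M f"
    by (rule Bochner_Integration.integrable_bound[OF g f]) (use le in \<open>eventually_elim, auto\<close>)
  then have "(LINT x|M. norm (f x)) \<le> (LINT x|M. g x)" by (intro integral_mono_AE g le integrable_norm)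
  then show ?thesis using integral_norm_bound[of M f] by linarith
qed

lemma one_plus_norm_add_le: "1 + norm (x + y) \<le> (1 + norm x) * (1 + norm (y::'a::real_normed_vector))"
  using norm_triangle_ineq[of x y] mult_nonneg_nonneg[OF norm_ge_zero[of x] norm_ge_zero[of y]]
  unfolding distrib_left distrib_right by linarith

lemma one_plus_norm_power_le:
  fixes x y :: "'a::real_normed_vector"
  shows "(1 + norm x) ^ N \<le> (1 + norm y) ^ N * (1 + norm (x - y)) ^ N"
  using power_mono[OF one_plus_norm_add_le[of y "x - y"], of N] by (simp add: power_mult_distrib)

text \<open>Translating a kernel by \<open>x\<close> costs a factor \<open>(1 + |x|)^N\<close> with
  \<open>N\<close> the order of \<open>u\<close>. That one exponent serves all kernels makes the
  constant in Bernstein's inequality independent of the block.\<close>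

lemma tempered_growth:
  fixes u :: "'n::finite functional"
  assumes u: "u \<in> tempered_distributions"
  obtains N where "\<And>K. K \<in> schwartz \<Longrightarrow> \<exists>C. \<forall>x. norm (u (\<lambda>y. K (y - x))) \<le> C * (1 + norm x) ^ N"
proof -
  obtain N :: nat where N: "\<And>f B. f \<in> schwartz \<Longrightarrow>
    (\<And>is x. length is \<le> N \<Longrightarrow> (1 + norm x) ^ N * cmod (partial_deriv is f x) \<le> B) \<Longrightarrow> cmod (u f) \<le> real N * B"
    using tempered_order[OF u] by blast
  have "\<exists>C. \<forall>x. norm (u (\<lambda>y. K (y - x))) \<le> C * (1 + norm x) ^ N" if K: "K \<in> schwartz" for K
  proof -
    have "\<forall>is. \<exists>C. C \<ge> 0 \<and> (\<forall>x. (1 + norm x) ^ N * norm (partial_deriv is K x) \<le> C)" using schwartz_bound[OF K] by metis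
    then obtain C where C: "\<And>is. C is \<ge> 0" "\<And>is x. (1 + norm x) ^ N * norm (partial_deriv is K x) \<le> C is" by metis
    \<comment> \<open>Only finitely many mixed derivatives of order at most \<open>N\<close> occur,
      so their bounds can be added.\<close>
    define S where "S = {is :: 'n list. set is \<subseteq> UNIV \<and> length is \<le> N}"
    have S: "finite S" unfolding S_def by (rule finite_lists_length_le) simp
    have "norm (u (\<lambda>y. K (y - x))) \<le> (real N * sum C S) * (1 + norm x) ^ N" for x
    proof -
      have "norm (u (\<lambda>y. K (y - x))) \<le> real N * (sum C S * (1 + norm x) ^ N)"
      proof (rule N[OF schwartz_translate[OF K]])
        fix "is" :: "'n list" and y assume l: "length is \<le> N"
        have "(1 + norm y) ^ N * norm (partial_deriv is (\<lambda>y. K (y - x)) y) \<le> ((1 + norm x) ^ N * (1 + norm (y - x)) ^ N) * norm (partial_deriv is K (y - x))"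
          unfolding partial_deriv_translate[OF schwartz_smooth[OF K]] by (intro mult_right_mono one_plus_norm_power_le) auto
        also have "\<dots> = (1 + norm x) ^ N * ((1 + norm (y - x)) ^ N * norm (partial_deriv is K (y - x)))" by (simp add: mult.assoc)
        also have "\<dots> \<le> (1 + norm x) ^ N * C is" by (intro mult_left_mono C) auto
        also have "\<dots> \<le> (1 + norm x) ^ N * sum C S"
          using l C(1) S by (intro mult_left_mono member_le_sum) (auto simp: S_def)
        finally show "(1 + norm y) ^ N * norm (partial_deriv is (\<lambda>y. K (y - x)) y) \<le> sum C S * (1 + norm x) ^ N" by (simp add: mult.commute)
      qed
      then show ?thesis by (simp add: mult.assoc)
    qed
    then show ?thesis by blast
  qed
  then show ?thesis using that by blast
qed

lemma schwartz_weighted_integrable: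
  fixes \<theta> :: "real ^ 'n::finite \<Rightarrow> complex"
  assumes "\<theta> \<in> schwartz"
  shows "integrable lborel (\<lambda>y. (1 + norm y) ^ N * norm (\<theta> y))"
proof -
  obtain C where C: "\<And>x. (1 + norm x) ^ (DIM(real^'n) + 2 + N) * norm (partial_deriv [] \<theta> x) \<le> C" using schwartz_bound[OF assms] by metis
  have [measurable]: "\<theta> \<in> borel_measurable borel" by (rule schwartz_measurable[OF assms])
  show ?thesis
  proof (rule integrable_decay)
    show "(\<lambda>y. (1 + norm y) ^ N * norm (\<theta> y)) \<in> borel_measurable borel" by measurable
    fix x
    have "norm ((1 + norm x) ^ N * norm (\<theta> x)) = (1 + norm x) ^ N * norm (\<theta> x)"
      by (simp add: abs_mult)
    then show "(1 + norm x) ^ (DIM(real^'n) + 2) * norm ((1 + norm x) ^ N * norm (\<theta> x)) \<le> C"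
      using C[of x] by (simp only: power_add mult.assoc partial_deriv.simps(1))
  qed
qed

text \<open>Derivatives of the convolution fall on the fixed Schwartz kernel, so convergence of
  \<open>\<theta>k\<close> in all weighted \<open>L^1\<close> norms, without any control of its
  derivatives, gives convergence in every Schwartz seminorm.\<close>

lemma tempered_conv_fun_tendsto:
  fixes u :: "'n::finite functional" and \<theta> :: "real ^ 'n \<Rightarrow> complex"
  assumes u: "u \<in> tempered_distributions" and m: "m \<in> test_functions UNIV"
    and \<theta>k: "\<And>k. integrable lborel (\<theta>k k)" "\<And>k. smooth (inv_fourier (\<theta>k k))"
    and \<theta>: "integrable lborel \<theta>" "smooth (inv_fourier \<theta>)"
    and int: "\<And>N k. integrable lborel (\<lambda>z. (1 + norm z) ^ N * norm (\<theta>k k z - \<theta> z))"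
    and lim: "\<And>N. (\<lambda>k. LINT z|lborel. (1 + norm z) ^ N * norm (\<theta>k k z - \<theta> z)) \<longlonglongrightarrow> 0"
  shows "(\<lambda>k. u (conv_fun (fourier m) (\<theta>k k))) \<longlonglongrightarrow> u (conv_fun (fourier m) \<theta>)"
proof (rule tempered_tendsto[OF u convolution_schwartz[OF m \<theta>k] convolution_schwartz[OF m \<theta>]])
  fix N "is" and e :: real assume e: "e > 0"
  define L where "L = partial_deriv is (fourier m)"
  have L: "L \<in> schwartz" unfolding L_def by (rule schwartz_partial_deriv[OF fourier_schwartz[OF m]])
  have Lm [measurable]: "L \<in> borel_measurable borel" by (rule schwartz_measurable[OF L])
  obtain C where "\<And>x. (1 + norm x) ^ N * norm (partial_deriv [] L x) \<le> C" and C0: "C \<ge> 0" using schwartz_bound[OF L] by blast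
  then have C: "(1 + norm x) ^ N * norm (L x) \<le> C" for x by simp
  obtain B where "\<And>x. (1 + norm x) ^ 0 * norm (partial_deriv [] L x) \<le> B" using schwartz_bound[OF L] by metis
  then have B: "norm (L x) \<le> B" for x by simp
  have i: "integrable lborel (\<lambda>z. L (y - z) * h z)" if h: "integrable lborel h" for h y
  proof (rule Bochner_Integration.integrable_bound)
    show "integrable lborel (\<lambda>z. of_real B * h z)" using h by simp
    have [measurable]: "h \<in> borel_measurable borel" using borel_measurable_integrable[OF h] by simp
    show "(\<lambda>z. L (y - z) * h z) \<in> borel_measurable lborel" by measurable
    show "AE z in lborel. norm (L (y - z) * h z) \<le> norm (of_real B * h z)"
      using B by (intro AE_I2) (auto simp: norm_mult intro!: mult_right_mono order_trans[OF B abs_ge_self])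
  qed
  have est: "(1 + norm y) ^ N * norm (partial_deriv is (conv_fun (fourier m) (\<theta>k k)) y - partial_deriv is (conv_fun (fourier m) \<theta>) y)
    \<le> C * (LINT z|lborel. (1 + norm z) ^ N * norm (\<theta>k k z - \<theta> z))" for k y
  proof -
    have "partial_deriv is (conv_fun (fourier m) (\<theta>k k)) y - partial_deriv is (conv_fun (fourier m) \<theta>) y
      = (LINT z|lborel. L (y - z) * (\<theta>k k z - \<theta> z))"
      unfolding partial_deriv_convolution[OF m \<theta>k] partial_deriv_convolution[OF m \<theta>] L_def[symmetric] conv_fun_def
      using i[OF \<theta>k(1)] i[OF \<theta>(1)] by (simp add: right_diff_distrib)
    then have "(1 + norm y) ^ N * norm (partial_deriv is (conv_fun (fourier m) (\<theta>k k)) y - partial_deriv is (conv_fun (fourier m) \<theta>) y)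
      = norm (LINT z|lborel. of_real ((1 + norm y) ^ N) * (L (y - z) * (\<theta>k k z - \<theta> z)))"
      by (simp add: norm_mult norm_power abs_of_nonneg del: of_real_power of_real_add)
    also have "\<dots> \<le> (LINT z|lborel. C * ((1 + norm z) ^ N * norm (\<theta>k k z - \<theta> z)))"
    proof (rule norm_integral_le)
      show "integrable lborel (\<lambda>z. C * ((1 + norm z) ^ N * norm (\<theta>k k z - \<theta> z)))" using int by simp
      fix z
      have "norm (of_real ((1 + norm y) ^ N) * (L (y - z) * (\<theta>k k z - \<theta> z))) = (1 + norm y) ^ N * norm (L (y - z)) * norm (\<theta>k k z - \<theta> z)"
        by (simp add: norm_mult norm_power abs_of_nonneg del: of_real_power of_real_add)
      also have "\<dots> \<le> ((1 + norm z) ^ N * (1 + norm (y - z)) ^ N) * norm (L (y - z)) * norm (\<theta>k k z - \<theta> z)"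
        by (intro mult_right_mono one_plus_norm_power_le) auto
      also have "\<dots> = ((1 + norm (y - z)) ^ N * norm (L (y - z))) * ((1 + norm z) ^ N * norm (\<theta>k k z - \<theta> z))" by (simp add: mult_ac)
      also have "\<dots> \<le> C * ((1 + norm z) ^ N * norm (\<theta>k k z - \<theta> z))" by (intro mult_right_mono C) auto
      finally show "norm (of_real ((1 + norm y) ^ N) * (L (y - z) * (\<theta>k k z - \<theta> z))) \<le> C * ((1 + norm z) ^ N * norm (\<theta>k k z - \<theta> z))" .
    qed
    finally show ?thesis by simp
  qed
  have "(\<lambda>k. C * (LINT z|lborel. (1 + norm z) ^ N * norm (\<theta>k k z - \<theta> z))) \<longlonglongrightarrow> C * 0" by (intro tendsto_intros lim)
  then have "eventually (\<lambda>k. C * (LINT z|lborel. (1 + norm z) ^ N * norm (\<theta>k k z - \<theta> z)) < e) sequentially"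
    using e by (intro order_tendstoD(2)) auto
  then show "\<forall>\<^sub>F k in sequentially. \<forall>y. (1 + norm y) ^ N * norm (partial_deriv is (conv_fun (fourier m) (\<theta>k k)) y - partial_deriv is (conv_fun (fourier m) \<theta>) y) \<le> e"
  proof eventually_elim
    case (elim k)
    show ?case
    proof
      fix y
      show "(1 + norm y) ^ N * norm (partial_deriv is (conv_fun (fourier m) (\<theta>k k)) y - partial_deriv is (conv_fun (fourier m) \<theta>) y) \<le> e"
        using est[of y k] elim by linarith
    qed
  qed
qed

lemma cutoff_dilation_tendsto:
  assumes "cutoff \<kappa>"
  shows "(\<lambda>k. \<kappa> ((1 / real (Suc k)) *\<^sub>R z)) \<longlonglongrightarrow> 1"
proof (rule tendsto_eventually)
  obtain K :: nat where K: "norm z \<le> real K" using real_arch_simple by blast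
  show "\<forall>\<^sub>F k in sequentially. \<kappa> ((1 / real (Suc k)) *\<^sub>R z) = 1"
    unfolding eventually_sequentially
  proof (intro exI[of _ K] allI impI)
    fix k assume "k \<ge> K"
    then have "norm ((1 / real (Suc k)) *\<^sub>R z) \<le> 1" using K by (simp add: field_simps)
    then show "\<kappa> ((1 / real (Suc k)) *\<^sub>R z) = 1" by (rule cutoffD(2)[OF assms])
  qed
qed

lemma inv_fourier_translated_fourier:
  fixes l :: "real ^ 'n::finite \<Rightarrow> complex"
  assumes l: "l \<in> test_functions UNIV"
  shows "inv_fourier (\<lambda>y. fourier l (y - x)) = (\<lambda>\<xi>. l \<xi> * character x \<xi>)"
proof
  fix \<xi>
  have [measurable]: "fourier l \<in> borel_measurable borel" by (rule schwartz_measurable[OF fourier_schwartz[OF l]])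
  have "inv_fourier (\<lambda>y. fourier l (y - x)) \<xi> = (LINT y|lborel. fourier l (y - x) * character \<xi> y)"
    by (rule inv_fourier_eq) measurable
  also have "\<dots> = (LINT y|lborel. fourier l (y + (-x)) * character \<xi> (y + (-x)) * character \<xi> x)"
  proof (intro Bochner_Integration.integral_cong refl)
    fix y
    have "character \<xi> y = character \<xi> (y + (-x)) * character \<xi> x"
      using character_add[of "y + (-x)" x \<xi>] by (simp only: character_commute[of _ \<xi>]) simp
    then show "fourier l (y - x) * character \<xi> y = fourier l (y + (-x)) * character \<xi> (y + (-x)) * character \<xi> x" by simp
  qed
  also have "\<dots> = (LINT y|lborel. fourier l y * character \<xi> y * character \<xi> x)"
    by (rule integral_translate) measurable
  also have "\<dots> = inv_fourier (fourier l) \<xi> * character \<xi> x"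
    by (subst inv_fourier_eq) auto
  finally show "inv_fourier (\<lambda>y. fourier l (y - x)) \<xi> = l \<xi> * character x \<xi>"
    by (simp add: fourier_inversion[OF l] character_commute[of \<xi>])
qed

text \<open>Extends the action of \<open>g\<close> from test functions to the Schwartz function
  \<open>fourier l (y - x)\<close> by inserting cutoffs. The dominating function comes from
  \<open>u\<close>: almost everywhere \<open>g\<close> is the value of \<open>u\<close> on a
  translated kernel, hence of polynomial growth. For \<open>m * l = m\<close> the result is a
  reproducing formula for the block.\<close>

lemma represents_convolution:
  fixes u :: "'n::finite functional" and m l g \<rho> \<kappa> :: "real ^ 'n \<Rightarrow> complex"
  assumes u: "u \<in> tempered_distributions" and m: "m \<in> test_functions UNIV" and l: "l \<in> test_functions UNIV"
    and g: "represents g (fourier_multiplier m u)" and \<rho>: "mollifier \<rho>" and \<kappa>: "cutoff \<kappa>"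
  shows "(LINT y|lebesgue. g y * fourier l (y - x)) = u (\<lambda>z. fourier (\<lambda>\<xi>. m \<xi> * l \<xi>) (z - x))"
proof -
  define \<theta> where "\<theta> y = fourier l (y - x)" for y
  have \<theta>: "\<theta> \<in> schwartz" unfolding \<theta>_def by (rule schwartz_translate[OF fourier_schwartz[OF l]])
  have \<theta>m [measurable]: "\<theta> \<in> borel_measurable borel" by (rule schwartz_measurable[OF \<theta>])
  have inv: "inv_fourier \<theta> = (\<lambda>\<xi>. l \<xi> * character x \<xi>)" unfolding \<theta>_def by (rule inv_fourier_translated_fourier[OF l])
  have sinv: "smooth (inv_fourier \<theta>)" unfolding inv by (intro smooth_mult smooth_character test_functions_smooth[OF l])
  define \<theta>k where "\<theta>k k y = \<theta> y * \<kappa> ((1 / real (Suc k)) *\<^sub>R y)" for k y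
  have \<theta>k: "\<theta>k k \<in> test_functions UNIV" for k
    unfolding \<theta>k_def by (rule test_functions_mult(2)[OF cutoff_dilation[OF \<kappa>] schwartz_smooth[OF \<theta>]]) simp
  have \<kappa>m [measurable]: "\<kappa> \<in> borel_measurable borel" by (rule smooth_measurable[OF test_functions_smooth[OF cutoffD(1)[OF \<kappa>]]])
  obtain B where B: "\<And>x. norm (\<kappa> x) \<le> B" "B \<ge> 0" using test_functions_bounded[OF cutoffD(1)[OF \<kappa>]] by blast
  have diff: "norm (\<theta>k k z - \<theta> z) = norm (\<theta> z) * norm (\<kappa> ((1 / real (Suc k)) *\<^sub>R z) - 1)" for k z
    unfolding \<theta>k_def norm_mult[symmetric] by (simp add: algebra_simps)
  have diff_le: "norm (\<theta>k k z - \<theta> z) \<le> norm (\<theta> z) * (B + 1)" for k z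
    unfolding diff using norm_triangle_ineq4[of "\<kappa> ((1 / real (Suc k)) *\<^sub>R z)" 1] B(1)[of "(1 / real (Suc k)) *\<^sub>R z"]
    by (intro mult_left_mono) auto
  have wi: "integrable lborel (\<lambda>z. (B + 1) * ((1 + norm z) ^ N * norm (\<theta> z)))" for N
    using schwartz_weighted_integrable[OF \<theta>] by simp
  have bound: "norm ((1 + norm z) ^ N * norm (\<theta>k k z - \<theta> z)) \<le> (B + 1) * ((1 + norm z) ^ N * norm (\<theta> z))" for N k z
  proof -
    have "(1 + norm z) ^ N * norm (\<theta>k k z - \<theta> z) \<le> (1 + norm z) ^ N * (norm (\<theta> z) * (B + 1))"
      by (intro mult_left_mono diff_le) auto
    then show ?thesis by (simp add: abs_mult mult_ac)
  qed
  have meas: "(\<lambda>z. (1 + norm z) ^ N * norm (\<theta>k k z - \<theta> z)) \<in> borel_measurable lborel" for N k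
    unfolding \<theta>k_def by measurable
  have "(\<lambda>k. u (conv_fun (fourier m) (\<theta>k k))) \<longlonglongrightarrow> u (conv_fun (fourier m) \<theta>)"
  proof (rule tempered_conv_fun_tendsto[OF u m test_functions_integrable[OF \<theta>k] smooth_inv_fourier[OF \<theta>k] schwartz_integrable[OF \<theta>] sinv])
    fix N
    show "integrable lborel (\<lambda>z. (1 + norm z) ^ N * norm (\<theta>k k z - \<theta> z))" for k
      by (rule Bochner_Integration.integrable_bound[OF wi meas]) (use bound B in \<open>auto intro!: AE_I2\<close>)
    have "(\<lambda>k. LINT z|lborel. (1 + norm z) ^ N * norm (\<theta>k k z - \<theta> z)) \<longlonglongrightarrow> (LINT z|(lborel :: (real^'n) measure). (0::real))"
    proof (rule integral_dominated_convergence[where w = "\<lambda>z. (B + 1) * ((1 + norm z) ^ N * norm (\<theta> z))"])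
      show "(\<lambda>z. (1 + norm z) ^ N * norm (\<theta>k k z - \<theta> z)) \<in> borel_measurable lborel" for k by (rule meas)
      show "integrable lborel (\<lambda>z. (B + 1) * ((1 + norm z) ^ N * norm (\<theta> z)))" by (rule wi)
      show "AE z in lborel. norm ((1 + norm z) ^ N * norm (\<theta>k k z - \<theta> z)) \<le> (B + 1) * ((1 + norm z) ^ N * norm (\<theta> z))" for k
        by (intro AE_I2 bound)
      show "AE z in lborel. (\<lambda>k. (1 + norm z) ^ N * norm (\<theta>k k z - \<theta> z)) \<longlonglongrightarrow> 0"
      proof (rule AE_I2)
        fix z
        have "(\<lambda>k. (1 + norm z) ^ N * (norm (\<theta> z) * norm (\<kappa> ((1 / real (Suc k)) *\<^sub>R z) - 1))) \<longlonglongrightarrow> (1 + norm z) ^ N * (norm (\<theta> z) * norm (1 - 1 :: complex))"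
          by (intro tendsto_intros cutoff_dilation_tendsto[OF \<kappa>])
        then show "(\<lambda>k. (1 + norm z) ^ N * norm (\<theta>k k z - \<theta> z)) \<longlonglongrightarrow> 0" unfolding diff by simp
      qed
    qed simp
    then show "(\<lambda>k. LINT z|lborel. (1 + norm z) ^ N * norm (\<theta>k k z - \<theta> z)) \<longlonglongrightarrow> 0" by simp
  qed
  moreover have "u (conv_fun (fourier m) (\<theta>k k)) = (LINT y|lebesgue. g y * \<theta>k k y)" for k
  proof -
    have "fourier_multiplier m u (\<theta>k k) = (LINT y|lebesgue. g y * \<theta>k k y)"
      using g \<theta>k[of k] unfolding represents_def dist_of_fun_def by blast
    then show ?thesis using fourier_multiplier_eq[OF m \<theta>k] by metis
  qed
  moreover have "(\<lambda>k. LINT y|lebesgue. g y * \<theta>k k y) \<longlonglongrightarrow> (LINT y|lebesgue. g y * \<theta> y)"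
  proof -
    obtain N where N: "\<And>K. K \<in> schwartz \<Longrightarrow> \<exists>C. \<forall>x. norm (u (\<lambda>y. K (y - x))) \<le> C * (1 + norm x) ^ N"
      using tempered_growth[OF u] by blast
    obtain C where C: "\<And>x. norm (u (\<lambda>y. fourier m (y - x))) \<le> C * (1 + norm x) ^ N" using N[OF fourier_schwartz[OF m]] by blast
    have gC: "AE y in lebesgue. norm (g y) \<le> C * (1 + norm y) ^ N"
      using represents_fourier_multiplier[OF u m \<rho> g] by eventually_elim (simp add: C)
    have gm [measurable]: "g \<in> borel_measurable lebesgue" by (rule represents_measurable[OF g])
    have \<theta>l [measurable]: "\<theta> \<in> borel_measurable lebesgue" "\<theta>k k \<in> borel_measurable lebesgue" for k
      by (intro borel_measurable_lebesgueI \<theta>m smooth_measurable test_functions_smooth[OF \<theta>k])+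
    show ?thesis
    proof (rule integral_dominated_convergence[where w = "\<lambda>y. (C * B) * ((1 + norm y) ^ N * norm (\<theta> y))"])
      have "integrable lborel (\<lambda>y. (C * B) * ((1 + norm y) ^ N * norm (\<theta> y)))"
        by (intro integrable_mult_right schwartz_weighted_integrable[OF \<theta>])
      then show "integrable lebesgue (\<lambda>y. (C * B) * ((1 + norm y) ^ N * norm (\<theta> y)))"
        by (subst integrable_completion) auto
      show "AE y in lebesgue. norm (g y * \<theta>k k y) \<le> (C * B) * ((1 + norm y) ^ N * norm (\<theta> y))" for k
        using gC
      proof eventually_elim
        case (elim y)
        have "norm (g y * \<theta>k k y) \<le> (C * (1 + norm y) ^ N) * (norm (\<theta> y) * B)"
          unfolding norm_mult \<theta>k_def using elim B order_trans[OF norm_ge_zero elim]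
          by (intro mult_mono mult_left_mono) auto
        then show ?case by (simp add: mult_ac)
      qed
      show "AE y in lebesgue. (\<lambda>k. g y * \<theta>k k y) \<longlonglongrightarrow> g y * \<theta> y"
      proof (rule AE_I2)
        fix y
        have "(\<lambda>k. g y * (\<theta> y * \<kappa> ((1 / real (Suc k)) *\<^sub>R y))) \<longlonglongrightarrow> g y * (\<theta> y * 1)"
          by (intro tendsto_intros cutoff_dilation_tendsto[OF \<kappa>])
        then show "(\<lambda>k. g y * \<theta>k k y) \<longlonglongrightarrow> g y * \<theta> y" by (simp add: \<theta>k_def)
      qed
    qed measurable
  qed
  ultimately have "u (conv_fun (fourier m) \<theta>) = (LINT y|lebesgue. g y * \<theta> y)"
    using LIMSEQ_unique by simp
  moreover have "conv_fun (fourier m) \<theta> = (\<lambda>z. fourier (\<lambda>\<xi>. m \<xi> * l \<xi>) (z - x))"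
  proof
    fix z
    have mm: "(\<lambda>\<xi>. m \<xi> * l \<xi>) \<in> borel_measurable borel"
      by (intro smooth_measurable smooth_mult test_functions_smooth[OF m] test_functions_smooth[OF l])
    show "conv_fun (fourier m) \<theta> z = fourier (\<lambda>\<xi>. m \<xi> * l \<xi>) (z - x)"
      unfolding convolution_fourier[OF m schwartz_integrable[OF \<theta>]] inv using fourier_mult_character[OF mm, of x z] by (simp add: mult.assoc)
  qed
  ultimately show ?thesis by (simp add: \<theta>_def)
qed

text \<open>In the reproducing formula \<open>|v|\<close> is split as
  \<open>|v|^p |v|^(1-p)\<close>, and the second factor is bounded by Peetre's maximal function with
  value \<open>M\<close> at \<open>x\<close>. This gives \<open>M \<le> A M^(1-p) I\<close> with
  \<open>I\<close> the integral of \<open>|g|^p\<close>, and dividing by \<open>M^(1-p)\<close>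
  bounds \<open>M^p\<close>. The division is legitimate since polynomial growth of \<open>v\<close>
  makes \<open>M\<close> finite.\<close>

lemma bernstein_pointwise:
  fixes v g L :: "real ^ 'n::finite \<Rightarrow> complex"
  assumes p: "0 < p" "p < 1" and v: "\<And>z. v z = (LINT y|lebesgue. g y * L (y - z))"
    and g: "g \<in> borel_measurable lebesgue" "AE y in lebesgue. g y = v y" and L: "L \<in> borel_measurable borel"
    and C: "\<And>y. norm (v y) \<le> C * (1 + norm y) ^ N" and A: "\<And>w. (1 + norm w) ^ N * norm (L w) \<le> A"
    and fin: "(\<integral>\<^sup>+y. ennreal (norm (g y) powr p) \<partial>lebesgue) < \<infinity>"
  shows "norm (v x) powr p \<le> A * enn2real (\<integral>\<^sup>+y. ennreal (norm (g y) powr p) \<partial>lebesgue)"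
proof -
  note [measurable] = g(1)
  have Lx [measurable]: "(\<lambda>y. L (y - z)) \<in> borel_measurable lebesgue" for z
    by (rule borel_measurable_lebesgueI) (use L in measurable)
  define I where "I = (LINT y|lebesgue. norm (g y) powr p)"
  have int: "integrable lebesgue (\<lambda>y. norm (g y) powr p)"
    unfolding integrable_iff_bounded using fin by simp
  have I: "enn2real (\<integral>\<^sup>+y. ennreal (norm (g y) powr p) \<partial>lebesgue) = I"
    unfolding I_def by (subst integral_eq_nn_integral) auto
  have "0 \<le> C * (1 + norm (0::real^'n)) ^ N" using C[of 0] norm_ge_zero order_trans by blast
  then have C0: "C \<ge> 0" by simp
  have "0 \<le> (1 + norm (0::real^'n)) ^ N * norm (L 0)" by simp
  then have A0: "A \<ge> 0" using A[of 0] by linarith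
  \<comment> \<open>The supremum of \<open>q\<close> is Peetre's maximal function of
    \<open>v\<close> at \<open>x\<close>; the exponent \<open>N\<close> matches the growth of
    \<open>v\<close>.\<close>
  define q where "q y = norm (v y) / (1 + norm (y - x)) ^ N" for y
  have pos: "(1 + norm (a::real^'n)) ^ N \<ge> 1" for a by (rule one_le_power) simp
  have pos0: "(1 + norm (a::real^'n)) ^ N > 0" for a using pos[of a] by linarith
  have qb: "q y \<le> C * (1 + norm x) ^ N" for y
  proof -
    have "norm (v y) \<le> C * ((1 + norm x) ^ N * (1 + norm (y - x)) ^ N)"
      using C[of y] mult_left_mono[OF one_plus_norm_power_le[of y N x] C0] by linarith
    then show ?thesis unfolding q_def by (simp only: pos_divide_le_eq[OF pos0] mult.assoc)
  qed
  then have bdd: "bdd_above (range q)" by (intro bdd_aboveI2)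
  define M where "M = (SUP y. q y)"
  have qM: "q y \<le> M" for y unfolding M_def by (intro cSUP_upper bdd) simp
  have M0: "M \<ge> 0" using qM[of x] by (simp add: q_def) (meson norm_ge_zero order_trans)
  have vM: "norm (v y) \<le> M * (1 + norm (y - x)) ^ N" for y
    using qM[of y] unfolding q_def by (simp only: pos_divide_le_eq[OF pos0])
  have key: "norm (v y) * norm (L (y - z)) \<le> (M powr (1 - p) * A * (1 + norm (z - x)) ^ N) * norm (v y) powr p" for y z
  proof -
    define t where "t = norm (v y)"
    define w where "w = (1 + norm (y - x)) ^ N"
    have w: "w \<ge> 1" unfolding w_def by (rule pos)
    have "t = t powr p * t powr (1 - p)"
      by (cases "t = 0") (auto simp: t_def powr_add[symmetric])
    also have "\<dots> \<le> t powr p * (M * w) powr (1 - p)"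
      using vM[of y] p by (intro mult_left_mono powr_mono2) (auto simp: t_def w_def)
    also have "\<dots> \<le> t powr p * (M powr (1 - p) * w)"
    proof -
      have "w powr (1 - p) \<le> w powr 1" using w p by (intro powr_mono) auto
      then have "w powr (1 - p) \<le> w" using w by simp
      then show ?thesis using M0 w by (simp add: powr_mult mult_left_mono)
    qed
    finally have "t * norm (L (y - z)) \<le> (t powr p * (M powr (1 - p) * w)) * norm (L (y - z))" by (intro mult_right_mono) auto
    also have "\<dots> \<le> (t powr p * (M powr (1 - p) * ((1 + norm (z - x)) ^ N * (1 + norm (y - z)) ^ N))) * norm (L (y - z))"
    proof -
      have "w \<le> (1 + norm (z - x)) ^ N * (1 + norm (y - z)) ^ N"
        using one_plus_norm_power_le[of "y - x" N "z - x"] by (simp add: w_def)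
      then show ?thesis by (intro mult_right_mono mult_left_mono) auto
    qed
    also have "\<dots> = (t powr p * (M powr (1 - p) * (1 + norm (z - x)) ^ N)) * ((1 + norm (y - z)) ^ N * norm (L (y - z)))" by (simp add: mult_ac)
    also have "\<dots> \<le> (t powr p * (M powr (1 - p) * (1 + norm (z - x)) ^ N)) * A"
      using A[of "y - z"] by (intro mult_left_mono) auto
    finally show ?thesis unfolding t_def by (simp add: mult_ac)
  qed
  have "q z \<le> M powr (1 - p) * A * I" for z
  proof -
    have "norm (v z) \<le> (LINT y|lebesgue. (M powr (1 - p) * A * (1 + norm (z - x)) ^ N) * norm (g y) powr p)"
      unfolding v[of z]
    proof (rule norm_integral_le_AE)
      show "integrable lebesgue (\<lambda>y. (M powr (1 - p) * A * (1 + norm (z - x)) ^ N) * norm (g y) powr p)" using int by simp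
      show "(\<lambda>y. g y * L (y - z)) \<in> borel_measurable lebesgue" by measurable
      show "AE y in lebesgue. norm (g y * L (y - z)) \<le> (M powr (1 - p) * A * (1 + norm (z - x)) ^ N) * norm (g y) powr p"
        using g(2) by eventually_elim (use key in \<open>simp add: norm_mult\<close>)
    qed
    also have "\<dots> = (M powr (1 - p) * A * I) * (1 + norm (z - x)) ^ N" by (simp add: I_def)
    finally show ?thesis unfolding q_def by (simp only: pos_divide_le_eq[OF pos0])
  qed
  then have M_le: "M \<le> M powr (1 - p) * A * I" unfolding M_def by (intro cSUP_least) auto
  have "M powr p \<le> A * I"
  proof (cases "M = 0")
    case False
    then have "M > 0" using M0 by simp
    have "M powr (1 - p) * M powr p = M" using \<open>M > 0\<close> by (simp add: powr_add[symmetric])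
    then have "M powr (1 - p) * M powr p \<le> M powr (1 - p) * (A * I)" using M_le by (simp add: mult.assoc)
    then show ?thesis using \<open>M > 0\<close> by (subst (asm) mult_le_cancel_left_pos) auto
  qed (use A0 in \<open>simp add: I_def\<close>)
  moreover have "norm (v x) powr p \<le> M powr p" using vM[of x] p by (intro powr_mono2) auto
  ultimately show ?thesis unfolding I by linarith
qed

text \<open>Summability of the blocks' \<open>L\<^sup>p\<close> quasi-norms gives, by Bernstein's inequality, summability of their
  maximal functions, which is the domination needed to remove the cutoff \<open>\<kappa>(2\<^sup>-\<^sup>J \<xi>)\<close> from the partition of unity.\<close>

lemma block_limit:
  fixes u :: "'n::finite functional" and D \<rho> \<kappa> :: "real ^ 'n \<Rightarrow> complex" and s l :: "nat \<Rightarrow> real ^ 'n \<Rightarrow> complex"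
  assumes p: "0 < p" "p < 1" and u: "u \<in> tempered_distributions"
    and D: "represents D u" "D \<in> borel_measurable borel" "isCont D x"
    and \<rho>: "mollifier \<rho>" and \<kappa>: "cutoff \<kappa>"
    and s: "\<And>j. s j \<in> test_functions UNIV" and l: "\<And>j. l j \<in> test_functions UNIV" and sl: "\<And>j \<xi>. s j \<xi> * l j \<xi> = s j \<xi>"
    and A: "\<And>N. \<exists>A. \<forall>j w. (1 + norm w) ^ N * norm (fourier (l j) w) \<le> A"
    and part: "\<And>r. \<exists>I. finite I \<and> (\<forall>\<xi>. norm \<xi> \<le> r \<longrightarrow> (\<Sum>j\<in>I. s j \<xi>) = 1 \<and> (\<forall>j. j \<notin> I \<longrightarrow> s j \<xi> = 0))"
    and fin: "block_sum s p u < \<infinity>"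
  shows "(\<lambda>J. \<Sum>j<J. u (\<lambda>y. fourier (s j) (y - x))) \<longlonglongrightarrow> D x"
proof -
  obtain g where g: "\<And>j. represents (g j) (fourier_multiplier (s j) u)"
    and gs: "block_sum s p u = (\<Sum>j. \<integral>\<^sup>+x. ennreal (norm (g j x) powr p) \<partial>lebesgue)"
    using block_sum_finite[OF fin] by blast
  define v where "v j z = u (\<lambda>y. fourier (s j) (y - z))" for j z
  have gv: "AE y in lebesgue. g j y = v j y" for j unfolding v_def by (rule represents_fourier_multiplier[OF u s \<rho> g])
  have gm [measurable]: "g j \<in> borel_measurable lebesgue" for j by (rule represents_measurable[OF g])
  define a where "a j = (\<integral>\<^sup>+x. ennreal (norm (g j x) powr p) \<partial>lebesgue)" for j
  have afin: "a j < \<infinity>" for j using single_le_suminf[of a j] fin unfolding gs a_def by (rule le_less_trans)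
  have a_sum: "summable (\<lambda>j. enn2real (a j))"
  proof (rule summable_suminf_not_top)
    have "(\<Sum>j. ennreal (enn2real (a j))) = (\<Sum>j. a j)" using afin by (intro suminf_cong ennreal_enn2real) (simp add: less_top)
    then show "(\<Sum>j. ennreal (enn2real (a j))) \<noteq> \<top>" using fin unfolding gs a_def[symmetric] by simp
  qed simp
  obtain N where N: "\<And>K. K \<in> schwartz \<Longrightarrow> \<exists>C. \<forall>x. norm (u (\<lambda>y. K (y - x))) \<le> C * (1 + norm x) ^ N"
    using tempered_growth[OF u] by blast
  obtain A0 where A0: "\<And>j w. (1 + norm w) ^ N * norm (fourier (l j) w) \<le> A0" using A[of N] by blast
  have "0 \<le> (1 + norm (0::real^'n)) ^ N * norm (fourier (l 0) 0)" by simp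
  then have A00: "A0 \<ge> 0" using A0[of 0 0] by linarith
  \<comment> \<open>Bernstein's bound on the supremum of the \<open>j\<close>-th block.\<close>
  define b where "b j = (A0 * enn2real (a j)) powr (1 / p)" for j
  have vb: "norm (v j z) \<le> b j" for j z
  proof -
    obtain C where C: "\<And>x. norm (v j x) \<le> C * (1 + norm x) ^ N" unfolding v_def using N[OF fourier_schwartz[OF s]] by blast
    have rep: "v j z = (LINT y|lebesgue. g j y * fourier (l j) (y - z))" for z
      unfolding v_def represents_convolution[OF u s l g \<rho> \<kappa>] sl ..
    have "norm (v j z) powr p \<le> A0 * enn2real (a j)"
      unfolding a_def by (rule bernstein_pointwise[OF p rep gm gv schwartz_measurable[OF fourier_schwartz[OF l]] C A0])
        (use afin in \<open>simp add: a_def\<close>)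
    then have "(norm (v j z) powr p) powr (1 / p) \<le> b j" unfolding b_def using p by (intro powr_mono2) auto
    then show ?thesis using p by (simp add: powr_powr)
  qed
  have b0: "b j \<ge> 0" for j unfolding b_def by simp
  have b_sum: "summable b"
  proof (rule summable_comparison_test_ev)
    have s: "summable (\<lambda>j. A0 * enn2real (a j))" by (intro summable_mult a_sum)
    then show "summable (\<lambda>j. A0 * enn2real (a j))" .
    \<comment> \<open>The terms tend to 0, and for a term below 1 the power with exponent
      \<open>1 / p > 1\<close> is at most the term itself.\<close>
    have "eventually (\<lambda>j. A0 * enn2real (a j) < 1) sequentially"
      using summable_LIMSEQ_zero[OF s] by (rule order_tendstoD(2)) simp
    then show "\<forall>\<^sub>F j in sequentially. norm (b j) \<le> A0 * enn2real (a j)"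
    proof eventually_elim
      case (elim j)
      have "(A0 * enn2real (a j)) powr (1 / p) \<le> (A0 * enn2real (a j)) powr 1"
        using elim p A00 by (intro powr_mono') auto
      then show ?case using A00 by (simp add: b_def)
    qed
  qed
  define \<kappa>J where "\<kappa>J J \<xi> = \<kappa> ((1 / 2 ^ J) *\<^sub>R \<xi>)" for J :: nat and \<xi>
  have \<kappa>J: "\<kappa>J J \<in> test_functions UNIV" for J unfolding \<kappa>J_def by (rule cutoff_dilation[OF \<kappa>]) simp
  have \<kappa>m [measurable]: "\<kappa> \<in> borel_measurable borel" by (rule smooth_measurable[OF test_functions_smooth[OF cutoffD(1)[OF \<kappa>]]])
  \<comment> \<open>The \<open>L^1\<close> norm of the kernel of the cutoff is the same at every
    scale \<open>J\<close>, so \<open>b j * Q\<close> dominates the cut-off blocks for all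
    \<open>J\<close> at once.\<close>
  define Q where "Q = (LINT w|lborel. norm (fourier \<kappa> w))"
  have Fm [measurable]: "fourier (\<kappa>J J) \<in> borel_measurable borel" for J by (rule schwartz_measurable[OF fourier_schwartz[OF \<kappa>J]])
  have Fm0 [measurable]: "fourier \<kappa> \<in> borel_measurable borel" by (rule fourier_measurable[OF \<kappa>m])
  have Q: "(LINT y|lborel. norm (fourier (\<kappa>J J) (y - x))) = Q" for J x
  proof -
    have "(LINT y|lborel. norm (fourier (\<kappa>J J) (y - x))) = (LINT y|lborel. norm (fourier (\<kappa>J J) y))"
      using integral_translate[of "\<lambda>y. norm (fourier (\<kappa>J J) y)" "-x"] by simp
    also have "\<dots> = \<bar>1 / 2 ^ J\<bar> ^ DIM(real^'n) *\<^sub>R (LINT y|lborel. norm (fourier (\<kappa>J J) (0 + (1 / 2 ^ J) *\<^sub>R y)))"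
      by (rule integral_affine) auto
    also have "\<dots> = Q"
      unfolding \<kappa>J_def Q_def by (subst fourier_scale) (auto simp: norm_mult norm_divide norm_power)
    finally show ?thesis .
  qed
  define c where "c j J = u (\<lambda>y. fourier (\<lambda>\<xi>. s j \<xi> * \<kappa>J J \<xi>) (y - x))" for j J
  have c_bound: "norm (c j J) \<le> b j * Q" for j J
  proof -
    have il: "integrable lborel (\<lambda>y. norm (fourier (\<kappa>J J) (y - x)))"
      using schwartz_integrable[OF schwartz_translate[OF fourier_schwartz[OF \<kappa>J]]] by simp
    have "c j J = (LINT y|lebesgue. g j y * fourier (\<kappa>J J) (y - x))"
      unfolding c_def by (rule represents_convolution[OF u s \<kappa>J g \<rho> \<kappa>, symmetric])
    also have "norm \<dots> \<le> (LINT y|lebesgue. b j * norm (fourier (\<kappa>J J) (y - x)))"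
    proof (rule norm_integral_le_AE)
      have ib: "integrable lborel (\<lambda>y. b j * norm (fourier (\<kappa>J J) (y - x)))" using il by simp
      then show "integrable lebesgue (\<lambda>y. b j * norm (fourier (\<kappa>J J) (y - x)))"
        using borel_measurable_integrable[OF ib] by (simp add: integrable_completion)
      have [measurable]: "(\<lambda>y. fourier (\<kappa>J J) (y - x)) \<in> borel_measurable lebesgue" by (rule borel_measurable_lebesgueI) measurable
      show "(\<lambda>y. g j y * fourier (\<kappa>J J) (y - x)) \<in> borel_measurable lebesgue" by measurable
      show "AE y in lebesgue. norm (g j y * fourier (\<kappa>J J) (y - x)) \<le> b j * norm (fourier (\<kappa>J J) (y - x))"
        using gv[of j] by eventually_elim (simp add: norm_mult mult_right_mono vb)
    qed
    also have "\<dots> = b j * Q"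
      using Q[of J x] by (subst lebesgue_integral_eq_lborel) auto
    finally show ?thesis .
  qed
  \<comment> \<open>The cutoff equals 1 on the compact support of \<open>s j\<close> as soon as
    \<open>2^J\<close> exceeds its radius, so the sequence is eventually constant.\<close>
  have c_lim: "(\<lambda>J. c j J) \<longlonglongrightarrow> v j x" for j
  proof (rule tendsto_eventually)
    obtain r where r: "\<And>\<xi>. s j \<xi> \<noteq> 0 \<Longrightarrow> norm \<xi> \<le> r" using s[of j] by (auto simp: test_functions_UNIV_iff)
    obtain J0 :: nat where J0: "r < 2 ^ J0" using real_arch_pow[of 2 r] by auto
    show "\<forall>\<^sub>F J in sequentially. c j J = v j x"
      unfolding eventually_sequentially
    proof (intro exI[of _ J0] allI impI)
      fix J assume J: "J0 \<le> J"
      have "s j \<xi> * \<kappa>J J \<xi> = s j \<xi>" for \<xi>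
      proof (cases "s j \<xi> = 0")
        case False
        have "(2::real) ^ J0 \<le> 2 ^ J" using J by (intro power_increasing) auto
        then have "norm \<xi> \<le> 2 ^ J" using r[OF False] J0 by linarith
        then have "norm ((1 / 2 ^ J) *\<^sub>R \<xi>) \<le> 1" by simp
        then show ?thesis unfolding \<kappa>J_def using cutoffD(2)[OF \<kappa>] by simp
      qed simp
      then have "(\<lambda>\<xi>. s j \<xi> * \<kappa>J J \<xi>) = s j" by (rule ext)
      then show "c j J = v j x" unfolding c_def v_def by (simp only:)
    qed
  qed
  \<comment> \<open>On the support of the cutoff only finitely many symbols are nonzero, and they
    sum to 1; the sum over \<open>j\<close> therefore passes through \<open>u\<close> and leaves the
    cutoff alone.\<close>
  have c_sum: "(\<Sum>j. c j J) = u (\<lambda>y. fourier (\<kappa>J J) (y - x))" for J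
  proof -
    obtain r where r: "\<And>\<xi>. \<kappa>J J \<xi> \<noteq> 0 \<Longrightarrow> norm \<xi> \<le> r" using \<kappa>J[of J] by (auto simp: test_functions_UNIV_iff)
    obtain I where I: "finite I" "\<And>\<xi>. norm \<xi> \<le> r \<Longrightarrow> (\<Sum>j\<in>I. s j \<xi>) = 1" "\<And>\<xi> j. norm \<xi> \<le> r \<Longrightarrow> j \<notin> I \<Longrightarrow> s j \<xi> = 0"
      using part[of r] by blast
    have z: "c j J = 0" if "j \<notin> I" for j
    proof -
      have "(\<lambda>\<xi>. s j \<xi> * \<kappa>J J \<xi>) = (\<lambda>_. 0)" using I(3)[OF r that] by (auto simp: fun_eq_iff)
      then show ?thesis unfolding c_def by (simp add: fourier_def tempered_0[OF u])
    qed
    have "(\<Sum>j. c j J) = (\<Sum>j\<in>I. c j J)" by (rule suminf_finite[OF I(1) z])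
    also have "\<dots> = u (\<lambda>y. fourier (\<lambda>\<xi>. \<Sum>j\<in>I. s j \<xi> * \<kappa>J J \<xi>) (y - x))"
      unfolding c_def by (rule tempered_fourier_sum[OF u I(1)]) (rule test_functions_mult(1)[OF s test_functions_smooth[OF \<kappa>J]])
    also have "(\<lambda>\<xi>. \<Sum>j\<in>I. s j \<xi> * \<kappa>J J \<xi>) = \<kappa>J J"
    proof
      fix \<xi>
      show "(\<Sum>j\<in>I. s j \<xi> * \<kappa>J J \<xi>) = \<kappa>J J \<xi>"
        using I(2)[OF r, of \<xi>] by (cases "\<kappa>J J \<xi> = 0") (auto simp: sum_distrib_right[symmetric])
    qed
    finally show ?thesis .
  qed
  \<comment> \<open>Tannery's theorem interchanges the sum over \<open>j\<close> with the removal of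
    the cutoff, and yields absolute convergence of the block series.\<close>
  have T: "summable (\<lambda>j. norm (v j x)) \<and> ((\<lambda>J. \<Sum>j. c j J) \<longlonglongrightarrow> (\<Sum>j. v j x))"
  proof -
    have "eventually (\<lambda>(j, J). norm (c j J) \<le> b j * Q) (at_top \<times>\<^sub>F sequentially)"
      by (rule always_eventually) (simp add: c_bound)
    from tannerys_theorem[OF c_lim this summable_mult2[OF b_sum]] show ?thesis by simp
  qed
  have "(\<lambda>J. u (\<lambda>y. fourier (\<kappa>J J) (y - x))) \<longlonglongrightarrow> D x"
    unfolding \<kappa>J_def by (rule tempered_low_frequency[OF u D \<kappa>])
  then have "D x = (\<Sum>j. v j x)" using T LIMSEQ_unique unfolding c_sum by blast
  moreover have "(\<lambda>J. \<Sum>j<J. v j x) \<longlonglongrightarrow> (\<Sum>j. v j x)"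
    by (rule summable_LIMSEQ[OF summable_norm_cancel[OF conjunct1[OF T]]])
  ultimately show ?thesis by (simp add: v_def)
qed

section \<open>The Hausdorff operator\<close>

text \<open>\<open>\<Phi>\<close> is only Lebesgue measurable; a Borel version of it makes the
  kernel of the operator jointly measurable, as Fubini's theorem requires.\<close>

lemma completion_ex_borel_measurable_complex:
  fixes f :: "'a \<Rightarrow> complex"
  assumes "f \<in> borel_measurable (completion M)"
  obtains f' where "f' \<in> borel_measurable M" "AE x in M. f x = f' x"
proof -
  have "(\<lambda>x. Re (f x)) \<in> borel_measurable (completion M)" "(\<lambda>x. Im (f x)) \<in> borel_measurable (completion M)"
    using assms by measurable
  then obtain a b where a: "a \<in> borel_measurable M" "AE x in M. Re (f x) = a x"
    and b: "b \<in> borel_measurable M" "AE x in M. Im (f x) = b x"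
    using completion_ex_borel_measurable_real by metis
  show ?thesis
  proof (rule that)
    show "(\<lambda>x. of_real (a x) + \<i> * of_real (b x)) \<in> borel_measurable M" using a(1) b(1) by measurable
    show "AE x in M. f x = of_real (a x) + \<i> * of_real (b x)"
      using a(2) b(2) by eventually_elim (auto simp: complex_eq_iff)
  qed
qed

lemma hausdorff_nn_integral:
  fixes g :: "real ^ 'n::finite \<Rightarrow> complex"
  assumes "g \<in> borel_measurable borel" "y \<noteq> (0::real^'n)"
  shows "(\<integral>\<^sup>+x. ennreal (norm (g ((1 / norm y) *\<^sub>R x - a))) \<partial>lborel) = ennreal (norm y ^ CARD('n)) * (\<integral>\<^sup>+x. ennreal (norm (g x)) \<partial>lborel)"
proof -
  have y: "norm y > 0" using assms(2) by simp
  have "(\<integral>\<^sup>+x. ennreal (norm (g ((1 / norm y) *\<^sub>R x - a))) \<partial>lborel)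
    = ennreal (\<bar>norm y\<bar> ^ DIM(real^'n)) * (\<integral>\<^sup>+x. ennreal (norm (g ((1 / norm y) *\<^sub>R (norm y *\<^sub>R a + norm y *\<^sub>R x) - a))) \<partial>lborel)"
    using assms y by (intro nn_integral_affine) auto
  also have "(\<lambda>x. g ((1 / norm y) *\<^sub>R (norm y *\<^sub>R a + norm y *\<^sub>R x) - a)) = g"
    using y by (simp add: scaleR_add_right)
  finally show ?thesis using y by simp
qed

lemma annulus_measure:
  assumes "0 \<le> s" "s \<le> t"
  shows "measure lborel {y::real ^ 'n::finite. s \<le> norm y \<and> norm y \<le> t} = unit_ball_vol CARD('n) * (t ^ CARD('n) - s ^ CARD('n))"
proof -
  have "{y::real^'n. s \<le> norm y \<and> norm y \<le> t} = cball 0 t - ball 0 s" by auto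
  moreover have "measure lborel (cball (0::real^'n) t - ball 0 s) = measure lborel (cball (0::real^'n) t) - measure lborel (ball (0::real^'n) s)"
    using assms by (intro measure_Diff) (auto simp: emeasure_lborel_cball_finite[unfolded infinity_ennreal_def less_top[symmetric]])
  ultimately show ?thesis using assms by (simp add: content_cball content_ball algebra_simps)
qed

text \<open>The sup bound is known for \<open>a\<close> alone, the \<open>p\<close>-integral for
  \<open>a + b\<close> alone. If \<open>|a| > 2 |b|\<close>, then
  \<open>|a| \<le> 2 |a + b|\<close>, and \<open>|a| = |a|^(1-p) |a|^p\<close> combines the two;
  otherwise \<open>|a|\<close> is absorbed by \<open>2 |b|\<close>.\<close>

lemma split_powr_bound:
  fixes a b :: complex
  assumes p: "0 < p" "p < 1" and M: "norm a \<le> M"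
  shows "norm (a + b) \<le> M powr (1 - p) * 2 powr p * norm (a + b) powr p + 3 * norm b"
proof -
  have "norm a \<le> M powr (1 - p) * 2 powr p * norm (a + b) powr p + 2 * norm b"
  proof (cases "norm a \<le> 2 * norm b")
    case True
    moreover have "0 \<le> M powr (1 - p) * 2 powr p * norm (a + b) powr p" by simp
    ultimately show ?thesis by linarith
  next
    case False
    have "norm a \<le> norm (a + b) + norm b" using norm_triangle_ineq4[of "a + b" b] by simp
    then have le: "norm a \<le> 2 * norm (a + b)" using False by linarith
    have "norm a = norm a powr (1 - p) * norm a powr p"
      using False by (cases "a = 0") (auto simp: powr_add[symmetric])
    also have "\<dots> \<le> M powr (1 - p) * (2 * norm (a + b)) powr p"
      using M le p by (intro mult_mono powr_mono2) auto
    also have "\<dots> = M powr (1 - p) * 2 powr p * norm (a + b) powr p" by (simp add: powr_mult)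
    finally show ?thesis using norm_ge_zero[of b] by linarith
  qed
  then show ?thesis using norm_triangle_ineq[of a b] by linarith
qed

section \<open>The operator applied to a translated bump\<close>

text \<open>The Hausdorff operator on the translate of \<open>g\<close> by \<open>a\<close>, for a
  Borel kernel \<Psi>. With \<Psi> as an argument, the bounded and the small part of the kernel can
  be estimated separately.\<close>

definition haus :: "(real ^ 'n::finite \<Rightarrow> complex) \<Rightarrow> (real ^ 'n \<Rightarrow> complex) \<Rightarrow> real ^ 'n \<Rightarrow> real ^ 'n \<Rightarrow> complex" where
  "haus g \<Psi> a x = (LINT y|lborel. \<Psi> y * g ((1 / norm y) *\<^sub>R x - a))"

context
  fixes g \<Psi> :: "real ^ 'n::finite \<Rightarrow> complex" and a1 a2 r0 :: real
  assumes g: "g \<in> test_functions UNIV" and r0: "\<And>x. g x \<noteq> 0 \<Longrightarrow> norm x \<le> r0"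
    and \<Psi>: "integrable lborel \<Psi>" and \<Psi>0: "\<And>y. \<Psi> y \<noteq> 0 \<Longrightarrow> 0 < norm y \<and> norm y \<le> a2"
begin

lemma hausdorff_measurable [measurable]: "g \<in> borel_measurable borel" "\<Psi> \<in> borel_measurable borel"
  using smooth_measurable[OF test_functions_smooth[OF g]] borel_measurable_integrable[OF \<Psi>] by auto

text \<open>For fixed \<open>y\<close> the inner integral is \<open>|\<Psi> y|\<close> times
  \<open>|y|^n\<close> times the \<open>L^1\<close> norm of \<open>g\<close>. This finite double
  integral justifies the later exchanges of integrals.\<close>

lemma hausdorff_kernel_bound:
  "(\<integral>\<^sup>+y. \<integral>\<^sup>+x. ennreal (norm (\<Psi> y * g ((1 / norm y) *\<^sub>R x - a))) \<partial>lborel \<partial>lborel)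
    \<le> ennreal (a2 ^ CARD('n) * (LINT x|lborel. norm (g x)) * (LINT y|lborel. norm (\<Psi> y)))"
proof -
  let ?I = "LINT x|lborel. norm (g x)"
  have I: "(\<integral>\<^sup>+x. ennreal (norm (g x)) \<partial>lborel) = ennreal ?I"
    using test_functions_integrable[OF g] by (intro nn_integral_eq_integral) auto
  have "(\<integral>\<^sup>+x. ennreal (norm (\<Psi> y * g ((1 / norm y) *\<^sub>R x - a))) \<partial>lborel) \<le> ennreal (a2 ^ CARD('n) * ?I) * ennreal (norm (\<Psi> y))" for y
  proof (cases "\<Psi> y = 0")
    case False
    have y: "y \<noteq> 0" "norm y \<le> a2" using \<Psi>0[OF False] by auto
    have "(\<integral>\<^sup>+x. ennreal (norm (\<Psi> y * g ((1 / norm y) *\<^sub>R x - a))) \<partial>lborel) = ennreal (norm (\<Psi> y)) * (\<integral>\<^sup>+x. ennreal (norm (g ((1 / norm y) *\<^sub>R x - a))) \<partial>lborel)"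
      unfolding norm_mult by (subst ennreal_mult') (auto intro!: nn_integral_cmult)
    also have "\<dots> = ennreal (norm (\<Psi> y)) * (ennreal (norm y ^ CARD('n)) * ennreal ?I)"
      unfolding hausdorff_nn_integral[OF hausdorff_measurable(1) y(1)] I ..
    also have "\<dots> \<le> ennreal (norm (\<Psi> y)) * (ennreal (a2 ^ CARD('n)) * ennreal ?I)"
      using y by (intro mult_left_mono mult_right_mono ennreal_leI power_mono) auto
    also have "\<dots> = ennreal (a2 ^ CARD('n) * ?I) * ennreal (norm (\<Psi> y))"
      using y order_trans[OF norm_ge_zero y(2)] by (subst ennreal_mult) (auto simp: mult_ac)
    finally show ?thesis .
  qed simp
  then have "(\<integral>\<^sup>+y. \<integral>\<^sup>+x. ennreal (norm (\<Psi> y * g ((1 / norm y) *\<^sub>R x - a))) \<partial>lborel \<partial>lborel)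
    \<le> (\<integral>\<^sup>+y. ennreal (a2 ^ CARD('n) * ?I) * ennreal (norm (\<Psi> y)) \<partial>lborel)"
    by (intro nn_integral_mono)
  also have "\<dots> = ennreal (a2 ^ CARD('n) * ?I) * (\<integral>\<^sup>+y. ennreal (norm (\<Psi> y)) \<partial>lborel)"
    by (rule nn_integral_cmult) measurable
  also have "(\<integral>\<^sup>+y. ennreal (norm (\<Psi> y)) \<partial>lborel) = ennreal (LINT y|lborel. norm (\<Psi> y))"
    using \<Psi> by (intro nn_integral_eq_integral) auto
  also have "ennreal (a2 ^ CARD('n) * ?I) * \<dots> = ennreal (a2 ^ CARD('n) * ?I * (LINT y|lborel. norm (\<Psi> y)))"
    by (rule ennreal_mult''[symmetric]) simp
  finally show ?thesis .
qed

lemma hausdorff_kernel_integrable: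
  assumes [measurable]: "w \<in> borel_measurable borel" and B: "\<And>x. norm (w x) \<le> (B::real)"
  shows "integrable (lborel \<Otimes>\<^sub>M lborel) (\<lambda>(y, x). \<Psi> y * g ((1 / norm y) *\<^sub>R x - a) * w x)"
proof -
  have 1: "integrable (lborel \<Otimes>\<^sub>M lborel) (\<lambda>(y, x). \<Psi> y * g ((1 / norm y) *\<^sub>R x - a))"
    unfolding integrable_iff_bounded
  proof
    show "(\<lambda>(y, x). \<Psi> y * g ((1 / norm y) *\<^sub>R x - a)) \<in> borel_measurable (lborel \<Otimes>\<^sub>M lborel)" by measurable
    have "(\<integral>\<^sup>+z. ennreal (norm (case z of (y, x) \<Rightarrow> \<Psi> y * g ((1 / norm y) *\<^sub>R x - a))) \<partial>(lborel \<Otimes>\<^sub>M lborel))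
      = (\<integral>\<^sup>+y. \<integral>\<^sup>+x. ennreal (norm (\<Psi> y * g ((1 / norm y) *\<^sub>R x - a))) \<partial>lborel \<partial>lborel)"
      by (subst lborel.nn_integral_fst[symmetric]) auto
    also have "\<dots> < \<infinity>" using le_less_trans[OF hausdorff_kernel_bound] by simp
    finally show "(\<integral>\<^sup>+z. ennreal (norm (case z of (y, x) \<Rightarrow> \<Psi> y * g ((1 / norm y) *\<^sub>R x - a))) \<partial>(lborel \<Otimes>\<^sub>M lborel)) < \<infinity>" .
  qed
  have 2: "integrable (lborel \<Otimes>\<^sub>M lborel) (\<lambda>z. B *\<^sub>R (case z of (y, x) \<Rightarrow> \<Psi> y * g ((1 / norm y) *\<^sub>R x - a)))"
    by (rule integrable_scaleR_right[OF 1])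
  show ?thesis
  proof (rule Bochner_Integration.integrable_bound[OF 2])
    show "AE z in lborel \<Otimes>\<^sub>M lborel. norm (case z of (y, x) \<Rightarrow> \<Psi> y * g ((1 / norm y) *\<^sub>R x - a) * w x) \<le> norm (B *\<^sub>R (case z of (y, x) \<Rightarrow> \<Psi> y * g ((1 / norm y) *\<^sub>R x - a)))"
    proof (rule AE_I2)
      fix z :: "(real^'n) \<times> (real^'n)"
      obtain y x where z: "z = (y, x)" by fastforce
      have "norm (\<Psi> y * g ((1 / norm y) *\<^sub>R x - a)) * norm (w x) \<le> norm (\<Psi> y * g ((1 / norm y) *\<^sub>R x - a)) * \<bar>B\<bar>"
        using B[of x] by (intro mult_left_mono) auto
      then show "norm (case z of (y, x) \<Rightarrow> \<Psi> y * g ((1 / norm y) *\<^sub>R x - a) * w x) \<le> norm (B *\<^sub>R (case z of (y, x) \<Rightarrow> \<Psi> y * g ((1 / norm y) *\<^sub>R x - a)))"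
        unfolding z by (simp add: norm_mult mult_ac)
    qed
  qed measurable
qed

lemma haus_mult_integrable:
  assumes [measurable]: "w \<in> borel_measurable borel" and B: "\<And>x. norm (w x) \<le> (B::real)"
  shows "integrable lborel (\<lambda>x. haus g \<Psi> a x * w x)"
    "(LINT x|lborel. haus g \<Psi> a x * w x) = (LINT y|lborel. \<Psi> y * (LINT x|lborel. g ((1 / norm y) *\<^sub>R x - a) * w x))"
proof -
  note int = hausdorff_kernel_integrable[OF assms, of a]
  show "integrable lborel (\<lambda>x. haus g \<Psi> a x * w x)"
    using lborel_pair.integrable_snd[OF int] by (simp add: haus_def)
  show "(LINT x|lborel. haus g \<Psi> a x * w x) = (LINT y|lborel. \<Psi> y * (LINT x|lborel. g ((1 / norm y) *\<^sub>R x - a) * w x))"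
  proof -
    have "(LINT x|lborel. haus g \<Psi> a x * w x) = (LINT x|lborel. LINT y|lborel. \<Psi> y * g ((1 / norm y) *\<^sub>R x - a) * w x)"
      unfolding haus_def by simp
    also have "\<dots> = (LINT y|lborel. LINT x|lborel. \<Psi> y * g ((1 / norm y) *\<^sub>R x - a) * w x)"
      by (rule lborel_pair.Fubini_integral[OF int])
    also have "\<dots> = (LINT y|lborel. \<Psi> y * (LINT x|lborel. g ((1 / norm y) *\<^sub>R x - a) * w x))"
      by (simp only: mult.assoc integral_mult_right_zero)
    finally show ?thesis .
  qed
qed

lemma haus_kernel_section_integrable: "integrable lborel (\<lambda>y. \<Psi> y * g ((1 / norm y) *\<^sub>R x - a))"
proof -
  obtain B where B: "\<And>x. norm (g x) \<le> B" "B \<ge> 0" using test_functions_bounded[OF g] by blast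
  have "integrable lborel (\<lambda>y. B *\<^sub>R \<Psi> y)" using \<Psi> by simp
  then show ?thesis
    by (rule Bochner_Integration.integrable_bound) (use B in \<open>auto simp: norm_mult mult.commute[of B] intro!: mult_left_mono\<close>)
qed

lemma haus_norm_integral:
  assumes [measurable]: "w \<in> borel_measurable borel" and B: "\<And>x. norm (w x) \<le> (B::real)"
  shows "(LINT x|lborel. norm (haus g \<Psi> a x * w x)) \<le> B * (a2 ^ CARD('n) * (LINT x|lborel. norm (g x)) * (LINT y|lborel. norm (\<Psi> y)))"
proof -
  let ?E = "a2 ^ CARD('n) * (LINT x|lborel. norm (g x)) * (LINT y|lborel. norm (\<Psi> y))"
  have B0: "B \<ge> 0" using B[of 0] norm_ge_zero order_trans by blast
  \<comment> \<open>\<open>a2\<close> is known to be nonnegative only when \<Psi> is nonzero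
    somewhere; otherwise the last factor is 0.\<close>
  have E0: "?E \<ge> 0"
  proof (cases "\<forall>y. \<Psi> y = 0")
    case False
    then obtain y where "\<Psi> y \<noteq> 0" by blast
    then have "a2 \<ge> 0" using \<Psi>0[of y] by linarith
    then show ?thesis by simp
  qed simp
  have hm: "haus g \<Psi> a \<in> borel_measurable borel" unfolding haus_def by measurable
  have "ennreal (LINT x|lborel. norm (haus g \<Psi> a x * w x)) = (\<integral>\<^sup>+x. ennreal (norm (haus g \<Psi> a x * w x)) \<partial>lborel)"
    using haus_mult_integrable(1)[OF assms] by (intro nn_integral_eq_integral[symmetric]) auto
  also have "\<dots> \<le> (\<integral>\<^sup>+x. ennreal B * (\<integral>\<^sup>+y. ennreal (norm (\<Psi> y * g ((1 / norm y) *\<^sub>R x - a))) \<partial>lborel) \<partial>lborel)"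
  proof (intro nn_integral_mono)
    fix x
    have "ennreal (norm (haus g \<Psi> a x)) \<le> (\<integral>\<^sup>+y. ennreal (norm (\<Psi> y * g ((1 / norm y) *\<^sub>R x - a))) \<partial>lborel)"
      unfolding haus_def by (rule integral_norm_bound_ennreal[OF haus_kernel_section_integrable])
    moreover have "ennreal (norm (w x)) \<le> ennreal B" by (rule ennreal_leI[OF B])
    ultimately have "ennreal (norm (w x)) * ennreal (norm (haus g \<Psi> a x)) \<le> ennreal B * (\<integral>\<^sup>+y. ennreal (norm (\<Psi> y * g ((1 / norm y) *\<^sub>R x - a))) \<partial>lborel)"
      by (intro mult_mono) auto
    then show "ennreal (norm (haus g \<Psi> a x * w x)) \<le> ennreal B * (\<integral>\<^sup>+y. ennreal (norm (\<Psi> y * g ((1 / norm y) *\<^sub>R x - a))) \<partial>lborel)"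
      by (simp add: norm_mult ennreal_mult mult.commute)
  qed
  also have "\<dots> = ennreal B * (\<integral>\<^sup>+x. \<integral>\<^sup>+y. ennreal (norm (\<Psi> y * g ((1 / norm y) *\<^sub>R x - a))) \<partial>lborel \<partial>lborel)"
    by (rule nn_integral_cmult) measurable
  also have "(\<integral>\<^sup>+x. \<integral>\<^sup>+y. ennreal (norm (\<Psi> y * g ((1 / norm y) *\<^sub>R x - a))) \<partial>lborel \<partial>lborel)
    = (\<integral>\<^sup>+y. \<integral>\<^sup>+x. ennreal (norm (\<Psi> y * g ((1 / norm y) *\<^sub>R x - a))) \<partial>lborel \<partial>lborel)"
    by (rule lborel_pair.Fubini') measurable
  also have "ennreal B * \<dots> \<le> ennreal B * ennreal ?E" by (intro mult_left_mono hausdorff_kernel_bound) auto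
  also have "\<dots> = ennreal (B * ?E)" using B0 E0 by (subst ennreal_mult) auto
  finally show ?thesis using B0 E0 by (subst (asm) ennreal_le_iff) auto
qed

text \<open>The support of \<open>g\<close> forces \<open>|x| / |y|\<close> to lie within
  \<open>r0\<close> of \<open>R\<close>, so \<open>y\<close> runs through an annulus around radius
  \<open>|x| / R\<close> whose relative width tends to 0 as \<open>R\<close> grows. The difference
  of powers is its relative volume.\<close>

lemma haus_sup_bound:
  fixes e :: "real ^ 'n"
  assumes \<Psi>b: "\<And>y. norm (\<Psi> y) \<le> A" and gb: "\<And>x. norm (g x) \<le> B" and e: "norm e = 1" and R: "R > r0" "r0 > 0" and x: "norm x \<le> R * b"
    and b: "b \<ge> 0"
  shows "norm (haus g \<Psi> (R *\<^sub>R e) x) \<le> A * B * (unit_ball_vol CARD('n) * b ^ CARD('n) * ((R / (R - r0)) ^ CARD('n) - (R / (R + r0)) ^ CARD('n)))"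
proof -
  let ?n = "CARD('n)"
  let ?S = "{y::real^'n. norm x / (R + r0) \<le> norm y \<and> norm y \<le> norm x / (R - r0)}"
  have A0: "A \<ge> 0" "B \<ge> 0" using \<Psi>b[of 0] gb[of 0] norm_ge_zero order_trans by blast+
  have rr: "norm x / (R + r0) \<le> norm x / (R - r0)" using R by (intro divide_left_mono) auto
  have S: "y \<in> ?S" if "\<Psi> y * g ((1 / norm y) *\<^sub>R x - R *\<^sub>R e) \<noteq> 0" for y
  proof -
    have y: "norm y > 0" and n: "norm ((1 / norm y) *\<^sub>R x - R *\<^sub>R e) \<le> r0" using that \<Psi>0[of y] r0 by auto
    have "norm ((1 / norm y) *\<^sub>R x) = norm x / norm y" using y by simp
    moreover have "norm (R *\<^sub>R e) = R" using e R by simp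
    ultimately have "\<bar>norm x / norm y - R\<bar> \<le> r0"
      using norm_triangle_ineq3[of "(1 / norm y) *\<^sub>R x" "R *\<^sub>R e"] n by linarith
    then have "norm x / norm y \<le> R + r0" "R - r0 \<le> norm x / norm y" by linarith+
    then show ?thesis using y R by (simp add: field_simps)
  qed
  have Sm: "?S \<in> sets lborel" by simp
  have Sf: "emeasure lborel ?S < \<infinity>"
  proof -
    have "emeasure lborel ?S \<le> emeasure lborel (cball (0::real^'n) (norm x / (R - r0)))" by (intro emeasure_mono) auto
    then show ?thesis using emeasure_lborel_cball_finite le_less_trans by blast
  qed
  have "norm (haus g \<Psi> (R *\<^sub>R e) x) \<le> (LINT y|lborel. (A * B) * indicator ?S y)"
    unfolding haus_def
  proof (rule norm_integral_le)
    show "integrable lborel (\<lambda>y. (A * B) * indicator ?S y)"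
      using Sm Sf by (intro integrable_mult_right integrable_real_indicator)
    fix y
    show "norm (\<Psi> y * g ((1 / norm y) *\<^sub>R x - R *\<^sub>R e)) \<le> (A * B) * indicator ?S y"
    proof (cases "\<Psi> y * g ((1 / norm y) *\<^sub>R x - R *\<^sub>R e) = 0")
      case True
      then show ?thesis unfolding True norm_zero using A0 by simp
    next
      case False
      have "norm (\<Psi> y * g ((1 / norm y) *\<^sub>R x - R *\<^sub>R e)) \<le> A * B"
        unfolding norm_mult using A0 by (intro mult_mono \<Psi>b gb) auto
      then show ?thesis using S[OF False] by simp
    qed
  qed
  also have "\<dots> = A * B * measure lborel ?S" by simp
  also have "measure lborel ?S = unit_ball_vol ?n * ((norm x / (R - r0)) ^ ?n - (norm x / (R + r0)) ^ ?n)"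
    using R rr by (intro annulus_measure) auto
  also have "\<dots> = unit_ball_vol ?n * (norm x / R) ^ ?n * ((R / (R - r0)) ^ ?n - (R / (R + r0)) ^ ?n)"
    using R by (simp add: power_divide right_diff_distrib)
  also have "A * B * \<dots> \<le> A * B * (unit_ball_vol ?n * b ^ ?n * ((R / (R - r0)) ^ ?n - (R / (R + r0)) ^ ?n))"
  proof -
    have "norm x / R \<le> b" using x R by (simp add: field_simps)
    moreover have "(R / (R + r0)) ^ ?n \<le> (R / (R - r0)) ^ ?n"
      using R by (intro power_mono divide_left_mono) auto
    ultimately show ?thesis using A0 R
      by (intro mult_left_mono mult_right_mono power_mono) (auto simp: unit_ball_vol_nonneg)
  qed
  finally show ?thesis .
qed

text \<open>The substitution \<open>x = |y| (R e + \<eta>)\<close> turns \<open>|x| / R\<close> into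
  \<open>|y| |e + \<eta> / R|\<close>, which tends to \<open>|y|\<close> because \<open>e\<close> is
  a unit vector. The variables \<eta> and \<open>y\<close> then separate.\<close>

lemma haus_limit:
  fixes e :: "real ^ 'n" and \<beta> :: "real \<Rightarrow> complex"
  assumes e: "norm e = 1" and \<beta>: "continuous_on UNIV \<beta>" "\<And>s. norm (\<beta> s) \<le> B"
  shows "(\<lambda>k. LINT x|lborel. haus g \<Psi> (real (Suc k) *\<^sub>R e) x * \<beta> (norm x / real (Suc k))) \<longlonglongrightarrow>
    (LINT x|lborel. g x) * (LINT y|lborel. \<Psi> y * of_real (norm y ^ CARD('n)) * \<beta> (norm y))"
proof -
  have \<beta>m [measurable]: "\<beta> \<in> borel_measurable borel" by (rule borel_measurable_continuous_onI[OF \<beta>(1)])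
  have B0: "B \<ge> 0" using \<beta>(2)[of 0] norm_ge_zero order_trans by blast
  let ?Ig = "LINT x|lborel. norm (g x)"
  \<comment> \<open>The inner integral after this substitution, with the Jacobian
    \<open>|y|^n\<close> taken out.\<close>
  define c where "c k y = (LINT \<eta>|lborel. g \<eta> * \<beta> (norm y * norm (real (Suc k) *\<^sub>R e + \<eta>) / real (Suc k)))" for k and y :: "real^'n"
  have cm [measurable]: "c k \<in> borel_measurable borel" for k unfolding c_def by measurable
  have gi: "integrable lborel (\<lambda>x. norm (g x))" using test_functions_integrable[OF g] by simp
  have c_le: "norm (c k y) \<le> ?Ig * B" for k y
  proof -
    have "norm (c k y) \<le> (LINT \<eta>|lborel. norm (g \<eta>) * B)"
      unfolding c_def using gi \<beta>(2) by (intro norm_integral_le) (auto simp: norm_mult intro!: mult_left_mono)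
    then show ?thesis by simp
  qed
  have c_lim: "(\<lambda>k. c k y) \<longlonglongrightarrow> (LINT x|lborel. g x) * \<beta> (norm y)" for y
  proof -
    have "(\<lambda>k. c k y) \<longlonglongrightarrow> (LINT \<eta>|lborel. g \<eta> * \<beta> (norm y))"
      unfolding c_def
    proof (rule integral_dominated_convergence[where w = "\<lambda>\<eta>. norm (g \<eta>) * B"])
      show "integrable lborel (\<lambda>\<eta>. norm (g \<eta>) * B)" using gi by simp
      show "AE \<eta> in lborel. norm (g \<eta> * \<beta> (norm y * norm (real (Suc k) *\<^sub>R e + \<eta>) / real (Suc k))) \<le> norm (g \<eta>) * B" for k
        using \<beta>(2) by (intro AE_I2) (auto simp: norm_mult intro!: mult_left_mono)
      show "AE \<eta> in lborel. (\<lambda>k. g \<eta> * \<beta> (norm y * norm (real (Suc k) *\<^sub>R e + \<eta>) / real (Suc k))) \<longlonglongrightarrow> g \<eta> * \<beta> (norm y)"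
      proof (rule AE_I2)
        fix \<eta> :: "real^'n"
        have eq: "norm y * norm (real (Suc k) *\<^sub>R e + \<eta>) / real (Suc k) = norm y * norm (e + (1 / real (Suc k)) *\<^sub>R \<eta>)" for k
        proof -
          have "real (Suc k) *\<^sub>R e + \<eta> = real (Suc k) *\<^sub>R (e + (1 / real (Suc k)) *\<^sub>R \<eta>)"
            by (simp add: scaleR_add_right del: of_nat_Suc)
          then have "norm (real (Suc k) *\<^sub>R e + \<eta>) = real (Suc k) * norm (e + (1 / real (Suc k)) *\<^sub>R \<eta>)"
            by (simp del: of_nat_Suc)
          then show ?thesis by (simp del: of_nat_Suc)
        qed
        have "(\<lambda>k. norm y * norm (e + (1 / real (Suc k)) *\<^sub>R \<eta>)) \<longlonglongrightarrow> norm y * norm (e + 0 *\<^sub>R \<eta>)"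
          by (intro tendsto_intros LIMSEQ_Suc[OF lim_1_over_n])
        then have "(\<lambda>k. norm y * norm (e + (1 / real (Suc k)) *\<^sub>R \<eta>)) \<longlonglongrightarrow> norm y" using e by simp
        moreover have "isCont \<beta> (norm y)" using \<beta>(1) by (simp add: continuous_on_eq_continuous_at)
        ultimately have "(\<lambda>k. \<beta> (norm y * norm (e + (1 / real (Suc k)) *\<^sub>R \<eta>))) \<longlonglongrightarrow> \<beta> (norm y)"
          by (rule isCont_tendsto_compose[rotated])
        then show "(\<lambda>k. g \<eta> * \<beta> (norm y * norm (real (Suc k) *\<^sub>R e + \<eta>) / real (Suc k))) \<longlonglongrightarrow> g \<eta> * \<beta> (norm y)"
          unfolding eq by (intro tendsto_intros)
      qed
    qed measurable
    then show ?thesis by simp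
  qed
  have eq: "(LINT x|lborel. haus g \<Psi> (real (Suc k) *\<^sub>R e) x * \<beta> (norm x / real (Suc k))) = (LINT y|lborel. \<Psi> y * of_real (norm y ^ CARD('n)) * c k y)" for k
  proof -
    have "(LINT x|lborel. haus g \<Psi> (real (Suc k) *\<^sub>R e) x * \<beta> (norm x / real (Suc k)))
      = (LINT y|lborel. \<Psi> y * (LINT x|lborel. g ((1 / norm y) *\<^sub>R x - real (Suc k) *\<^sub>R e) * \<beta> (norm x / real (Suc k))))"
      by (rule haus_mult_integrable(2)[OF _ \<beta>(2)]) measurable
    also have "\<dots> = (LINT y|lborel. \<Psi> y * of_real (norm y ^ CARD('n)) * c k y)"
    proof (intro Bochner_Integration.integral_cong refl)
      fix y
      show "\<Psi> y * (LINT x|lborel. g ((1 / norm y) *\<^sub>R x - real (Suc k) *\<^sub>R e) * \<beta> (norm x / real (Suc k))) = \<Psi> y * of_real (norm y ^ CARD('n)) * c k y"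
      proof (cases "\<Psi> y = 0")
        case False
        then have y: "norm y > 0" using \<Psi>0 by blast
        have "(LINT x|lborel. g ((1 / norm y) *\<^sub>R x - real (Suc k) *\<^sub>R e) * \<beta> (norm x / real (Suc k)))
          = \<bar>norm y\<bar> ^ DIM(real^'n) *\<^sub>R (LINT x|lborel. g ((1 / norm y) *\<^sub>R (norm y *\<^sub>R (real (Suc k) *\<^sub>R e) + norm y *\<^sub>R x) - real (Suc k) *\<^sub>R e)
             * \<beta> (norm (norm y *\<^sub>R (real (Suc k) *\<^sub>R e) + norm y *\<^sub>R x) / real (Suc k)))"
          using y by (intro integral_affine) auto
        also have "(\<lambda>x. g ((1 / norm y) *\<^sub>R (norm y *\<^sub>R (real (Suc k) *\<^sub>R e) + norm y *\<^sub>R x) - real (Suc k) *\<^sub>R e)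
             * \<beta> (norm (norm y *\<^sub>R (real (Suc k) *\<^sub>R e) + norm y *\<^sub>R x) / real (Suc k)))
          = (\<lambda>\<eta>. g \<eta> * \<beta> (norm y * norm (real (Suc k) *\<^sub>R e + \<eta>) / real (Suc k)))"
        proof
          fix \<eta>
          have 1: "norm y *\<^sub>R (real (Suc k) *\<^sub>R e) + norm y *\<^sub>R \<eta> = norm y *\<^sub>R (real (Suc k) *\<^sub>R e + \<eta>)" by (simp only: scaleR_add_right)
          have 2: "(1 / norm y) *\<^sub>R (norm y *\<^sub>R (real (Suc k) *\<^sub>R e + \<eta>)) - real (Suc k) *\<^sub>R e = \<eta>" using y by simp
          have 3: "norm (norm y *\<^sub>R (real (Suc k) *\<^sub>R e + \<eta>)) = norm y * norm (real (Suc k) *\<^sub>R e + \<eta>)" by simp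
          show "g ((1 / norm y) *\<^sub>R (norm y *\<^sub>R (real (Suc k) *\<^sub>R e) + norm y *\<^sub>R \<eta>) - real (Suc k) *\<^sub>R e)
             * \<beta> (norm (norm y *\<^sub>R (real (Suc k) *\<^sub>R e) + norm y *\<^sub>R \<eta>) / real (Suc k)) = g \<eta> * \<beta> (norm y * norm (real (Suc k) *\<^sub>R e + \<eta>) / real (Suc k))"
            by (simp only: 1 2 3)
        qed
        finally show ?thesis by (simp add: c_def scaleR_conv_of_real[where 'a = complex])
      qed simp
    qed
    finally show ?thesis .
  qed
  have "(\<lambda>k. LINT y|lborel. \<Psi> y * of_real (norm y ^ CARD('n)) * c k y) \<longlonglongrightarrow> (LINT y|lborel. \<Psi> y * of_real (norm y ^ CARD('n)) * ((LINT x|lborel. g x) * \<beta> (norm y)))"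
  proof (rule integral_dominated_convergence[where w = "\<lambda>y. norm (\<Psi> y) * (a2 ^ CARD('n) * (?Ig * B))"])
    show "integrable lborel (\<lambda>y. norm (\<Psi> y) * (a2 ^ CARD('n) * (?Ig * B)))" using \<Psi> by simp
    show "AE y in lborel. (\<lambda>k. \<Psi> y * of_real (norm y ^ CARD('n)) * c k y) \<longlonglongrightarrow> \<Psi> y * of_real (norm y ^ CARD('n)) * ((LINT x|lborel. g x) * \<beta> (norm y))"
      by (intro AE_I2 tendsto_intros c_lim)
    show "AE y in lborel. norm (\<Psi> y * of_real (norm y ^ CARD('n)) * c k y) \<le> norm (\<Psi> y) * (a2 ^ CARD('n) * (?Ig * B))" for k
    proof (rule AE_I2)
      fix y
      show "norm (\<Psi> y * of_real (norm y ^ CARD('n)) * c k y) \<le> norm (\<Psi> y) * (a2 ^ CARD('n) * (?Ig * B))"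
      proof (cases "\<Psi> y = 0")
        case False
        then have "norm y \<le> a2" using \<Psi>0 by blast
        then have "norm y ^ CARD('n) * norm (c k y) \<le> a2 ^ CARD('n) * (?Ig * B)"
          using c_le[of k y] order_trans[OF norm_ge_zero \<open>norm y \<le> a2\<close>] by (intro mult_mono power_mono) auto
        then show ?thesis by (simp add: norm_mult norm_power mult.assoc mult_left_mono)
      qed simp
    qed
  qed measurable
  moreover have "(LINT y|lborel. \<Psi> y * of_real (norm y ^ CARD('n)) * ((LINT x|lborel. g x) * \<beta> (norm y)))
    = (LINT x|lborel. g x) * (LINT y|lborel. \<Psi> y * of_real (norm y ^ CARD('n)) * \<beta> (norm y))"
    by (subst integral_mult_right_zero[symmetric]) (simp add: mult_ac)
  ultimately show ?thesis unfolding eq by simp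
qed

end

section \<open>Vanishing of the radial averages\<close>

lemma locally_integrable_annulus:
  fixes \<Phi> :: "real ^ 'n::finite \<Rightarrow> complex"
  assumes "locally_integrable_on (- {0}) \<Phi>" "0 < a"
  shows "integrable lebesgue (\<lambda>y. indicator {y. a \<le> norm y \<and> norm y \<le> b} y *\<^sub>R \<Phi> y)"
proof -
  have "{y::real^'n. a \<le> norm y \<and> norm y \<le> b} = cball 0 b - ball 0 a" by auto
  moreover have "compact (cball (0::real^'n) b - ball 0 a)" by (intro compact_diff) auto
  ultimately have "compact {y::real^'n. a \<le> norm y \<and> norm y \<le> b}" by simp
  then have "set_integrable lebesgue {y. a \<le> norm y \<and> norm y \<le> b} \<Phi>"
    using assms by (auto simp: locally_integrable_on_def)
  then show ?thesis by (simp add: set_integrable_def)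
qed

text \<open>Split the restriction of \<open>\<Phi>\<close> to an annulus into a bounded part and a part that is small in \<open>L\<^sup>1\<close>. The
  \<open>L\<^sup>1\<close> norm of the image \<open>D\<close> of the bounded part is at most \<open>sup |D|\<^sup>1\<^sup>-\<^sup>p \<integral>|D|\<^sup>p\<close>, which tends to 0 with the sup norm.\<close>

lemma hausdorff_core:
  fixes \<Phi> g :: "real ^ 'n::finite \<Rightarrow> complex" and e :: "real ^ 'n" and \<beta> :: "real \<Rightarrow> complex"
  assumes p: "0 < p" "p < 1" and \<Phi>: "locally_integrable_on (- {0}) \<Phi>"
    and g: "g \<in> test_functions UNIV" "(LINT x|lborel. g x) \<noteq> 0" and e: "norm e = 1"
    and C: "C \<ge> 0" "\<And>k. k \<ge> k0 \<Longrightarrow> (\<integral>\<^sup>+x. ennreal (norm (hausdorff_op \<Phi> (\<lambda>x. g (x - real (Suc k) *\<^sub>R e)) x) powr p) \<partial>lebesgue) \<le> ennreal C"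
    and \<beta>: "continuous_on UNIV \<beta>" "\<And>s. \<beta> s \<noteq> 0 \<Longrightarrow> a1 \<le> s \<and> s \<le> a2" "0 < a1"
  shows "(LINT y|lebesgue. \<Phi> y * of_real (norm y ^ CARD('n)) * \<beta> (norm y)) = 0"
proof -
  obtain r where r: "\<And>x. g x \<noteq> 0 \<Longrightarrow> norm x \<le> r" using g(1) by (auto simp: test_functions_UNIV_iff)
  define r0 where "r0 = max r 1"
  have r0: "\<And>x. g x \<noteq> 0 \<Longrightarrow> norm x \<le> r0" "r0 > 0" using r by (fastforce simp: r0_def)+
  define a where "a = max a2 a1"
  have a: "a > 0" "a2 \<le> a" using \<beta>(3) by (auto simp: a_def)
  \<comment> \<open>Where the weight is nonzero, \<open>|x| / R\<close> lies between
    \<open>a1\<close> and \<open>a\<close>; for \<open>R > 2 r0\<close> the quotient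
    \<open>|x| / |y|\<close> agrees with \<open>R\<close> up to a factor 2. So only \<open>y\<close>
    in this annulus contributes.\<close>
  let ?A = "{y::real^'n. a1 / 2 \<le> norm y \<and> norm y \<le> 2 * a}"
  have Am [measurable]: "?A \<in> sets borel" by measurable
  define \<Phi>A where "\<Phi>A y = indicator ?A y *\<^sub>R \<Phi> y" for y
  have \<Phi>A: "integrable lebesgue \<Phi>A" unfolding \<Phi>A_def using \<beta>(3) by (intro locally_integrable_annulus[OF \<Phi>]) simp
  obtain \<Psi>0 where \<Psi>0: "\<Psi>0 \<in> borel_measurable lborel" "AE y in lborel. \<Phi>A y = \<Psi>0 y"
    using completion_ex_borel_measurable_complex[OF borel_measurable_integrable[OF \<Phi>A]] by blast
  \<comment> \<open>Restricted once more: the Borel version agrees with \<open>\<Phi>A\<close> only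
    almost everywhere, but its support is used pointwise.\<close>
  define \<Psi> where "\<Psi> y = indicator ?A y *\<^sub>R \<Psi>0 y" for y
  have \<Psi>m [measurable]: "\<Psi> \<in> borel_measurable borel" unfolding \<Psi>_def using \<Psi>0(1) by measurable
  have \<Psi>AE: "AE y in lebesgue. \<Phi>A y = \<Psi> y"
    using AE_completion[OF \<Psi>0(2)] by eventually_elim (auto simp: \<Psi>_def \<Phi>A_def indicator_def)
  have \<Psi>m': "\<Psi> \<in> borel_measurable lebesgue" by (rule borel_measurable_lebesgueI[OF \<Psi>m])
  have "integrable lebesgue \<Psi>"
    using integrable_cong_AE[OF borel_measurable_integrable[OF \<Phi>A] \<Psi>m' \<Psi>AE] \<Phi>A by blast
  then have \<Psi>: "integrable lborel \<Psi>" by (subst (asm) integrable_completion) auto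
  have \<Psi>s: "0 < norm y \<and> norm y \<le> 2 * a" if "\<Psi> y \<noteq> 0" for y
    using that \<beta>(3) by (auto simp: \<Psi>_def indicator_def split: if_splits)
  obtain B where B: "\<And>s. norm (\<beta> s) \<le> B" "B > 0"
  proof -
    have "compact (\<beta> ` {a1..a2})" by (intro compact_continuous_image continuous_on_subset[OF \<beta>(1)]) auto
    then obtain B where B: "\<forall>y\<in>\<beta> ` {a1..a2}. norm y \<le> B" using compact_imp_bounded bounded_iff by metis
    have "norm (\<beta> s) \<le> max B 1" for s
      using B \<beta>(2)[of s] by (cases "\<beta> s = 0") (auto simp: le_max_iff_disj)
    then show ?thesis using that[of "max B 1"] by simp
  qed
  obtain Bg where Bg: "\<And>x. norm (g x) \<le> Bg" "Bg \<ge> 0" using test_functions_bounded[OF g(1)] by blast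
  have \<beta>m [measurable]: "\<beta> \<in> borel_measurable borel" by (rule borel_measurable_continuous_onI[OF \<beta>(1)])
  have gm [measurable]: "g \<in> borel_measurable borel" by (rule smooth_measurable[OF test_functions_smooth[OF g(1)]])
  define R where "R k = real (Suc k)" for k
  define w where "w k x = \<beta> (norm x / R k)" for k and x :: "real^'n"
  have wm [measurable]: "w k \<in> borel_measurable borel" for k unfolding w_def by measurable
  have wB: "norm (w k x) \<le> B" for k x unfolding w_def by (rule B(1))
  define L where "L = (LINT x|lborel. g x) * (LINT y|lborel. \<Psi> y * of_real (norm y ^ CARD('n)) * \<beta> (norm y))"
  have lim: "(\<lambda>k. LINT x|lborel. haus g \<Psi> (R k *\<^sub>R e) x * w k x) \<longlonglongrightarrow> L"
    unfolding L_def R_def w_def by (rule haus_limit[OF g(1) r0(1) \<Psi> \<Psi>s e \<beta>(1) B(1)])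
  have haus_eq: "hausdorff_op \<Phi> (\<lambda>x. g (x - R k *\<^sub>R e)) x = haus g \<Psi> (R k *\<^sub>R e) x" if Rk: "R k > 2 * r0" and wx: "w k x \<noteq> 0" for k x
  proof -
    have R0: "R k > 0" by (simp add: R_def)
    have x: "a1 * R k \<le> norm x" "norm x \<le> a * R k"
      using \<beta>(2)[of "norm x / R k"] wx R0 a(2) unfolding w_def by (auto simp: field_simps intro: order_trans)
    have inA: "y \<in> ?A" if "g ((1 / norm y) *\<^sub>R x - R k *\<^sub>R e) \<noteq> 0" for y
    proof -
      have n: "norm ((1 / norm y) *\<^sub>R x - R k *\<^sub>R e) \<le> r0" using r0(1) that by blast
      have nR: "norm (R k *\<^sub>R e) = R k" using e R0 by simp
      have ny: "norm ((1 / norm y) *\<^sub>R x) = norm x / norm y" by simp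
      have ab: "\<bar>norm x / norm y - R k\<bar> \<le> r0"
        using norm_triangle_ineq3[of "(1 / norm y) *\<^sub>R x" "R k *\<^sub>R e"] n unfolding nR ny by linarith
      have y: "norm y > 0"
      proof (rule ccontr)
        assume "\<not> norm y > 0"
        then have "norm y = 0" by simp
        then show False using ab Rk r0(2) by simp
      qed
      have "norm x / norm y \<le> 2 * R k" "R k / 2 \<le> norm x / norm y" using ab Rk by linarith+
      then have "norm x \<le> 2 * R k * norm y" "R k * norm y \<le> 2 * norm x" using y by (auto simp: field_simps)
      then have "a1 * R k \<le> (2 * norm y) * R k" "norm y * R k \<le> (2 * a) * R k" using x by (auto simp: mult_ac)
      then show ?thesis using R0 by auto
    qed
    have "hausdorff_op \<Phi> (\<lambda>x. g (x - R k *\<^sub>R e)) x = (LINT y|lebesgue. \<Phi>A y * g ((1 / norm y) *\<^sub>R x - R k *\<^sub>R e))"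
      unfolding hausdorff_op_def
    proof (intro Bochner_Integration.integral_cong refl)
      fix y
      show "\<Phi> y * g ((1 / norm y) *\<^sub>R x - R k *\<^sub>R e) = \<Phi>A y * g ((1 / norm y) *\<^sub>R x - R k *\<^sub>R e)"
        using inA[of y] by (cases "g ((1 / norm y) *\<^sub>R x - R k *\<^sub>R e) = 0") (auto simp: \<Phi>A_def)
    qed
    also have "\<dots> = (LINT y|lebesgue. \<Psi> y * g ((1 / norm y) *\<^sub>R x - R k *\<^sub>R e))"
    proof (rule integral_cong_AE)
      have m: "(\<lambda>y. g ((1 / norm y) *\<^sub>R x - R k *\<^sub>R e)) \<in> borel_measurable lebesgue"
        by (rule borel_measurable_lebesgueI) measurable
      show "(\<lambda>y. \<Phi>A y * g ((1 / norm y) *\<^sub>R x - R k *\<^sub>R e)) \<in> borel_measurable lebesgue"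
        by (rule borel_measurable_times[OF borel_measurable_integrable[OF \<Phi>A] m])
      show "(\<lambda>y. \<Psi> y * g ((1 / norm y) *\<^sub>R x - R k *\<^sub>R e)) \<in> borel_measurable lebesgue"
        by (rule borel_measurable_times[OF \<Psi>m' m])
      show "AE y in lebesgue. \<Phi>A y * g ((1 / norm y) *\<^sub>R x - R k *\<^sub>R e) = \<Psi> y * g ((1 / norm y) *\<^sub>R x - R k *\<^sub>R e)"
        using \<Psi>AE by eventually_elim simp
    qed
    also have "\<dots> = haus g \<Psi> (R k *\<^sub>R e) x"
      unfolding haus_def by (rule lebesgue_integral_eq_lborel) measurable
    finally show ?thesis .
  qed
  let ?V = "unit_ball_vol CARD('n)"
  define \<epsilon> where "\<epsilon> k = (R k / (R k - r0)) ^ CARD('n) - (R k / (R k + r0)) ^ CARD('n)" for k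
  have \<epsilon>: "\<epsilon> \<longlonglongrightarrow> 0"
  proof -
    have i: "(\<lambda>k. 1 / R k) \<longlonglongrightarrow> 0" unfolding R_def by (rule LIMSEQ_Suc[OF lim_1_over_n])
    have "(\<lambda>k. (1 / (1 - r0 * (1 / R k))) ^ CARD('n) - (1 / (1 + r0 * (1 / R k))) ^ CARD('n)) \<longlonglongrightarrow> (1 / (1 - r0 * 0)) ^ CARD('n) - (1 / (1 + r0 * 0)) ^ CARD('n)"
      by (intro tendsto_intros i) auto
    moreover have "(1 / (1 - r0 * (1 / R k))) ^ CARD('n) - (1 / (1 + r0 * (1 / R k))) ^ CARD('n) = \<epsilon> k" for k
    proof -
      have "R k > 0" by (simp add: R_def)
      then have "1 - r0 * (1 / R k) = (R k - r0) / R k" "1 + r0 * (1 / R k) = (R k + r0) / R k" by (auto simp: field_simps)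
      then show ?thesis by (simp add: \<epsilon>_def)
    qed
    ultimately show ?thesis by simp
  qed
  \<comment> \<open>Here \<open>m\<close> is the height at which \<Psi> is truncated. It stays fixed
    while \<open>k\<close> tends to infinity, and only the \<open>L^1\<close> norm of the part above
    the height survives in the bound.\<close>
  have L_le: "norm L \<le> 3 * (B * ((2 * a) ^ CARD('n) * (LINT x|lborel. norm (g x)) * (LINT y|lborel. norm (indicator {y. norm (\<Psi> y) > real m} y *\<^sub>R \<Psi> y))))" for m :: nat
  proof -
    define \<Psi>1 where "\<Psi>1 y = indicator {y. \<not> norm (\<Psi> y) > real m} y *\<^sub>R \<Psi> y" for y
    define \<Psi>2 where "\<Psi>2 y = indicator {y. norm (\<Psi> y) > real m} y *\<^sub>R \<Psi> y" for y
    have \<Psi>12: "\<Psi> y = \<Psi>1 y + \<Psi>2 y" for y by (simp add: \<Psi>1_def \<Psi>2_def indicator_def)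
    have m12 [measurable]: "\<Psi>1 \<in> borel_measurable borel" "\<Psi>2 \<in> borel_measurable borel" unfolding \<Psi>1_def \<Psi>2_def by measurable
    have i1: "integrable lborel \<Psi>1" by (rule Bochner_Integration.integrable_bound[OF \<Psi>]) (auto simp: \<Psi>1_def indicator_def)
    have i2: "integrable lborel \<Psi>2" by (rule Bochner_Integration.integrable_bound[OF \<Psi>]) (auto simp: \<Psi>2_def indicator_def)
    have s1: "\<And>y. \<Psi>1 y \<noteq> 0 \<Longrightarrow> 0 < norm y \<and> norm y \<le> 2 * a" "\<And>y. \<Psi>2 y \<noteq> 0 \<Longrightarrow> 0 < norm y \<and> norm y \<le> 2 * a"
      using \<Psi>s by (auto simp: \<Psi>1_def \<Psi>2_def)
    have b1: "norm (\<Psi>1 y) \<le> real m" for y by (auto simp: \<Psi>1_def indicator_def)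
    note G1 = g(1) r0(1) i1 s1(1) and G2 = g(1) r0(1) i2 s1(2) and G = g(1) r0(1) \<Psi> \<Psi>s
    have hsum: "haus g \<Psi> b x = haus g \<Psi>1 b x + haus g \<Psi>2 b x" for b x
      unfolding haus_def \<Psi>12 distrib_right
      by (rule Bochner_Integration.integral_add[OF haus_kernel_section_integrable[OF G1] haus_kernel_section_integrable[OF G2]])
    define M where "M k = B * (real m * Bg * (?V * a ^ CARD('n) * \<epsilon> k))" for k
    have Mlim: "M \<longlonglongrightarrow> 0"
    proof -
      have "M \<longlonglongrightarrow> B * (real m * Bg * (?V * a ^ CARD('n) * 0))" unfolding M_def by (intro tendsto_intros \<epsilon>)
      then show ?thesis by simp
    qed
    let ?E = "B * ((2 * a) ^ CARD('n) * (LINT x|lborel. norm (g x)) * (LINT y|lborel. norm (\<Psi>2 y)))"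
    have bound: "norm (LINT x|lborel. haus g \<Psi> (R k *\<^sub>R e) x * w k x) \<le> M k powr (1 - p) * 2 powr p * (B powr p * C) + 3 * ?E"
      if k: "k \<ge> k0" "R k > 2 * r0" for k
    proof -
      let ?H = "\<lambda>x. haus g \<Psi> (R k *\<^sub>R e) x * w k x"
      let ?H1 = "\<lambda>x. haus g \<Psi>1 (R k *\<^sub>R e) x * w k x"
      let ?H2 = "\<lambda>x. haus g \<Psi>2 (R k *\<^sub>R e) x * w k x"
      have R0: "R k > 0" by (simp add: R_def)
      have eps0: "\<epsilon> k \<ge> 0"
        unfolding \<epsilon>_def using k r0(2) R0 by (simp, intro power_mono divide_left_mono) auto
      have H1: "norm (?H1 x) \<le> M k" for x
      proof (cases "w k x = 0")
        case True
        then show ?thesis using eps0 B(2) Bg(2) a(1) by (simp add: M_def)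
      next
        case False
        have "norm x \<le> R k * a"
          using \<beta>(2)[of "norm x / R k"] False R0 a(2) unfolding w_def by (auto simp: field_simps intro: order_trans)
        then have "norm (haus g \<Psi>1 (R k *\<^sub>R e) x) \<le> real m * Bg * (?V * a ^ CARD('n) * \<epsilon> k)"
          unfolding \<epsilon>_def using k r0(2) a(1) by (intro haus_sup_bound[OF G1 b1 Bg(1) e]) auto
        then have "norm (haus g \<Psi>1 (R k *\<^sub>R e) x) * norm (w k x) \<le> (real m * Bg * (?V * a ^ CARD('n) * \<epsilon> k)) * B"
          using wB[of k x] eps0 Bg(2) a(1) by (intro mult_mono) auto
        then show ?thesis by (simp add: M_def norm_mult mult.commute)
      qed
      have iH: "integrable lborel ?H" by (rule haus_mult_integrable(1)[OF G wm wB])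
      have Hm [measurable]: "?H \<in> borel_measurable lborel" using iH by (rule borel_measurable_integrable)
      \<comment> \<open>The constant is divided out on the side of \<open>?H\<close>, which is
        measurable, so that it can be pulled out of the integral again afterwards.\<close>
      have Hp: "(\<integral>\<^sup>+x. ennreal (norm (?H x) powr p) \<partial>lborel) \<le> ennreal (B powr p * C)"
      proof -
        have "(\<integral>\<^sup>+x. ennreal (norm (?H x) powr p / B powr p) \<partial>lborel) \<le> (\<integral>\<^sup>+x. ennreal (norm (hausdorff_op \<Phi> (\<lambda>x. g (x - R k *\<^sub>R e)) x) powr p) \<partial>lebesgue)"
          unfolding nn_integral_completion
        proof (intro nn_integral_mono ennreal_leI)
          fix x
          show "norm (?H x) powr p / B powr p \<le> norm (hausdorff_op \<Phi> (\<lambda>x. g (x - R k *\<^sub>R e)) x) powr p"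
          proof (cases "w k x = 0")
            case False
            have "norm (?H x) powr p \<le> (norm (haus g \<Psi> (R k *\<^sub>R e) x) * B) powr p"
              unfolding norm_mult using p wB by (intro powr_mono2 mult_left_mono) auto
            also have "\<dots> = norm (hausdorff_op \<Phi> (\<lambda>x. g (x - R k *\<^sub>R e)) x) powr p * B powr p"
              unfolding haus_eq[OF k(2) False] using B(2) by (simp add: powr_mult)
            finally show ?thesis using B(2) by (simp add: field_simps)
          qed simp
        qed
        also have "\<dots> \<le> ennreal C" using C(2)[OF k(1)] unfolding R_def .
        finally have le: "(\<integral>\<^sup>+x. ennreal (norm (?H x) powr p / B powr p) \<partial>lborel) \<le> ennreal C" .
        have "(\<integral>\<^sup>+x. ennreal (norm (?H x) powr p) \<partial>lborel) = (\<integral>\<^sup>+x. ennreal (B powr p) * ennreal (norm (?H x) powr p / B powr p) \<partial>lborel)"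
          using B(2) by (subst ennreal_mult'[symmetric]) auto
        also have "\<dots> = ennreal (B powr p) * (\<integral>\<^sup>+x. ennreal (norm (?H x) powr p / B powr p) \<partial>lborel)"
          by (rule nn_integral_cmult) measurable
        also have "\<dots> \<le> ennreal (B powr p) * ennreal C" using le by (intro mult_left_mono) auto
        finally show ?thesis by (simp add: ennreal_mult'[symmetric])
      qed
      have iH2: "integrable lborel ?H2" by (rule haus_mult_integrable(1)[OF G2 wm wB])
      have iHp: "integrable lborel (\<lambda>x. norm (?H x) powr p)"
        unfolding integrable_iff_bounded
      proof
        show "(\<lambda>x. norm (?H x) powr p) \<in> borel_measurable lborel" by measurable
        show "(\<integral>\<^sup>+x. ennreal (norm (norm (?H x) powr p)) \<partial>lborel) < \<infinity>" using le_less_trans[OF Hp] by simp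
      qed
      have Hp': "(LINT x|lborel. norm (?H x) powr p) \<le> B powr p * C"
        using Hp C(1) by (subst (asm) nn_integral_eq_integral[OF iHp]) auto
      have "norm (LINT x|lborel. ?H x) \<le> (LINT x|lborel. M k powr (1 - p) * 2 powr p * norm (?H x) powr p + 3 * norm (?H2 x))"
      proof (rule norm_integral_le)
        show "integrable lborel (\<lambda>x. M k powr (1 - p) * 2 powr p * norm (?H x) powr p + 3 * norm (?H2 x))"
          using iHp iH2 by (intro Bochner_Integration.integrable_add integrable_mult_right integrable_norm)
        fix x
        have "?H x = ?H1 x + ?H2 x" by (simp add: hsum distrib_right)
        then show "norm (?H x) \<le> M k powr (1 - p) * 2 powr p * norm (?H x) powr p + 3 * norm (?H2 x)"
          using split_powr_bound[OF p H1, of x "?H2 x"] by simp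
      qed
      also have "\<dots> = M k powr (1 - p) * 2 powr p * (LINT x|lborel. norm (?H x) powr p) + 3 * (LINT x|lborel. norm (?H2 x))"
        using iHp iH2 by simp
      also have "\<dots> \<le> M k powr (1 - p) * 2 powr p * (B powr p * C) + 3 * ?E"
        using Hp' haus_norm_integral[OF G2 wm wB, of "R k *\<^sub>R e" k] by (intro add_mono mult_left_mono) auto
      finally show ?thesis .
    qed
    \<comment> \<open>The decisive use of \<open>p < 1\<close>: the exponent \<open>1 - p\<close> is
      positive, so the first summand tends to 0 with the sup bound \<open>M k\<close>.\<close>
    have "(\<lambda>k. M k powr (1 - p) * 2 powr p * (B powr p * C) + 3 * ?E) \<longlonglongrightarrow> 0 powr (1 - p) * 2 powr p * (B powr p * C) + 3 * ?E"
    proof (intro tendsto_intros tendsto_powr')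
      show "M \<longlonglongrightarrow> 0" by (rule Mlim)
      have "0 \<le> M k" if "R k > 2 * r0" for k
      proof -
        have "R k > 0" by (simp add: R_def)
        then have "\<epsilon> k \<ge> 0" unfolding \<epsilon>_def using that r0(2) by (simp, intro power_mono divide_left_mono) auto
        then show ?thesis using B(2) Bg(2) a(1) by (simp add: M_def)
      qed
      moreover have "eventually (\<lambda>k. R k > 2 * r0) sequentially"
      proof -
        obtain K :: nat where "2 * r0 < real K" using reals_Archimedean2 by blast
        then show ?thesis unfolding eventually_sequentially R_def by (intro exI[of _ K]) auto
      qed
      ultimately show "0 \<noteq> (0::real) \<or> 0 < 1 - p \<and> (\<forall>\<^sub>F k in sequentially. 0 \<le> M k)"
        using p by (auto elim: eventually_mono)
    qed
    then have lim2: "(\<lambda>k. M k powr (1 - p) * 2 powr p * (B powr p * C) + 3 * ?E) \<longlonglongrightarrow> 3 * ?E" by simp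
    have "norm L \<le> 3 * ?E"
    proof (rule tendsto_le[OF _ lim2 tendsto_norm[OF lim]])
      obtain K :: nat where K: "2 * r0 < real K" using reals_Archimedean2 by blast
      show "\<forall>\<^sub>F k in sequentially. norm (LINT x|lborel. haus g \<Psi> (R k *\<^sub>R e) x * w k x) \<le> M k powr (1 - p) * 2 powr p * (B powr p * C) + 3 * ?E"
        unfolding eventually_sequentially
      proof (intro exI[of _ "max k0 K"] allI impI)
        fix k assume "max k0 K \<le> k"
        then have "k0 \<le> k" "R k > 2 * r0" using K by (auto simp: R_def)
        then show "norm (LINT x|lborel. haus g \<Psi> (R k *\<^sub>R e) x * w k x) \<le> M k powr (1 - p) * 2 powr p * (B powr p * C) + 3 * ?E" by (rule bound)
      qed
    qed simp
    then show ?thesis unfolding \<Psi>2_def .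
  qed
  \<comment> \<open>Raising the truncation height makes the \<open>L^1\<close> norm of the remaining
    part tend to 0, which leaves \<open>L = 0\<close>.\<close>
  have "(\<lambda>m. LINT y|lborel. norm (indicator {y. norm (\<Psi> y) > real m} y *\<^sub>R \<Psi> y)) \<longlonglongrightarrow> (LINT y|(lborel :: (real^'n) measure). (0::real))"
  proof (rule integral_dominated_convergence[where w = "\<lambda>y. norm (\<Psi> y)"])
    show "AE y in lborel. (\<lambda>m. norm (indicator {y. norm (\<Psi> y) > real m} y *\<^sub>R \<Psi> y)) \<longlonglongrightarrow> 0"
    proof (rule AE_I2, rule tendsto_eventually)
      fix y
      obtain K :: nat where K: "norm (\<Psi> y) \<le> real K" using real_arch_simple by blast
      show "\<forall>\<^sub>F m in sequentially. norm (indicator {y. norm (\<Psi> y) > real m} y *\<^sub>R \<Psi> y) = 0"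
        unfolding eventually_sequentially using K by (intro exI[of _ K]) (auto simp: indicator_def)
    qed
    show "AE y in lborel. norm (norm (indicator {y. norm (\<Psi> y) > real m} y *\<^sub>R \<Psi> y)) \<le> norm (\<Psi> y)" for m :: nat
      by (auto simp: indicator_def)
  qed (use \<Psi> in auto)
  then have t0: "(\<lambda>m. LINT y|lborel. norm (indicator {y. norm (\<Psi> y) > real m} y *\<^sub>R \<Psi> y)) \<longlonglongrightarrow> 0" by simp
  have "(\<lambda>m. 3 * (B * ((2 * a) ^ CARD('n) * (LINT x|lborel. norm (g x)) * (LINT y|lborel. norm (indicator {y. norm (\<Psi> y) > real m} y *\<^sub>R \<Psi> y)))))
    \<longlonglongrightarrow> 3 * (B * ((2 * a) ^ CARD('n) * (LINT x|lborel. norm (g x)) * 0))"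
    by (intro tendsto_mult tendsto_const t0)
  then have "norm L \<le> 3 * (B * ((2 * a) ^ CARD('n) * (LINT x|lborel. norm (g x)) * 0))"
    by (rule LIMSEQ_le_const) (use L_le in blast)
  then have "L = 0" by simp
  then have Z: "(LINT y|lborel. \<Psi> y * of_real (norm y ^ CARD('n)) * \<beta> (norm y)) = 0" using g(2) by (simp add: L_def)
  have "(LINT y|lebesgue. \<Phi> y * of_real (norm y ^ CARD('n)) * \<beta> (norm y)) = (LINT y|lebesgue. \<Phi>A y * (of_real (norm y ^ CARD('n)) * \<beta> (norm y)))"
  proof (intro Bochner_Integration.integral_cong refl)
    fix y :: "real^'n"
    show "\<Phi> y * of_real (norm y ^ CARD('n)) * \<beta> (norm y) = \<Phi>A y * (of_real (norm y ^ CARD('n)) * \<beta> (norm y))"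
      using \<beta>(2)[of "norm y"] \<beta>(3) a by (cases "\<beta> (norm y) = 0") (auto simp: \<Phi>A_def)
  qed
  also have "\<dots> = (LINT y|lebesgue. \<Psi> y * (of_real (norm y ^ CARD('n)) * \<beta> (norm y)))"
  proof (rule integral_cong_AE)
    have m: "(\<lambda>y::real^'n. of_real (norm y ^ CARD('n)) * \<beta> (norm y)) \<in> borel_measurable lebesgue"
      by (rule borel_measurable_lebesgueI) measurable
    show "(\<lambda>y. \<Phi>A y * (of_real (norm y ^ CARD('n)) * \<beta> (norm y))) \<in> borel_measurable lebesgue"
      by (rule borel_measurable_times[OF borel_measurable_integrable[OF \<Phi>A] m])
    show "(\<lambda>y. \<Psi> y * (of_real (norm y ^ CARD('n)) * \<beta> (norm y))) \<in> borel_measurable lebesgue"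
      by (rule borel_measurable_times[OF \<Psi>m' m])
    show "AE y in lebesgue. \<Phi>A y * (of_real (norm y ^ CARD('n)) * \<beta> (norm y)) = \<Psi> y * (of_real (norm y ^ CARD('n)) * \<beta> (norm y))"
      using \<Psi>AE by eventually_elim simp
  qed
  also have "\<dots> = (LINT y|lborel. \<Psi> y * of_real (norm y ^ CARD('n)) * \<beta> (norm y))"
    by (subst lebesgue_integral_eq_lborel) (auto simp: mult.assoc)
  finally show ?thesis using Z by simp
qed

text \<open>For points near \<open>x \<noteq> 0\<close> only \<open>y\<close> from one fixed annulus
  contributes, and \<Phi> is integrable there. Around the origin these annuli shrink to 0, where
  \<Phi> need not be integrable.\<close>

lemma hausdorff_op_continuous:
  fixes \<Phi> f :: "real ^ 'n::finite \<Rightarrow> complex"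
  assumes \<Phi>: "locally_integrable_on (- {0}) \<Phi>" and f: "f \<in> test_functions (- {0})" and x: "x \<noteq> 0"
  shows "isCont (hausdorff_op \<Phi> f) x"
  unfolding continuous_at_sequentially
proof (intro allI impI)
  fix X assume X: "X \<longlonglongrightarrow> x"
  have ft: "f \<in> test_functions UNIV" using f by (simp add: test_functions_off_0_iff)
  obtain r1 where r1: "r1 > 0" "\<And>x. f x \<noteq> 0 \<Longrightarrow> r1 \<le> norm x" using f by (auto simp: test_functions_off_0_iff)
  obtain r where r: "\<And>x. f x \<noteq> 0 \<Longrightarrow> norm x \<le> r" using ft by (auto simp: test_functions_UNIV_iff)
  define r2 where "r2 = max r 1"
  have r2: "r2 > 0" "\<And>x. f x \<noteq> 0 \<Longrightarrow> norm x \<le> r2" using r by (fastforce simp: r2_def)+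
  obtain B where B: "\<And>x. norm (f x) \<le> B" "B \<ge> 0" using test_functions_bounded[OF ft] by blast
  have fm [measurable]: "f \<in> borel_measurable borel" by (rule smooth_measurable[OF test_functions_smooth[OF ft]])
  have nx: "norm x > 0" using x by simp
  \<comment> \<open>Agrees with \<open>X\<close> from some index on, but stays in the region served
    by a single annulus for every index, so that one dominating function suffices.\<close>
  define Y where "Y k = (if norm (X k - x) < norm x / 2 then X k else x)" for k
  have ev: "eventually (\<lambda>k. Y k = X k) sequentially"
    using tendstoD[OF X, of "norm x / 2"] nx by (auto simp: Y_def dist_norm elim: eventually_mono)
  have Yx: "Y \<longlonglongrightarrow> x" using X tendsto_cong[OF ev] by blast
  have Yn: "norm x / 2 \<le> norm (Y k)" "norm (Y k) \<le> 2 * norm x" for k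
    using norm_triangle_ineq3[of "X k" x] nx by (auto simp: Y_def abs_le_iff)
  let ?A = "{y::real^'n. norm x / (2 * r2) \<le> norm y \<and> norm y \<le> 2 * norm x / r1}"
  have A: "y \<in> ?A" if "f ((1 / norm y) *\<^sub>R z) \<noteq> 0" "norm x / 2 \<le> norm z" "norm z \<le> 2 * norm x" for y z
  proof -
    have "norm ((1 / norm y) *\<^sub>R z) = norm z / norm y" by simp
    then have n: "r1 \<le> norm z / norm y" "norm z / norm y \<le> r2" using r1(2)[OF that(1)] r2(2)[OF that(1)] by simp_all
    have y: "norm y > 0"
    proof (rule ccontr)
      assume "\<not> norm y > 0"
      then have "norm y = 0" by simp
      then show False using n(1) r1(1) by simp
    qed
    have "r1 * norm y \<le> norm z" "norm z \<le> r2 * norm y" using n y by (auto simp: field_simps)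
    then have "r1 * norm y \<le> 2 * norm x" "norm x \<le> (2 * r2) * norm y" using that by auto
    then show ?thesis using r1(1) r2(1) by (auto simp: field_simps)
  qed
  have int: "integrable lebesgue (\<lambda>y. indicator ?A y *\<^sub>R \<Phi> y)"
    using nx r2(1) by (intro locally_integrable_annulus[OF \<Phi>]) simp
  have eq: "hausdorff_op \<Phi> f z = (LINT y|lebesgue. (indicator ?A y *\<^sub>R \<Phi> y) * f ((1 / norm y) *\<^sub>R z))"
    if "norm x / 2 \<le> norm z" "norm z \<le> 2 * norm x" for z
    unfolding hausdorff_op_def
  proof (intro Bochner_Integration.integral_cong refl)
    fix y
    show "\<Phi> y * f ((1 / norm y) *\<^sub>R z) = (indicator ?A y *\<^sub>R \<Phi> y) * f ((1 / norm y) *\<^sub>R z)"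
      using A[of y z] that by (cases "f ((1 / norm y) *\<^sub>R z) = 0") auto
  qed
  have m: "(\<lambda>y. (indicator ?A y *\<^sub>R \<Phi> y) * f ((1 / norm y) *\<^sub>R z)) \<in> borel_measurable lebesgue" for z
    by (rule borel_measurable_times[OF borel_measurable_integrable[OF int] borel_measurable_lebesgueI]) measurable
  have "(\<lambda>k. LINT y|lebesgue. (indicator ?A y *\<^sub>R \<Phi> y) * f ((1 / norm y) *\<^sub>R Y k)) \<longlonglongrightarrow> (LINT y|lebesgue. (indicator ?A y *\<^sub>R \<Phi> y) * f ((1 / norm y) *\<^sub>R x))"
  proof (rule integral_dominated_convergence[where w = "\<lambda>y. norm (indicator ?A y *\<^sub>R \<Phi> y) * B"])
    show "integrable lebesgue (\<lambda>y. norm (indicator ?A y *\<^sub>R \<Phi> y) * B)" by (intro integrable_mult_left integrable_norm int)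
    show "AE y in lebesgue. (\<lambda>k. (indicator ?A y *\<^sub>R \<Phi> y) * f ((1 / norm y) *\<^sub>R Y k)) \<longlonglongrightarrow> (indicator ?A y *\<^sub>R \<Phi> y) * f ((1 / norm y) *\<^sub>R x)"
    proof (rule AE_I2)
      fix y :: "real^'n"
      have l: "(\<lambda>k. (1 / norm y) *\<^sub>R Y k) \<longlonglongrightarrow> (1 / norm y) *\<^sub>R x" by (intro tendsto_intros Yx)
      have "isCont f ((1 / norm y) *\<^sub>R x)"
        using smooth_continuous[OF test_functions_smooth[OF ft], of UNIV] by (simp add: continuous_on_eq_continuous_at)
      then show "(\<lambda>k. (indicator ?A y *\<^sub>R \<Phi> y) * f ((1 / norm y) *\<^sub>R Y k)) \<longlonglongrightarrow> (indicator ?A y *\<^sub>R \<Phi> y) * f ((1 / norm y) *\<^sub>R x)"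
        by (intro tendsto_mult tendsto_const isCont_tendsto_compose[OF _ l])
    qed
    show "AE y in lebesgue. norm ((indicator ?A y *\<^sub>R \<Phi> y) * f ((1 / norm y) *\<^sub>R Y k)) \<le> norm (indicator ?A y *\<^sub>R \<Phi> y) * B" for k
      unfolding norm_mult by (intro AE_I2 mult_left_mono B) auto
  qed (rule m)+
  then have "(\<lambda>k. hausdorff_op \<Phi> f (Y k)) \<longlonglongrightarrow> hausdorff_op \<Phi> f x" using Yn nx by (simp add: eq)
  moreover have "eventually (\<lambda>k. hausdorff_op \<Phi> f (Y k) = hausdorff_op \<Phi> f (X k)) sequentially"
    using ev by eventually_elim simp
  ultimately show "(hausdorff_op \<Phi> f \<circ> X) \<longlonglongrightarrow> hausdorff_op \<Phi> f x" unfolding o_def by (simp add: tendsto_cong)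
qed

lemma hausdorff_op_measurable:
  fixes \<Phi> f :: "real ^ 'n::finite \<Rightarrow> complex"
  assumes "locally_integrable_on (- {0}) \<Phi>" "f \<in> test_functions (- {0})"
  shows "hausdorff_op \<Phi> f \<in> borel_measurable borel"
proof -
  have "(\<lambda>x. if x \<in> - {0} then hausdorff_op \<Phi> f x else hausdorff_op \<Phi> f 0) \<in> borel_measurable borel"
    using hausdorff_op_continuous[OF assms]
    by (intro borel_measurable_continuous_on_if continuous_at_imp_continuous_on continuous_on_const) auto
  moreover have "(\<lambda>x. if x \<in> - {0} then hausdorff_op \<Phi> f x else hausdorff_op \<Phi> f 0) = hausdorff_op \<Phi> f" by auto
  ultimately show ?thesis by simp
qed

text \<open>For fixed \<open>x \<noteq> 0\<close> the function \<open>f (x / |y|)\<close> of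
  \<open>y\<close> is continuous and radial, with support in an annulus, hence itself one of the
  weights for which the hypothesis holds.\<close>

lemma zero_operatorI:
  fixes \<Phi> :: "real ^ 'n::finite \<Rightarrow> complex"
  assumes z: "\<And>(\<beta> :: real \<Rightarrow> complex) a1 a2. continuous_on UNIV \<beta> \<Longrightarrow> (\<And>s. \<beta> s \<noteq> 0 \<Longrightarrow> a1 \<le> s \<and> s \<le> a2) \<Longrightarrow> 0 < a1 \<Longrightarrow>
    (LINT y|lebesgue. \<Phi> y * of_real (norm y ^ CARD('n)) * \<beta> (norm y)) = 0"
  shows "zero_operator (hausdorff_op \<Phi>)"
  unfolding zero_operator_def
proof (intro ballI allI)
  fix f :: "real ^ 'n \<Rightarrow> complex" and x assume f: "f \<in> test_functions (- {0})"
  have ft: "f \<in> test_functions UNIV" using f by (simp add: test_functions_off_0_iff)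
  obtain r1 where r1: "r1 > 0" "\<And>x. f x \<noteq> 0 \<Longrightarrow> r1 \<le> norm x" using f by (auto simp: test_functions_off_0_iff)
  obtain r where r: "\<And>x. f x \<noteq> 0 \<Longrightarrow> norm x \<le> r" using ft by (auto simp: test_functions_UNIV_iff)
  define r2 where "r2 = max r 1"
  have r2: "r2 > 0" "\<And>x. f x \<noteq> 0 \<Longrightarrow> norm x \<le> r2" using r by (fastforce simp: r2_def)+
  have f0: "f 0 = 0" using r1 by force
  show "hausdorff_op \<Phi> f x = 0"
  proof (cases "x = 0")
    case True
    then show ?thesis using f0 by (simp add: hausdorff_op_def)
  next
    case False
    then have nx: "norm x > 0" by simp
    \<comment> \<open>The power of \<open>s\<close> cancels the factor \<open>|y|^n\<close> of the
      hypothesis.\<close>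
    define \<beta> where "\<beta> s = (if s > 0 then f ((1 / s) *\<^sub>R x) / of_real (s ^ CARD('n)) else 0)" for s :: real
    have supp: "norm x / r2 \<le> s \<and> s \<le> norm x / r1" if "\<beta> s \<noteq> 0" for s
    proof -
      have s: "s > 0" and "f ((1 / s) *\<^sub>R x) \<noteq> 0" using that by (auto simp: \<beta>_def split: if_splits)
      then have "r1 \<le> norm ((1 / s) *\<^sub>R x)" "norm ((1 / s) *\<^sub>R x) \<le> r2" using r1(2) r2(2) by blast+
      then have "r1 \<le> norm x / s" "norm x / s \<le> r2" using s by auto
      then show ?thesis using s r1(1) r2(1) by (auto simp: field_simps)
    qed
    have c0: "norm x / r2 > 0" using nx r2 by simp
    have "isCont \<beta> s" for s
    proof (cases "s > 0")
      case True
      have fc: "isCont f z" for z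
        using smooth_continuous[OF test_functions_smooth[OF ft], of UNIV] by (simp add: continuous_on_eq_continuous_at)
      have i: "isCont (\<lambda>s. (1 / s) *\<^sub>R x) s"
        by (intro continuous_scaleR continuous_divide continuous_const continuous_ident) (use True in auto)
      have j: "isCont (\<lambda>s. complex_of_real (s ^ CARD('n))) s"
        by (intro continuous_of_real continuous_power continuous_ident)
      have "isCont (\<lambda>s. f ((1 / s) *\<^sub>R x) / of_real (s ^ CARD('n))) s"
        by (rule isCont_divide[OF isCont_o2[OF i fc] j]) (use True in simp)
      moreover have "eventually (\<lambda>t. \<beta> t = f ((1 / t) *\<^sub>R x) / of_real (t ^ CARD('n))) (nhds s)"
        using eventually_nhds_in_open[of "{0<..}" s] True by (auto simp: \<beta>_def elim!: eventually_mono)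
      ultimately show ?thesis by (subst isCont_cong)
    next
      case False
      have "eventually (\<lambda>t. t \<in> {..<norm x / r2}) (nhds s)" using False c0 by (intro eventually_nhds_in_open) auto
      then have "eventually (\<lambda>t. \<beta> t = 0) (nhds s)" by eventually_elim (use supp in force)
      then show ?thesis using isCont_cong[of \<beta> "\<lambda>_. 0" s] by simp
    qed
    then have "continuous_on UNIV \<beta>" by (simp add: continuous_on_eq_continuous_at)
    from z[OF this supp c0] have "(LINT y|lebesgue. \<Phi> y * of_real (norm y ^ CARD('n)) * \<beta> (norm y)) = 0" .
    moreover have "(\<lambda>y::real^'n. \<Phi> y * of_real (norm y ^ CARD('n)) * \<beta> (norm y)) = (\<lambda>y. \<Phi> y * f ((1 / norm y) *\<^sub>R x))"
    proof
      fix y :: "real^'n"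
      show "\<Phi> y * of_real (norm y ^ CARD('n)) * \<beta> (norm y) = \<Phi> y * f ((1 / norm y) *\<^sub>R x)"
        using f0 by (cases "y = 0") (auto simp: \<beta>_def)
    qed
    ultimately show ?thesis unfolding hausdorff_op_def by (simp only:)
  qed
qed

section \<open>Upper bounds for the norms\<close>

text \<open>The multiplier is defined by duality. Moving the convolution from the test function to
  \<open>f\<close> reflects the kernel, which is why \<open>f (z + w)\<close> appears in place of
  \<open>f (z - w)\<close>.\<close>

lemma represents_block:
  fixes m f :: "real ^ 'n::finite \<Rightarrow> complex"
  assumes m: "m \<in> test_functions UNIV" and f: "f \<in> test_functions UNIV"
  shows "represents (\<lambda>z. LINT w|lborel. f (z + w) * fourier m w) (fourier_multiplier m (dist_of_fun f))"
proof -
  let ?K = "fourier m"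
  let ?G = "\<lambda>z. LINT w|lborel. f (z + w) * ?K w"
  have Ki: "integrable lborel ?K" by (rule schwartz_integrable[OF fourier_schwartz[OF m]])
  have Km [measurable]: "?K \<in> borel_measurable borel" by (rule schwartz_measurable[OF fourier_schwartz[OF m]])
  have fm [measurable]: "f \<in> borel_measurable borel" by (rule smooth_measurable[OF test_functions_smooth[OF f]])
  obtain B where B: "\<And>x. norm (f x) \<le> B" "B \<ge> 0" using test_functions_bounded[OF f] by blast
  have Gm [measurable]: "?G \<in> borel_measurable borel" by measurable
  obtain b where b: "\<And>x. norm (?K x) \<le> b"
    using norm_fourier_le[OF test_functions_integrable[OF m]] by blast
  have Gb: "norm (?G z) \<le> B * (LINT w|lborel. norm (?K w))" for z
  proof -
    have "norm (?G z) \<le> (LINT w|lborel. B * norm (?K w))"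
      using Ki B by (intro norm_integral_le) (auto simp: norm_mult intro!: mult_right_mono)
    then show ?thesis by simp
  qed
  show ?thesis unfolding represents_def
  proof
    show "locally_integrable_on UNIV ?G"
      unfolding locally_integrable_on_def lebesgue_on_UNIV_eq
    proof (intro conjI allI impI)
      show "?G \<in> borel_measurable lebesgue" by (rule borel_measurable_lebesgueI) measurable
      fix K :: "(real^'n) set" assume K: "compact K \<and> K \<subseteq> UNIV"
      then have Kf: "emeasure lborel K < \<infinity>" by (intro emeasure_compact_finite) simp
      have Kb: "K \<in> sets borel" using K by (simp add: borel_compact)
      show "set_integrable lebesgue K ?G"
        unfolding set_integrable_def
      proof (rule Bochner_Integration.integrable_bound)
        show "integrable lebesgue (\<lambda>z. (B * (LINT w|lborel. norm (?K w))) * indicator K z)"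
          using Kf Kb by (intro integrable_mult_right integrable_real_indicator) auto
        show "(\<lambda>z. indicator K z *\<^sub>R ?G z) \<in> borel_measurable lebesgue"
          by (intro borel_measurable_lebesgueI borel_measurable_scaleR borel_measurable_indicator Gm Kb)
        show "AE z in lebesgue. norm (indicator K z *\<^sub>R ?G z) \<le> norm ((B * (LINT w|lborel. norm (?K w))) * indicator K z)"
          using Gb order_trans[OF Gb abs_ge_self] by (intro AE_I2) (auto simp: indicator_def)
      qed
    qed
    show "\<forall>\<theta>\<in>test_functions UNIV. fourier_multiplier m (dist_of_fun f) \<theta> = dist_of_fun ?G \<theta>"
    proof
      fix \<theta> :: "real^'n \<Rightarrow> complex" assume \<theta>: "\<theta> \<in> test_functions UNIV"
      have \<theta>m [measurable]: "\<theta> \<in> borel_measurable borel" by (rule smooth_measurable[OF test_functions_smooth[OF \<theta>]])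
      have \<theta>i: "integrable lborel \<theta>" and fi: "integrable lborel f" using \<theta> f by (auto intro: test_functions_integrable)
      have int: "integrable (lborel \<Otimes>\<^sub>M lborel) (\<lambda>(x, z). f x * (?K (x - z) * \<theta> z))"
      proof (rule Bochner_Integration.integrable_bound)
        have "integrable (lborel \<Otimes>\<^sub>M lborel) (\<lambda>(x, z). f x * \<theta> z)"
        proof (rule lborel_pair.Fubini_integrable)
          show "integrable lborel (\<lambda>x. LINT z|lborel. norm (case (x, z) of (x, z) \<Rightarrow> f x * \<theta> z))"
            using fi \<theta>i by (simp add: norm_mult)
          show "AE x in lborel. integrable lborel (\<lambda>z. case (x, z) of (x, z) \<Rightarrow> f x * \<theta> z)" using \<theta>i by simp
        qed measurable
        then show "integrable (lborel \<Otimes>\<^sub>M lborel) (\<lambda>q. b *\<^sub>R (case q of (x, z) \<Rightarrow> f x * \<theta> z))" by (rule integrable_scaleR_right)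
        show "AE q in lborel \<Otimes>\<^sub>M lborel. norm (case q of (x, z) \<Rightarrow> f x * (?K (x - z) * \<theta> z)) \<le> norm (b *\<^sub>R (case q of (x, z) \<Rightarrow> f x * \<theta> z))"
        proof (rule AE_I2)
          fix q :: "(real^'n) \<times> (real^'n)"
          obtain x z where q: "q = (x, z)" by fastforce
          have "norm (?K (x - z)) * (norm (f x) * norm (\<theta> z)) \<le> \<bar>b\<bar> * (norm (f x) * norm (\<theta> z))"
            using b[of "x - z"] by (intro mult_right_mono) auto
          then show "norm (case q of (x, z) \<Rightarrow> f x * (?K (x - z) * \<theta> z)) \<le> norm (b *\<^sub>R (case q of (x, z) \<Rightarrow> f x * \<theta> z))"
            unfolding q by (simp add: norm_mult mult_ac)
        qed
      qed measurable
      have cm: "conv_fun ?K \<theta> \<in> borel_measurable borel"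
        by (rule schwartz_measurable[OF convolution_schwartz[OF m \<theta>i smooth_inv_fourier[OF \<theta>]]])
      have "fourier_multiplier m (dist_of_fun f) \<theta> = (LINT x|lborel. f x * conv_fun ?K \<theta> x)"
        unfolding fourier_multiplier_eq[OF m \<theta>] dist_of_fun_def by (rule lebesgue_integral_eq_lborel[OF borel_measurable_times[OF fm cm]])
      also have "\<dots> = (LINT x|lborel. LINT z|lborel. f x * (?K (x - z) * \<theta> z))"
        unfolding conv_fun_def by (simp only: integral_mult_right_zero)
      also have "\<dots> = (LINT z|lborel. LINT x|lborel. f x * (?K (x - z) * \<theta> z))" by (rule lborel_pair.Fubini_integral[OF int, symmetric])
      also have "\<dots> = (LINT z|lborel. ?G z * \<theta> z)"
      proof (intro Bochner_Integration.integral_cong refl)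
        fix z
        have "(LINT x|lborel. f x * (?K (x - z) * \<theta> z)) = (LINT x|lborel. f x * ?K (x - z)) * \<theta> z"
          by (simp only: mult.assoc[symmetric] integral_mult_left_zero)
        also have "(LINT x|lborel. f x * ?K (x - z)) = (LINT x|lborel. f (x + z) * ?K (x + z - z))"
          by (rule integral_translate[of "\<lambda>x. f x * ?K (x - z)" z, symmetric]) measurable
        also have "\<dots> = ?G z" by (intro Bochner_Integration.integral_cong refl) (simp add: add.commute)
        finally show "(LINT x|lborel. f x * (?K (x - z) * \<theta> z)) = ?G z * \<theta> z" .
      qed
      also have "\<dots> = dist_of_fun ?G \<theta>" unfolding dist_of_fun_def by (rule lebesgue_integral_eq_lborel[OF borel_measurable_times[OF Gm \<theta>m], symmetric])
      finally show "fourier_multiplier m (dist_of_fun f) \<theta> = dist_of_fun ?G \<theta>" .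
    qed
  qed
qed

text \<open>The right-hand side is free of \<open>a\<close>, because a translation of
  \<open>f\<close> translates every block. One finite value therefore bounds the quasi-norms of all
  translates.\<close>

lemma block_sum_translate:
  fixes f \<rho> :: "real ^ 'n::finite \<Rightarrow> complex"
  assumes s: "\<And>j. s j \<in> test_functions UNIV" and f: "f \<in> test_functions UNIV" and \<rho>: "mollifier \<rho>"
  shows "block_sum s p (dist_of_fun (\<lambda>x. f (x - a))) = (\<Sum>j. \<integral>\<^sup>+z. ennreal (norm (LINT w|lborel. f (z + w) * fourier (s j) w) powr p) \<partial>lborel)"
  unfolding block_sum_def
proof (intro suminf_cong)
  fix j
  let ?G = "\<lambda>z. LINT w|lborel. f (z + w) * fourier (s j) w"
  have fm [measurable]: "f \<in> borel_measurable borel" by (rule smooth_measurable[OF test_functions_smooth[OF f]])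
  have Km [measurable]: "fourier (s j) \<in> borel_measurable borel" by (rule schwartz_measurable[OF fourier_schwartz[OF s]])
  have fa: "(\<lambda>x. f (x - a)) \<in> test_functions UNIV" using test_functions_affine[OF f, of 1 "-a"] by simp
  have r: "represents (\<lambda>z. ?G (z - a)) (fourier_multiplier (s j) (dist_of_fun (\<lambda>x. f (x - a))))"
    using represents_block[OF s fa, of j] by (simp add: algebra_simps)
  obtain g where g: "represents g (fourier_multiplier (s j) (dist_of_fun (\<lambda>x. f (x - a))))"
    "dist_abs (fourier_multiplier (s j) (dist_of_fun (\<lambda>x. f (x - a)))) = (\<lambda>x. ennreal (cmod (g x)))"
    using dist_abs_represents[OF r] by blast
  have "AE z in lebesgue. g z = ?G (z - a)" by (rule represents_unique[OF \<rho> g(1) r])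
  then have "(\<integral>\<^sup>+x. epowr (dist_abs (fourier_multiplier (s j) (dist_of_fun (\<lambda>x. f (x - a)))) x) p \<partial>lebesgue)
    = (\<integral>\<^sup>+z. ennreal (norm (?G (z - a)) powr p) \<partial>lebesgue)"
    unfolding g(2) by (intro nn_integral_cong_AE) (auto simp: epowr_ennreal elim!: eventually_mono)
  also have "\<dots> = (\<integral>\<^sup>+z. ennreal (norm (?G (z - a)) powr p) \<partial>lborel)" by (rule nn_integral_completion)
  also have "\<dots> = (\<integral>\<^sup>+z. ennreal (norm (?G z) powr p) \<partial>lborel)"
    using nn_integral_affine[of "\<lambda>z. ennreal (norm (?G z) powr p)" 1 "-a"] by simp
  finally show "(\<integral>\<^sup>+x. epowr (dist_abs (fourier_multiplier (s j) (dist_of_fun (\<lambda>x. f (x - a)))) x) p \<partial>lebesgue)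
    = (\<integral>\<^sup>+z. ennreal (norm (?G z) powr p) \<partial>lborel)" .
qed

section \<open>Decay of averages over translates\<close>

text \<open>Rapid decay compensates for a small \<open>p\<close>: with
  \<open>N p \<ge> n + 2\<close> the \<open>p\<close>-th power is still dominated by an integrable
  weight.\<close>

lemma decay_exponent:
  assumes "0 < p"
  obtains N :: nat where "\<And>(z :: real ^ 'n::finite) c. 0 \<le> c \<Longrightarrow> (c / (1 + norm z) ^ N) powr p \<le> c powr p * (1 / (1 + norm z) ^ (CARD('n) + 2))"
proof -
  obtain N :: nat where N: "real (CARD('n) + 2) / p \<le> real N" using real_arch_simple by blast
  have "(c / (1 + norm z) ^ N) powr p \<le> c powr p * (1 / (1 + norm z) ^ (CARD('n) + 2))" if c: "0 \<le> c" for z :: "real^'n" and c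
  proof -
    have z: "1 + norm z > 0" by (simp add: add_pos_nonneg)
    have "(1 + norm z) ^ (CARD('n) + 2) = (1 + norm z) powr real (CARD('n) + 2)" using z by (rule powr_realpow[symmetric])
    also have "\<dots> \<le> (1 + norm z) powr (real N * p)"
      using N assms by (intro powr_mono) (auto simp: field_simps)
    also have "\<dots> = ((1 + norm z) ^ N) powr p" using z by (simp add: powr_powr[symmetric] powr_realpow)
    finally have le: "(1 + norm z) ^ (CARD('n) + 2) \<le> ((1 + norm z) ^ N) powr p" .
    have "(c / (1 + norm z) ^ N) powr p = c powr p * (1 / ((1 + norm z) ^ N) powr p)"
      using c z by (simp add: powr_divide)
    also have "\<dots> \<le> c powr p * (1 / (1 + norm z) ^ (CARD('n) + 2))"
      using le z by (intro mult_left_mono divide_left_mono) auto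
    finally show ?thesis .
  qed
  then show ?thesis using that by blast
qed

lemma nn_integral_decay_powr:
  fixes G :: "real ^ 'n::finite \<Rightarrow> real"
  assumes N: "\<And>(z :: real ^ 'n) c. 0 \<le> c \<Longrightarrow> (c / (1 + norm z) ^ N) powr p \<le> c powr p * (1 / (1 + norm z) ^ (CARD('n) + 2))"
    and p: "0 < p" and c: "0 \<le> c" and G: "\<And>z. 0 \<le> G z" "\<And>z. G z \<le> c / (1 + norm z) ^ N"
  shows "(\<integral>\<^sup>+z. ennreal (G z powr p) \<partial>lborel) \<le> ennreal (c powr p) * (\<integral>\<^sup>+z. ennreal (1 / (1 + norm (z::real^'n)) ^ (DIM(real^'n) + 2)) \<partial>lborel)"
proof -
  have "(\<integral>\<^sup>+z. ennreal (G z powr p) \<partial>lborel) \<le> (\<integral>\<^sup>+z. ennreal (c powr p) * ennreal (1 / (1 + norm (z::real^'n)) ^ (DIM(real^'n) + 2)) \<partial>lborel)"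
  proof (intro nn_integral_mono)
    fix z :: "real^'n"
    have "G z powr p \<le> (c / (1 + norm z) ^ N) powr p" using G p by (intro powr_mono2) auto
    also have "\<dots> \<le> c powr p * (1 / (1 + norm z) ^ (CARD('n) + 2))" by (rule N[OF c])
    finally show "ennreal (G z powr p) \<le> ennreal (c powr p) * ennreal (1 / (1 + norm z) ^ (DIM(real^'n) + 2))"
      by (subst ennreal_mult'[symmetric]) (auto intro: ennreal_leI)
  qed
  also have "\<dots> = ennreal (c powr p) * (\<integral>\<^sup>+z. ennreal (1 / (1 + norm (z::real^'n)) ^ (DIM(real^'n) + 2)) \<partial>lborel)"
    by (rule nn_integral_cmult) auto
  finally show ?thesis .
qed

lemma schwartz_weight_mult_integrable:
  fixes K :: "real ^ 'n::finite \<Rightarrow> complex"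
  assumes "K \<in> schwartz"
  shows "integrable lborel (\<lambda>w. (c * (1 + norm w)) ^ N * norm (K w))"
  using schwartz_weighted_integrable[OF assms, of N] by (simp add: power_mult_distrib mult.assoc)

text \<open>If \<open>f (z + t w)\<close> is nonzero and \<open>|t| \<le> 1\<close>, then
  \<open>|z| \<le> r + |w|\<close>. Decay in \<open>z\<close> can thus be charged to the Schwartz
  kernel, uniformly in \<open>t\<close>.\<close>

lemma translate_average_decay:
  fixes f K :: "real ^ 'n::finite \<Rightarrow> complex"
  assumes f: "\<And>x. norm (f x) \<le> B" "B \<ge> 0" and r: "\<And>x. f x \<noteq> 0 \<Longrightarrow> norm x \<le> r" "r \<ge> 0" and K: "K \<in> schwartz"
    and t: "\<bar>t\<bar> \<le> 1"
  shows "norm (LINT w|lborel. f (z + t *\<^sub>R w) * K w) \<le> (B * (LINT w|lborel. ((1 + r) * (1 + norm w)) ^ N * norm (K w))) / (1 + norm z) ^ N"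
proof -
  have pos: "(1 + norm z) ^ N > 0" by (simp add: add_pos_nonneg)
  have "norm (LINT w|lborel. f (z + t *\<^sub>R w) * K w) \<le> (LINT w|lborel. (B / (1 + norm z) ^ N) * (((1 + r) * (1 + norm w)) ^ N * norm (K w)))"
  proof (rule norm_integral_le)
    show "integrable lborel (\<lambda>w. (B / (1 + norm z) ^ N) * (((1 + r) * (1 + norm w)) ^ N * norm (K w)))"
      by (intro integrable_mult_right schwartz_weight_mult_integrable[OF K])
    fix w
    show "norm (f (z + t *\<^sub>R w) * K w) \<le> (B / (1 + norm z) ^ N) * (((1 + r) * (1 + norm w)) ^ N * norm (K w))"
    proof (cases "f (z + t *\<^sub>R w) = 0")
      case True
      then show ?thesis using f(2) r(2) pos by simp
    next
      case False
      have "norm z \<le> norm (z + t *\<^sub>R w) + norm (t *\<^sub>R w)" using norm_triangle_ineq4[of "z + t *\<^sub>R w" "t *\<^sub>R w"] by simp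
      also have "\<dots> \<le> r + norm w" using r(1)[OF False] t mult_right_mono[OF t norm_ge_zero[of w]] by (intro add_mono) auto
      also have "1 + \<dots> \<le> (1 + r) * (1 + norm w)" using r(2) by (simp add: algebra_simps)
      finally have "(1 + norm z) ^ N \<le> ((1 + r) * (1 + norm w)) ^ N" by (intro power_mono) auto
      then have "B * (1 + norm z) ^ N \<le> B * ((1 + r) * (1 + norm w)) ^ N" using f(2) by (intro mult_left_mono)
      then have "B \<le> (B / (1 + norm z) ^ N) * ((1 + r) * (1 + norm w)) ^ N" using pos by (simp only: pos_le_divide_eq times_divide_eq_left)
      then have "norm (f (z + t *\<^sub>R w)) \<le> (B / (1 + norm z) ^ N) * ((1 + r) * (1 + norm w)) ^ N" using f(1) order_trans by blast
      then show ?thesis unfolding norm_mult mult.assoc[symmetric] by (intro mult_right_mono) auto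
    qed
  qed
  then show ?thesis by simp
qed

text \<open>The Lipschitz bound on the difference gains a factor \<open>t |w|\<close>; the
  \<open>|w|\<close> is paid for by one more power of the weight. With \<open>t = 2^(-j)\<close> the
  gain makes the sum over the dyadic blocks converge.\<close>

lemma translate_difference_decay:
  fixes f K :: "real ^ 'n::finite \<Rightarrow> complex"
  assumes f: "\<And>x y. norm (f x - f y) \<le> L * norm (x - y)" "L \<ge> 0" and r: "\<And>x. f x \<noteq> 0 \<Longrightarrow> norm x \<le> r" "r \<ge> 0" and K: "K \<in> schwartz"
    and t: "0 \<le> t" "2 * t \<le> 1"
  shows "norm (LINT w|lborel. (f (z + t *\<^sub>R w) - f (z + (2 * t) *\<^sub>R w)) * K w) \<le> (L * t * (LINT w|lborel. ((1 + r) * (1 + norm w)) ^ Suc N * norm (K w))) / (1 + norm z) ^ N"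
proof -
  have pos: "(1 + norm z) ^ N > 0" by (simp add: add_pos_nonneg)
  have "norm (LINT w|lborel. (f (z + t *\<^sub>R w) - f (z + (2 * t) *\<^sub>R w)) * K w) \<le> (LINT w|lborel. (L * t / (1 + norm z) ^ N) * (((1 + r) * (1 + norm w)) ^ Suc N * norm (K w)))"
  proof (rule norm_integral_le)
    show "integrable lborel (\<lambda>w. (L * t / (1 + norm z) ^ N) * (((1 + r) * (1 + norm w)) ^ Suc N * norm (K w)))"
      by (intro integrable_mult_right schwartz_weight_mult_integrable[OF K])
    fix w
    let ?d = "f (z + t *\<^sub>R w) - f (z + (2 * t) *\<^sub>R w)"
    show "norm (?d * K w) \<le> (L * t / (1 + norm z) ^ N) * (((1 + r) * (1 + norm w)) ^ Suc N * norm (K w))"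
    proof (cases "?d = 0")
      case True
      have "0 \<le> (L * t / (1 + norm z) ^ N) * (((1 + r) * (1 + norm w)) ^ Suc N * norm (K w))"
        using f(2) r(2) t(1) pos by (intro mult_nonneg_nonneg divide_nonneg_nonneg zero_le_power) auto
      then show ?thesis unfolding True by simp
    next
      case False
      have "\<exists>s. 0 \<le> s \<and> s \<le> 1 \<and> f (z + s *\<^sub>R w) \<noteq> 0"
      proof (cases "f (z + t *\<^sub>R w) = 0")
        case True
        then have "f (z + (2 * t) *\<^sub>R w) \<noteq> 0" using False by simp
        then show ?thesis using t by (intro exI[of _ "2 * t"]) auto
      qed (use t in \<open>auto intro!: exI[of _ t]\<close>)
      then obtain s where s: "0 \<le> s" "s \<le> 1" "f (z + s *\<^sub>R w) \<noteq> 0" by blast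
      have "norm z \<le> norm (z + s *\<^sub>R w) + norm (s *\<^sub>R w)" using norm_triangle_ineq4[of "z + s *\<^sub>R w" "s *\<^sub>R w"] by simp
      also have "\<dots> \<le> r + norm w" using r(1)[OF s(3)] s mult_right_mono[OF s(2) norm_ge_zero[of w]] by (intro add_mono) auto
      also have "1 + \<dots> \<le> (1 + r) * (1 + norm w)" using r(2) by (simp add: algebra_simps)
      finally have le: "(1 + norm z) ^ N \<le> ((1 + r) * (1 + norm w)) ^ N" by (intro power_mono) auto
      have w: "norm w \<le> (1 + r) * (1 + norm w)" using r(2) by (simp add: algebra_simps add_increasing)
      have "norm ?d \<le> L * norm ((z + t *\<^sub>R w) - (z + (2 * t) *\<^sub>R w))" by (rule f(1))
      also have "(z + t *\<^sub>R w) - (z + (2 * t) *\<^sub>R w) = (- t) *\<^sub>R w" by (simp add: algebra_simps flip: scaleR_add_left)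
      also have "L * norm ((- t) *\<^sub>R w) = L * t * norm w" using t(1) by simp
      finally have d: "norm ?d \<le> L * t * norm w" .
      have "norm w * (1 + norm z) ^ N \<le> ((1 + r) * (1 + norm w)) ^ Suc N"
        unfolding power_Suc using w le r(2) by (intro mult_mono) auto
      then have "(L * t) * (norm w * (1 + norm z) ^ N) \<le> (L * t) * ((1 + r) * (1 + norm w)) ^ Suc N" using f(2) t(1) by (intro mult_left_mono) auto
      then have "L * t * norm w \<le> (L * t / (1 + norm z) ^ N) * ((1 + r) * (1 + norm w)) ^ Suc N"
        using pos by (simp only: pos_le_divide_eq times_divide_eq_left mult.assoc)
      then have "norm ?d \<le> (L * t / (1 + norm z) ^ N) * ((1 + r) * (1 + norm w)) ^ Suc N" using d by linarith
      then show ?thesis unfolding norm_mult mult.assoc[symmetric] by (intro mult_right_mono) auto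
    qed
  qed
  then show ?thesis by simp
qed

text \<open>By scaling, block \<open>j > 0\<close> is the average of
  \<open>f (z + t w) - f (z + 2 t w)\<close> against one fixed kernel with
  \<open>t = 2^(-j)\<close>. The \<open>p\<close>-th powers are then dominated by a geometric series
  of ratio \<open>2^(-p)\<close>.\<close>

lemma dyadic_block_sum_finite:
  fixes f \<kappa> \<rho> :: "real ^ 'n::finite \<Rightarrow> complex"
  assumes p: "0 < p" and f: "f \<in> test_functions UNIV" and \<rho>: "mollifier \<rho>" and \<kappa>: "cutoff \<kappa>"
  shows "\<exists>C::real. \<forall>a. block_sum (dyadic_symbol \<kappa>) p (dist_of_fun (\<lambda>x. f (x - a))) \<le> ennreal C"
proof -
  obtain N :: nat where N: "\<And>(z :: real ^ 'n) c. 0 \<le> c \<Longrightarrow> (c / (1 + norm z) ^ N) powr p \<le> c powr p * (1 / (1 + norm z) ^ (CARD('n) + 2))"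
    using decay_exponent[OF p, where 'n = 'n] by blast
  obtain B where B: "\<And>x. norm (f x) \<le> B" "B \<ge> 0" using test_functions_bounded[OF f] by blast
  obtain L where L: "\<And>x y. norm (f x - f y) \<le> L * norm (x - y)" "L \<ge> 0" using test_functions_lipschitz[OF f] by blast
  obtain r' where r': "\<And>x. f x \<noteq> 0 \<Longrightarrow> norm x \<le> r'" using f by (auto simp: test_functions_UNIV_iff)
  define r where "r = max r' 0"
  have r: "\<And>x. f x \<noteq> 0 \<Longrightarrow> norm x \<le> r" "r \<ge> 0" using r' by (fastforce simp: r_def)+
  have fm [measurable]: "f \<in> borel_measurable borel" by (rule smooth_measurable[OF test_functions_smooth[OF f]])
  define K where "K = fourier \<kappa>"
  have \<kappa>t: "\<kappa> \<in> test_functions UNIV" by (rule cutoffD(1)[OF \<kappa>])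
  have K: "K \<in> schwartz" unfolding K_def by (rule fourier_schwartz[OF \<kappa>t])
  have Km [measurable]: "K \<in> borel_measurable borel" by (rule schwartz_measurable[OF K])
  have \<kappa>m: "\<kappa> \<in> borel_measurable borel" by (rule smooth_measurable[OF test_functions_smooth[OF \<kappa>t]])
  define G where "G j z = (LINT w|lborel. f (z + w) * fourier (dyadic_symbol \<kappa> j) w)" for j z
  have G0: "G 0 z = (LINT w|lborel. f (z + 1 *\<^sub>R w) * K w)" for z
    by (simp add: G_def K_def dyadic_symbol_def[abs_def])
  have Ki: "integrable lborel (\<lambda>w. f (z + t *\<^sub>R w) * K w)" for z t
  proof (rule Bochner_Integration.integrable_bound)
    show "integrable lborel (\<lambda>w. B *\<^sub>R K w)" using schwartz_integrable[OF K] by simp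
    show "AE w in lborel. norm (f (z + t *\<^sub>R w) * K w) \<le> norm (B *\<^sub>R K w)"
      using B by (intro AE_I2) (auto simp: norm_mult intro!: mult_right_mono)
  qed measurable
  have scale: "(LINT w|lborel. f (z + w) * fourier (\<lambda>\<xi>. \<kappa> (t *\<^sub>R \<xi>)) w) = (LINT w|lborel. f (z + t *\<^sub>R w) * K w)" if t: "t > 0" for z t
  proof -
    have "(LINT w|lborel. f (z + w) * fourier (\<lambda>\<xi>. \<kappa> (t *\<^sub>R \<xi>)) w) = (LINT w|lborel. f (z + w) * (of_real (1 / t ^ CARD('n)) * K ((1 / t) *\<^sub>R w)))"
      unfolding fourier_scale[OF \<kappa>m t] K_def ..
    also have "\<dots> = \<bar>t\<bar> ^ DIM(real^'n) *\<^sub>R (LINT w|lborel. f (z + (0 + t *\<^sub>R w)) * (of_real (1 / t ^ CARD('n)) * K ((1 / t) *\<^sub>R (0 + t *\<^sub>R w))))"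
      using t by (intro integral_affine) auto
    also have "\<dots> = (LINT w|lborel. f (z + t *\<^sub>R w) * K w)"
      using t by (simp add: scaleR_conv_of_real[where 'a = complex] mult.left_commute)
    finally show ?thesis .
  qed
  have fKi: "integrable lborel (\<lambda>w. f (z + w) * fourier m w)" if "m \<in> test_functions UNIV" for m z
  proof (rule Bochner_Integration.integrable_bound)
    have [measurable]: "fourier m \<in> borel_measurable borel" by (rule schwartz_measurable[OF fourier_schwartz[OF that]])
    show "integrable lborel (\<lambda>w. B *\<^sub>R fourier m w)" using schwartz_integrable[OF fourier_schwartz[OF that]] by simp
    show "AE w in lborel. norm (f (z + w) * fourier m w) \<le> norm (B *\<^sub>R fourier m w)"
      using B by (intro AE_I2) (auto simp: norm_mult intro!: mult_right_mono)
    show "(\<lambda>w. f (z + w) * fourier m w) \<in> borel_measurable lborel" by measurable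
  qed
  have GS: "G (Suc j) z = (LINT w|lborel. (f (z + (1 / 2 ^ Suc j) *\<^sub>R w) - f (z + (2 * (1 / 2 ^ Suc j)) *\<^sub>R w)) * K w)" for j z
  proof -
    have tf: "(\<lambda>\<xi>. \<kappa> ((1 / 2 ^ Suc j) *\<^sub>R \<xi>)) \<in> test_functions UNIV" "(\<lambda>\<xi>. \<kappa> ((2 * (1 / 2 ^ Suc j)) *\<^sub>R \<xi>)) \<in> test_functions UNIV"
      by (rule cutoff_dilation[OF \<kappa>], simp)+
    have "fourier (dyadic_symbol \<kappa> (Suc j)) w = fourier (\<lambda>\<xi>. \<kappa> ((1 / 2 ^ Suc j) *\<^sub>R \<xi>)) w - fourier (\<lambda>\<xi>. \<kappa> ((2 * (1 / 2 ^ Suc j)) *\<^sub>R \<xi>)) w" for w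
    proof -
      have "dyadic_symbol \<kappa> (Suc j) = (\<lambda>\<xi>. \<kappa> ((1 / 2 ^ Suc j) *\<^sub>R \<xi>) + (-1) * \<kappa> ((2 * (1 / 2 ^ Suc j)) *\<^sub>R \<xi>))"
        by (simp add: dyadic_symbol_def[abs_def])
      then have "fourier (dyadic_symbol \<kappa> (Suc j)) w = fourier (\<lambda>\<xi>. \<kappa> ((1 / 2 ^ Suc j) *\<^sub>R \<xi>)) w + fourier (\<lambda>\<xi>. (-1) * \<kappa> ((2 * (1 / 2 ^ Suc j)) *\<^sub>R \<xi>)) w"
        using fourier_add[OF test_functions_integrable[OF tf(1)] integrable_mult_right[OF test_functions_integrable[OF tf(2)]], of "-1" w] by simp
      then show ?thesis
        unfolding fourier_cmult[OF smooth_measurable[OF test_functions_smooth[OF tf(2)]]] by simp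
    qed
    then have "G (Suc j) z = (LINT w|lborel. f (z + w) * fourier (\<lambda>\<xi>. \<kappa> ((1 / 2 ^ Suc j) *\<^sub>R \<xi>)) w - f (z + w) * fourier (\<lambda>\<xi>. \<kappa> ((2 * (1 / 2 ^ Suc j)) *\<^sub>R \<xi>)) w)"
      unfolding G_def by (simp add: right_diff_distrib)
    also have "\<dots> = (LINT w|lborel. f (z + w) * fourier (\<lambda>\<xi>. \<kappa> ((1 / 2 ^ Suc j) *\<^sub>R \<xi>)) w) - (LINT w|lborel. f (z + w) * fourier (\<lambda>\<xi>. \<kappa> ((2 * (1 / 2 ^ Suc j)) *\<^sub>R \<xi>)) w)"
      by (rule Bochner_Integration.integral_diff[OF fKi[OF tf(1)] fKi[OF tf(2)]])
    also have "\<dots> = (LINT w|lborel. f (z + (1 / 2 ^ Suc j) *\<^sub>R w) * K w) - (LINT w|lborel. f (z + (2 * (1 / 2 ^ Suc j)) *\<^sub>R w) * K w)"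
      by (subst (1 2) scale) auto
    also have "\<dots> = (LINT w|lborel. f (z + (1 / 2 ^ Suc j) *\<^sub>R w) * K w - f (z + (2 * (1 / 2 ^ Suc j)) *\<^sub>R w) * K w)"
      by (rule Bochner_Integration.integral_diff[OF Ki Ki, symmetric])
    finally show ?thesis by (simp only: left_diff_distrib)
  qed
  define I where "I k = (LINT w|lborel. ((1 + r) * (1 + norm w)) ^ k * norm (K w))" for k
  have I0: "I k \<ge> 0" for k unfolding I_def using r(2) by (intro Bochner_Integration.integral_nonneg mult_nonneg_nonneg zero_le_power) auto
  define c where "c = max (B * I N) (L * I (Suc N))"
  have c0: "c \<ge> 0" using B(2) I0 by (simp add: c_def le_max_iff_disj)
  have G_le: "norm (G j z) \<le> (c / 2 ^ j) / (1 + norm z) ^ N" for j z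
  proof (cases j)
    case 0
    have "norm (G 0 z) \<le> (B * I N) / (1 + norm z) ^ N"
      using translate_average_decay[OF B r K, where t = 1 and z = z and N = N] unfolding G0 I_def by simp
    also have "\<dots> \<le> c / (1 + norm z) ^ N" by (intro divide_right_mono) (auto simp: c_def)
    finally show ?thesis using 0 by simp
  next
    case (Suc i)
    have "norm (G (Suc i) z) \<le> (L * (1 / 2 ^ Suc i) * I (Suc N)) / (1 + norm z) ^ N"
      unfolding GS I_def by (rule translate_difference_decay[OF L r K]) auto
    also have "L * (1 / 2 ^ Suc i) * I (Suc N) = (L * I (Suc N)) / 2 ^ Suc i" by simp
    also have "\<dots> / (1 + norm z) ^ N \<le> (c / 2 ^ Suc i) / (1 + norm z) ^ N" by (intro divide_right_mono) (auto simp: c_def)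
    finally show ?thesis using Suc by simp
  qed
  let ?J = "\<integral>\<^sup>+z. ennreal (1 / (1 + norm (z::real^'n)) ^ (DIM(real^'n) + 2)) \<partial>lborel"
  have J: "?J < \<infinity>" by (rule nn_integral_decay)
  have "(\<Sum>j. \<integral>\<^sup>+z. ennreal (norm (G j z) powr p) \<partial>lborel) \<le> (\<Sum>j. ennreal ((c / 2 ^ j) powr p) * ?J)"
    using c0 G_le by (intro suminf_le nn_integral_decay_powr[OF N p]) auto
  also have "\<dots> = (\<Sum>j. ennreal ((c / 2 ^ j) powr p)) * ?J" by simp
  also have "\<dots> < \<infinity>"
  proof -
    have "(c / 2 ^ j) powr p = c powr p * ((1 / 2) powr p) ^ j" for j
    proof -
      have "(c / 2 ^ j) powr p = c powr p * (1 / 2 ^ j) powr p" using c0 powr_mult[of c "1 / 2 ^ j" p] by simp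
      also have "(1 / 2 ^ j) powr p = ((1 / 2) powr p) ^ j"
        by (induction j) (auto simp: powr_mult power_one_over powr_divide)
      finally show ?thesis .
    qed
    moreover have "(1 / 2) powr p < (1::real)" using p by (simp add: powr_divide)
    ultimately have "summable (\<lambda>j. (c / 2 ^ j) powr p)" by (simp add: summable_mult summable_geometric)
    then have "(\<Sum>j. ennreal ((c / 2 ^ j) powr p)) < \<infinity>" by (subst suminf_ennreal2) auto
    then show ?thesis using J by (simp add: ennreal_mult_less_top)
  qed
  finally have "(\<Sum>j. \<integral>\<^sup>+z. ennreal (norm (G j z) powr p) \<partial>lborel) < \<infinity>" .
  then obtain C where C: "(\<Sum>j. \<integral>\<^sup>+z. ennreal (norm (G j z) powr p) \<partial>lborel) = ennreal C"
    by (cases "(\<Sum>j. \<integral>\<^sup>+z. ennreal (norm (G j z) powr p) \<partial>lborel)") auto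
  have "block_sum (dyadic_symbol \<kappa>) p (dist_of_fun (\<lambda>x. f (x - a))) = ennreal C" for a
    unfolding block_sum_translate[OF dyadic_symbol_test_function[OF \<kappa>] f \<rho>] G_def[symmetric] C ..
  then show ?thesis by (intro exI[of _ C]) simp
qed

section \<open>Uniform decompositions\<close>

definition unit_bump :: "(real ^ 'n::finite \<Rightarrow> real) \<Rightarrow> bool" where
  "unit_bump \<eta> \<longleftrightarrow> smooth \<eta> \<and> (\<forall>\<xi>. 0 \<le> \<eta> \<xi>) \<and> (\<forall>\<xi>. infnorm \<xi> \<le> 1/2 \<longrightarrow> \<eta> \<xi> = 1) \<and> (\<forall>\<xi>. infnorm \<xi> \<ge> 3/4 \<longrightarrow> \<eta> \<xi> = 0)"

lemma lattice_point_add: "lattice_point (k + l) = lattice_point k + lattice_point l"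
  by (simp add: lattice_point_def vec_eq_iff)

lemma lattice_point_0 [simp]: "lattice_point 0 = 0"
  by (simp add: lattice_point_def vec_eq_iff)

text \<open>A finite box with all lattice points whose translated bump meets the ball of radius
  \<open>r\<close>; the margin 1 covers the support radius 3/4.\<close>

definition lattice_cube :: "real \<Rightarrow> (int ^ 'n::finite) set" where
  "lattice_cube r = {l. \<forall>i. l $ i \<in> {- \<lceil>r\<rceil> - 1..\<lceil>r\<rceil> + 1}}"

lemma finite_lattice_cube: "finite (lattice_cube r :: (int ^ 'n::finite) set)"
proof -
  let ?F = "PiE (UNIV :: 'n set) (\<lambda>_. {- \<lceil>r\<rceil> - 1..\<lceil>r\<rceil> + 1})"
  have "lattice_cube r \<subseteq> vec_lambda ` ?F"
  proof
    fix l :: "int ^ 'n" assume "l \<in> lattice_cube r"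
    then have "vec_nth l \<in> ?F" by (auto simp: lattice_cube_def)
    then show "l \<in> vec_lambda ` ?F" by (metis vec_nth_inverse imageI)
  qed
  then show ?thesis by (rule finite_subset) (intro finite_imageI finite_PiE finite finite_atLeastAtMost_int)
qed

lemma unit_bump_outside_lattice_cube:
  assumes \<eta>: "unit_bump \<eta>" and \<xi>: "norm \<xi> \<le> r" and l: "l \<notin> lattice_cube r"
  shows "\<eta> (\<xi> - lattice_point l) = 0"
proof -
  obtain i where "l $ i \<notin> {- \<lceil>r\<rceil> - 1..\<lceil>r\<rceil> + 1}" using l by (auto simp: lattice_cube_def)
  then have "l $ i \<le> - \<lceil>r\<rceil> - 2 \<or> \<lceil>r\<rceil> + 2 \<le> l $ i" by auto
  then have "real_of_int (l $ i) \<le> real_of_int (- \<lceil>r\<rceil> - 2) \<or> real_of_int (\<lceil>r\<rceil> + 2) \<le> real_of_int (l $ i)"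
    by (simp only: of_int_le_iff)
  moreover have "\<bar>\<xi> $ i\<bar> \<le> r" using component_le_norm_cart[of \<xi> i] \<xi> by simp
  moreover have "r \<le> real_of_int \<lceil>r\<rceil>" by simp
  ultimately have "3 / 4 \<le> \<bar>\<xi> $ i - real_of_int (l $ i)\<bar>"
    unfolding of_int_diff of_int_minus of_int_add of_int_numeral by (elim disjE) linarith+
  also have "\<dots> \<le> infnorm (\<xi> - lattice_point l)"
    using component_le_infnorm_cart[of "\<xi> - lattice_point l" i] by (simp add: lattice_point_def)
  finally show ?thesis using \<eta> by (simp add: unit_bump_def)
qed

definition bump_sum :: "(real ^ 'n::finite \<Rightarrow> real) \<Rightarrow> real ^ 'n \<Rightarrow> real" where
  "bump_sum \<eta> \<xi> = (\<Sum>\<^sub>\<infinity>l. \<eta> (\<xi> - lattice_point l))"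

lemma bump_sum_eq:
  assumes "unit_bump \<eta>" "norm \<xi> \<le> r"
  shows "bump_sum \<eta> \<xi> = (\<Sum>l\<in>lattice_cube r. \<eta> (\<xi> - lattice_point l))"
proof -
  have "bump_sum \<eta> \<xi> = (\<Sum>\<^sub>\<infinity>l\<in>lattice_cube r. \<eta> (\<xi> - lattice_point l))"
    unfolding bump_sum_def using unit_bump_outside_lattice_cube[OF assms]
    by (intro infsum_cong_neutral) auto
  then show ?thesis by (simp add: finite_lattice_cube)
qed

text \<open>The bump at the nearest lattice point already has the value 1, since rounding changes
  each coordinate by at most 1/2.\<close>

lemma bump_sum_ge_1:
  fixes \<eta> :: "real ^ 'n::finite \<Rightarrow> real"
  assumes \<eta>: "unit_bump \<eta>"
  shows "1 \<le> bump_sum \<eta> \<xi>"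
proof -
  define l :: "int ^ 'n" where "l = (\<chi> i. round (\<xi> $ i))"
  have c: "\<bar>(\<xi> - lattice_point l) $ i\<bar> \<le> 1 / 2" for i
    using of_int_round_abs_le[of "\<xi> $ i"] by (simp add: l_def lattice_point_def abs_minus_commute)
  have "infnorm (\<xi> - lattice_point l) \<le> 1 / 2"
    unfolding infnorm_cart by (intro cSup_least) (use c in auto)
  then have 1: "\<eta> (\<xi> - lattice_point l) = 1" using \<eta> by (simp add: unit_bump_def)
  then have l: "l \<in> lattice_cube (norm \<xi>)"
    using unit_bump_outside_lattice_cube[OF \<eta> order_refl, of l \<xi>] by fastforce
  have "\<eta> (\<xi> - lattice_point l) \<le> (\<Sum>l\<in>lattice_cube (norm \<xi>). \<eta> (\<xi> - lattice_point l))"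
    using \<eta> by (intro member_le_sum l finite_lattice_cube) (auto simp: unit_bump_def)
  then show ?thesis using 1 bump_sum_eq[OF \<eta> order_refl, of \<xi>] by simp
qed

lemma bump_sum_translate: "bump_sum \<eta> (\<xi> - lattice_point k) = bump_sum \<eta> \<xi>"
proof -
  have "bij_betw (\<lambda>l. l + k) UNIV UNIV" by (rule bij_betwI[where g = "\<lambda>l. l - k"]) auto
  from infsum_reindex_bij_betw[OF this, of "\<lambda>l. \<eta> (\<xi> - lattice_point l)"]
  show ?thesis by (simp add: bump_sum_def lattice_point_add algebra_simps)
qed

lemma uniform_symbol_eq: "uniform_symbol \<eta> k \<xi> = \<eta> (\<xi> - lattice_point k) * inverse (bump_sum \<eta> \<xi>)"
  by (simp add: uniform_symbol_def bump_sum_def)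

lemma uniform_symbol_translate: "uniform_symbol \<eta> k \<xi> = uniform_symbol \<eta> 0 (\<xi> - lattice_point k)"
  by (simp add: uniform_symbol_eq bump_sum_translate)

lemma unit_bump_support:
  fixes \<eta> :: "real ^ 'n::finite \<Rightarrow> real"
  assumes "unit_bump \<eta>" "\<eta> \<xi> \<noteq> 0"
  shows "norm \<xi> \<le> CARD('n)"
proof -
  have i: "infnorm \<xi> \<le> 3 / 4" using assms by (force simp: unit_bump_def)
  have n: "real CARD('n) \<ge> 1" using zero_less_card_finite[where 'a = 'n] by linarith
  have "norm \<xi> \<le> sqrt (real CARD('n)) * infnorm \<xi>" using norm_le_infnorm[of \<xi>] by simp
  also have "\<dots> \<le> sqrt (real CARD('n)) * 1" using i by (intro mult_left_mono) auto
  also have "\<dots> \<le> CARD('n)" using n real_sqrt_le_mono[of "real CARD('n)" "(real CARD('n))\<^sup>2"] by (simp add: power2_eq_square)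
  finally show ?thesis .
qed

lemma unit_bump_test_function:
  fixes \<eta> :: "real ^ 'n::finite \<Rightarrow> real"
  assumes "unit_bump \<eta>"
  shows "(\<lambda>\<xi>. complex_of_real (\<eta> \<xi>)) \<in> test_functions UNIV"
  unfolding test_functions_UNIV_iff using assms unit_bump_support[OF assms]
  by (auto simp: unit_bump_def intro!: smooth_of_real exI[of _ "real CARD('n)"])

lemma uniform_symbol_test_function:
  fixes \<eta> :: "real ^ 'n::finite \<Rightarrow> real"
  assumes \<eta>: "unit_bump \<eta>"
  shows "(\<lambda>\<xi>. complex_of_real (uniform_symbol \<eta> k \<xi>)) \<in> test_functions UNIV"
proof -
  have aff: "(\<lambda>\<xi>. complex_of_real (\<eta> (\<xi> - lattice_point l))) \<in> test_functions UNIV" for l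
    using test_functions_affine[OF unit_bump_test_function[OF \<eta>], of 1 "- lattice_point l"] by simp
  have "smooth (\<lambda>\<xi>. complex_of_real (bump_sum \<eta> \<xi>))"
  proof (rule smooth_local)
    fix x :: "real ^ 'n"
    show "\<exists>U g. open U \<and> x \<in> U \<and> smooth g \<and> (\<forall>y\<in>U. complex_of_real (bump_sum \<eta> y) = g y)"
    proof (intro exI conjI ballI)
      show "smooth (\<lambda>y. \<Sum>l\<in>lattice_cube (norm x + 1). complex_of_real (\<eta> (y - lattice_point l)))"
        by (intro smooth_sum test_functions_smooth[OF aff])
      show "x \<in> ball 0 (norm x + 1)" by simp
      fix y :: "real ^ 'n" assume "y \<in> ball 0 (norm x + 1)"
      then show "complex_of_real (bump_sum \<eta> y) = (\<Sum>l\<in>lattice_cube (norm x + 1). complex_of_real (\<eta> (y - lattice_point l)))"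
        using bump_sum_eq[OF \<eta>, of y "norm x + 1"] by simp
    qed simp
  qed
  moreover have "complex_of_real (bump_sum \<eta> \<xi>) \<noteq> 0" for \<xi> using bump_sum_ge_1[OF \<eta>, of \<xi>] by auto
  ultimately have "smooth (\<lambda>\<xi>. inverse (complex_of_real (bump_sum \<eta> \<xi>)))" by (rule smooth_inverse)
  from test_functions_mult(1)[OF aff this, of k] show ?thesis by (simp add: uniform_symbol_eq)
qed

lemma uniform_symbol_sum:
  assumes \<eta>: "unit_bump \<eta>" and \<xi>: "norm \<xi> \<le> r"
  shows "(\<Sum>k\<in>lattice_cube r. uniform_symbol \<eta> k \<xi>) = 1"
proof -
  have "(\<Sum>k\<in>lattice_cube r. uniform_symbol \<eta> k \<xi>) = bump_sum \<eta> \<xi> * inverse (bump_sum \<eta> \<xi>)"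
    unfolding uniform_symbol_eq bump_sum_eq[OF assms] by (simp add: sum_distrib_right)
  then show ?thesis using bump_sum_ge_1[OF \<eta>, of \<xi>] by simp
qed

text \<open>Shifting a symbol multiplies its kernel by a character, so estimates of absolute values
  hold for all uniform blocks with the same constants.\<close>

lemma fourier_shift:
  fixes m :: "real ^ 'n::finite \<Rightarrow> complex"
  assumes "m \<in> test_functions UNIV"
  shows "norm (fourier (\<lambda>\<xi>. m (\<xi> - a)) w) = norm (fourier m w)"
  using fourier_translate[OF smooth_measurable[OF test_functions_smooth[OF assms]], of "-a" w]
  by (simp add: norm_mult character_def)

lemma epowr_epowr: "p \<noteq> 0 \<Longrightarrow> epowr (epowr a (1 / p)) p = a"
  by (cases a) (auto simp: epowr_def powr_powr)

text \<open>Block sums are indexed by natural numbers, so the lattice is enumerated. It is a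
  countable union of finite boxes, and it is infinite.\<close>

lemma obtain_lattice_enumeration:
  obtains e :: "nat \<Rightarrow> int ^ 'n::finite" where "bij e"
proof -
  have "inj (\<lambda>m::int. (\<chi> i. m) :: int ^ 'n)" by (auto simp: inj_def vec_eq_iff)
  then have "infinite (range (\<lambda>m::int. (\<chi> i. m) :: int ^ 'n))" using infinite_UNIV_int by (simp add: finite_image_iff)
  then have inf: "infinite (UNIV :: (int ^ 'n) set)" by (rule infinite_super[OF subset_UNIV])
  have "(UNIV :: (int ^ 'n) set) \<subseteq> (\<Union>r::nat. lattice_cube (real r))"
  proof
    fix l :: "int ^ 'n"
    define m where "m = nat (\<Sum>i\<in>UNIV. \<bar>l $ i\<bar>)"
    have "\<bar>l $ i\<bar> \<le> int m" for i
    proof -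
      have "\<bar>l $ i\<bar> \<le> (\<Sum>i\<in>UNIV. \<bar>l $ i\<bar>)" by (intro member_le_sum) auto
      then show ?thesis by (simp add: m_def)
    qed
    then have "l \<in> lattice_cube (real m)" by (auto simp: lattice_cube_def abs_le_iff) (smt (verit))+
    then show "l \<in> (\<Union>r::nat. lattice_cube (real r))" by blast
  qed
  then have "countable (UNIV :: (int ^ 'n) set)"
    by (rule countable_subset) (auto intro: countable_finite finite_lattice_cube)
  from bij_betw_from_nat_into[OF this inf] show ?thesis by (rule that)
qed

text \<open>The terms are nonnegative extended reals, so the unordered sum over the lattice is the
  series along any enumeration.\<close>

lemma modulation_norm_eq:
  assumes e: "bij e" and p: "p \<noteq> 0"
  shows "modulation_norm \<eta> p u = epowr (block_sum (\<lambda>j \<xi>. of_real (uniform_symbol \<eta> (e j) \<xi>)) p u) (1 / p)"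
proof -
  define F where "F k = (\<integral>\<^sup>+x. epowr (dist_abs (uniform_block \<eta> k u) x) p \<partial>lebesgue)" for k
  have "(\<Sum>\<^sub>\<infinity>k. F k) = (\<Sum>\<^sub>\<infinity>j. F (e j))" by (rule infsum_reindex_bij_betw[OF e, symmetric])
  also have "\<dots> = (\<Sum>j. F (e j))"
    by (rule sums_unique[OF has_sum_imp_sums[OF has_sum_infsum]]) (rule nonneg_summable_on_complete, simp)
  finally have "(\<Sum>\<^sub>\<infinity>k. F k) = (\<Sum>j. F (e j))" .
  then show ?thesis
    unfolding modulation_norm_def Lp_norm_def epowr_epowr[OF p] block_sum_def F_def uniform_block_def by simp
qed

text \<open>Along an arbitrary enumeration the partial sums do not telescope; convergence comes from
  \<open>block_limit\<close>, which draws it from finiteness of the block sum.\<close>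

lemma uniform_limit:
  fixes u :: "'n::finite functional" and D \<rho> \<kappa> :: "real ^ 'n \<Rightarrow> complex"
  assumes p: "0 < p" "p < 1" and u: "u \<in> tempered_distributions"
    and D: "represents D u" "D \<in> borel_measurable borel" "isCont D x"
    and \<rho>: "mollifier \<rho>" and \<kappa>: "cutoff \<kappa>" and \<eta>: "unit_bump \<eta>" and e: "bij e"
    and fin: "block_sum (\<lambda>j \<xi>. of_real (uniform_symbol \<eta> (e j) \<xi>)) p u < \<infinity>"
  shows "(\<lambda>J. \<Sum>j<J. u (\<lambda>y. fourier (\<lambda>\<xi>. of_real (uniform_symbol \<eta> (e j) \<xi>)) (y - x))) \<longlonglongrightarrow> D x"
proof -
  let ?s = "\<lambda>j \<xi>. complex_of_real (uniform_symbol \<eta> (e j) \<xi>)"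
  \<comment> \<open>A widened cutoff, equal to 1 on the ball of radius \<open>n\<close> that
    contains the support of the bump. Its lattice translates reproduce the symbols, and their
    kernels have the same absolute value, so that Bernstein's inequality holds with one constant for
    all blocks.\<close>
  define L where "L \<xi> = \<kappa> ((1 / real CARD('n)) *\<^sub>R \<xi>)" for \<xi>
  have L: "L \<in> test_functions UNIV" unfolding L_def[abs_def] by (rule cutoff_dilation[OF \<kappa>]) simp
  show ?thesis
  proof (rule block_limit[OF p u D \<rho> \<kappa>, where s = ?s and l = "\<lambda>j \<xi>. L (\<xi> - lattice_point (e j))"])
    show "?s j \<in> test_functions UNIV" for j by (rule uniform_symbol_test_function[OF \<eta>])
    show "(\<lambda>\<xi>. L (\<xi> - lattice_point (e j))) \<in> test_functions UNIV" for j
      using test_functions_affine[OF L, of 1 "- lattice_point (e j)"] by simp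
    show "?s j \<xi> * L (\<xi> - lattice_point (e j)) = ?s j \<xi>" for j \<xi>
    proof (cases "\<eta> (\<xi> - lattice_point (e j)) = 0")
      case False
      from unit_bump_support[OF \<eta> False] have "norm ((1 / real CARD('n)) *\<^sub>R (\<xi> - lattice_point (e j))) \<le> 1" by simp
      then show ?thesis by (simp add: L_def cutoffD(2)[OF \<kappa>])
    qed (simp add: uniform_symbol_eq)
    show "\<exists>A. \<forall>j w. (1 + norm w) ^ N * norm (fourier (\<lambda>\<xi>. L (\<xi> - lattice_point (e j))) w) \<le> A" for N
      unfolding fourier_shift[OF L] using fourier_decay[OF L, of N] by blast
    show "\<exists>I. finite I \<and> (\<forall>\<xi>. norm \<xi> \<le> r \<longrightarrow> (\<Sum>j\<in>I. ?s j \<xi>) = 1 \<and> (\<forall>j. j \<notin> I \<longrightarrow> ?s j \<xi> = 0))" for r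
    proof (intro exI conjI allI impI)
      have b: "bij_betw e (e -` lattice_cube r) (lattice_cube r)"
        using e by (auto simp: bij_def bij_betw_def inj_on_def surj_image_vimage_eq)
      then show "finite (e -` lattice_cube r)" using bij_betw_finite finite_lattice_cube by blast
      fix \<xi> :: "real ^ 'n" assume \<xi>: "norm \<xi> \<le> r"
      have "(\<Sum>j\<in>e -` lattice_cube r. uniform_symbol \<eta> (e j) \<xi>) = (\<Sum>k\<in>lattice_cube r. uniform_symbol \<eta> k \<xi>)"
        by (rule sum.reindex_bij_betw[OF b])
      then show "(\<Sum>j\<in>e -` lattice_cube r. ?s j \<xi>) = 1"
        unfolding uniform_symbol_sum[OF \<eta> \<xi>] by (simp flip: of_real_sum)
      fix j assume "j \<notin> e -` lattice_cube r"
      then show "?s j \<xi> = 0" using unit_bump_outside_lattice_cube[OF \<eta> \<xi>] by (simp add: uniform_symbol_eq)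
    qed
  qed (rule fin)
qed

section \<open>Summation over the lattice and modulation blocks of a bump\<close>

text \<open>An integral test: up to a constant factor, each term is bounded by the integral of the
  continuous weight over the unit cube at its lattice point.\<close>

lemma lattice_sum_finite:
  fixes e :: "nat \<Rightarrow> int ^ 'n::finite"
  assumes e: "bij e"
  shows "(\<Sum>j. ennreal (1 / (1 + norm (lattice_point (e j))) ^ (CARD('n) + 2))) < \<infinity>"
proof -
  let ?m = "CARD('n) + 2"
  \<comment> \<open>On the unit cube at a lattice point \<open>k\<close>, \<open>1 + |x|\<close> is
    at most \<open>n + 1\<close> times \<open>1 + |k|\<close>.\<close>
  let ?c = "real (CARD('n) + 1) ^ ?m"
  let ?h = "\<lambda>x::real^'n. ennreal (1 / (1 + norm x) ^ ?m)"
  \<comment> \<open>Open cubes are disjoint, because the floors of the coordinates recover the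
    lattice point.\<close>
  define Q where "Q j = box (lattice_point (e j)) (lattice_point (e j) + One)" for j
  have One: "One \<bullet> b = 1" if "b \<in> Basis" for b :: "real^'n" using that by (simp add: inner_sum_left inner_Basis)
  have nth: "One $ i = (1::real)" for i :: 'n using One[of "axis i 1"] by (simp only: cart_eq_inner_axis axis_in_Basis_iff) simp
  have Q: "\<lfloor>x $ i\<rfloor> = e j $ i" "0 < x $ i - lattice_point (e j) $ i" "x $ i - lattice_point (e j) $ i < 1" if "x \<in> Q j" for x j i
  proof -
    have *: "real_of_int (e j $ i) < x $ i" "x $ i < real_of_int (e j $ i) + 1"
      using that by (auto simp: Q_def mem_box_cart lattice_point_def nth simp del: sum_component)
    then show "\<lfloor>x $ i\<rfloor> = e j $ i" by (simp add: floor_eq_iff)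
    show "0 < x $ i - lattice_point (e j) $ i" "x $ i - lattice_point (e j) $ i < 1"
      using * by (auto simp: lattice_point_def)
  qed
  have dis: "disjoint_family Q"
    unfolding disjoint_family_on_def
  proof (intro ballI impI)
    fix j k :: nat assume "j \<noteq> k"
    then have "e j \<noteq> e k" using e by (auto simp: bij_def inj_def)
    then show "Q j \<inter> Q k = {}" using Q(1) by (auto simp: vec_eq_iff) metis
  qed
  have Qm: "Q j \<in> sets lborel" for j by (simp add: Q_def)
  have em: "emeasure lborel (Q j) = 1" for j
    unfolding Q_def by (subst emeasure_lborel_box) (auto simp: inner_add_left One)
  have le: "ennreal (1 / (1 + norm (lattice_point (e j))) ^ ?m) \<le> ennreal ?c * ?h x" if x: "x \<in> Q j" for j x
  proof -
    have "norm (x - lattice_point (e j)) \<le> (\<Sum>i\<in>UNIV. \<bar>(x - lattice_point (e j)) $ i\<bar>)" by (rule norm_le_l1_cart)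
    also have "\<dots> \<le> (\<Sum>i\<in>(UNIV::'n set). 1)"
      by (intro sum_mono) (use Q(2,3)[OF x] in \<open>auto simp: abs_le_iff intro: less_imp_le\<close>, smt (verit))
    finally have "norm (x - lattice_point (e j)) \<le> real CARD('n)" by simp
    then have "1 + norm x \<le> 1 + norm (lattice_point (e j)) + real CARD('n)"
      using norm_triangle_ineq2[of x "lattice_point (e j)"] by linarith
    also have "\<dots> \<le> real (CARD('n) + 1) * (1 + norm (lattice_point (e j)))" by (simp add: algebra_simps)
    finally have "(1 + norm x) ^ ?m \<le> (real (CARD('n) + 1) * (1 + norm (lattice_point (e j)))) ^ ?m" by (intro power_mono) auto
    then have "(1 + norm x) ^ ?m \<le> ?c * (1 + norm (lattice_point (e j))) ^ ?m" by (simp only: power_mult_distrib)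
    moreover have "(1 + norm x) ^ ?m > 0" "(1 + norm (lattice_point (e j))) ^ ?m > 0" by (intro zero_less_power add_pos_nonneg; simp)+
    moreover have "1 / b \<le> c * (1 / a)" if "a \<le> c * b" "a > 0" "b > 0" for a b c :: real using that by (simp add: field_simps)
    ultimately have "1 / (1 + norm (lattice_point (e j))) ^ ?m \<le> ?c * (1 / (1 + norm x) ^ ?m)" by blast
    then show ?thesis by (subst ennreal_mult'[symmetric]) (auto intro: ennreal_leI)
  qed
  have "(\<Sum>j. ennreal (1 / (1 + norm (lattice_point (e j))) ^ ?m)) = (\<Sum>j. \<integral>\<^sup>+x. ennreal (1 / (1 + norm (lattice_point (e j))) ^ ?m) * indicator (Q j) x \<partial>lborel)"
    by (simp only: nn_integral_cmult_indicator[OF Qm] em mult_1_right)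
  also have "\<dots> \<le> (\<Sum>j. \<integral>\<^sup>+x. (ennreal ?c * ?h x) * indicator (Q j) x \<partial>lborel)"
    using le by (intro suminf_le nn_integral_mono) (auto simp: indicator_def)
  also have "\<dots> = (\<integral>\<^sup>+x. (\<Sum>j. (ennreal ?c * ?h x) * indicator (Q j) x) \<partial>lborel)"
    by (rule nn_integral_suminf[symmetric]) (simp add: Q_def)
  also have "\<dots> \<le> (\<integral>\<^sup>+x. ennreal ?c * ?h x \<partial>lborel)"
  proof (intro nn_integral_mono)
    fix x
    show "(\<Sum>j. (ennreal ?c * ?h x) * indicator (Q j) x) \<le> ennreal ?c * ?h x"
    proof (cases "\<exists>i. x \<in> Q i")
      case True
      then obtain i where "x \<in> Q i" by blast
      from suminf_cmult_indicator[OF dis this, of "\<lambda>_. ennreal ?c * ?h x"] show ?thesis by simp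
    qed auto
  qed
  also have "\<dots> = ennreal ?c * (\<integral>\<^sup>+x. ?h x \<partial>lborel)" by (rule nn_integral_cmult) auto
  also have "\<dots> < \<infinity>" using nn_integral_decay[where 'a = "real^'n"] by (simp add: ennreal_mult_less_top)
  finally show ?thesis .
qed

text \<open>Integrating over \<open>z\<close> needs decay in space, which comes from the compact
  support of \<open>f\<close>; summing over the lattice needs decay in frequency, which comes from
  its smoothness. Both have to be present in one bound.\<close>

lemma uniform_block_sum_finite:
  fixes f \<rho> :: "real ^ 'n::finite \<Rightarrow> complex"
  assumes p: "0 < p" and f: "f \<in> test_functions UNIV" and \<rho>: "mollifier \<rho>" and \<eta>: "unit_bump \<eta>" and e: "bij e"
  shows "\<exists>C::real. \<forall>a. block_sum (\<lambda>j \<xi>. of_real (uniform_symbol \<eta> (e j) \<xi>)) p (dist_of_fun (\<lambda>x. f (x - a))) \<le> ennreal C"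
proof -
  obtain M :: nat where M: "\<And>(z :: real ^ 'n) c. 0 \<le> c \<Longrightarrow> (c / (1 + norm z) ^ M) powr p \<le> c powr p * (1 / (1 + norm z) ^ (CARD('n) + 2))"
    using decay_exponent[OF p, where 'n = 'n] by blast
  obtain B where B: "\<And>x. norm (f x) \<le> B" "B \<ge> 0" using test_functions_bounded[OF f] by blast
  obtain r' where r': "\<And>x. f x \<noteq> 0 \<Longrightarrow> norm x \<le> r'" using f by (auto simp: test_functions_UNIV_iff)
  define r where "r = max r' 0"
  have r: "\<And>x. f x \<noteq> 0 \<Longrightarrow> norm x \<le> r" "r \<ge> 0" using r' by (fastforce simp: r_def)+
  have fm [measurable]: "f \<in> borel_measurable borel" by (rule smooth_measurable[OF test_functions_smooth[OF f]])
  \<comment> \<open>Twice the exponent, since only the square root of each of the two bounds is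
    used.\<close>
  let ?N = "M + M"
  define s where "s = (\<lambda>j \<xi>. complex_of_real (uniform_symbol \<eta> (e j) \<xi>))"
  define S where "S = (\<lambda>\<xi>. complex_of_real (uniform_symbol \<eta> 0 \<xi>))"
  have S: "S \<in> test_functions UNIV" unfolding S_def by (rule uniform_symbol_test_function[OF \<eta>])
  have Sm [measurable]: "S \<in> borel_measurable borel" by (rule smooth_measurable[OF test_functions_smooth[OF S]])
  have st: "s j \<in> test_functions UNIV" for j unfolding s_def by (rule uniform_symbol_test_function[OF \<eta>])
  have sS: "s j = (\<lambda>\<xi>. S (\<xi> - lattice_point (e j)))" for j
    unfolding s_def S_def by (rule ext) (subst uniform_symbol_translate, rule refl)
  have sn: "norm (fourier (s j) w) = norm (fourier S w)" for j w unfolding sS by (rule fourier_shift[OF S])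
  define G where "G j z = (LINT w|lborel. f (z + w) * fourier (s j) w)" for j z
  define I where "I = (LINT w|lborel. ((1 + r) * (1 + norm w)) ^ ?N * norm (fourier S w))"
  have G1: "norm (G j z) \<le> (B * I) / (1 + norm z) ^ ?N" for j z
    using translate_average_decay[OF B r fourier_schwartz[OF st], where t = 1 and z = z and N = ?N]
    unfolding G_def I_def sn by simp
  obtain A where A: "\<And>\<xi>. (1 + norm \<xi>) ^ ?N * norm (fourier f \<xi>) \<le> A" using fourier_decay[OF f] by blast
  have A0: "A \<ge> 0" using order_trans[OF norm_ge_zero, of "fourier f 0" A] A[of 0] by simp
  define I' where "I' = (LINT w|lborel. (1 + norm w) ^ ?N * norm (S w))"
  \<comment> \<open>The multiplication formula moves the transform from the symbol to
    \<open>f\<close>. There the shift by \<open>z\<close> is a mere character, so the bound is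
    uniform in \<open>z\<close>, and the decay of \<open>fourier f\<close> near the lattice point
    gives the decay in frequency.\<close>
  have G2: "norm (G j z) \<le> (A * I') / (1 + norm (lattice_point (e j))) ^ ?N" for j z
  proof -
    let ?k = "lattice_point (e j)"
    have kp: "(1 + norm ?k) ^ ?N > 0" by (intro zero_less_power add_pos_nonneg) auto
    have fz: "(\<lambda>w. f (w + z)) \<in> test_functions UNIV" using test_functions_affine[OF f, of 1 z] by simp
    have "G j z = (LINT w|lborel. f (w + z) * fourier (s j) w)" unfolding G_def by (simp add: add.commute)
    also have "\<dots> = (LINT \<xi>|lborel. fourier (\<lambda>w. f (w + z)) \<xi> * s j \<xi>)"
      by (rule fourier_multiplication_formula[OF test_functions_integrable[OF fz] test_functions_integrable[OF st], symmetric])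
    also have "norm \<dots> \<le> (LINT \<xi>|lborel. (A / (1 + norm ?k) ^ ?N) * ((1 + norm (\<xi> - ?k)) ^ ?N * norm (S (\<xi> - ?k))))"
    proof (rule norm_integral_le)
      have "integrable lborel (\<lambda>w. (1 + norm w) ^ ?N * norm (S w))" by (rule schwartz_weighted_integrable[OF test_functions_schwartz[OF S]])
      then have "integrable lborel (\<lambda>\<xi>. (1 + norm (\<xi> - ?k)) ^ ?N * norm (S (\<xi> - ?k)))"
        using integrable_affine[of "\<lambda>w. (1 + norm w) ^ ?N * norm (S w)" 1 "- ?k"] by simp
      then show "integrable lborel (\<lambda>\<xi>. (A / (1 + norm ?k) ^ ?N) * ((1 + norm (\<xi> - ?k)) ^ ?N * norm (S (\<xi> - ?k))))" by (rule integrable_mult_right)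
      fix \<xi> :: "real ^ 'n"
      have "norm ?k \<le> norm \<xi> + norm (\<xi> - ?k)" using norm_triangle_ineq4[of \<xi> "\<xi> - ?k"] by simp
      then have "1 + norm ?k \<le> (1 + norm \<xi>) * (1 + norm (\<xi> - ?k))"
        using mult_nonneg_nonneg[OF norm_ge_zero[of \<xi>] norm_ge_zero[of "\<xi> - ?k"]]
        unfolding distrib_left distrib_right mult_1_left mult_1_right by linarith
      then have "(1 + norm ?k) ^ ?N \<le> (1 + norm \<xi>) ^ ?N * (1 + norm (\<xi> - ?k)) ^ ?N"
        unfolding power_mult_distrib[symmetric] by (intro power_mono) auto
      then have "norm (fourier f \<xi>) * (1 + norm ?k) ^ ?N \<le> norm (fourier f \<xi>) * ((1 + norm \<xi>) ^ ?N * (1 + norm (\<xi> - ?k)) ^ ?N)"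
        by (intro mult_left_mono) auto
      also have "\<dots> = ((1 + norm \<xi>) ^ ?N * norm (fourier f \<xi>)) * (1 + norm (\<xi> - ?k)) ^ ?N" by (simp only: mult.commute mult.left_commute)
      also have "\<dots> \<le> A * (1 + norm (\<xi> - ?k)) ^ ?N" by (rule mult_right_mono[OF A]) simp
      finally have *: "norm (fourier f \<xi>) \<le> (A / (1 + norm ?k) ^ ?N) * (1 + norm (\<xi> - ?k)) ^ ?N"
        using kp by (simp only: pos_le_divide_eq times_divide_eq_left)
      have "norm (fourier (\<lambda>w. f (w + z)) \<xi> * s j \<xi>) = norm (fourier f \<xi>) * norm (S (\<xi> - ?k))"
        unfolding fourier_translate[OF fm] sS by (simp add: norm_mult character_def)
      also have "\<dots> \<le> ((A / (1 + norm ?k) ^ ?N) * (1 + norm (\<xi> - ?k)) ^ ?N) * norm (S (\<xi> - ?k))"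
        by (rule mult_right_mono[OF *]) simp
      finally show "norm (fourier (\<lambda>w. f (w + z)) \<xi> * s j \<xi>) \<le> (A / (1 + norm ?k) ^ ?N) * ((1 + norm (\<xi> - ?k)) ^ ?N * norm (S (\<xi> - ?k)))"
        by (simp only: mult.assoc)
    qed
    also have "\<dots> = (A / (1 + norm ?k) ^ ?N) * (LINT \<xi>|lborel. (1 + norm (\<xi> - ?k)) ^ ?N * norm (S (\<xi> - ?k)))"
      by (rule integral_mult_right_zero)
    also have "(LINT \<xi>|lborel. (1 + norm (\<xi> - ?k)) ^ ?N * norm (S (\<xi> - ?k))) = I'"
      using integral_translate[of "\<lambda>w. (1 + norm w) ^ ?N * norm (S w)" "- ?k"] unfolding I'_def by simp
    finally show ?thesis by simp
  qed
  define c where "c = max (B * I) (A * I')"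
  have "I' \<ge> 0" unfolding I'_def by (intro Bochner_Integration.integral_nonneg mult_nonneg_nonneg zero_le_power) auto
  then have c0: "c \<ge> 0" using A0 by (simp add: c_def le_max_iff_disj)
  have G_le: "norm (G j z) \<le> (c / (1 + norm (lattice_point (e j))) ^ M) / (1 + norm z) ^ M" for j z
  proof -
    have kp: "(1 + norm (lattice_point (e j))) ^ M > 0" "(1 + norm z) ^ M > 0" by (intro zero_less_power add_pos_nonneg; simp)+
    have sq: "(c / (a * a)) * (c / (b * b)) = ((c / b) / a)\<^sup>2" for a b c :: real by (simp add: power2_eq_square)
    have "norm (G j z) \<le> c / (1 + norm z) ^ ?N"
      by (rule order_trans[OF G1 divide_right_mono]) (auto simp: c_def)
    moreover have "norm (G j z) \<le> c / (1 + norm (lattice_point (e j))) ^ ?N"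
      by (rule order_trans[OF G2 divide_right_mono]) (auto simp: c_def)
    \<comment> \<open>the geometric mean of a bound that decays in \<open>z\<close> and one that decays in the frequency\<close>
    ultimately have "norm (G j z) * norm (G j z) \<le> (c / (1 + norm z) ^ ?N) * (c / (1 + norm (lattice_point (e j))) ^ ?N)"
      using c0 by (intro mult_mono) auto
    also have "\<dots> = ((c / (1 + norm (lattice_point (e j))) ^ M) / (1 + norm z) ^ M)\<^sup>2"
      unfolding power_add by (rule sq)
    finally have "(norm (G j z))\<^sup>2 \<le> ((c / (1 + norm (lattice_point (e j))) ^ M) / (1 + norm z) ^ M)\<^sup>2"
      by (simp add: power2_eq_square)
    then show ?thesis using c0 kp by (intro power2_le_imp_le[of "norm (G j z)"]) auto
  qed
  let ?J = "\<integral>\<^sup>+z. ennreal (1 / (1 + norm (z::real^'n)) ^ (DIM(real^'n) + 2)) \<partial>lborel"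
  have J: "?J < \<infinity>" by (rule nn_integral_decay)
  have "(\<Sum>j. \<integral>\<^sup>+z. ennreal (norm (G j z) powr p) \<partial>lborel) \<le> (\<Sum>j. (ennreal (c powr p) * ?J) * ennreal (1 / (1 + norm (lattice_point (e j))) ^ (CARD('n) + 2)))"
  proof (intro suminf_le)
    fix j
    have "(\<integral>\<^sup>+z. ennreal (norm (G j z) powr p) \<partial>lborel) \<le> ennreal ((c / (1 + norm (lattice_point (e j))) ^ M) powr p) * ?J"
      using c0 G_le by (intro nn_integral_decay_powr[OF M p]) auto
    also have "\<dots> \<le> ennreal (c powr p * (1 / (1 + norm (lattice_point (e j))) ^ (CARD('n) + 2))) * ?J"
      by (intro mult_right_mono ennreal_leI M c0) simp
    also have "\<dots> = (ennreal (c powr p) * ?J) * ennreal (1 / (1 + norm (lattice_point (e j))) ^ (CARD('n) + 2))"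
      by (simp only: ennreal_mult'[OF powr_ge_zero] ac_simps)
    finally show "(\<integral>\<^sup>+z. ennreal (norm (G j z) powr p) \<partial>lborel) \<le> (ennreal (c powr p) * ?J) * ennreal (1 / (1 + norm (lattice_point (e j))) ^ (CARD('n) + 2))" .
  qed auto
  also have "\<dots> = (ennreal (c powr p) * ?J) * (\<Sum>j. ennreal (1 / (1 + norm (lattice_point (e j))) ^ (CARD('n) + 2)))"
    by (rule ennreal_suminf_cmult)
  also have "\<dots> < \<infinity>" using J lattice_sum_finite[OF e] by (simp add: ennreal_mult_less_top)
  finally have "(\<Sum>j. \<integral>\<^sup>+z. ennreal (norm (G j z) powr p) \<partial>lborel) < \<infinity>" .
  then obtain C where C: "(\<Sum>j. \<integral>\<^sup>+z. ennreal (norm (G j z) powr p) \<partial>lborel) = ennreal C"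
    by (cases "(\<Sum>j. \<integral>\<^sup>+z. ennreal (norm (G j z) powr p) \<partial>lborel)") auto
  have "block_sum s p (dist_of_fun (\<lambda>x. f (x - a))) = ennreal C" for a
    unfolding block_sum_translate[OF st f \<rho>] G_def[symmetric] C ..
  then show ?thesis unfolding s_def by (intro exI[of _ C]) simp
qed

section \<open>The quasi-norms of translates and of functions\<close>

lemma epowr_mono: "a \<le> b \<Longrightarrow> 0 \<le> r \<Longrightarrow> epowr a r \<le> epowr b r"
  unfolding epowr_def by (cases a; cases b) (auto simp: top_unique intro!: ennreal_leI powr_mono2)

lemma epowr_0 [simp]: "epowr 0 r = 0"
  by (simp add: epowr_def)

lemma Lp_norm_powr: "p \<noteq> 0 \<Longrightarrow> epowr (Lp_norm p G) p = (\<integral>\<^sup>+x. epowr (G x) p \<partial>lebesgue)"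
  by (simp add: Lp_norm_def epowr_epowr)

lemma Lp_norm_0 [simp]: "Lp_norm p (\<lambda>_. 0) = 0"
  by (simp add: Lp_norm_def)

text \<open>Convolution with the dilate of scale \<open>t\<close> is an average of
  \<open>f (x - a - t z)\<close> against \<psi>. Its decay bound is uniform for \<open>t < 1\<close>
  and therefore passes to the supremum.\<close>

lemma hardy_norm_translate_bounded:
  fixes f \<psi> :: "real ^ 'n::finite \<Rightarrow> complex"
  assumes p: "0 < p" and f: "f \<in> test_functions UNIV" and \<psi>: "\<psi> \<in> schwartz"
  shows "\<exists>C::real. \<forall>a. hardy_norm \<psi> p (dist_of_fun (\<lambda>x. f (x - a))) \<le> ennreal C"
proof -
  obtain N :: nat where N: "\<And>(z :: real ^ 'n) c. 0 \<le> c \<Longrightarrow> (c / (1 + norm z) ^ N) powr p \<le> c powr p * (1 / (1 + norm z) ^ (CARD('n) + 2))"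
    using decay_exponent[OF p, where 'n = 'n] by blast
  obtain B where B: "\<And>x. norm (f x) \<le> B" "B \<ge> 0" using test_functions_bounded[OF f] by blast
  obtain r' where r': "\<And>x. f x \<noteq> 0 \<Longrightarrow> norm x \<le> r'" using f by (auto simp: test_functions_UNIV_iff)
  define r where "r = max r' 0"
  have r: "\<And>x. f x \<noteq> 0 \<Longrightarrow> norm x \<le> r" "r \<ge> 0" using r' by (fastforce simp: r_def)+
  have fm [measurable]: "f \<in> borel_measurable borel" by (rule smooth_measurable[OF test_functions_smooth[OF f]])
  have \<psi>m [measurable]: "\<psi> \<in> borel_measurable borel" by (rule schwartz_measurable[OF \<psi>])
  define c where "c = B * (LINT w|lborel. ((1 + r) * (1 + norm w)) ^ N * norm (\<psi> w))"
  have c0: "c \<ge> 0"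
    unfolding c_def using B(2) r(2) by (intro mult_nonneg_nonneg Bochner_Integration.integral_nonneg zero_le_power) auto
  let ?J = "\<integral>\<^sup>+z. ennreal (1 / (1 + norm (z::real^'n)) ^ (DIM(real^'n) + 2)) \<partial>lborel"
  have le: "norm (conv_dist (dilate t \<psi>) (dist_of_fun (\<lambda>x. f (x - a))) x) \<le> c / (1 + norm (x - a)) ^ N" if t: "0 < t" "t < 1" for t x a
  proof -
    have "conv_dist (dilate t \<psi>) (dist_of_fun (\<lambda>x. f (x - a))) x = (LINT y|lborel. f (y - a) * (of_real (1 / t ^ CARD('n)) * \<psi> ((1 / t) *\<^sub>R (x - y))))"
      unfolding conv_dist_def dist_of_fun_def dilate_eq by (rule lebesgue_integral_eq_lborel) measurable
    also have "\<dots> = \<bar>- t\<bar> ^ DIM(real^'n) *\<^sub>R (LINT z|lborel. f ((x + (- t) *\<^sub>R z) - a) * (of_real (1 / t ^ CARD('n)) * \<psi> ((1 / t) *\<^sub>R (x - (x + (- t) *\<^sub>R z)))))"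
      using t by (intro integral_affine) auto
    also have "\<dots> = \<bar>- t\<bar> ^ DIM(real^'n) *\<^sub>R (LINT z|lborel. of_real (1 / t ^ CARD('n)) * (f ((x - a) + (- t) *\<^sub>R z) * \<psi> z))"
      using t by (simp add: algebra_simps)
    also have "\<dots> = (LINT z|lborel. f ((x - a) + (- t) *\<^sub>R z) * \<psi> z)"
      unfolding integral_mult_right_zero using t by (simp add: scaleR_conv_of_real[where 'a = complex])
    finally show ?thesis
      using translate_average_decay[OF B r \<psi>, where t = "- t" and z = "x - a" and N = N] t by (simp add: c_def)
  qed
  have "(\<integral>\<^sup>+x. epowr (SUP t\<in>{0<..<1}. ennreal (cmod (conv_dist (dilate t \<psi>) (dist_of_fun (\<lambda>x. f (x - a))) x))) p \<partial>lebesgue) \<le> ennreal (c powr p) * ?J" for a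
  proof -
    have "(\<integral>\<^sup>+x. epowr (SUP t\<in>{0<..<1}. ennreal (cmod (conv_dist (dilate t \<psi>) (dist_of_fun (\<lambda>x. f (x - a))) x))) p \<partial>lebesgue)
      \<le> (\<integral>\<^sup>+x. ennreal ((c / (1 + norm (x - a)) ^ N) powr p) \<partial>lebesgue)"
    proof (rule nn_integral_mono)
      fix x
      have "(SUP t\<in>{0<..<1}. ennreal (cmod (conv_dist (dilate t \<psi>) (dist_of_fun (\<lambda>x. f (x - a))) x))) \<le> ennreal (c / (1 + norm (x - a)) ^ N)"
        using le by (intro SUP_least ennreal_leI) auto
      then have "epowr (SUP t\<in>{0<..<1}. ennreal (cmod (conv_dist (dilate t \<psi>) (dist_of_fun (\<lambda>x. f (x - a))) x))) p \<le> epowr (ennreal (c / (1 + norm (x - a)) ^ N)) p"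
        using p by (intro epowr_mono) auto
      also have "\<dots> = ennreal ((c / (1 + norm (x - a)) ^ N) powr p)" using c0 by (intro epowr_ennreal) simp
      finally show "epowr (SUP t\<in>{0<..<1}. ennreal (cmod (conv_dist (dilate t \<psi>) (dist_of_fun (\<lambda>x. f (x - a))) x))) p \<le> ennreal ((c / (1 + norm (x - a)) ^ N) powr p)" .
    qed
    also have "\<dots> = (\<integral>\<^sup>+x. ennreal ((c / (1 + norm (x - a)) ^ N) powr p) \<partial>lborel)" by (rule nn_integral_completion)
    also have "\<dots> = (\<integral>\<^sup>+z. ennreal ((c / (1 + norm (z::real^'n)) ^ N) powr p) \<partial>lborel)"
      using nn_integral_affine[of "\<lambda>z::real^'n. ennreal ((c / (1 + norm z) ^ N) powr p)" 1 "- a", symmetric] by simp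
    also have "\<dots> \<le> ennreal (c powr p) * ?J" using c0 by (intro nn_integral_decay_powr[OF N p]) auto
    finally show ?thesis .
  qed
  then have "hardy_norm \<psi> p (dist_of_fun (\<lambda>x. f (x - a))) \<le> epowr (ennreal (c powr p) * ?J) (1 / p)" for a
    unfolding hardy_norm_def Lp_norm_def using p by (intro epowr_mono) auto
  moreover have "ennreal (c powr p) * ?J < \<infinity>" using nn_integral_decay[where 'a = "real^'n"] by (simp add: ennreal_mult_less_top)
  then obtain K where "ennreal (c powr p) * ?J = ennreal K" "K \<ge> 0" by (cases "ennreal (c powr p) * ?J") auto
  ultimately show ?thesis by (auto simp: epowr_ennreal)
qed

lemma hardy_norm_lower:
  fixes u :: "'n::finite functional" and D \<psi> \<kappa> :: "real ^ 'n \<Rightarrow> complex"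
  assumes p: "0 < p" and u: "u \<in> tempered_distributions"
    and D: "represents D u" "D \<in> borel_measurable borel" "\<And>x. x \<noteq> 0 \<Longrightarrow> isCont D x"
    and \<psi>: "\<psi> \<in> schwartz" and \<kappa>: "cutoff \<kappa>"
  shows "ennreal (norm (LINT z|lborel. \<psi> z) powr p) * (\<integral>\<^sup>+x. ennreal (norm (D x) powr p) \<partial>lebesgue) \<le> epowr (hardy_norm \<psi> p u) p"
proof -
  let ?I = "LINT z|lborel. \<psi> z"
  let ?S = "\<lambda>x. SUP t\<in>{0<..<1}. ennreal (cmod (conv_dist (dilate t \<psi>) u x))"
  have [measurable]: "D \<in> borel_measurable lebesgue" by (rule borel_measurable_lebesgueI[OF D(2)])
  have S: "ennreal (norm (D x * ?I)) \<le> ?S x" if x: "x \<noteq> 0" for x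
  proof (rule tendsto_upperbound)
    show "((\<lambda>t. ennreal (norm (u (\<lambda>y. dilate t \<psi> (x - y))))) \<longlongrightarrow> ennreal (norm (D x * ?I))) (at_right 0)"
      by (intro tendsto_ennrealI tendsto_norm tempered_approximate_identity[OF u D(1,2) D(3)[OF x] \<psi> \<kappa>])
    have "eventually (\<lambda>t::real. t \<in> {0<..<1}) (at_right 0)" by (rule eventually_at_right_real) simp
    then show "eventually (\<lambda>t. ennreal (norm (u (\<lambda>y. dilate t \<psi> (x - y)))) \<le> ?S x) (at_right 0)"
      by eventually_elim (auto simp: conv_dist_def intro!: SUP_upper2)
  qed simp
  have "ennreal (norm ?I powr p) * (\<integral>\<^sup>+x. ennreal (norm (D x) powr p) \<partial>lebesgue) = (\<integral>\<^sup>+x. ennreal (norm ?I powr p) * ennreal (norm (D x) powr p) \<partial>lebesgue)"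
    by (rule nn_integral_cmult[symmetric]) measurable
  also have "\<dots> \<le> (\<integral>\<^sup>+x. epowr (?S x) p \<partial>lebesgue)"
  proof (rule nn_integral_mono_AE)
    have "AE x in lebesgue. x \<noteq> (0::real^'n)" by (rule AE_completion) (rule AE_lborel_singleton)
    then show "AE x in lebesgue. ennreal (norm ?I powr p) * ennreal (norm (D x) powr p) \<le> epowr (?S x) p"
    proof eventually_elim
      case (elim x)
      have "ennreal (norm ?I powr p) * ennreal (norm (D x) powr p) = ennreal (norm (D x * ?I) powr p)"
        by (simp add: norm_mult powr_mult ennreal_mult' mult.commute)
      also have "\<dots> = epowr (ennreal (norm (D x * ?I))) p" by (rule epowr_ennreal[symmetric]) simp
      also have "\<dots> \<le> epowr (?S x) p" using S[OF elim] p by (intro epowr_mono) auto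
      finally show ?case .
    qed
  qed
  also have "\<dots> = epowr (hardy_norm \<psi> p u) p" using p by (simp add: hardy_norm_def Lp_norm_powr)
  finally show ?thesis .
qed

lemma besov_norm_eq: "p \<noteq> 0 \<Longrightarrow> besov_norm \<phi> p u = epowr (block_sum (dyadic_symbol \<phi>) p u) (1 / p)"
  by (simp add: besov_norm_def Lp_norm_powr block_sum_def dyadic_block_def)

text \<open>Allows the sum over blocks and the integral in the Triebel-Lizorkin quasi-norm to be
  interchanged. If no function represents \<open>u\<close>, the value is constantly
  \<infinity>.\<close>

lemma dist_abs_powr_measurable: "(\<lambda>x. epowr (dist_abs u x) p) \<in> borel_measurable lebesgue"
proof (cases "\<exists>g. represents g u")
  case True
  then obtain g where "represents g u" by blast
  then obtain g' where g': "represents g' u" "dist_abs u = (\<lambda>x. ennreal (cmod (g' x)))" by (rule dist_abs_represents)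
  have [measurable]: "g' \<in> borel_measurable lebesgue" by (rule represents_measurable[OF g'(1)])
  show ?thesis unfolding g'(2) by (simp add: epowr_ennreal)
next
  case False
  then show ?thesis by (simp add: dist_abs_def)
qed

lemma triebel_lizorkin_norm_eq: "p \<noteq> 0 \<Longrightarrow> triebel_lizorkin_norm \<phi> p u = epowr (block_sum (dyadic_symbol \<phi>) p u) (1 / p)"
  by (simp add: triebel_lizorkin_norm_def Lp_norm_def epowr_epowr block_sum_def dyadic_block_def nn_integral_suminf dist_abs_powr_measurable)

section \<open>The zero distribution and auxiliary bumps\<close>

lemma represents_zero: "represents (\<lambda>_. 0) (\<lambda>_. 0)"
  by (simp add: represents_def locally_integrable_on_def dist_of_fun_def set_integrable_def)

lemma zero_tempered: "(\<lambda>_. 0) \<in> tempered_distributions"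
  by (simp add: tempered_distributions_def)

text \<open>The function that \<open>dist_abs\<close> chooses for the zero distribution is known to
  vanish only almost everywhere, hence the appeal to uniqueness.\<close>

lemma block_sum_zero:
  fixes \<rho> :: "real ^ 'n::finite \<Rightarrow> complex" and s :: "nat \<Rightarrow> real ^ 'n \<Rightarrow> complex"
  assumes \<rho>: "mollifier \<rho>"
  shows "block_sum s p (\<lambda>_. 0) = 0"
proof -
  obtain g where g: "represents g (\<lambda>_::real^'n\<Rightarrow>complex. 0)" "dist_abs (\<lambda>_::real^'n\<Rightarrow>complex. 0) = (\<lambda>x. ennreal (cmod (g x)))"
    using dist_abs_represents[OF represents_zero] by blast
  have "AE x in lebesgue. g x = 0" by (rule represents_unique[OF \<rho> g(1) represents_zero])
  then have "(\<integral>\<^sup>+x. epowr (dist_abs (\<lambda>_::real^'n\<Rightarrow>complex. 0) x) p \<partial>lebesgue) = (\<integral>\<^sup>+x. 0 \<partial>(lebesgue :: (real^'n) measure))"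
    unfolding g(2) by (intro nn_integral_cong_AE) (auto simp: epowr_ennreal elim!: eventually_mono)
  moreover have "fourier_multiplier m (\<lambda>_. 0) = (\<lambda>_. 0)" for m :: "real^'n \<Rightarrow> complex"
    by (simp add: fourier_multiplier_def inv_fourier_dist_def mult_dist_def fourier_dist_def)
  ultimately show ?thesis by (simp add: block_sum_def)
qed

lemma hardy_norm_zero: "hardy_norm \<psi> p (\<lambda>_. 0) = 0"
  by (simp add: hardy_norm_def conv_dist_def)

text \<open>The bump is nonnegative and equals 1 on the ball of radius 1/2, so its integral is
  positive; rescaling and normalising it produces a mollifier.\<close>

lemma unit_bump_mollifier:
  fixes \<eta> :: "real ^ 'n::finite \<Rightarrow> real"
  assumes \<eta>: "unit_bump \<eta>"
  shows "(LINT x|lborel. complex_of_real (\<eta> x)) \<noteq> 0"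
    and "\<exists>\<rho> :: real ^ 'n \<Rightarrow> complex. mollifier \<rho>"
proof -
  let ?g = "\<lambda>x. complex_of_real (\<eta> x)"
  have g: "?g \<in> test_functions UNIV" by (rule unit_bump_test_function[OF \<eta>])
  have gm: "?g \<in> borel_measurable borel" by (rule smooth_measurable[OF test_functions_smooth[OF g]])
  have "integrable lborel ?g" by (rule test_functions_integrable[OF g])
  then have i: "integrable lborel \<eta>" by (simp only: complex_of_real_integrable_eq)
  have "measure lborel (ball (0::real^'n) (1/2)) = (LINT x|lborel. indicator (ball (0::real^'n) (1/2)) x)" by simp
  also have "\<dots> \<le> (LINT x|lborel. \<eta> x)"
  proof (rule integral_mono[OF _ i])
    show "integrable lborel (indicat_real (ball (0::real^'n) (1/2)))"
      using emeasure_bounded_finite[of "ball (0::real^'n) (1/2)"] by (intro integrable_real_indicator) auto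
    fix x :: "real^'n"
    have "infnorm x \<le> 1/2" if "norm x < 1/2" using infnorm_le_norm[of x] that by simp
    then show "indicator (ball 0 (1/2)) x \<le> \<eta> x" using \<eta> by (auto simp: unit_bump_def indicator_def)
  qed
  finally have le: "measure lborel (ball (0::real^'n) (1/2)) \<le> (LINT x|lborel. \<eta> x)" .
  have "0 < measure lborel (ball (0::real^'n) (1/2))" by (simp add: content_ball_pos)
  then have "(LINT x|lborel. \<eta> x) > 0" using le by (rule less_le_trans)
  then show nz: "(LINT x|lborel. ?g x) \<noteq> 0" by (simp add: integral_complex_of_real)
  \<comment> \<open>The map \<open>x \<mapsto> 2 x - One\<close> takes the unit cube with corner 0
    onto the centred cube of half-side 1, which contains the support of the bump.\<close>
  define h where "h x = ?g (2 *\<^sub>R x + - One)" for x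
  have h: "h \<in> test_functions UNIV" unfolding h_def[abs_def] by (rule test_functions_affine[OF g]) simp
  have hm: "h \<in> borel_measurable borel" by (rule smooth_measurable[OF test_functions_smooth[OF h]])
  have "(LINT x|lborel. ?g x) = \<bar>2\<bar> ^ DIM(real^'n) *\<^sub>R (LINT x|lborel. ?g (- One + 2 *\<^sub>R x))" by (rule integral_affine[OF gm]) simp
  also have "(LINT x|lborel. ?g (- One + 2 *\<^sub>R x)) = (LINT x|lborel. h x)" by (simp add: h_def)
  finally have hI: "(LINT x|lborel. h x) \<noteq> 0" using nz by auto
  have One: "One \<bullet> b = 1" if "b \<in> Basis" for b :: "real^'n" using that by (simp add: inner_sum_left inner_Basis)
  have nth: "One $ i = (1::real)" for i :: 'n using One[of "axis i 1"] by (simp only: cart_eq_inner_axis axis_in_Basis_iff) simp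
  have supp: "w \<in> cbox 0 One" if "h w \<noteq> 0" for w
  proof -
    have "\<eta> (2 *\<^sub>R w + - One) \<noteq> 0" using that by (simp add: h_def)
    then have "\<not> 3/4 \<le> infnorm (2 *\<^sub>R w + - One)" using \<eta> unfolding unit_bump_def by blast
    then have "\<bar>(2 *\<^sub>R w + - One) $ i\<bar> < 3/4" for i using component_le_infnorm_cart[of "2 *\<^sub>R w + - One" i] by linarith
    then have b: "\<bar>2 * w $ i - 1\<bar> < 3/4" for i by (simp add: nth del: sum_component)
    have "0 \<le> w $ i \<and> w $ i \<le> 1" for i using b[of i] by linarith
    then show ?thesis by (auto simp: mem_box_cart nth simp del: sum_component)
  qed
  have "mollifier (\<lambda>w. inverse (LINT x|lborel. h x) * h w)"
    unfolding mollifier_def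
    using test_functions_mult(2)[OF h smooth_const, of "inverse (LINT x|lborel. h x)"] supp hI by auto
  then show "\<exists>\<rho> :: real ^ 'n \<Rightarrow> complex. mollifier \<rho>" by blast
qed

section \<open>Boundedness of Hausdorff operators\<close>

text \<open>The bound is available only for translates whose support avoids the origin, so the
  translations start far enough out.\<close>

lemma hausdorff_op_zeroI:
  fixes \<Phi> g :: "real ^ 'n::finite \<Rightarrow> complex"
  assumes p: "0 < p" "p < 1" and \<Phi>: "locally_integrable_on (- {0}) \<Phi>"
    and g: "g \<in> test_functions UNIV" "(LINT x|lborel. g x) \<noteq> 0"
    and C: "C \<ge> 0" "\<And>a. (\<lambda>x. g (x - a)) \<in> test_functions (- {0}) \<Longrightarrow>
      (\<integral>\<^sup>+x. ennreal (norm (hausdorff_op \<Phi> (\<lambda>x. g (x - a)) x) powr p) \<partial>lebesgue) \<le> ennreal C"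
  shows "zero_operator (hausdorff_op \<Phi>)"
proof (rule zero_operatorI)
  fix \<beta> :: "real \<Rightarrow> complex" and a1 a2
  assume \<beta>: "continuous_on UNIV \<beta>" "\<And>s. \<beta> s \<noteq> 0 \<Longrightarrow> a1 \<le> s \<and> s \<le> a2" "0 < a1"
  obtain r where r: "\<And>x. g x \<noteq> 0 \<Longrightarrow> norm x \<le> r" using g(1) by (auto simp: test_functions_UNIV_iff)
  \<comment> \<open>An arbitrary coordinate direction; \<open>undefined\<close> names some
    coordinate of the nonempty index type.\<close>
  define e :: "real^'n" where "e = axis undefined 1"
  have e: "norm e = 1" by (simp add: e_def)
  show "(LINT y|lebesgue. \<Phi> y * of_real (norm y ^ CARD('n)) * \<beta> (norm y)) = 0"
  proof (rule hausdorff_core[OF p \<Phi> g e C(1) _ \<beta>])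
    \<comment> \<open>From this index on, the support lies within \<open>r \<le> k\<close> of a
      point of norm \<open>k + 1\<close> and so keeps distance at least 1 from the origin.\<close>
    fix k assume k: "k \<ge> nat \<lceil>r\<rceil>"
    show "(\<integral>\<^sup>+x. ennreal (norm (hausdorff_op \<Phi> (\<lambda>x. g (x - real (Suc k) *\<^sub>R e)) x) powr p) \<partial>lebesgue) \<le> ennreal C"
    proof (rule C(2), unfold test_functions_off_0_iff, intro conjI exI[of _ 1] allI impI)
      show "(\<lambda>x. g (x - real (Suc k) *\<^sub>R e)) \<in> test_functions UNIV"
        using test_functions_affine[OF g(1), of 1 "- (real (Suc k) *\<^sub>R e)"] by simp
      fix x assume "g (x - real (Suc k) *\<^sub>R e) \<noteq> 0"
      then have "norm (x - real (Suc k) *\<^sub>R e) \<le> r" by (rule r)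
      moreover have "r \<le> real k" using k by linarith
      moreover have "norm (real (Suc k) *\<^sub>R e) = real k + 1" using e by simp
      ultimately show "1 \<le> norm x" using norm_triangle_ineq2[of "real (Suc k) *\<^sub>R e" x] by (simp add: norm_minus_commute)
    qed simp
  qed
qed

text \<open>Isolates what depends on the space: a bound on the quasi-norms of all translates of one
  bump, and a lower bound by the \<open>L^p\<close> integral for distributions given by functions
  continuous off the origin. In the converse direction the zero distribution represents
  \<open>H f\<close>.\<close>

lemma bounded_on_dist_space_iff:
  fixes \<Phi> g :: "real ^ 'n::finite \<Rightarrow> complex" and N :: "'n functional \<Rightarrow> ennreal"
  assumes p: "0 < p" "p < 1" and \<Phi>: "locally_integrable_on (- {0}) \<Phi>"
    and g: "g \<in> test_functions UNIV" "(LINT x|lborel. g x) \<noteq> 0"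
    and zero: "N (\<lambda>_. 0) = 0"
    and upper: "\<exists>C::real. \<forall>a. N (dist_of_fun (\<lambda>x. g (x - a))) \<le> ennreal C"
    and c: "c > 0"
    and lower: "\<And>u D. u \<in> tempered_distributions \<Longrightarrow> represents D u \<Longrightarrow> D \<in> borel_measurable borel \<Longrightarrow> (\<And>x. x \<noteq> 0 \<Longrightarrow> isCont D x) \<Longrightarrow>
      N u < \<infinity> \<Longrightarrow> ennreal c * (\<integral>\<^sup>+x. ennreal (norm (D x) powr p) \<partial>lebesgue) \<le> epowr (N u) p"
  shows "bounded_on_dist_space N (hausdorff_op \<Phi>) \<longleftrightarrow> zero_operator (hausdorff_op \<Phi>)"
proof
  assume "bounded_on_dist_space N (hausdorff_op \<Phi>)"
  then obtain C0 :: real where C0: "C0 \<ge> 0" "\<And>f. f \<in> test_functions (- {0}) \<Longrightarrow>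
     \<exists>u\<in>tempered_distributions. represents (hausdorff_op \<Phi> f) u \<and> N u < \<infinity> \<and> N u \<le> ennreal C0 * N (dist_of_fun f)"
    unfolding bounded_on_dist_space_def by blast
  obtain C1 :: real where C1: "\<And>a. N (dist_of_fun (\<lambda>x. g (x - a))) \<le> ennreal C1" using upper by blast
  define C where "C = (C0 * max C1 0) powr p / c"
  show "zero_operator (hausdorff_op \<Phi>)"
  proof (rule hausdorff_op_zeroI[OF p \<Phi> g])
    show "C \<ge> 0" using c by (simp add: C_def)
    fix a assume f: "(\<lambda>x. g (x - a)) \<in> test_functions (- {0})"
    let ?D = "hausdorff_op \<Phi> (\<lambda>x. g (x - a))"
    let ?I = "\<integral>\<^sup>+x. ennreal (norm (?D x) powr p) \<partial>lebesgue"
    obtain u where u: "u \<in> tempered_distributions" "represents ?D u" "N u < \<infinity>" "N u \<le> ennreal C0 * N (dist_of_fun (\<lambda>x. g (x - a)))"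
      using C0(2)[OF f] by blast
    have "N u \<le> ennreal C0 * ennreal (max C1 0)"
      by (rule order_trans[OF u(4) mult_left_mono[OF order_trans[OF C1 ennreal_leI]]]) auto
    also have "\<dots> = ennreal (C0 * max C1 0)" using C0(1) by (simp add: ennreal_mult')
    finally have "epowr (N u) p \<le> epowr (ennreal (C0 * max C1 0)) p" using p by (intro epowr_mono) auto
    also have "\<dots> = ennreal ((C0 * max C1 0) powr p)" using C0(1) by (intro epowr_ennreal) auto
    finally have "ennreal c * ?I \<le> ennreal ((C0 * max C1 0) powr p)"
      using lower[OF u(1,2) hausdorff_op_measurable[OF \<Phi> f] hausdorff_op_continuous[OF \<Phi> f] u(3)] by (rule order_trans[rotated])
    then have "ennreal (1 / c) * (ennreal c * ?I) \<le> ennreal (1 / c) * ennreal ((C0 * max C1 0) powr p)" by (rule mult_left_mono) simp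
    moreover have "ennreal (1 / c) * (ennreal c * ?I) = ?I"
      unfolding mult.assoc[symmetric] using c by (subst ennreal_mult[symmetric]) auto
    moreover have "ennreal (1 / c) * ennreal ((C0 * max C1 0) powr p) = ennreal C"
      unfolding C_def using c by (subst ennreal_mult[symmetric]) auto
    ultimately show "?I \<le> ennreal C" by simp
  qed
next
  assume z: "zero_operator (hausdorff_op \<Phi>)"
  show "bounded_on_dist_space N (hausdorff_op \<Phi>)"
    unfolding bounded_on_dist_space_def
  proof (intro exI[of _ 0] conjI ballI bexI)
    fix f :: "real^'n \<Rightarrow> complex" assume "f \<in> test_functions (- {0})"
    then have "hausdorff_op \<Phi> f = (\<lambda>_. 0)" using z by (auto simp: zero_operator_def)
    then show "represents (hausdorff_op \<Phi> f) (\<lambda>_. 0)" by (simp add: represents_zero)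
  qed (auto simp: zero zero_tempered)
qed

lemma bounded_on_Lp_iff:
  fixes \<Phi> g :: "real ^ 'n::finite \<Rightarrow> complex"
  assumes p: "0 < p" "p < 1" and \<Phi>: "locally_integrable_on (- {0}) \<Phi>"
    and g: "g \<in> test_functions UNIV" "(LINT x|lborel. g x) \<noteq> 0"
  shows "bounded_on_Lp p (hausdorff_op \<Phi>) \<longleftrightarrow> zero_operator (hausdorff_op \<Phi>)"
proof
  assume "bounded_on_Lp p (hausdorff_op \<Phi>)"
  then obtain C0 :: real where C0: "C0 \<ge> 0" "\<And>f. f \<in> test_functions (- {0}) \<Longrightarrow>
     Lp_norm p (\<lambda>x. ennreal (cmod (hausdorff_op \<Phi> f x))) \<le> ennreal C0 * Lp_norm p (\<lambda>x. ennreal (cmod (f x)))"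
    unfolding bounded_on_Lp_def by blast
  have gm [measurable]: "g \<in> borel_measurable borel" by (rule smooth_measurable[OF test_functions_smooth[OF g(1)]])
  obtain B where B: "\<And>x. norm (g x) \<le> B" "B \<ge> 0" using test_functions_bounded[OF g(1)] by blast
  obtain r where r: "\<And>x. g x \<noteq> 0 \<Longrightarrow> norm x \<le> r" using g(1) by (auto simp: test_functions_UNIV_iff)
  let ?K = "\<integral>\<^sup>+x. ennreal (norm (g x) powr p) \<partial>lborel"
  have "?K \<le> (\<integral>\<^sup>+x. ennreal (B powr p) * indicator (cball (0::real^'n) r) x \<partial>lborel)"
  proof (rule nn_integral_mono)
    fix x :: "real^'n"
    show "ennreal (norm (g x) powr p) \<le> ennreal (B powr p) * indicator (cball 0 r) x"
      using r[of x] B p by (cases "g x = 0") (auto simp: top_unique intro!: ennreal_leI powr_mono2)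
  qed
  also have "\<dots> = ennreal (B powr p) * emeasure lborel (cball (0::real^'n) r)" by (rule nn_integral_cmult_indicator) simp
  also have "\<dots> < \<infinity>" using emeasure_compact_finite[OF compact_cball, of "0::real^'n" r] by (simp add: ennreal_mult_less_top)
  finally obtain K where K: "?K = ennreal K" "K \<ge> 0" by (cases ?K) auto
  have norm_g: "Lp_norm p (\<lambda>x. ennreal (cmod (g (x - a)))) = ennreal (K powr (1 / p))" for a
  proof -
    have "(\<integral>\<^sup>+x. epowr (ennreal (cmod (g (x - a)))) p \<partial>lebesgue) = (\<integral>\<^sup>+x. ennreal (norm (g (x - a)) powr p) \<partial>lborel)"
      by (simp add: epowr_ennreal nn_integral_completion)
    also have "\<dots> = ?K" using nn_integral_affine[of "\<lambda>z. ennreal (norm (g z) powr p)" 1 "- a"] by simp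
    finally show ?thesis using K by (simp add: Lp_norm_def epowr_ennreal)
  qed
  define C where "C = (C0 * K powr (1 / p)) powr p"
  show "zero_operator (hausdorff_op \<Phi>)"
  proof (rule hausdorff_op_zeroI[OF p \<Phi> g])
    show "C \<ge> 0" by (simp add: C_def)
    fix a assume f: "(\<lambda>x. g (x - a)) \<in> test_functions (- {0})"
    let ?D = "hausdorff_op \<Phi> (\<lambda>x. g (x - a))"
    have "Lp_norm p (\<lambda>x. ennreal (cmod (?D x))) \<le> ennreal (C0 * K powr (1 / p))"
      using C0(2)[OF f] C0(1) unfolding norm_g by (simp add: ennreal_mult')
    then have "epowr (Lp_norm p (\<lambda>x. ennreal (cmod (?D x)))) p \<le> epowr (ennreal (C0 * K powr (1 / p))) p" using p by (intro epowr_mono) auto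
    then show "(\<integral>\<^sup>+x. ennreal (norm (?D x) powr p) \<partial>lebesgue) \<le> ennreal C"
      using p C0(1) by (simp add: Lp_norm_powr epowr_ennreal C_def)
  qed
next
  assume z: "zero_operator (hausdorff_op \<Phi>)"
  have "hausdorff_op \<Phi> f = (\<lambda>_. 0)" if "f \<in> test_functions (- {0})" for f using z that by (auto simp: zero_operator_def)
  then show "bounded_on_Lp p (hausdorff_op \<Phi>)"
    unfolding bounded_on_Lp_def by (intro exI[of _ 0]) simp
qed

text \<open>Common form of the modulation, Besov and Triebel-Lizorkin cases. Since
  \<open>epowr\<close> sends only \<infinity> to \<infinity>, finiteness of \<open>N u\<close>
  passes to the block sum, on which the convergence of the blocks may rely.\<close>

lemma block_sum_bounded_iff:
  fixes \<Phi> g \<rho> :: "real ^ 'n::finite \<Rightarrow> complex" and s :: "nat \<Rightarrow> real ^ 'n \<Rightarrow> complex"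
  assumes p: "0 < p" "p < 1" and \<Phi>: "locally_integrable_on (- {0}) \<Phi>"
    and g: "g \<in> test_functions UNIV" "(LINT x|lborel. g x) \<noteq> 0" and \<rho>: "mollifier \<rho>"
    and s: "\<And>j. s j \<in> test_functions UNIV"
    and N: "\<And>u. N u = epowr (block_sum s p u) (1 / p)"
    and upper: "\<exists>C::real. \<forall>a. block_sum s p (dist_of_fun (\<lambda>x. g (x - a))) \<le> ennreal C"
    and lim: "\<And>u D x. u \<in> tempered_distributions \<Longrightarrow> represents D u \<Longrightarrow> D \<in> borel_measurable borel \<Longrightarrow> isCont D x \<Longrightarrow>
      block_sum s p u < \<infinity> \<Longrightarrow> (\<lambda>J. \<Sum>j<J. u (\<lambda>y. fourier (s j) (y - x))) \<longlonglongrightarrow> D x"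
  shows "bounded_on_dist_space N (hausdorff_op \<Phi>) \<longleftrightarrow> zero_operator (hausdorff_op \<Phi>)"
proof (rule bounded_on_dist_space_iff[OF p \<Phi> g, where c = 1])
  show "N (\<lambda>_. 0) = 0" by (simp add: N block_sum_zero[OF \<rho>])
  obtain C :: real where C: "\<And>a. block_sum s p (dist_of_fun (\<lambda>x. g (x - a))) \<le> ennreal C" using upper by blast
  have "N (dist_of_fun (\<lambda>x. g (x - a))) \<le> ennreal (max C 0 powr (1 / p))" for a
  proof -
    have "N (dist_of_fun (\<lambda>x. g (x - a))) \<le> epowr (ennreal (max C 0)) (1 / p)"
      unfolding N using p by (intro epowr_mono order_trans[OF C ennreal_leI]) auto
    also have "\<dots> = ennreal (max C 0 powr (1 / p))" by (rule epowr_ennreal) simp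
    finally show ?thesis .
  qed
  then show "\<exists>C::real. \<forall>a. N (dist_of_fun (\<lambda>x. g (x - a))) \<le> ennreal C" by blast
  fix u and D :: "real^'n \<Rightarrow> complex"
  assume u: "u \<in> tempered_distributions" "represents D u" "D \<in> borel_measurable borel" "\<And>x. x \<noteq> 0 \<Longrightarrow> isCont D x" and fin: "N u < \<infinity>"
  have b: "block_sum s p u < \<infinity>" using fin by (auto simp: N epowr_def less_top split: if_splits)
  have "(\<integral>\<^sup>+x. ennreal (norm (D x) powr p) \<partial>lebesgue) \<le> block_sum s p u"
    by (rule block_sum_lower[OF p u(1) s \<rho> b]) (rule lim[OF u(1-3) u(4) b])
  then show "ennreal 1 * (\<integral>\<^sup>+x. ennreal (norm (D x) powr p) \<partial>lebesgue) \<le> epowr (N u) p"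
    using p by (simp add: N epowr_epowr)
qed simp

theorem corollary3p2:
  fixes p :: real
    and \<Phi> \<psi> \<phi> :: "real ^ 'n \<Rightarrow> complex"
    and \<eta> :: "real ^ 'n \<Rightarrow> real"
  assumes p: "0 < p" "p < 1"
    and \<Phi>: "locally_integrable_on (- {0}) \<Phi>"
    and \<psi>: "\<psi> \<in> schwartz" "(LINT x|lebesgue. \<psi> x) \<noteq> 0"
    and \<phi>: "smooth \<phi>" "supp \<phi> \<subseteq> {\<xi>. norm \<xi> < 3/2}" "\<And>\<xi>. norm \<xi> \<le> 4/3 \<Longrightarrow> \<phi> \<xi> = 1"
    and \<eta>: "smooth \<eta>" "\<And>\<xi>. \<eta> \<xi> \<in> {0..1}"
      "\<And>\<xi>. infnorm \<xi> \<le> 1/2 \<Longrightarrow> \<eta> \<xi> = 1" "\<And>\<xi>. infnorm \<xi> \<ge> 3/4 \<Longrightarrow> \<eta> \<xi> = 0"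
  shows "(bounded_on_Lp p (hausdorff_op \<Phi>)
        \<longleftrightarrow> zero_operator (hausdorff_op \<Phi>))
    \<and> (bounded_on_dist_space (hardy_norm \<psi> p) (hausdorff_op \<Phi>)
        \<longleftrightarrow> zero_operator (hausdorff_op \<Phi>))
    \<and> (bounded_on_dist_space (modulation_norm \<eta> p) (hausdorff_op \<Phi>)
        \<longleftrightarrow> zero_operator (hausdorff_op \<Phi>))
    \<and> (bounded_on_dist_space (besov_norm \<phi> p) (hausdorff_op \<Phi>)
        \<longleftrightarrow> zero_operator (hausdorff_op \<Phi>))
    \<and> (bounded_on_dist_space (triebel_lizorkin_norm \<phi> p) (hausdorff_op \<Phi>)
        \<longleftrightarrow> zero_operator (hausdorff_op \<Phi>))"
proof (intro conjI)
  \<comment> \<open>The auxiliary functions all come from the data of the spaces: \<eta> supplies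
    the mollifier and the translated bump, \<phi> the cutoff.\<close>
  have \<eta>': "unit_bump \<eta>" using \<eta> by (auto simp: unit_bump_def)
  obtain \<rho> :: "real ^ 'n \<Rightarrow> complex" where \<rho>: "mollifier \<rho>" using unit_bump_mollifier(2)[OF \<eta>'] by blast
  obtain e :: "nat \<Rightarrow> int ^ 'n" where e: "bij e" by (rule obtain_lattice_enumeration)
  have \<phi>0: "norm \<xi> < 3/2" if "\<phi> \<xi> \<noteq> 0" for \<xi>
    using that \<phi>(2) closure_subset[of "{\<xi>. \<phi> \<xi> \<noteq> 0}"] by (auto simp: supp_def)
  have \<phi>t: "\<phi> \<in> test_functions UNIV" unfolding test_functions_UNIV_iff using \<phi>(1) \<phi>0 less_imp_le by blast
  have \<kappa>: "cutoff \<phi>"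
    unfolding cutoff_def
  proof (intro conjI allI impI)
    fix x :: "real^'n"
    show "\<phi> x = 1" if "norm x \<le> 1" using \<phi>(3)[of x] that by simp
    show "\<phi> x = 0" if "2 \<le> norm x" using \<phi>0[of x] that by force
  qed (rule \<phi>t)
  \<comment> \<open>The bump translated in all five cases is the window of the modulation space, a
    test function of nonzero integral.\<close>
  define g where "g x = complex_of_real (\<eta> x)" for x
  have g: "g \<in> test_functions UNIV" "(LINT x|lborel. g x) \<noteq> 0"
    unfolding g_def[abs_def] by (rule unit_bump_test_function[OF \<eta>'] unit_bump_mollifier(1)[OF \<eta>'])+
  have p0: "p \<noteq> 0" using p by simp
  show "bounded_on_Lp p (hausdorff_op \<Phi>) \<longleftrightarrow> zero_operator (hausdorff_op \<Phi>)"
    by (rule bounded_on_Lp_iff[OF p \<Phi> g])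
  have \<psi>0: "(LINT x|lborel. \<psi> x) \<noteq> 0" using \<psi> lebesgue_integral_eq_lborel[OF schwartz_measurable[OF \<psi>(1)]] by simp
  show "bounded_on_dist_space (hardy_norm \<psi> p) (hausdorff_op \<Phi>) \<longleftrightarrow> zero_operator (hausdorff_op \<Phi>)"
    using hardy_norm_lower[OF p(1) _ _ _ _ \<psi>(1) \<kappa>] \<psi>0
    by (intro bounded_on_dist_space_iff[OF p \<Phi> g hardy_norm_zero hardy_norm_translate_bounded[OF p(1) g(1) \<psi>(1)], where c = "norm (LINT z|lborel. \<psi> z) powr p"]) auto
  show "bounded_on_dist_space (modulation_norm \<eta> p) (hausdorff_op \<Phi>) \<longleftrightarrow> zero_operator (hausdorff_op \<Phi>)"
    by (rule block_sum_bounded_iff[OF p \<Phi> g \<rho>, where s = "\<lambda>j \<xi>. of_real (uniform_symbol \<eta> (e j) \<xi>)"])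
      (rule uniform_symbol_test_function[OF \<eta>'] modulation_norm_eq[OF e p0]
        uniform_block_sum_finite[OF p(1) g(1) \<rho> \<eta>' e] uniform_limit[OF p _ _ _ _ \<rho> \<kappa> \<eta>' e]; assumption)+
  show "bounded_on_dist_space (besov_norm \<phi> p) (hausdorff_op \<Phi>) \<longleftrightarrow> zero_operator (hausdorff_op \<Phi>)"
    by (rule block_sum_bounded_iff[OF p \<Phi> g \<rho>, where s = "dyadic_symbol \<phi>"])
      (rule dyadic_symbol_test_function[OF \<kappa>] besov_norm_eq[OF p0]
        dyadic_block_sum_finite[OF p(1) g(1) \<rho> \<kappa>] dyadic_limit[OF _ _ _ _ \<kappa>]; assumption)+
  show "bounded_on_dist_space (triebel_lizorkin_norm \<phi> p) (hausdorff_op \<Phi>) \<longleftrightarrow> zero_operator (hausdorff_op \<Phi>)"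
    by (rule block_sum_bounded_iff[OF p \<Phi> g \<rho>, where s = "dyadic_symbol \<phi>"])
      (rule dyadic_symbol_test_function[OF \<kappa>] triebel_lizorkin_norm_eq[OF p0]
        dyadic_block_sum_finite[OF p(1) g(1) \<rho> \<kappa>] dyadic_limit[OF _ _ _ _ \<kappa>]; assumption)+
qed

end
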